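(* Let $N\geq 5$, $\alpha>2-N$, $\frac{N-4}{N-2}\alpha-4\leq\beta<\alpha-2$, and let $\gamma$, $2^{**}_{\alpha,\beta}$ be defined as in the context. Then the problem $$\mathrm{div}\big(|x|^{\alpha}\nabla(|x|^{-\beta}\mathrm{div}(|x|^\alpha\nabla u))\big)=|x|^\gamma|u|^{2^{**}_{\alpha,\beta}-2}u\quad\text{in }\mathbb{R}^N\setminus\{0\},\qquad u\in\mathcal{D}^{2,2}_{\alpha,\beta}(\mathbb{R}^N),$$ has a unique (up to scalings and change of sign) nontrivial radial solution: the nontrivial radial solutions are exactly the functions $\pm U_\lambda$, $\lambda>0$, where $U_\lambda(x)=\lambda^{\frac{N+2\alpha-\beta-4}{2}}U(\lambda x)$ with $$U(x)=\frac{C_{N,\alpha,\beta}}{|x|^{\alpha-\beta-2}(1+|x|^{\alpha-\beta-2})^{\frac{N+\beta}{\alpha-\beta-2}}},$$ $$C_{N,\alpha,\beta}=\left[(N+\beta)(N+\alpha-2)(N+2\alpha-\beta-4)(N+3\alpha-2\beta-6)\right]^{\frac{N+\beta}{4(\alpha-\beta-2)}}.$$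
   Context: $\gamma$ is defined by $(N+\beta)(N+\gamma)=(N+2\alpha-\beta-4)^2$, and $2^{**}_{\alpha,\beta}=\frac{2(N+\gamma)}{N+2\alpha-\beta-4}$. $\mathcal{D}^{2,2}_{\alpha,\beta}(\mathbb{R}^N)$ is the completion of $C^\infty_0(\mathbb{R}^N\setminus\{0\})$ with respect to the norm $\left(\int_{\mathbb{R}^N}|x|^{-\beta}|\mathrm{div}(|x|^{\alpha}\nabla u)|^2\,\mathrm{d}x\right)^{1/2}$. *)

theory Defs
  imports "HOL-Analysis.Analysis"
begin

primrec Ck :: "nat \<Rightarrow> ('a::euclidean_space \<Rightarrow> real) \<Rightarrow> bool" where
  "Ck 0 f \<longleftrightarrow> continuous_on UNIV f"
| "Ck (Suc k) f \<longleftrightarrow>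
     (\<forall>x. f differentiable at x) \<and> (\<forall>i\<in>Basis. Ck k (\<lambda>x. frechet_derivative f (at x) i))"

text \<open>Functions of class \<open>C\<^sub>c\<^sup>\<infinity>\<close> on the punctured space, extended by zero to the origin.\<close>

definition test_functions :: "('a::euclidean_space \<Rightarrow> real) set" where
  "test_functions =
     {\<phi>. (\<forall>k. Ck k \<phi>) \<and> compact (closure {x. \<phi> x \<noteq> 0}) \<and> 0 \<notin> closure {x. \<phi> x \<noteq> 0}}"

definition grad :: "('a::euclidean_space \<Rightarrow> real) \<Rightarrow> 'a \<Rightarrow> 'a" where
  "grad f x = (\<Sum>i\<in>Basis. frechet_derivative f (at x) i *\<^sub>R i)"

definition divergence :: "('a::euclidean_space \<Rightarrow> 'a) \<Rightarrow> 'a \<Rightarrow> real" where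
  "divergence F x = (\<Sum>i\<in>Basis. frechet_derivative F (at x) i \<bullet> i)"

definition wdiv :: "real \<Rightarrow> ('a::euclidean_space \<Rightarrow> real) \<Rightarrow> 'a \<Rightarrow> real" where
  "wdiv \<alpha> u = divergence (\<lambda>x. norm x powr \<alpha> *\<^sub>R grad u x)"

definition D_norm :: "real \<Rightarrow> real \<Rightarrow> ('a::euclidean_space \<Rightarrow> real) \<Rightarrow> real" where
  "D_norm \<alpha> \<beta> \<phi> = sqrt (LINT x|lebesgue. norm x powr (- \<beta>) * \<bar>wdiv \<alpha> \<phi> x\<bar>\<^sup>2)"

text \<open>Local integrability is always meant on the punctured space.\<close>

definition loc_integrable :: "('a::euclidean_space \<Rightarrow> real) \<Rightarrow> bool" where
  "loc_integrable u \<longleftrightarrow> (\<forall>K. compact K \<and> 0 \<notin> K \<longrightarrow> set_integrable lebesgue K u)"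

text \<open>The completion of the test functions, realised as a space of functions (up to null sets): a
  Cauchy sequence for \<open>D_norm\<close> is identified with its limit in \<open>L\<^sup>1\<^sub>l\<^sub>o\<^sub>c\<close> of the punctured space.
  In the parameter range of interest the weighted Rellich inequality makes every Cauchy sequence
  converge in this sense. Sequences with the same limit are equivalent, since convergence to \<open>0\<close> in
  \<open>L\<^sup>1\<^sub>l\<^sub>o\<^sub>c\<close> forces the limit of \<open>wdiv \<alpha> (\<phi> n)\<close> in the weighted \<open>L\<^sup>2\<close> space to vanish.\<close>

definition D_space :: "real \<Rightarrow> real \<Rightarrow> ('a::euclidean_space \<Rightarrow> real) set" where
  "D_space \<alpha> \<beta> = {u. loc_integrable u \<and> (\<exists>\<phi>.
     (\<forall>n. \<phi> n \<in> test_functions) \<and>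
     (\<forall>\<epsilon>>0. \<exists>M::nat. \<forall>m\<ge>M. \<forall>n\<ge>M. D_norm \<alpha> \<beta> (\<lambda>x. \<phi> m x - \<phi> n x) < \<epsilon>) \<and>
     (\<forall>K. compact K \<and> 0 \<notin> K \<longrightarrow> (\<lambda>n. LINT x:K|lebesgue. \<bar>\<phi> n x - u x\<bar>) \<longlonglongrightarrow> 0))}"

text \<open>\<open>div (|x|\<^sup>\<alpha> \<nabla>v) = h\<close> in the sense of distributions on the punctured space; on test functions the
  operator is formally self-adjoint.\<close>

definition weak_wdiv ::
    "real \<Rightarrow> ('a::euclidean_space \<Rightarrow> real) \<Rightarrow> ('a \<Rightarrow> real) \<Rightarrow> bool" where
  "weak_wdiv \<alpha> v h \<longleftrightarrow> loc_integrable v \<and> loc_integrable h \<and>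
     (\<forall>\<phi>\<in>test_functions. (LINT x|lebesgue. v x * wdiv \<alpha> \<phi> x) = (LINT x|lebesgue. h x * \<phi> x))"

text \<open>\<open>div (|x|\<^sup>\<alpha> \<nabla>(|x|\<^sup>-\<^sup>\<beta> div (|x|\<^sup>\<alpha> \<nabla>u))) = |x|\<^sup>\<gamma> |u|\<^sup>p\<^sup>-\<^sup>2 u\<close> on the punctured space, where \<open>f\<close> is the
  inner \<open>div (|x|\<^sup>\<alpha> \<nabla>u)\<close>.\<close>

definition weak_solution ::
    "real \<Rightarrow> real \<Rightarrow> real \<Rightarrow> real \<Rightarrow> ('a::euclidean_space \<Rightarrow> real) \<Rightarrow> bool" where
  "weak_solution \<alpha> \<beta> \<gamma> p u \<longleftrightarrow> (\<exists>f. weak_wdiv \<alpha> u f \<and>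
     weak_wdiv \<alpha> (\<lambda>x. norm x powr (- \<beta>) * f x)
       (\<lambda>x. norm x powr \<gamma> * (\<bar>u x\<bar> powr (p - 2) * u x)))"

text \<open>Elements of the completion are classes modulo null sets, hence the almost-everywhere form.\<close>

definition radial :: "('a::euclidean_space \<Rightarrow> real) \<Rightarrow> bool" where
  "radial u \<longleftrightarrow> (\<exists>g. AE x in lebesgue. u x = g (norm x))"

definition nontrivial :: "('a::euclidean_space \<Rightarrow> real) \<Rightarrow> bool" where
  "nontrivial u \<longleftrightarrow> \<not> (AE x in lebesgue. u x = 0)"

definition crit_exp :: "real \<Rightarrow> real \<Rightarrow> real \<Rightarrow> real \<Rightarrow> real" where
  "crit_exp N \<alpha> \<beta> \<gamma> = 2 * (N + \<gamma>) / (N + 2 * \<alpha> - \<beta> - 4)"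

definition bubble_const :: "real \<Rightarrow> real \<Rightarrow> real \<Rightarrow> real" where
  "bubble_const N \<alpha> \<beta> =
     ((N + \<beta>) * (N + \<alpha> - 2) * (N + 2 * \<alpha> - \<beta> - 4) * (N + 3 * \<alpha> - 2 * \<beta> - 6))
       powr ((N + \<beta>) / (4 * (\<alpha> - \<beta> - 2)))"

definition bubble :: "real \<Rightarrow> real \<Rightarrow> real \<Rightarrow> 'a::euclidean_space \<Rightarrow> real" where
  "bubble N \<alpha> \<beta> x =
     bubble_const N \<alpha> \<beta> /
       (norm x powr (\<alpha> - \<beta> - 2) *
        (1 + norm x powr (\<alpha> - \<beta> - 2)) powr ((N + \<beta>) / (\<alpha> - \<beta> - 2)))"

definition scaled_bubble ::
    "real \<Rightarrow> real \<Rightarrow> real \<Rightarrow> real \<Rightarrow> 'a::euclidean_space \<Rightarrow> real" where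
  "scaled_bubble N \<alpha> \<beta> s x =
     s powr ((N + 2 * \<alpha> - \<beta> - 4) / 2) * bubble N \<alpha> \<beta> (s *\<^sub>R x)"

end

(* Writing a radial u as |x|^(-m) v(ln |x|), with 2 m = N + 2 alpha - beta - 4 and 2 k = N + beta, turns
   the problem into the autonomous equation (D^2 - m^2) (D^2 - k^2) v = |v|^r v with r k = 2 (m - k).
   Approximation by test functions in the weighted norm bounds v and makes it tend to 0 at both ends, so
   that the weak equation becomes the fixed-point equation v = K * |v|^r v for the positive Green function
   K of the operator, and v is a genuine solution leaving 0 along the two-dimensional unstable manifold,
   v ~ A e^(k t). The system for v and w = v'' - k^2 v is cooperative: of two solutions with the same A,
   the one with the larger coefficient of e^(m t) in w grows without bound, so a bounded solution is
   determined by A. A suitable power of sech is a bounded solution, and its translates (the dilations of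
   the bubble) and their negatives realise every A <> 0; A = 0 belongs to v = 0. *)
theory Submission
  imports Defs
begin

section \<open>Smooth functions on the line\<close>

text \<open>The approximating test functions need not be radial, so they carry no approximating
  profiles, and v is reached by duality. A radial weight with profile (D + m)(D - k) \<zeta> moves
  the divergence operator onto the test functions, and Cauchy-Schwarz leaves the energy norm times
  the L2 norm of \<zeta>. For \<eta> supported in a unit interval, (D + m)(D - k) \<zeta> = \<eta>
  has a solution whose L2 norm is at most a fixed multiple of the L1 norm of \<eta>: v is a bounded
  functional on L1, hence a bounded function. Smallness of v at minus infinity does not yet give
  coordinates on the unstable manifold. These are integrals of the nonlinearity against e^(-k t) and
  e^(-m t), so it must be O(e^(\<mu> t)) with some \<mu> > m. The room comes from r k = 2 (m - k):
  decay of v at a rate close to k yields \<mu> close to (r + 1) k = 2 m - k > m. The same relation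
  singles out S = (2 cosh ((m - k) t / 2))^(-q) with (m - k) q = 2 k: D^2 - k^2 turns S into a
  combination with power q + 2 only, D^2 - m^2 turns that into power q + 4, and r q = 4.\<close>

primrec Dk :: "real set \<Rightarrow> nat \<Rightarrow> (real \<Rightarrow> real) \<Rightarrow> bool" where
  "Dk S 0 f \<longleftrightarrow> continuous_on S f"
| "Dk S (Suc k) f \<longleftrightarrow> (\<forall>x\<in>S. f differentiable at x) \<and> Dk S k (deriv f)"

definition smooth_on :: "real set \<Rightarrow> (real \<Rightarrow> real) \<Rightarrow> bool" where
  "smooth_on S f \<longleftrightarrow> (\<forall>k. Dk S k f)"

lemma Dk_cong:
  assumes "open S" "\<And>x. x \<in> S \<Longrightarrow> f x = g x" "Dk S k f"
  shows "Dk S k g"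
  using assms(2,3)
proof (induction k arbitrary: f g)
  case 0
  then show ?case by (metis Dk.simps(1) continuous_on_cong)
next
  case (Suc k)
  have ev: "\<forall>\<^sub>F y in nhds x. f y = g y" if "x \<in> S" for x
    using assms(1) that Suc.prems(1) eventually_nhds by blast
  have "deriv f x = deriv g x" if "x \<in> S" for x
    using deriv_cong_ev[OF ev[OF that] refl] .
  moreover have "g differentiable at x" if "x \<in> S" for x
  proof -
    have "(f has_field_derivative deriv f x) (at x)"
      using Suc.prems(2) that by (simp add: DERIV_deriv_iff_real_differentiable)
    then have "(g has_field_derivative deriv f x) (at x)"
      using DERIV_cong_ev[OF refl ev[OF that] refl] by blast
    then show ?thesis
      using real_differentiable_def by blast
  qed
  ultimately show ?case
    using Suc.IH[of "deriv f" "deriv g"] Suc.prems by auto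
qed

lemma Dk_SucI:
  assumes "open S" "\<And>x. x \<in> S \<Longrightarrow> (f has_real_derivative f' x) (at x)" "Dk S k f'"
  shows "Dk S (Suc k) f"
proof -
  have "deriv f x = f' x" if "x \<in> S" for x
    using assms(2)[OF that] by (rule DERIV_imp_deriv)
  then have "Dk S k (deriv f)"
    using Dk_cong[OF assms(1) _ assms(3), of "deriv f"] by simp
  then show ?thesis
    using assms(2) real_differentiable_def by auto
qed

lemma Dk_SucD:
  assumes "Dk S (Suc k) f" "x \<in> S"
  shows "(f has_real_derivative deriv f x) (at x)"
  using assms by (simp add: DERIV_deriv_iff_real_differentiable)

lemma Dk_continuous: "Dk S k f \<Longrightarrow> continuous_on S f"
  by (cases k) (auto simp: continuous_at_imp_continuous_on differentiable_imp_continuous_within)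

lemma Dk_mono1: "Dk S (Suc k) f \<Longrightarrow> Dk S k f"
proof (induction k arbitrary: f)
  case 0
  then show ?case using Dk_continuous[of S "Suc 0" f] by simp
next
  case (Suc k)
  then show ?case by simp
qed

lemma Dk_const: "Dk S k (\<lambda>_. c)"
proof (induction k arbitrary: c)
  case (Suc k)
  have "deriv (\<lambda>_. c) = (\<lambda>_::real. 0::real)" by (rule ext) (simp add: deriv_const)
  then show ?case using Suc[of 0] by simp
qed auto

lemma Dk_ident: "open S \<Longrightarrow> Dk S k (\<lambda>x. x)"
  by (cases k) (auto intro!: Dk_SucI[where f'="\<lambda>_. 1"] Dk_const derivative_eq_intros simp del: Dk.simps(2))

lemma Dk_add:
  assumes "open S"
  shows "Dk S k f \<Longrightarrow> Dk S k g \<Longrightarrow> Dk S k (\<lambda>x. f x + g x)"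
proof (induction k arbitrary: f g)
  case 0
  then show ?case by (auto intro: continuous_intros)
next
  case (Suc k)
  show ?case
  proof (rule Dk_SucI[OF assms])
    show "((\<lambda>x. f x + g x) has_real_derivative (deriv f x + deriv g x)) (at x)" if "x \<in> S" for x
      using Dk_SucD[OF Suc.prems(1) that] Dk_SucD[OF Suc.prems(2) that] by (rule DERIV_add)
    show "Dk S k (\<lambda>x. deriv f x + deriv g x)"
      using Suc by auto
  qed
qed

lemma Dk_mult:
  assumes "open S"
  shows "Dk S k f \<Longrightarrow> Dk S k g \<Longrightarrow> Dk S k (\<lambda>x. f x * g x)"
proof (induction k arbitrary: f g)
  case 0
  then show ?case by (auto intro: continuous_intros)
next
  case (Suc k)
  show ?case
  proof (rule Dk_SucI[OF assms])
    show "((\<lambda>x. f x * g x) has_real_derivative (deriv f x * g x + f x * deriv g x)) (at x)"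
      if "x \<in> S" for x
      using DERIV_mult[OF Dk_SucD[OF Suc.prems(1) that] Dk_SucD[OF Suc.prems(2) that]]
      by (simp add: algebra_simps)
    show "Dk S k (\<lambda>x. deriv f x * g x + f x * deriv g x)"
      using Suc.prems Dk_mono1[OF Suc.prems(1)] Dk_mono1[OF Suc.prems(2)] 
      by (intro Dk_add Suc.IH assms) auto
  qed
qed

lemma Dk_compose:
  assumes "open S" "open T" "g ` S \<subseteq> T"
  shows "Dk T k f \<Longrightarrow> Dk S k g \<Longrightarrow> Dk S k (\<lambda>x. f (g x))"
proof (induction k arbitrary: f)
  case 0
  then show ?case using assms(3) continuous_on_compose2 by auto
next
  case (Suc k)
  show ?case
  proof (rule Dk_SucI[OF assms(1)])
    show "((\<lambda>x. f (g x)) has_real_derivative (deriv f (g x) * deriv g x)) (at x)" if "x \<in> S" for x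
      using DERIV_chain2[OF Dk_SucD[OF Suc.prems(1)] Dk_SucD[OF Suc.prems(2) that]] assms(3) that
      by auto
    show "Dk S k (\<lambda>x. deriv f (g x) * deriv g x)"
    proof (rule Dk_mult[OF assms(1)])
      show "Dk S k (\<lambda>x. deriv f (g x))"
        using Suc.prems Dk_mono1[OF Suc.prems(2)] Suc.IH[of "deriv f"] by simp
      show "Dk S k (deriv g)" using Suc.prems by simp
    qed
  qed
qed

lemma smooth_on_I:
  assumes "open S" "\<And>x. x \<in> S \<Longrightarrow> (f has_real_derivative f' x) (at x)" "smooth_on S f'"
  shows "smooth_on S f"
  unfolding smooth_on_def
proof
  fix k show "Dk S k f"
    using Dk_SucI[OF assms(1,2), of k] assms(3) Dk_mono1 unfolding smooth_on_def by blast
qed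

lemma smooth_on_deriv: "smooth_on S f \<Longrightarrow> smooth_on S (deriv f)"
  unfolding smooth_on_def by (metis Dk.simps(2))

lemma smooth_on_DERIV: "smooth_on S f \<Longrightarrow> x \<in> S \<Longrightarrow> (f has_real_derivative deriv f x) (at x)"
  unfolding smooth_on_def using Dk_SucD by blast

lemma smooth_on_continuous: "smooth_on S f \<Longrightarrow> continuous_on S f"
  unfolding smooth_on_def using Dk_continuous by blast

lemma smooth_on_const [simp]: "smooth_on S (\<lambda>_. c)"
  by (simp add: smooth_on_def Dk_const)

lemma smooth_on_ident: "open S \<Longrightarrow> smooth_on S (\<lambda>x. x)"
  by (simp add: smooth_on_def Dk_ident)

lemma smooth_on_add: "open S \<Longrightarrow> smooth_on S f \<Longrightarrow> smooth_on S g \<Longrightarrow> smooth_on S (\<lambda>x. f x + g x)"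
  by (simp add: smooth_on_def Dk_add)

lemma smooth_on_mult: "open S \<Longrightarrow> smooth_on S f \<Longrightarrow> smooth_on S g \<Longrightarrow> smooth_on S (\<lambda>x. f x * g x)"
  by (simp add: smooth_on_def Dk_mult)

lemma smooth_on_cmult: "open S \<Longrightarrow> smooth_on S f \<Longrightarrow> smooth_on S (\<lambda>x. c * f x)"
  by (intro smooth_on_mult smooth_on_const)

lemma smooth_on_diff:
  assumes "open S" "smooth_on S f" "smooth_on S g"
  shows "smooth_on S (\<lambda>x. f x - g x)"
  using smooth_on_add[OF assms(1,2) smooth_on_cmult[OF assms(1,3), of "-1"]] by simp

lemma smooth_on_compose:
  "open S \<Longrightarrow> open T \<Longrightarrow> g ` S \<subseteq> T \<Longrightarrow> smooth_on T f \<Longrightarrow> smooth_on S g \<Longrightarrow> smooth_on S (\<lambda>x. f (g x))"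
  by (simp add: smooth_on_def Dk_compose)

lemma smooth_on_exp: "smooth_on UNIV (\<lambda>x. exp (c * x))"
proof -
  have "Dk UNIV k (\<lambda>x. exp (c * x))" for k
  proof (induction k)
    case 0 show ?case by (auto intro!: continuous_intros)
  next
    case (Suc k)
    show ?case
    proof (rule Dk_SucI)
      show "((\<lambda>x. exp (c * x)) has_real_derivative c * exp (c * x)) (at x)" for x
        by (auto intro!: derivative_eq_intros)
      show "Dk UNIV k (\<lambda>x. c * exp (c * x))" by (intro Dk_mult Dk_const Suc) auto
    qed auto
  qed
  then show ?thesis by (simp add: smooth_on_def)
qed

lemma smooth_on_powr: "smooth_on {0<..} (\<lambda>x. x powr c)"
proof -
  have "Dk {0<..} k (\<lambda>x. x powr c)" for k
  proof (induction k arbitrary: c)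
    case 0 show ?case by (auto intro!: continuous_intros)
  next
    case (Suc k)
    show ?case
    proof (rule Dk_SucI)
      show "((\<lambda>x. x powr c) has_real_derivative c * x powr (c - 1)) (at x)" if "x \<in> {0<..}" for x
        using that has_real_derivative_powr[of x c] by simp
      show "Dk {0<..} k (\<lambda>x. c * x powr (c - 1))" by (intro Dk_mult Dk_const Suc) auto
    qed auto
  qed
  then show ?thesis by (simp add: smooth_on_def)
qed

section \<open>Smooth bumps with compact support\<close>

text \<open>Carrying the polynomial as a parameter makes the family closed under differentiation, so
  that smoothness is an induction over a single derivative formula.\<close>

definition flat_exp :: "real poly \<Rightarrow> real \<Rightarrow> real" where
  "flat_exp p x = (if x > 0 then poly p (1/x) * exp (- 1/x) else 0)"

lemma poly_times_exp_decay: "((\<lambda>y::real. poly p y * exp (- y)) \<longlongrightarrow> 0) at_top"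
proof -
  have "((\<lambda>y. \<Sum>i\<le>degree p. coeff p i * (y ^ i / exp y)) \<longlongrightarrow> (\<Sum>i\<le>degree p. coeff p i * 0)) at_top"
    by (intro tendsto_sum tendsto_mult tendsto_const tendsto_power_div_exp_0)
  then show ?thesis
    by (simp add: poly_altdef exp_minus divide_simps sum_distrib_left sum_divide_distrib mult.assoc)
qed

text \<open>In the variable y = 1/x one has d/dx = -y^2 d/dy, hence p(y) e^(-y) becomes y^2 (p -
  p')(y) e^(-y); \<open>[:0,0,1:]\<close> is y^2.\<close>

lemma flat_exp_DERIV:
  "(flat_exp p has_real_derivative flat_exp ([:0,0,1:] * (p - pderiv p)) x) (at x)"
proof -
  consider "x > 0" | "x < 0" | "x = 0" by linarith
  then show ?thesis
  proof cases
    case 1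
    have d: "((\<lambda>x. poly p (1/x) * exp (- 1/x)) has_real_derivative
        flat_exp ([:0,0,1:] * (p - pderiv p)) x) (at x)"
    proof -
      have i: "((\<lambda>x. 1/x) has_real_derivative - 1 / x\<^sup>2) (at x)"
        using 1 by (auto intro!: derivative_eq_intros simp: power2_eq_square)
      have e: "((\<lambda>x. exp (- 1/x)) has_real_derivative exp (- 1/x) * (1 / x\<^sup>2)) (at x)"
        using 1 by (auto intro!: derivative_eq_intros simp: power2_eq_square)
      have "((\<lambda>x. poly p (1/x)) has_real_derivative poly (pderiv p) (1/x) * (- 1 / x\<^sup>2)) (at x)"
        by (rule DERIV_chain2[OF poly_DERIV i])
      from DERIV_mult[OF this e] show ?thesis
        using 1 by (rule_tac back_subst) (auto simp: flat_exp_def power2_eq_square algebra_simps)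
    qed
    have "\<forall>\<^sub>F y in nhds x. poly p (1/y) * exp (- 1/y) = flat_exp p y"
      using 1 by (intro eventually_mono[OF eventually_nhds_in_open[of "{0<..}"]])
        (auto simp: flat_exp_def)
    from DERIV_cong_ev[OF refl this refl] d show ?thesis by simp
  next
    case 2
    have d: "((\<lambda>x. 0) has_real_derivative flat_exp ([:0,0,1:] * (p - pderiv p)) x) (at x)"
      using 2 by (auto simp: flat_exp_def)
    have "\<forall>\<^sub>F y in nhds x. 0 = flat_exp p y"
      using 2 by (intro eventually_mono[OF eventually_nhds_in_open[of "{..<0}"]])
        (auto simp: flat_exp_def)
    from DERIV_cong_ev[OF refl this refl] d show ?thesis by simp
  next
    case 3
    \<comment> \<open>The difference quotient at 0 from the right is y p(y) e^(-y) with y = 1/h; the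
      factor \<open>[:0,1:]\<close> accounts for the division by h.\<close>
    have lim: "((\<lambda>h::real. poly ([:0,1:] * p) (inverse h) * exp (- inverse h)) \<longlongrightarrow> 0) (at_right 0)"
      by (rule filterlim_compose[OF poly_times_exp_decay filterlim_inverse_at_top_right])
    have "((\<lambda>h. (flat_exp p (0 + h) - flat_exp p 0) / h) \<longlongrightarrow> 0) (at_right 0)"
    proof (rule Lim_transform_eventually[OF lim])
      have "poly ([:0,1:] * p) (inverse h) * exp (- inverse h)
          = (flat_exp p (0 + h) - flat_exp p 0) / h" if "h > 0" for h
        using that by (simp add: flat_exp_def inverse_eq_divide)
      then show "\<forall>\<^sub>F h in at_right 0. poly ([:0,1:] * p) (inverse h) * exp (- inverse h)
          = (flat_exp p (0 + h) - flat_exp p 0) / h"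
        by (simp add: eventually_at_filter)
    qed
    moreover have "((\<lambda>h. (flat_exp p (0 + h) - flat_exp p 0) / h) \<longlongrightarrow> 0) (at_left 0)"
    proof (rule Lim_transform_eventually[OF tendsto_const])
      have "0 = (flat_exp p (0 + h) - flat_exp p 0) / h" if "h < 0" for h
        using that by (simp add: flat_exp_def)
      then show "\<forall>\<^sub>F h in at_left 0. 0 = (flat_exp p (0 + h) - flat_exp p 0) / h"
        by (simp add: eventually_at_filter)
    qed
    ultimately have "((\<lambda>h. (flat_exp p (0 + h) - flat_exp p 0) / h) \<longlongrightarrow> 0) (at 0)"
      using filterlim_at_split by blast
    then show ?thesis using 3 by (simp add: DERIV_def flat_exp_def)
  qed
qed

lemma smooth_on_flat_exp: "smooth_on UNIV (flat_exp p)"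
proof -
  have "Dk UNIV k (flat_exp p)" for k
  proof (induction k arbitrary: p)
    case 0
    show ?case using flat_exp_DERIV DERIV_isCont continuous_at_imp_continuous_on by (metis Dk.simps(1))
  next
    case (Suc k)
    then show ?case using Dk_SucI[OF _ flat_exp_DERIV] by blast
  qed
  then show ?thesis by (simp add: smooth_on_def)
qed

definition bump :: "real \<Rightarrow> real \<Rightarrow> real \<Rightarrow> real" where
  "bump a b t = flat_exp 1 (t - a) * flat_exp 1 (b - t)"

lemma smooth_on_bump: "smooth_on UNIV (bump a b)"
  unfolding bump_def
proof (intro smooth_on_mult)
  show "smooth_on UNIV (\<lambda>x. flat_exp 1 (x - a))"
    by (rule smooth_on_compose[of UNIV UNIV "\<lambda>x. x - a"])
      (auto intro!: smooth_on_flat_exp smooth_on_diff smooth_on_ident)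
  show "smooth_on UNIV (\<lambda>x. flat_exp 1 (b - x))"
    by (rule smooth_on_compose[of UNIV UNIV "\<lambda>x. b - x"])
      (auto intro!: smooth_on_flat_exp smooth_on_diff smooth_on_ident)
qed auto

lemma flat_exp_1_bounds: "0 \<le> flat_exp 1 x" "flat_exp 1 x \<le> 1" "x \<le> 0 \<Longrightarrow> flat_exp 1 x = 0"
    "x > 0 \<Longrightarrow> flat_exp 1 x > 0"
  by (auto simp: flat_exp_def)

lemma bump_pos: "a < t \<Longrightarrow> t < b \<Longrightarrow> bump a b t > 0"
  and bump_nonneg: "bump a b t \<ge> 0"
  and bump_eq_0: "t \<le> a \<or> b \<le> t \<Longrightarrow> bump a b t = 0"
  and bump_le_1: "bump a b t \<le> 1"
  using flat_exp_1_bounds by (auto simp: bump_def intro!: mult_le_one)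

text \<open>Vanishing is required only on the open complement of the closed interval; this is the
  form that passes to derivatives without enlarging the interval.\<close>

definition test1 :: "real \<Rightarrow> real \<Rightarrow> (real \<Rightarrow> real) \<Rightarrow> bool" where
  "test1 a b \<eta> \<longleftrightarrow> smooth_on UNIV \<eta> \<and> (\<forall>t. t < a \<or> b < t \<longrightarrow> \<eta> t = 0)"

lemma test1_deriv:
  assumes "test1 a b \<eta>" shows "test1 a b (deriv \<eta>)"
  unfolding test1_def
proof (intro conjI allI impI)
  show "smooth_on UNIV (deriv \<eta>)" using assms smooth_on_deriv by (simp add: test1_def)
  fix t assume t: "t < a \<or> b < t"
  have "\<forall>\<^sub>F y in nhds t. y \<in> {..<a} \<union> {b<..}"
    using t by (intro eventually_nhds_in_open) auto
  then have "\<forall>\<^sub>F y in nhds t. \<eta> y = 0"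
    by (rule eventually_mono) (use assms in \<open>auto simp: test1_def\<close>)
  then show "deriv \<eta> t = 0"
    using deriv_cong_ev[of \<eta> "\<lambda>_. 0" t t] by (simp add: deriv_const)
qed

lemma test1_mult: "test1 a b \<eta> \<Longrightarrow> smooth_on UNIV f \<Longrightarrow> test1 a b (\<lambda>t. \<eta> t * f t)"
  by (auto simp: test1_def intro: smooth_on_mult)

lemma test1_add: "test1 a b \<eta> \<Longrightarrow> test1 a b \<theta> \<Longrightarrow> test1 a b (\<lambda>t. \<eta> t + \<theta> t)"
  by (auto simp: test1_def intro: smooth_on_add)

lemma test1_cmult: "test1 a b \<eta> \<Longrightarrow> test1 a b (\<lambda>t. c * \<eta> t)"
  by (auto simp: test1_def intro: smooth_on_cmult)

lemma test1_bump: "test1 a b (bump a b)"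
  by (auto simp: test1_def smooth_on_bump bump_eq_0)

lemma test1_DERIV: "test1 a b \<eta> \<Longrightarrow> (\<eta> has_real_derivative deriv \<eta> t) (at t)"
  by (auto simp: test1_def intro: smooth_on_DERIV)

lemma test1_continuous: "test1 a b \<eta> \<Longrightarrow> continuous_on A \<eta>"
  by (meson continuous_on_subset smooth_on_continuous subset_UNIV test1_def)

section \<open>Test functions and the weighted divergence\<close>

lemma frechet_eqI: "(f has_derivative f') (at x) \<Longrightarrow> frechet_derivative f (at x) = f'"
  by (metis frechet_derivative_at)

lemma Ck_SucI:
  assumes "\<And>x. (f has_derivative f' x) (at x)" "\<And>i. i \<in> Basis \<Longrightarrow> Ck k (\<lambda>x. f' x i)"
  shows "Ck (Suc k) f"
  using assms frechet_eqI[OF assms(1)] by (auto simp: differentiable_def)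

lemma Ck_SucD: "Ck (Suc k) f \<Longrightarrow> (f has_derivative frechet_derivative f (at x)) (at x)"
  by (simp add: frechet_derivative_works[symmetric])

lemma Ck_continuous: "Ck k f \<Longrightarrow> continuous_on UNIV f"
  by (cases k) (auto simp: continuous_at_imp_continuous_on differentiable_imp_continuous_within)

lemma Ck_mono1: "Ck (Suc k) f \<Longrightarrow> Ck k f"
proof (induction k arbitrary: f)
  case 0
  then show ?case using Ck_continuous[of "Suc 0" f] by simp
qed auto

lemma Ck_const: "Ck k (\<lambda>_. c)"
proof (induction k arbitrary: c)
  case (Suc k)
  show ?case
    by (rule Ck_SucI[where f'="\<lambda>x h. 0"]) (auto intro: Suc)
qed auto

lemma Ck_inner: "Ck k (\<lambda>x. x \<bullet> i)"
proof (cases k)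
  case (Suc k)
  show ?thesis unfolding Suc
    by (rule Ck_SucI[where f'="\<lambda>x h. h \<bullet> i"]) (auto intro!: Ck_const derivative_eq_intros)
qed (auto intro: continuous_intros)

lemma Ck_add: "Ck k f \<Longrightarrow> Ck k g \<Longrightarrow> Ck k (\<lambda>x. f x + g x)"
proof (induction k arbitrary: f g)
  case (Suc k)
  show ?case
  proof (rule Ck_SucI)
    show "((\<lambda>x. f x + g x) has_derivative
        (\<lambda>h. frechet_derivative f (at x) h + frechet_derivative g (at x) h)) (at x)" for x
      using Suc.prems by (intro has_derivative_add Ck_SucD)
    show "Ck k (\<lambda>x. frechet_derivative f (at x) i + frechet_derivative g (at x) i)"
      if "i \<in> Basis" for i
      using Suc that by auto
  qed
qed (auto intro: continuous_intros)

lemma Ck_mult: "Ck k f \<Longrightarrow> Ck k g \<Longrightarrow> Ck k (\<lambda>x. f x * g x)"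
proof (induction k arbitrary: f g)
  case (Suc k)
  show ?case
  proof (rule Ck_SucI)
    show "((\<lambda>x. f x * g x) has_derivative
        (\<lambda>h. f x * frechet_derivative g (at x) h + frechet_derivative f (at x) h * g x)) (at x)" for x
      using Suc.prems by (intro has_derivative_mult Ck_SucD)
    show "Ck k (\<lambda>x. f x * frechet_derivative g (at x) i + frechet_derivative f (at x) i * g x)"
      if "i \<in> Basis" for i
      using Suc.prems that Ck_mono1[OF Suc.prems(1)] Ck_mono1[OF Suc.prems(2)]
      by (intro Ck_add Suc.IH) auto
  qed
qed (auto intro: continuous_intros)

definition pd :: "('a::euclidean_space \<Rightarrow> real) \<Rightarrow> 'a \<Rightarrow> 'a \<Rightarrow> real" where
  "pd f i x = frechet_derivative f (at x) i"

lemma test_functions_support: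
  fixes \<phi> :: "'a::euclidean_space \<Rightarrow> real"
  assumes "\<phi> \<in> test_functions"
  obtains r R where "0 < r" "\<And>x. norm x < r \<or> R < norm x \<Longrightarrow> \<phi> x = 0"
proof -
  let ?S = "closure {x. \<phi> x \<noteq> 0}"
  have c: "compact ?S" and z: "0 \<notin> ?S" using assms by (auto simp: test_functions_def)
  from c obtain R where R: "\<And>x. x \<in> ?S \<Longrightarrow> norm x \<le> R"
    using bounded_iff compact_imp_bounded by metis
  have "open (- ?S)" by auto
  with z obtain r where r: "r > 0" "ball 0 r \<subseteq> - ?S"
    by (meson ComplI openE)
  show ?thesis
  proof (rule that[OF r(1)])
    fix x :: 'a assume "norm x < r \<or> R < norm x"
    then have "x \<notin> ?S" using r(2) R[of x] by (auto simp: subset_iff)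
    then show "\<phi> x = 0" using closure_subset[of "{x. \<phi> x \<noteq> 0}"] by auto
  qed
qed

lemma test_functions_Ck: "\<phi> \<in> test_functions \<Longrightarrow> Ck k \<phi>"
  by (simp add: test_functions_def)

lemma test_functionsI:
  assumes "\<And>k. Ck k \<phi>" "0 < r" "\<And>x. norm x < r \<or> R < norm x \<Longrightarrow> \<phi> x = 0"
  shows "\<phi> \<in> test_functions"
proof -
  have "closed ({x. r \<le> norm x} \<inter> cball 0 R)"
    by (intro closed_Int closed_Collect_le) (auto intro: continuous_intros)
  moreover have "{x. \<phi> x \<noteq> 0} \<subseteq> {x. r \<le> norm x} \<inter> cball 0 R"
    using assms(3) by (force simp: not_less[symmetric])
  ultimately have s: "closure {x. \<phi> x \<noteq> 0} \<subseteq> {x. r \<le> norm x} \<inter> cball 0 R"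
    by (rule closure_minimal[rotated])
  then have "bounded (closure {x. \<phi> x \<noteq> 0})"
    by (meson bounded_cball bounded_subset inf.boundedE)
  with s show ?thesis using assms(1,2) by (auto simp: test_functions_def compact_eq_bounded_closed)
qed

lemma test_functions_diff:
  fixes \<phi> :: "'a::euclidean_space \<Rightarrow> real"
  assumes "\<phi> \<in> test_functions" "\<psi> \<in> test_functions"
  shows "(\<lambda>x. \<phi> x - \<psi> x) \<in> test_functions"
proof -
  obtain r R where 1: "0 < r" "\<And>x. norm x < r \<or> R < norm x \<Longrightarrow> \<phi> x = 0"
    using test_functions_support[OF assms(1)] by blast
  obtain r' R' where 2: "0 < r'" "\<And>x. norm x < r' \<or> R' < norm x \<Longrightarrow> \<psi> x = 0"
    using test_functions_support[OF assms(2)] by blast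
  show ?thesis
  proof (rule test_functionsI)
    show "0 < min r r'" using 1 2 by simp
    show "Ck k (\<lambda>x. \<phi> x - \<psi> x)" for k
      using Ck_add[OF test_functions_Ck[OF assms(1)] Ck_mult[OF Ck_const[of k "-1"] test_functions_Ck[OF assms(2)]]]
      by simp
    fix x :: 'a assume "norm x < min r r' \<or> max R R' < norm x"
    then show "\<phi> x - \<psi> x = 0" using 1(2)[of x] 2(2)[of x] by auto
  qed
qed

lemma frechet_derivative_locally_0:
  fixes f :: "'a::real_normed_vector \<Rightarrow> 'b::real_normed_vector"
  assumes "open S" "x \<in> S" "\<And>y. y \<in> S \<Longrightarrow> f y = 0"
  shows "(f has_derivative (\<lambda>_. 0)) (at x)"
  by (rule has_derivative_transform_within_open[of "\<lambda>_. 0" _ _ _ S]) (use assms in auto)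

lemma open_off_annulus: "open {x::'a::euclidean_space. norm x < r \<or> R < norm x}"
  by (intro open_Collect_disj open_Collect_less continuous_intros)

lemma pd_support:
  assumes "\<And>x. norm x < r \<or> R < norm x \<Longrightarrow> f x = 0" "norm x < r \<or> R < norm x"
  shows "pd f i x = 0"
  unfolding pd_def
  using frechet_eqI[OF frechet_derivative_locally_0[OF open_off_annulus[of r R], of x f]] assms by auto

lemma Ck_pd: "Ck (Suc k) f \<Longrightarrow> i \<in> Basis \<Longrightarrow> Ck k (pd f i)"
  by (simp add: pd_def[abs_def])

lemma has_derivative_pd_eq:
  assumes "(f has_derivative f') (at x)" shows "f' i = pd f i x"
  using frechet_eqI[OF assms] by (simp add: pd_def)

text \<open>Stated with the exponent c - 2 and the linear form x \<bullet> h instead of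
  \<open>sgn x\<close>, so that every further derivative is again a power of the norm times
  coordinates.\<close>

lemma has_derivative_norm_powr:
  fixes x :: "'a::euclidean_space"
  assumes "x \<noteq> 0"
  shows "((\<lambda>x. norm x powr c) has_derivative (\<lambda>h. c * norm x powr (c - 2) * (x \<bullet> h))) (at x)"
proof -
  have "((\<lambda>x. norm x powr c) has_derivative (\<lambda>h. (c * norm x powr (c - 1)) * (sgn x \<bullet> h))) (at x)"
  proof -
    have "((\<lambda>r. r powr c) has_derivative (\<lambda>h. (c * norm x powr (c - 1)) * h)) (at (norm x))"
      using has_real_derivative_powr[of "norm x" c] assms by (simp add: has_field_derivative_def)
    from has_derivative_compose[OF has_derivative_norm[OF assms] this] show ?thesis
      by (simp add: inner_commute)
  qed
  moreover have "norm x powr (c - 1) = norm x powr (c - 2) * norm x"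
    using powr_add[of "norm x" "c - 2" 1] assms by simp
  moreover have "norm x * (sgn x \<bullet> h) = x \<bullet> h" for h
    using assms by (simp add: sgn_div_norm)
  ultimately show ?thesis by (simp add: mult.assoc)
qed

text \<open>The product rule away from the origin. At the origin both sides are 0: the field
  vanishes on a ball because the support avoids 0, and 0 \<open>powr\<close> anything is 0.\<close>

lemma wdiv_test:
  fixes \<phi> :: "'a::euclidean_space \<Rightarrow> real"
  assumes "\<phi> \<in> test_functions"
  shows "wdiv \<alpha> \<phi> x = norm x powr \<alpha> * (\<Sum>i\<in>Basis. pd (pd \<phi> i) i x)
      + \<alpha> * norm x powr (\<alpha> - 2) * (\<Sum>i\<in>Basis. (x \<bullet> i) * pd \<phi> i x)"
proof (cases "x = 0")
  case True
  obtain r R where r: "0 < r" "\<And>x. norm x < r \<or> R < norm x \<Longrightarrow> \<phi> x = 0"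
    using test_functions_support[OF assms] by blast
  have "norm y powr \<alpha> *\<^sub>R grad \<phi> y = 0" if "y \<in> ball 0 r" for y
    using pd_support[of r R \<phi> y, OF r(2)] that by (simp add: grad_def pd_def[symmetric])
  then have "((\<lambda>y. norm y powr \<alpha> *\<^sub>R grad \<phi> y) has_derivative (\<lambda>_. 0)) (at x)"
    using True r(1) frechet_derivative_locally_0[of "ball 0 r" x "\<lambda>y. norm y powr \<alpha> *\<^sub>R grad \<phi> y"] by auto
  then show ?thesis using True by (simp add: wdiv_def divergence_def frechet_eqI)
next
  case False
  have pdd: "(pd \<phi> i has_derivative (\<lambda>h. frechet_derivative (pd \<phi> i) (at x) h)) (at x)" if "i \<in> Basis" for i
    using Ck_SucD[OF Ck_pd[OF test_functions_Ck[OF assms] that]] by simp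
  have "(grad \<phi> has_derivative (\<lambda>h. \<Sum>i\<in>Basis. frechet_derivative (pd \<phi> i) (at x) h *\<^sub>R i)) (at x)"
    unfolding grad_def[abs_def] pd_def[of \<phi>, symmetric]
    by (intro has_derivative_sum has_derivative_scaleR_left pdd)
  from has_derivative_scaleR[OF has_derivative_norm_powr[OF False, of \<alpha>] this]
  have "((\<lambda>x. norm x powr \<alpha> *\<^sub>R grad \<phi> x) has_derivative
     (\<lambda>h. norm x powr \<alpha> *\<^sub>R (\<Sum>i\<in>Basis. frechet_derivative (pd \<phi> i) (at x) h *\<^sub>R i) +
          (\<alpha> * norm x powr (\<alpha> - 2) * (x \<bullet> h)) *\<^sub>R grad \<phi> x)) (at x)" .
  note fe = frechet_eqI[OF this]
  have g: "grad \<phi> x \<bullet> j = pd \<phi> j x" if "j \<in> Basis" for j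
    using that by (simp add: grad_def pd_def inner_sum_left inner_Basis if_distrib cong: if_cong)
  have s: "(\<Sum>i\<in>Basis. frechet_derivative (pd \<phi> i) (at x) j *\<^sub>R i) \<bullet> j = pd (pd \<phi> j) j x" if "j \<in> Basis" for j
    using that by (simp add: pd_def[of "pd \<phi> j"] inner_sum_left inner_Basis if_distrib cong: if_cong)
  show ?thesis
    by (simp add: wdiv_def divergence_def fe inner_add_left g s[unfolded pd_def[of "pd \<phi> _"]]
        pd_def[of "pd \<phi> _"] sum.distrib sum_distrib_left mult.assoc)
qed

section \<open>Radial functions in logarithmic coordinates\<close>

text \<open>The Emden-Fowler substitution with a free exponent. Products and radial differentiation
  stay within the family, the exponent keeping track of homogeneity. The value at the origin is 0,
  as 0 \<open>powr\<close> c is 0.\<close>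

definition lift :: "real \<Rightarrow> (real \<Rightarrow> real) \<Rightarrow> 'a::euclidean_space \<Rightarrow> real" where
  "lift c \<eta> x = norm x powr c * \<eta> (ln (norm x))"

lemma lift_has_derivative:
  fixes x :: "'a::euclidean_space"
  assumes "x \<noteq> 0" "(\<eta> has_real_derivative \<eta>' (ln (norm x))) (at (ln (norm x)))"
  shows "(lift c \<eta> has_derivative (\<lambda>h. lift (c - 2) (\<lambda>t. c * \<eta> t + \<eta>' t) x * (x \<bullet> h))) (at x)"
proof -
  have l: "((\<lambda>x. ln (norm x)) has_derivative (\<lambda>h. norm x powr (-2) * (x \<bullet> h))) (at x)"
  proof -
    have "(ln has_derivative (\<lambda>h. (1 / norm x) * h)) (at (norm x))"
      using DERIV_ln[of "norm x"] assms(1) unfolding has_field_derivative_def inverse_eq_divide 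
      by (metis (no_types) zero_less_norm_iff)
    from has_derivative_compose[OF has_derivative_norm[OF assms(1)] this]
    show ?thesis using assms(1)
      by (simp add: inner_commute sgn_div_norm powr_minus powr_numeral power2_eq_square divide_simps)
  qed
  have "((\<lambda>x. \<eta> (ln (norm x))) has_derivative (\<lambda>h. \<eta>' (ln (norm x)) * (norm x powr (-2) * (x \<bullet> h)))) (at x)"
    using has_derivative_compose[OF l, of \<eta> "\<lambda>h. \<eta>' (ln (norm x)) * h"] assms(2)
    by (simp add: has_field_derivative_def)
  from has_derivative_mult[OF has_derivative_norm_powr[OF assms(1), of c] this]
  have 1: "(lift c \<eta> has_derivative
     (\<lambda>h. norm x powr c * (\<eta>' (ln (norm x)) * (norm x powr (-2) * (x \<bullet> h))) +
          c * norm x powr (c - 2) * (x \<bullet> h) * \<eta> (ln (norm x)))) (at x)"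
    unfolding lift_def[abs_def] .
  have "norm x powr (c - 2) = norm x powr c * norm x powr (-2)"
    by (simp add: powr_add[symmetric])
  then have 2: "norm x powr c * (\<eta>' (ln (norm x)) * (norm x powr (-2) * (x \<bullet> h))) +
          c * norm x powr (c - 2) * (x \<bullet> h) * \<eta> (ln (norm x))
     = lift (c - 2) (\<lambda>t. c * \<eta> t + \<eta>' t) x * (x \<bullet> h)" for h
    by (simp add: lift_def algebra_simps)
  show ?thesis using 1 unfolding 2 .
qed

lemma ln_norm_outside:
  assumes "norm x < exp a \<or> exp b < norm x" "x \<noteq> 0"
  shows "ln (norm x) < a \<or> b < ln (norm x)"
  using assms by (metis exp_less_cancel_iff exp_ln zero_less_norm_iff)

lemma lift_test1_outside:
  assumes "test1 a b \<eta>" "norm x < exp a \<or> exp b < norm x"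
  shows "lift c \<eta> x = 0"
proof (cases "x = 0")
  case False
  then show ?thesis using ln_norm_outside[OF assms(2) False] assms(1) by (auto simp: lift_def test1_def)
qed (simp add: lift_def)

lemma lift_test1_has_derivative:
  assumes "test1 a b \<eta>"
  shows "(lift c \<eta> has_derivative (\<lambda>h. lift (c - 2) (\<lambda>t. c * \<eta> t + deriv \<eta> t) x * (x \<bullet> h))) (at x)"
proof (cases "x = 0")
  case True
  have "(lift c \<eta> has_derivative (\<lambda>_. 0)) (at x)"
    by (rule frechet_derivative_locally_0[of "ball 0 (exp a)"])
      (use True lift_test1_outside[OF assms] in auto)
  then show ?thesis using True by simp
qed (use lift_has_derivative[of x \<eta> "deriv \<eta>" c] test1_DERIV[OF assms] in simp)

text \<open>A partial derivative of a lift is another lift, with a profile vanishing off the same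
  interval, times a coordinate. The induction therefore runs over all exponents and profiles at
  once.\<close>

lemma lift_Ck: "test1 a b \<eta> \<Longrightarrow> Ck k (lift c \<eta>)"
proof (induction k arbitrary: c \<eta>)
  case 0
  show ?case
    using has_derivative_continuous[OF lift_test1_has_derivative[OF 0]] continuous_at_imp_continuous_on
    by (metis Ck.simps(1))
next
  case (Suc k)
  show ?case
    by (rule Ck_SucI[OF lift_test1_has_derivative[OF Suc.prems]])
      (intro Ck_mult Suc.IH Ck_inner test1_add test1_cmult test1_deriv Suc.prems)
qed

lemma lift_test_function:
  assumes "test1 a b \<eta>" shows "lift c \<eta> \<in> test_functions"
  using lift_test1_outside[OF assms]
  by (intro test_functionsI[where r="exp a" and R="exp b"] lift_Ck[OF assms]) auto

lemma sum_inner_Basis_sq: "(\<Sum>i\<in>Basis. (x \<bullet> i) * (x \<bullet> i)) = (norm (x::'a::euclidean_space))\<^sup>2"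
  by (simp add: power2_norm_eq_inner euclidean_inner[symmetric])

lemma powr_shift2: "norm (x::'a::euclidean_space) powr (c - 2) * (norm x)\<^sup>2 = norm x powr c"
proof (cases "x = 0")
  case False
  then have "(norm x)\<^sup>2 = norm x powr 2" by (simp add: powr_numeral)
  then show ?thesis by (simp only: powr_add[symmetric]) simp
qed simp

text \<open>The profile on the right is (D + c)(D + c + N + \<alpha> - 2) \<eta>, with N the
  dimension. For c = -m and c = -k, where N + \<alpha> - 2 = m + k, this gives the two halves (D -
  m)(D + k) and (D - k)(D + m) of the fourth-order operator.\<close>

lemma wdiv_lift:
  fixes x :: "'a::euclidean_space"
  assumes "test1 a b \<eta>"
  shows "wdiv \<alpha> (lift c \<eta>) x = lift (\<alpha> + c - 2) (\<lambda>t. deriv (deriv \<eta>) t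
     + (2 * c + DIM('a) + \<alpha> - 2) * deriv \<eta> t + c * (c + DIM('a) + \<alpha> - 2) * \<eta> t) x"
proof -
  let ?e1 = "\<lambda>t. c * \<eta> t + deriv \<eta> t"
  have t1: "test1 a b ?e1" by (intro test1_add test1_cmult test1_deriv assms)
  have d1: "deriv ?e1 t = c * deriv \<eta> t + deriv (deriv \<eta>) t" for t
    using DERIV_add[OF DERIV_cmult[OF test1_DERIV[OF assms]] test1_DERIV[OF test1_deriv[OF assms]]]
    by (rule DERIV_imp_deriv)
  have p1: "pd (lift c \<eta>) i = (\<lambda>x. lift (c - 2) ?e1 x * (x \<bullet> i))" for i :: 'a
    by (intro ext has_derivative_pd_eq[OF lift_test1_has_derivative[OF assms], symmetric])
  have p2: "pd (pd (lift c \<eta>) i) i x = lift (c - 2 - 2) (\<lambda>t. (c - 2) * ?e1 t + deriv ?e1 t) x * (x \<bullet> i) * (x \<bullet> i)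
      + lift (c - 2) ?e1 x" if "i \<in> Basis" for i :: 'a
  proof -
    have "((\<lambda>x. x \<bullet> i) has_derivative (\<lambda>h. h \<bullet> i)) (at x)" by (auto intro!: derivative_eq_intros)
    from has_derivative_pd_eq[OF has_derivative_mult[OF lift_test1_has_derivative[OF t1, of "c - 2"] this], of i]
    show ?thesis using that by (simp add: p1 inner_Basis algebra_simps)
  qed
  have s2: "(\<Sum>i\<in>Basis. pd (pd (lift c \<eta>) i) i x)
     = lift (c - 2 - 2) (\<lambda>t. (c - 2) * ?e1 t + deriv ?e1 t) x * (norm x)\<^sup>2 + DIM('a) * lift (c - 2) ?e1 x"
    by (simp add: p2 sum.distrib sum_distrib_left[symmetric] mult.assoc sum_inner_Basis_sq)
  have s1: "(\<Sum>i\<in>Basis. (x \<bullet> i) * pd (lift c \<eta>) i x) = lift (c - 2) ?e1 x * (norm x)\<^sup>2"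
    by (simp add: p1 sum_inner_Basis_sq[symmetric] sum_distrib_right mult_ac)
  have A: "norm x powr (\<alpha> + c - 2) = norm x powr \<alpha> * norm x powr (c - 2)"
    using powr_add[of "norm x" \<alpha> "c - 2"] by (simp add: add_diff_eq)
  have B: "norm x powr (c - 2 - 2) * (norm x)\<^sup>2 = norm x powr (c - 2)" by (rule powr_shift2)
  have C: "norm x powr (\<alpha> - 2) * (norm x)\<^sup>2 = norm x powr \<alpha>" by (rule powr_shift2)
  let ?l = "ln (norm x)" and ?P = "norm x powr \<alpha>" and ?Q = "norm x powr (c - 2)"
  have "wdiv \<alpha> (lift c \<eta>) x = ?P * ((norm x powr (c - 2 - 2) * (norm x)\<^sup>2) * ((c - 2) * ?e1 ?l + deriv ?e1 ?l)
     + DIM('a) * (?Q * ?e1 ?l)) + \<alpha> * (norm x powr (\<alpha> - 2) * (norm x)\<^sup>2) * (?Q * ?e1 ?l)"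
    unfolding wdiv_test[OF lift_test_function[OF assms]] s1 s2 by (simp add: lift_def algebra_simps)
  also have "\<dots> = lift (\<alpha> + c - 2) (\<lambda>t. deriv (deriv \<eta>) t
     + (2 * c + DIM('a) + \<alpha> - 2) * deriv \<eta> t + c * (c + DIM('a) + \<alpha> - 2) * \<eta> t) x"
    unfolding B C lift_def A d1 by (simp add: algebra_simps)
  finally show ?thesis .
qed

section \<open>Integration by parts against radial weights\<close>

lemma integrable_compact_support:
  fixes g :: "'a::euclidean_space \<Rightarrow> real"
  assumes "continuous_on UNIV g" "\<And>x. R < norm x \<Longrightarrow> g x = 0"
  shows "integrable lborel g"
proof -
  have "(\<lambda>x. indicator (cball 0 R) x *\<^sub>R g x) = g"
    using assms(2) by (auto simp: indicator_def fun_eq_iff)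
  moreover have "integrable lborel (\<lambda>x. indicator (cball 0 R) x *\<^sub>R g x)"
    by (rule borel_integrable_compact) (use continuous_on_subset[OF assms(1)] in auto)
  ultimately show ?thesis by simp
qed

text \<open>Translation invariance gives every difference quotient integral 0, and the mean value
  theorem bounds the quotients uniformly, so that the integral of the limit is 0 by dominated
  convergence. No iterated integration over coordinates is involved.\<close>

lemma integral_directional_derivative_eq_0:
  fixes g g' :: "'a::euclidean_space \<Rightarrow> real"
  assumes der: "\<And>x. ((\<lambda>t. g (x + t *\<^sub>R e)) has_real_derivative g' x) (at 0)"
    and cont: "continuous_on UNIV g" "continuous_on UNIV g'"
    and out: "\<And>x. R < norm x \<Longrightarrow> g x = 0" "\<And>x. R < norm x \<Longrightarrow> g' x = 0"
  shows "(LINT x|lborel. g' x) = 0"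
proof -
  have gm [measurable]: "g \<in> borel_measurable borel" and g'm [measurable]: "g' \<in> borel_measurable borel"
    by (rule borel_measurable_continuous_onI[OF cont(1)], rule borel_measurable_continuous_onI[OF cont(2)])
  have "\<exists>M. \<forall>x. \<bar>g' x\<bar> \<le> M"
  proof -
    have "compact (g' ` cball 0 R)"
      by (rule compact_continuous_image[OF continuous_on_subset[OF cont(2)]]) auto
    then obtain M where M: "\<And>y. y \<in> g' ` cball 0 R \<Longrightarrow> norm y \<le> M"
      using bounded_iff compact_imp_bounded by metis
    have "\<bar>g' x\<bar> \<le> max M 0" for x
    proof (cases "R < norm x")
      case False
      then have "norm (g' x) \<le> M" by (intro M) auto
      then show ?thesis by simp
    qed (use out(2) in auto)
    then show ?thesis by blast
  qed
  then obtain M where M: "\<And>x. \<bar>g' x\<bar> \<le> M" by blast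
  have M0: "0 \<le> M" using M[of 0] by linarith
  have derx: "((\<lambda>s. g (x + s *\<^sub>R e)) has_real_derivative g' (x + t *\<^sub>R e)) (at t)" for x t
    using der[of "x + t *\<^sub>R e"] DERIV_shift[of "\<lambda>s. g (x + s *\<^sub>R e)" _ 0 t]
    by (simp add: scaleR_add_left add_ac)
  have lip: "\<bar>g (x + h *\<^sub>R e) - g x\<bar> \<le> M * h" if h: "h > 0" for x h
  proof -
    obtain z where "0 < z" "z < h" "g (x + h *\<^sub>R e) - g (x + 0 *\<^sub>R e) = (h - 0) * g' (x + z *\<^sub>R e)"
      using MVT2[OF h, of "\<lambda>s. g (x + s *\<^sub>R e)" "\<lambda>s. g' (x + s *\<^sub>R e)"] derx by blast
    then show ?thesis using M[of "x + z *\<^sub>R e"] h by (simp add: abs_mult mult.commute)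
  qed
  define s where "s n x = (g (x + (1 / Suc n) *\<^sub>R e) - g x) / (1 / Suc n)" for n x
  have int_g: "integrable lborel g"
    by (rule integrable_compact_support[OF cont(1) out(1)])
  have shift: "integrable lborel (\<lambda>x. g (x + c))" "(LINT x|lborel. g (x + c)) = (LINT x|lborel. g x)" for c
  proof -
    have d: "distr lborel borel (\<lambda>x. c + x) = (lborel :: 'a measure)" by (rule lborel_distr_plus)
    show "integrable lborel (\<lambda>x. g (x + c))"
      using int_g by (subst (asm) d[symmetric], subst (asm) integrable_distr_eq) (auto simp: add.commute)
    show "(LINT x|lborel. g (x + c)) = (LINT x|lborel. g x)"
      by (subst (2) d[symmetric], subst integral_distr) (auto simp: add.commute)
  qed
  have zero: "(LINT x|lborel. s n x) = 0" for n
    unfolding s_def using shift[of "(1 / Suc n) *\<^sub>R e"] int_g by simp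
  have "(\<lambda>n. LINT x|lborel. s n x) \<longlonglongrightarrow> (LINT x|lborel. g' x)"
  \<comment> \<open>The steps 1/(n + 1) are at most 1, so every quotient vanishes outside the ball
    enlarged by \<open>norm e\<close>.\<close>
  proof (rule integral_dominated_convergence[where w="\<lambda>x. M * indicator (cball 0 (R + norm e)) x"])
    show "integrable lborel (\<lambda>x::'a. M * indicator (cball 0 (R + norm e)) x :: real)"
      using emeasure_bounded_finite[OF bounded_cball, of "0::'a" "R + norm e"]
      by (intro integrable_mult_right) (simp add: integrable_indicator_iff)
    show "s n \<in> borel_measurable lborel" for n unfolding s_def by measurable
    have "(\<lambda>n. s n x) \<longlonglongrightarrow> g' x" for x
    proof -
      have "((\<lambda>h. (g (x + h *\<^sub>R e) - g x) / h) \<longlongrightarrow> g' x) (at 0)"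
        using der[of x] by (simp add: DERIV_def)
      moreover have "filterlim (\<lambda>n. 1 / real (Suc n)) (at 0) sequentially"
        using LIMSEQ_Suc[OF lim_1_over_n[where 'a=real]] by (simp add: filterlim_at del: of_nat_Suc)
      ultimately show ?thesis unfolding s_def by (rule filterlim_compose)
    qed
    then show "AE x in lborel. (\<lambda>n. s n x) \<longlonglongrightarrow> g' x" by simp
    have "norm (s n x) \<le> M * indicator (cball 0 (R + norm e)) x" for n x
    proof (cases "norm x \<le> R + norm e")
      case True
      have "\<bar>g (x + (1 / Suc n) *\<^sub>R e) - g x\<bar> \<le> M * (1 / Suc n)" by (rule lip) simp
      then have "\<bar>g (x + (1 / Suc n) *\<^sub>R e) - g x\<bar> / (1 / Suc n) \<le> M"
        by (subst pos_divide_le_eq) auto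
      moreover have "norm (s n x) = \<bar>g (x + (1 / Suc n) *\<^sub>R e) - g x\<bar> / (1 / Suc n)"
        by (simp only: s_def real_norm_def abs_divide)
      ultimately show ?thesis using True by simp
    next
      case False
      have "norm ((1 / Suc n) *\<^sub>R e) \<le> norm e"
        by (simp add: divide_simps) (simp add: algebra_simps)
      then have "R < norm (x + (1 / Suc n) *\<^sub>R e)"
        using False norm_diff_ineq[of x "(1 / Suc n) *\<^sub>R e"] by linarith
      moreover have "R < norm x" using False norm_ge_zero[of e] by linarith
      ultimately show ?thesis using False out(1) by (simp add: s_def M0)
    qed
    then show "AE x in lborel. norm (s n x) \<le> M * indicator (cball 0 (R + norm e)) x" for n by simp
  qed (simp add: g'm)
  then show ?thesis unfolding zero using LIMSEQ_unique tendsto_const by blast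
qed

text \<open>The factor q may be singular at the origin; p switches it off on a ball, and the ball
  together with the punctured space is an open cover.\<close>

lemma continuous_on_cut:
  fixes p q :: "'a::euclidean_space \<Rightarrow> real"
  assumes "continuous_on UNIV p" "continuous_on (-{0}) q" "0 < r" "\<And>x. norm x < r \<Longrightarrow> p x = 0"
  shows "continuous_on UNIV (\<lambda>x. p x * q x)"
proof -
  have "continuous_on (-{0}) (\<lambda>x. p x * q x)"
    using assms(1,2) by (intro continuous_intros) (auto intro: continuous_on_subset)
  moreover have "continuous_on (ball 0 r) (\<lambda>x. p x * q x)"
    using continuous_on_cong[of "ball 0 r" "ball 0 r" "\<lambda>x. p x * q x" "\<lambda>_. 0"] assms(4) by simp
  ultimately have "continuous_on ((-{0}) \<union> ball 0 r) (\<lambda>x. p x * q x)"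
    by (intro continuous_on_open_Un) auto
  moreover have "(-{0}) \<union> ball 0 r = (UNIV :: 'a set)" using assms(3) by auto
  ultimately show ?thesis by simp
qed

lemma lift_continuous_on:
  assumes "continuous_on UNIV \<eta>"
  shows "continuous_on (-{0}) (lift c \<eta> :: 'a::euclidean_space \<Rightarrow> real)"
  unfolding lift_def[abs_def]
  by (intro continuous_intros continuous_on_compose2[OF assms]) auto

lemma DERIV_along:
  fixes f :: "'a::euclidean_space \<Rightarrow> real"
  assumes "(f has_derivative f') (at x)"
  shows "((\<lambda>t. f (x + t *\<^sub>R e)) has_real_derivative f' e) (at 0)"
proof -
  have "((\<lambda>t. x + t *\<^sub>R e) has_derivative (\<lambda>t. t *\<^sub>R e)) (at 0)"
    by (auto intro!: derivative_eq_intros)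
  then have "((\<lambda>t. f (x + t *\<^sub>R e)) has_derivative (\<lambda>t. f' (t *\<^sub>R e))) (at 0)"
    by (rule has_derivative_compose) (use assms in simp)
  moreover have "f' (t *\<^sub>R e) = f' e * t" for t
    using linear_scale[OF has_derivative_linear[OF assms], of t e] by simp
  ultimately show ?thesis by (simp add: has_field_derivative_def)
qed

lemma test_function_pd:
  fixes \<phi> :: "'a::euclidean_space \<Rightarrow> real"
  assumes "\<phi> \<in> test_functions" "i \<in> Basis"
  shows "continuous_on UNIV \<phi>" "continuous_on UNIV (pd \<phi> i)" "continuous_on UNIV (pd (pd \<phi> i) i)"
    and "((\<lambda>t. \<phi> (x + t *\<^sub>R i)) has_real_derivative pd \<phi> i x) (at 0)"
    and "((\<lambda>t. pd \<phi> i (x + t *\<^sub>R i)) has_real_derivative pd (pd \<phi> i) i x) (at 0)"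
proof -
  note C = test_functions_Ck[OF assms(1)]
  note C1 = Ck_pd[OF C assms(2)]
  show "continuous_on UNIV \<phi>" "continuous_on UNIV (pd \<phi> i)" "continuous_on UNIV (pd (pd \<phi> i) i)"
    using Ck_continuous[OF C] Ck_continuous[OF C1] Ck_continuous[OF Ck_pd[OF C1 assms(2)]] by auto
  show "((\<lambda>t. \<phi> (x + t *\<^sub>R i)) has_real_derivative pd \<phi> i x) (at 0)"
    unfolding pd_def using DERIV_along[OF Ck_SucD[OF C]] .
  show "((\<lambda>t. pd \<phi> i (x + t *\<^sub>R i)) has_real_derivative pd (pd \<phi> i) i x) (at 0)"
    unfolding pd_def[of "pd \<phi> i"] using DERIV_along[OF Ck_SucD[OF C1]] .
qed

lemma wdiv_lift_continuous:
  fixes \<phi> :: "'a::euclidean_space \<Rightarrow> real"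
  assumes \<phi>: "\<phi> \<in> test_functions" and c0: "continuous_on UNIV \<zeta>"
  shows "continuous_on UNIV (\<lambda>x. wdiv \<alpha> \<phi> x * lift c \<zeta> x)"
proof -
  obtain r R where r: "0 < r" "\<And>x. norm x < r \<or> R < norm x \<Longrightarrow> \<phi> x = 0"
    using test_functions_support[OF \<phi>] by blast
  have ps: "pd \<phi> i x = 0" if "norm x < r \<or> R < norm x" for i x
    using pd_support[of r R \<phi> x i, OF r(2)] that by blast
  have pps: "pd (pd \<phi> i) j x = 0" if "norm x < r \<or> R < norm x" for i j x
    using pd_support[of r R "pd \<phi> i" x j, OF ps] that by blast
  have "wdiv \<alpha> \<phi> x * lift c \<zeta> x = (\<Sum>i\<in>Basis. pd (pd \<phi> i) i x * (norm x powr \<alpha> * lift c \<zeta> x))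
    + (\<Sum>i\<in>Basis. pd \<phi> i x * ((x \<bullet> i) * (\<alpha> * norm x powr (\<alpha> - 2) * lift c \<zeta> x)))" for x
    unfolding wdiv_test[OF \<phi>] by (simp add: sum_distrib_left sum_distrib_right algebra_simps)
  moreover have "continuous_on UNIV (\<lambda>x. (\<Sum>i\<in>Basis. pd (pd \<phi> i) i x * (norm x powr \<alpha> * lift c \<zeta> x))
    + (\<Sum>i\<in>Basis. pd \<phi> i x * ((x \<bullet> i) * (\<alpha> * norm x powr (\<alpha> - 2) * lift c \<zeta> x))))"
  proof (intro continuous_on_add continuous_on_sum)
    fix i :: 'a assume i: "i \<in> Basis"
    show "continuous_on UNIV (\<lambda>x. pd (pd \<phi> i) i x * (norm x powr \<alpha> * lift c \<zeta> x))"
      by (rule continuous_on_cut[OF test_function_pd(3)[OF \<phi> i] _ r(1)])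
        (intro continuous_intros lift_continuous_on c0, auto simp: pps)
    show "continuous_on UNIV (\<lambda>x. pd \<phi> i x * ((x \<bullet> i) * (\<alpha> * norm x powr (\<alpha> - 2) * lift c \<zeta> x)))"
      by (rule continuous_on_cut[OF test_function_pd(2)[OF \<phi> i] _ r(1)])
        (intro continuous_intros lift_continuous_on c0, auto simp: ps)
  qed
  ultimately show ?thesis by simp
qed

text \<open>Green's second identity for the weighted operator. The radial factor needs two
  derivatives but no support condition, since \<phi> already cuts off infinity and the singularity
  at the origin.\<close>

lemma wdiv_lift_by_parts:
  fixes \<phi> :: "'a::euclidean_space \<Rightarrow> real"
  assumes \<phi>: "\<phi> \<in> test_functions"
    and d1: "\<And>t. (\<zeta> has_real_derivative \<zeta>1 t) (at t)"
    and d2: "\<And>t. (\<zeta>1 has_real_derivative \<zeta>2 t) (at t)"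
    and c2: "continuous_on UNIV \<zeta>2"
  shows "(LINT x|lborel. \<phi> x * lift (\<alpha> + c - 2)
        (\<lambda>t. \<zeta>2 t + (2 * c + DIM('a) + \<alpha> - 2) * \<zeta>1 t + c * (c + DIM('a) + \<alpha> - 2) * \<zeta> t) x)
     = (LINT x|lborel. wdiv \<alpha> \<phi> x * lift c \<zeta> x)" (is ?I)
    and "integrable lborel (\<lambda>x. wdiv \<alpha> \<phi> x * lift c \<zeta> x)" (is ?J)
    and "integrable lborel (\<lambda>x. \<phi> x * lift (\<alpha> + c - 2)
        (\<lambda>t. \<zeta>2 t + (2 * c + DIM('a) + \<alpha> - 2) * \<zeta>1 t + c * (c + DIM('a) + \<alpha> - 2) * \<zeta> t) x)" (is ?K)
proof -
  obtain r R where r: "0 < r" "\<And>x. norm x < r \<or> R < norm x \<Longrightarrow> \<phi> x = 0"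
    using test_functions_support[OF \<phi>] by blast
  have ps: "pd \<phi> i x = 0" if "norm x < r \<or> R < norm x" for i x
    using pd_support[of r R \<phi> x i, OF r(2)] that by blast
  have pps: "pd (pd \<phi> i) j x = 0" if "norm x < r \<or> R < norm x" for i j x
    using pd_support[of r R "pd \<phi> i" x j, OF ps] that by blast
  have c0: "continuous_on UNIV \<zeta>" and c1: "continuous_on UNIV \<zeta>1"
    using d1 d2 DERIV_continuous_on by (meson DERIV_isCont continuous_at_imp_continuous_on)+
  define e1 where "e1 t = c * \<zeta> t + \<zeta>1 t" for t
  define A :: "'a \<Rightarrow> real" where "A = lift (c + \<alpha>) \<zeta>"
  define A' :: "'a \<Rightarrow> real" where "A' = lift (c + \<alpha> - 2) (\<lambda>t. (c + \<alpha>) * \<zeta> t + \<zeta>1 t)"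
  define B :: "'a \<Rightarrow> real" where "B = lift (c + \<alpha> - 2) e1"
  define B' :: "'a \<Rightarrow> real" where "B' = lift (c + \<alpha> - 2 - 2) (\<lambda>t. (c + \<alpha> - 2) * e1 t + (c * \<zeta>1 t + \<zeta>2 t))"
  have Ad: "(A has_derivative (\<lambda>h. A' x * (x \<bullet> h))) (at x)" if "x \<noteq> 0" for x :: 'a
    unfolding A_def A'_def using lift_has_derivative[OF that, of \<zeta> \<zeta>1 "c + \<alpha>"] d1 by simp
  have Bd: "(B has_derivative (\<lambda>h. B' x * (x \<bullet> h))) (at x)" if "x \<noteq> 0" for x :: 'a
    unfolding B_def B'_def e1_def
    using lift_has_derivative[OF that, of "\<lambda>t. c * \<zeta> t + \<zeta>1 t" "\<lambda>t. c * \<zeta>1 t + \<zeta>2 t" "c + \<alpha> - 2"]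
      DERIV_add[OF DERIV_cmult[OF d1] d2] by blast
  have cA: "continuous_on (-{0}) A" "continuous_on (-{0}) A'" "continuous_on (-{0}) B" "continuous_on (-{0}) B'"
    unfolding A_def A'_def B_def B'_def e1_def
    by (intro lift_continuous_on continuous_intros c0 c1 c2)+
  \<comment> \<open>With w = \<open>lift c \<zeta>\<close>, this is the i-th component of
    |x|^\<alpha> (w grad \<phi> - \<phi> grad w): A is |x|^\<alpha> w and B x is |x|^\<alpha> grad
    w. Its divergence is the difference of the two integrands.\<close>
  define h where "h i x = pd \<phi> i x * A x - \<phi> x * (B x * (x \<bullet> i))" for i x :: 'a
  define h' where "h' i x = pd (pd \<phi> i) i x * A x + pd \<phi> i x * (A' x * (x \<bullet> i))
      - (pd \<phi> i x * (B x * (x \<bullet> i)) + \<phi> x * (B' x * (x \<bullet> i) * (x \<bullet> i) + B x))" for i x :: 'a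
  have int0: "(LINT x|lborel. h' i x) = 0" and inth: "integrable lborel (h' i)" if i: "i \<in> Basis" for i
  proof -
    note T = test_function_pd[OF \<phi> i]
    have cxi: "continuous_on (-{0}) (\<lambda>x. x \<bullet> i)" by (intro continuous_intros)
    note cut = continuous_on_cut[OF _ _ r(1)]
    have "continuous_on UNIV (\<lambda>x. pd (pd \<phi> i) i x * A x)"
      by (rule cut[OF T(3) cA(1)]) (simp add: pps)
    moreover have "continuous_on UNIV (\<lambda>x. pd \<phi> i x * A x)"
      by (rule cut[OF T(2) cA(1)]) (simp add: ps)
    moreover have "continuous_on UNIV (\<lambda>x. pd \<phi> i x * (A' x * (x \<bullet> i)))"
      by (rule cut[OF T(2) continuous_on_mult[OF cA(2) cxi]]) (simp add: ps)
    moreover have "continuous_on UNIV (\<lambda>x. pd \<phi> i x * (B x * (x \<bullet> i)))"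
      by (rule cut[OF T(2) continuous_on_mult[OF cA(3) cxi]]) (simp add: ps)
    moreover have "continuous_on UNIV (\<lambda>x. \<phi> x * (B x * (x \<bullet> i)))"
      by (rule cut[OF T(1) continuous_on_mult[OF cA(3) cxi]]) (simp add: r)
    moreover have "continuous_on UNIV (\<lambda>x. \<phi> x * (B' x * (x \<bullet> i) * (x \<bullet> i) + B x))"
      by (rule cut[OF T(1) continuous_on_add[OF continuous_on_mult[OF continuous_on_mult[OF cA(4) cxi] cxi] cA(3)]])
        (simp add: r)
    ultimately have ch: "continuous_on UNIV (h i)" and ch': "continuous_on UNIV (h' i)"
      unfolding h_def[abs_def] h'_def[abs_def]
      by - (intro continuous_on_add continuous_on_diff; assumption)+
    have out: "h i x = 0" "h' i x = 0" if "R < norm x" for x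
      using that r(2)[of x] ps[of x] pps[of x] by (simp_all add: h_def h'_def)
    show "(LINT x|lborel. h' i x) = 0"
    proof (rule integral_directional_derivative_eq_0[OF _ ch ch' out])
      fix x :: 'a
      show "((\<lambda>t. h i (x + t *\<^sub>R i)) has_real_derivative h' i x) (at 0)"
      proof (cases "x = 0")
        case False
        have I: "((\<lambda>t. (x + t *\<^sub>R i) \<bullet> i) has_real_derivative 1) (at 0)"
          using i by (auto intro!: derivative_eq_intros simp: inner_add_left)
        note AA = DERIV_along[OF Ad[OF False], of i] and BB = DERIV_along[OF Bd[OF False], of i]
        show ?thesis
          unfolding h_def[abs_def]
          by (rule DERIV_cong[OF DERIV_diff[OF DERIV_mult[OF T(5) AA] DERIV_mult[OF T(4) DERIV_mult[OF BB I]]]])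
            (simp add: h'_def algebra_simps)
      next
        case True
        have "(h i has_derivative (\<lambda>_. 0)) (at x)"
          by (rule frechet_derivative_locally_0[of "ball 0 r"])
            (use True r ps in \<open>auto simp: h_def\<close>)
        from DERIV_along[OF this, of i] show ?thesis using True r ps pps by (simp add: h'_def)
      qed
    qed auto
    show "integrable lborel (h' i)"
      by (rule integrable_compact_support[OF ch' out(2)])
  qed
  let ?\<theta> = "\<lambda>t. \<zeta>2 t + (2 * c + DIM('a) + \<alpha> - 2) * \<zeta>1 t + c * (c + DIM('a) + \<alpha> - 2) * \<zeta> t"
  have sum: "(\<Sum>i\<in>Basis. h' i x) = wdiv \<alpha> \<phi> x * lift c \<zeta> x - \<phi> x * lift (\<alpha> + c - 2) ?\<theta> x" for x
  proof -
    let ?l = "ln (norm x)" and ?S = "\<Sum>i\<in>Basis. (x \<bullet> i) * pd \<phi> i x"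
    have P1: "norm x powr (c + \<alpha>) = norm x powr \<alpha> * norm x powr c"
      and P2: "norm x powr (c + \<alpha> - 2) = norm x powr (\<alpha> - 2) * norm x powr c"
      using powr_add[of "norm x" \<alpha> c] powr_add[of "norm x" "\<alpha> - 2" c] by (simp_all add: algebra_simps)
    have P3: "norm x powr (c + \<alpha> - 2 - 2) * (norm x)\<^sup>2 = norm x powr (c + \<alpha> - 2)" by (rule powr_shift2)
    have P4: "\<alpha> + c - 2 = c + \<alpha> - 2" by simp
    have "(\<Sum>i\<in>Basis. h' i x) = (\<Sum>i\<in>Basis. pd (pd \<phi> i) i x) * A x + (A' x - B x) * ?S
        - \<phi> x * (B' x * (\<Sum>i\<in>Basis. (x \<bullet> i) * (x \<bullet> i)) + DIM('a) * B x)"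
      unfolding h'_def sum.distrib sum_subtractf
      by (simp add: sum_distrib_left sum_distrib_right sum.distrib sum_subtractf algebra_simps)
    also have "\<dots> = wdiv \<alpha> \<phi> x * lift c \<zeta> x - \<phi> x * lift (\<alpha> + c - 2) ?\<theta> x"
    proof -
      have b: "B' x * (norm x)\<^sup>2 = norm x powr (c + \<alpha> - 2) * ((c + \<alpha> - 2) * e1 ?l + (c * \<zeta>1 ?l + \<zeta>2 ?l))"
        unfolding B'_def lift_def P3[symmetric] by simp
      have a: "A' x - B x = \<alpha> * norm x powr (\<alpha> - 2) * (norm x powr c * \<zeta> ?l)"
        unfolding A'_def B_def lift_def e1_def P2 by (simp add: algebra_simps)
      show ?thesis
        unfolding sum_inner_Basis_sq b a wdiv_test[OF \<phi>] P4
        unfolding A_def B_def lift_def e1_def P1 by (simp add: algebra_simps)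
    qed
    finally show ?thesis .
  qed
  note cw = wdiv_lift_continuous[OF \<phi> c0, of \<alpha> c]
  show J: ?J
    by (rule integrable_compact_support[OF cw, of R]) (simp add: ps pps wdiv_test[OF \<phi>])
  have E: "\<phi> x * lift (\<alpha> + c - 2) ?\<theta> x = wdiv \<alpha> \<phi> x * lift c \<zeta> x - (\<Sum>i\<in>Basis. h' i x)" for x
    unfolding sum by simp
  have S: "integrable lborel (\<lambda>x. \<Sum>i\<in>Basis. h' i x)"
    by (intro Bochner_Integration.integrable_sum inth)
  show ?K unfolding E by (intro Bochner_Integration.integrable_diff J S)
  show ?I unfolding E
    by (subst Bochner_Integration.integral_diff[OF J S], subst Bochner_Integration.integral_sum)
      (auto simp: inth int0)
qed

section \<open>Polar coordinates\<close>

text \<open>The surface area of the unit sphere.\<close>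

definition sphere_const :: "nat \<Rightarrow> real" where
  "sphere_const n = n * unit_ball_vol n"

lemma sphere_const_pos: "n > 0 \<Longrightarrow> sphere_const n > 0"
  by (simp add: sphere_const_def)

text \<open>Reflected logarithmic radius, so that the half-lines \<open>{s<..}\<close> correspond to balls and have
  finite measure.\<close>

lemma distr_neg_ln_norm:
  "distr lborel borel (\<lambda>x::'a::euclidean_space. - ln (norm x))
     = density lborel (\<lambda>t. ennreal (sphere_const DIM('a) * exp (- real DIM('a) * t)))"
proof -
  let ?V = "unit_ball_vol (real DIM('a))" and ?n = "real DIM('a)"
  let ?f = "\<lambda>t. sphere_const DIM('a) * exp (- ?n * t)"
  let ?M = "distr lborel borel (\<lambda>x::'a. - ln (norm x))"
  have 1: "emeasure ?M {s<..} = ennreal (?V * exp (- s) ^ DIM('a))" for s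
  proof -
    have "emeasure ?M {s<..} = emeasure lborel ((\<lambda>x::'a. - ln (norm x)) -` {s<..} \<inter> space lborel)"
      by (rule emeasure_distr) auto
    also have "\<dots> = emeasure lborel (ball (0::'a) (exp (- s)))"
    proof (rule emeasure_eq_AE)
      have "AE x::'a in lborel. x \<noteq> 0" by (rule AE_lborel_singleton)
      then show "AE x::'a in lborel. x \<in> (\<lambda>x. - ln (norm x)) -` {s<..} \<inter> space lborel \<longleftrightarrow> x \<in> ball 0 (exp (- s))"
      proof (rule AE_mp, intro AE_I2 impI)
        fix x :: 'a assume "x \<noteq> 0"
        then have "ln (norm x) < - s \<longleftrightarrow> norm x < exp (- s)"
          by (metis exp_less_cancel_iff exp_ln zero_less_norm_iff)
        then show "x \<in> (\<lambda>x. - ln (norm x)) -` {s<..} \<inter> space lborel \<longleftrightarrow> x \<in> ball 0 (exp (- s))" by auto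
      qed
      have "(\<lambda>x::'a. - ln (norm x)) \<in> borel_measurable lborel" by measurable
      from measurable_sets[OF this, of "{s<..}"]
      show "(\<lambda>x::'a. - ln (norm x)) -` {s<..} \<inter> space lborel \<in> sets lborel" by simp
    qed simp
    also have "\<dots> = ennreal (?V * exp (- s) ^ DIM('a))" by (rule emeasure_ball) simp
    finally show ?thesis .
  qed
  have 2: "emeasure (density lborel (\<lambda>t. ennreal (?f t))) {s<..} = ennreal (?V * exp (- s) ^ DIM('a))" for s
  proof -
    have "emeasure (density lborel (\<lambda>t. ennreal (?f t))) {s<..} = (\<integral>\<^sup>+t. ennreal (?f t) * indicator {s<..} t \<partial>lborel)"
      by (subst emeasure_density) auto
    also have "\<dots> = (\<integral>\<^sup>+t. ennreal (?f t) * indicator {s..} t \<partial>lborel)"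
    proof (rule nn_integral_cong_AE)
      have "AE t in lborel. t \<noteq> s" by (rule AE_lborel_singleton)
      then show "AE t in lborel. ennreal (?f t) * indicator {s<..} t = ennreal (?f t) * indicator {s..} t"
        by (rule AE_mp) (auto simp: indicator_def)
    qed
    also have "\<dots> = ennreal (0 - (- (?V * exp (- ?n * s))))"
    proof (rule nn_integral_FTC_atLeast)
      show "((\<lambda>t. - (?V * exp (- ?n * t))) has_real_derivative ?f x) (at x)" for x
        by (auto intro!: derivative_eq_intros simp: sphere_const_def)
      have "((\<lambda>t. - (?V * exp (- ?n * t))) \<longlongrightarrow> - (?V * 0)) at_top"
        by (intro tendsto_intros filterlim_compose[OF exp_at_bot]
             filterlim_tendsto_neg_mult_at_bot[OF tendsto_const _ filterlim_ident]) auto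
      then show "((\<lambda>t. - (?V * exp (- ?n * t))) \<longlongrightarrow> 0) at_top" by simp
      show "0 \<le> ?f x" for x using sphere_const_pos[of "DIM('a)"] by simp
    qed auto
    also have "0 - (- (?V * exp (- ?n * s))) = ?V * exp (- s) ^ DIM('a)"
      by (simp add: exp_of_nat_mult[symmetric])
    finally show ?thesis .
  qed
  show ?thesis
    by (rule measure_eqI_lessThan) (simp_all only: 1 2, simp_all)
qed

lemma radial_integral_neg:
  fixes q :: "real \<Rightarrow> real"
  assumes [measurable]: "q \<in> borel_measurable borel"
  shows "(LINT x|(lborel :: 'a::euclidean_space measure). q (- ln (norm x)))
      = (LINT t|lborel. sphere_const DIM('a) * exp (- real DIM('a) * t) * q t)"
    and "integrable (lborel :: 'a measure) (\<lambda>x. q (- ln (norm x)))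
      \<longleftrightarrow> integrable lborel (\<lambda>t. sphere_const DIM('a) * exp (- real DIM('a) * t) * q t)"
proof -
  have p: "0 \<le> sphere_const DIM('a) * exp (- real DIM('a) * t)" for t
    using sphere_const_pos[of "DIM('a)"] by simp
  have "(LINT x|(lborel :: 'a measure). q (- ln (norm x)))
     = (LINT t|distr lborel borel (\<lambda>x::'a. - ln (norm x)). q t)"
    by (rule integral_distr[symmetric]) auto
  also have "\<dots> = (LINT t|lborel. sphere_const DIM('a) * exp (- real DIM('a) * t) * q t)"
    unfolding distr_neg_ln_norm by (subst integral_density) (use p in auto)
  finally show "(LINT x|(lborel :: 'a measure). q (- ln (norm x)))
      = (LINT t|lborel. sphere_const DIM('a) * exp (- real DIM('a) * t) * q t)" .
  have "integrable (lborel :: 'a measure) (\<lambda>x. q (- ln (norm x)))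
     \<longleftrightarrow> integrable (distr lborel borel (\<lambda>x::'a. - ln (norm x))) q"
    by (rule integrable_distr_eq[symmetric]) auto
  also have "\<dots> \<longleftrightarrow> integrable lborel (\<lambda>t. sphere_const DIM('a) * exp (- real DIM('a) * t) * q t)"
    unfolding distr_neg_ln_norm by (subst integrable_density) (use p in auto)
  finally show "integrable (lborel :: 'a measure) (\<lambda>x. q (- ln (norm x)))
      \<longleftrightarrow> integrable lborel (\<lambda>t. sphere_const DIM('a) * exp (- real DIM('a) * t) * q t)" .
qed

lemma radial_integral:
  fixes q :: "real \<Rightarrow> real"
  assumes [measurable]: "q \<in> borel_measurable borel"
  shows "(LINT x|(lborel :: 'a::euclidean_space measure). q (ln (norm x)))
      = sphere_const DIM('a) * (LINT t|lborel. exp (real DIM('a) * t) * q t)" (is ?A)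
    and "integrable (lborel :: 'a measure) (\<lambda>x. q (ln (norm x)))
      \<longleftrightarrow> integrable lborel (\<lambda>t. exp (real DIM('a) * t) * q t)" (is ?B)
proof -
  let ?s = "sphere_const DIM('a)"
  have s: "?s > 0" by (rule sphere_const_pos) simp
  have m: "(\<lambda>t. q (- t)) \<in> borel_measurable borel" by measurable
  note R = radial_integral_neg[where 'a='a, OF m]
  have "(LINT x|(lborel :: 'a measure). q (ln (norm x))) = (LINT t|lborel. ?s * exp (- real DIM('a) * t) * q (- t))"
    using R(1) by simp
  also have "\<dots> = (LINT t|lborel. ?s * (exp (real DIM('a) * t) * q t))"
    by (subst lborel_integral_real_affine[where c="-1" and t=0]) (auto simp: mult.assoc)
  finally show ?A by simp
  have "integrable (lborel :: 'a measure) (\<lambda>x. q (ln (norm x)))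
     \<longleftrightarrow> integrable lborel (\<lambda>t. ?s * exp (- real DIM('a) * t) * q (- t))"
    using R(2) by simp
  also have "\<dots> \<longleftrightarrow> integrable lborel (\<lambda>t. ?s * (exp (real DIM('a) * t) * q t))"
    by (subst lborel_integrable_real_affine_iff[where c="-1" and t=0, symmetric]) (auto simp: mult.assoc)
  finally show ?B using s by simp
qed

lemma lift_measurable [measurable]:
  assumes [measurable]: "q \<in> borel_measurable borel"
  shows "(lift c q :: 'a::euclidean_space \<Rightarrow> real) \<in> borel_measurable borel"
  unfolding lift_def[abs_def] by measurable

lemma lift_eq_exp: "x \<noteq> 0 \<Longrightarrow> lift c q x = exp (c * ln (norm x)) * q (ln (norm x))"
  by (simp add: lift_def powr_def)

text \<open>The exponential weight disappears when c is minus the dimension. The exponents of the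
  problem are such that this happens in all the energy and weak-form pairings.\<close>

lemma lift_integral:
  fixes q :: "real \<Rightarrow> real"
  assumes [measurable]: "q \<in> borel_measurable borel"
  shows "(LINT x|(lborel :: 'a::euclidean_space measure). lift c q x)
      = sphere_const DIM('a) * (LINT t|lborel. exp ((real DIM('a) + c) * t) * q t)" (is ?A)
    and "integrable (lborel :: 'a measure) (lift c q)
      \<longleftrightarrow> integrable lborel (\<lambda>t. exp ((real DIM('a) + c) * t) * q t)" (is ?B)
proof -
  let ?q = "\<lambda>t. exp (c * t) * q t"
  have m: "?q \<in> borel_measurable borel" by measurable
  have ae: "AE x::'a in lborel. lift c q x = ?q (ln (norm x))"
    using AE_lborel_singleton[of "0::'a"] by (rule AE_mp) (auto simp: lift_eq_exp)
  have e: "exp (real DIM('a) * t) * ?q t = exp ((real DIM('a) + c) * t) * q t" for t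
    by (simp add: distrib_right exp_add)
  show ?A
    using integral_cong_AE[OF _ _ ae] radial_integral(1)[OF m, where 'a='a] unfolding e by simp
  show ?B
    using integrable_cong_AE[OF _ _ ae] radial_integral(2)[OF m, where 'a='a] unfolding e by simp
qed

text \<open>The image of Lebesgue measure under the logarithm of the norm has a density, so null
  sets of the line pull back to null sets.\<close>

lemma AE_radial:
  assumes "AE t in lborel. P t"
  shows "AE x::'a::euclidean_space in lborel. P (ln (norm x))"
proof -
  have "AE t in lborel. P (- t)"
  proof -
    have "lborel = distr lborel borel (\<lambda>t::real. - t)"
      using lborel_distr_uminus by simp
    then have "AE t in distr lborel borel (\<lambda>t::real. - t). P t" using assms by metis
    then show ?thesis by (rule AE_distrD[rotated]) auto
  qed
  then have "AE t in density lborel (\<lambda>t. ennreal (sphere_const DIM('a) * exp (- real DIM('a) * t))). P (- t)"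
    by (subst AE_density) auto
  then have "AE t in distr lborel borel (\<lambda>x::'a. - ln (norm x)). P (- t)"
    unfolding distr_neg_ln_norm .
  then have "AE x::'a in lborel. P (- (- ln (norm x)))" by (rule AE_distrD[rotated]) auto
  then show ?thesis by simp
qed

lemma AE_lborel_shift:
  fixes c :: "'a::euclidean_space"
  assumes "AE t in lborel. P t" shows "AE t in lborel. P (c + t)"
proof -
  have "AE t in distr lborel borel (\<lambda>t. c + t). P t" using assms by (subst lborel_distr_plus)
  then show ?thesis by (rule AE_distrD[rotated]) auto
qed

text \<open>A radial profile need not be measurable; reading the function off along the dilates of one
  generic point gives a Borel profile.\<close>

lemma radial_borel_profile:
  fixes u :: "'a::euclidean_space \<Rightarrow> real"
  assumes u: "u \<in> borel_measurable lebesgue" and r: "radial u"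
  obtains v where "v \<in> borel_measurable borel" "AE x in lborel. u x = lift c v x"
proof -
  obtain g where g: "AE x in lborel. u x = g (norm x)"
    using r unfolding radial_def AE_completion_iff by blast
  obtain u' where u'[measurable]: "u' \<in> borel_measurable lborel" and uu': "AE x in lborel. u x = u' x"
    using completion_ex_borel_measurable_real[OF u] by blast
  have "AE x in lborel. u' x = g (norm x)" using g uu' by eventually_elim simp
  then obtain Z where Z: "Z \<in> null_sets lborel" and Zg: "\<And>x. x \<notin> Z \<Longrightarrow> u' x = g (norm x)"
    by (auto elim!: AE_E3)
  have [measurable]: "Z \<in> sets borel" using Z by auto
  \<comment> \<open>A dilation maps Lebesgue measure to a constant multiple of itself and so
    preserves null sets.\<close>
  have nullt: "AE x in lborel. exp t *\<^sub>R x \<notin> Z" for t :: real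
  proof -
    have "AE x in density (distr lborel borel (\<lambda>x::'a. 0 + exp t *\<^sub>R x)) (\<lambda>_. ennreal (\<bar>exp t\<bar> ^ DIM('a))). x \<notin> Z"
      using AE_not_in[OF Z] by (subst (asm) lborel_affine[of "exp t" 0]) simp_all
    then have "AE x in distr lborel borel (\<lambda>x::'a. 0 + exp t *\<^sub>R x). x \<notin> Z"
      by (subst (asm) AE_density) auto
    then have "AE x in lborel. 0 + exp t *\<^sub>R x \<notin> Z" by (rule AE_distrD[rotated]) auto
    then show ?thesis by simp
  qed
  have "AE t::real in lborel. AE x::'a in lborel. exp t *\<^sub>R x \<notin> Z" using nullt by simp
  \<comment> \<open>Exchanging the quantifiers by Fubini yields a point almost all of whose dilates
    avoid the exceptional set Z.\<close>
  then have "AE x::'a in lborel. AE t::real in lborel. exp t *\<^sub>R x \<notin> Z"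
  proof (subst lborel_pair.AE_commute[symmetric])
    have m: "(\<lambda>p::real \<times> 'a. exp (fst p) *\<^sub>R snd p) \<in> lborel \<Otimes>\<^sub>M lborel \<rightarrow>\<^sub>M borel"
      unfolding lborel_prod
      by simp (intro borel_measurable_continuous_onI continuous_intros)
    have "(\<lambda>p::real \<times> 'a. exp (fst p) *\<^sub>R snd p) -` (- Z) \<inter> space (lborel \<Otimes>\<^sub>M lborel)
        \<in> sets (lborel \<Otimes>\<^sub>M lborel)"
      by (rule measurable_sets[OF m]) auto
    then show "{p \<in> space (lborel \<Otimes>\<^sub>M lborel). exp (fst p) *\<^sub>R snd p \<notin> Z} \<in> sets (lborel \<Otimes>\<^sub>M (lborel::'a measure))"
      by (rule back_subst) auto
  qed
  with AE_lborel_singleton[of "0::'a"]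
  have "AE x::'a in lborel. x \<noteq> 0 \<and> (AE t::real in lborel. exp t *\<^sub>R x \<notin> Z)" by eventually_elim simp
  moreover have "ae_filter (lborel :: 'a measure) \<noteq> bot"
    by (simp add: ae_filter_eq_bot_iff emeasure_lborel_UNIV)
  ultimately obtain x0 :: 'a where x0: "x0 \<noteq> 0" "AE t::real in lborel. exp t *\<^sub>R x0 \<notin> Z"
    using eventually_happens' by blast
  let ?l = "ln (norm x0)"
  have "AE t in lborel. exp (- ?l + t) *\<^sub>R x0 \<notin> Z" by (rule AE_lborel_shift[OF x0(2)])
  from AE_radial[OF this, where 'a='a]
  have ae: "AE x::'a in lborel. exp (- ?l + ln (norm x)) *\<^sub>R x0 \<notin> Z" .
  define v where "v t = exp (- (c * t)) * u' (exp (- ?l + t) *\<^sub>R x0)" for t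
  show ?thesis
  proof (rule that)
    show "v \<in> borel_measurable borel" unfolding v_def by measurable
    have "AE x in lborel. x \<notin> Z" using Z by (rule AE_not_in)
    with ae uu' AE_lborel_singleton[of "0::'a"] show "AE x in lborel. u x = lift c v x"
    proof eventually_elim
      case (elim x)
      have "u' (exp (- ?l + ln (norm x)) *\<^sub>R x0) = g (norm (exp (- ?l + ln (norm x)) *\<^sub>R x0))"
        using elim by (intro Zg)
      also have "norm (exp (- ?l + ln (norm x)) *\<^sub>R x0) = norm x"
        using elim x0 by (simp add: exp_diff)
      also have "g (norm x) = u x" using elim Zg[of x] by simp
      finally show ?case using elim by (simp add: lift_eq_exp v_def exp_minus)
    qed
  qed
qed

section \<open>The fundamental lemma with an explicit bound\<close>

lemma smooth_on_real_polynomial_function: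
  fixes g :: "real \<Rightarrow> real"
  assumes "real_polynomial_function g" shows "smooth_on UNIV g"
  using assms
proof induction
  case (linear f)
  then obtain c where "f = (\<lambda>x. x * c)" using real_bounded_linear by blast
  then show ?case by (simp add: smooth_on_mult smooth_on_ident)
qed (auto intro: smooth_on_add smooth_on_mult)

lemma integrable_mult_bounded:
  fixes f g :: "'a \<Rightarrow> real"
  assumes "integrable M f" "g \<in> borel_measurable M" "\<And>x. \<bar>g x\<bar> \<le> B"
  shows "integrable M (\<lambda>x. f x * g x)"
proof (rule Bochner_Integration.integrable_bound)
  show "integrable M (\<lambda>x. B * f x)" using assms(1) by simp
  show "(\<lambda>x. f x * g x) \<in> borel_measurable M" using assms by measurable
  have "\<bar>f x * g x\<bar> \<le> \<bar>B * f x\<bar>" for x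
  proof -
    have "\<bar>f x * g x\<bar> \<le> \<bar>f x\<bar> * \<bar>B\<bar>"
      unfolding abs_mult by (intro mult_left_mono) (use assms(3)[of x] in auto)
    then show ?thesis by (simp add: abs_mult mult.commute)
  qed
  then show "AE x in M. norm (f x * g x) \<le> norm (B * f x)" by simp
qed

lemma bump_continuous: "continuous_on S (bump a b)"
  using smooth_on_continuous[OF smooth_on_bump] continuous_on_subset by blast

lemma bump_measurable [measurable]: "bump a b \<in> borel_measurable borel"
  by (rule borel_measurable_continuous_onI[OF bump_continuous])

lemma bump_integrable: "integrable lborel (bump a b)"
  by (rule integrable_compact_support[OF bump_continuous, of "max \<bar>a\<bar> \<bar>b\<bar>"])
    (rule bump_eq_0, auto)

text \<open>The multiples of a fixed bump by polynomials are dense enough: Weierstrass approximation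
  reaches all continuous factors, and a.e. limits of continuous functions reach the sign of \<open>w\<close>.\<close>

lemma AE_bound_from_test_functions:
  fixes w :: "real \<Rightarrow> real"
  assumes [measurable]: "w \<in> borel_measurable borel"
    and wi: "integrable lborel (\<lambda>t. indicator {a..b} t * w t)"
    and C: "0 \<le> C"
    and bd: "\<And>\<eta>. test1 a b \<eta> \<Longrightarrow> \<bar>LINT t|lborel. w t * \<eta> t\<bar> \<le> C * (LINT t|lborel. \<bar>\<eta> t\<bar>)"
  shows "AE t in lborel. a < t \<and> t < b \<longrightarrow> \<bar>w t\<bar> \<le> C"
proof -
  let ?\<chi> = "bump a b"
  have wchi: "w t * ?\<chi> t = (indicator {a..b} t * w t) * ?\<chi> t" for t
    by (cases "t \<in> {a..b}") (auto simp: bump_eq_0)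
  have wc: "integrable lborel (\<lambda>t. w t * ?\<chi> t)"
    unfolding wchi by (rule integrable_mult_bounded[OF wi, of _ 1]) (auto simp: bump_nonneg bump_le_1 abs_le_iff order.trans[OF _ bump_nonneg])
  note ci = bump_integrable[of a b]
  let ?W = "LINT t|lborel. \<bar>w t * ?\<chi> t\<bar>" and ?K = "LINT t|lborel. ?\<chi> t"
  have cont: "\<bar>LINT t|lborel. w t * ?\<chi> t * q t\<bar> \<le> C * (LINT t|lborel. ?\<chi> t * \<bar>q t\<bar>)"
    if q: "continuous_on UNIV q" and qB: "\<And>t. \<bar>q t\<bar> \<le> B" for q B
  proof (rule field_le_epsilon)
    fix e :: real assume e: "0 < e"
    \<comment> \<open>The total cost of a uniform error d is d times (W + C K), which this choice
      keeps below e; the summand 1 only prevents division by zero.\<close>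
    define d where "d = e / (?W + C * ?K + 1)"
    have W0: "0 \<le> ?W" and K0: "0 \<le> ?K" by (auto intro!: integral_nonneg_AE simp: bump_nonneg)
    then have den: "0 < ?W + C * ?K + 1" using C by (simp add: add_nonneg_pos)
    then have d: "0 < d" using e by (simp add: d_def)
    have de: "d * (?W + C * ?K) \<le> e"
      using e den by (simp add: d_def divide_simps)
    have [measurable]: "q \<in> borel_measurable borel" by (rule borel_measurable_continuous_onI[OF q])
    obtain g where g: "real_polynomial_function g" and gd: "\<And>x. x \<in> {a..b} \<Longrightarrow> \<bar>q x - g x\<bar> < d"
      using Stone_Weierstrass_real_polynomial_function[of "{a..b}" q d] continuous_on_subset[OF q] d
      by (metis compact_Icc subset_UNIV)
    have sg: "smooth_on UNIV g" by (rule smooth_on_real_polynomial_function[OF g])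
    then have [measurable]: "g \<in> borel_measurable borel"
      by (intro borel_measurable_continuous_onI smooth_on_continuous)
    \<comment> \<open>The approximation error is cut to the interval, because the polynomial is
      uncontrolled outside it; the bump vanishes there anyway.\<close>
    define r where "r t = indicator {a..b} t * (g t - q t)" for t
    have r: "\<bar>r t\<bar> \<le> d" for t using gd[of t] d by (auto simp: r_def indicator_def abs_minus_commute)
    have [measurable]: "r \<in> borel_measurable borel" unfolding r_def by measurable
    have gr: "?\<chi> t * g t = ?\<chi> t * (q t + r t)" for t
      using bump_eq_0[of t a b] by (auto simp: r_def indicator_def)
    have t1: "test1 a b (\<lambda>t. ?\<chi> t * g t)" by (rule test1_mult[OF test1_bump sg])
    have i1: "integrable lborel (\<lambda>t. w t * ?\<chi> t * q t)" by (rule integrable_mult_bounded[OF wc _ qB]) simp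
    have i2: "integrable lborel (\<lambda>t. w t * ?\<chi> t * r t)" by (rule integrable_mult_bounded[OF wc _ r]) simp
    have i3: "integrable lborel (\<lambda>t. ?\<chi> t * \<bar>q t\<bar>)"
      by (rule integrable_mult_bounded[OF ci, of _ B]) (use qB in auto)
    have "w t * (?\<chi> t * g t) = w t * ?\<chi> t * q t + w t * ?\<chi> t * r t" for t
      unfolding gr by (simp add: algebra_simps)
    then have "(LINT t|lborel. w t * (?\<chi> t * g t)) = (LINT t|lborel. w t * ?\<chi> t * q t) + (LINT t|lborel. w t * ?\<chi> t * r t)"
      using i1 i2 by simp
    moreover have "\<bar>LINT t|lborel. w t * ?\<chi> t * r t\<bar> \<le> d * ?W"
    proof -
      have "\<bar>LINT t|lborel. w t * ?\<chi> t * r t\<bar> \<le> (LINT t|lborel. \<bar>w t * ?\<chi> t * r t\<bar>)"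
        by (rule integral_abs_bound)
      also have "\<dots> \<le> (LINT t|lborel. d * \<bar>w t * ?\<chi> t\<bar>)"
      proof (rule integral_mono)
        show "\<bar>w t * ?\<chi> t * r t\<bar> \<le> d * \<bar>w t * ?\<chi> t\<bar>" for t
          unfolding abs_mult[of _ "r t"] using mult_left_mono[OF r, of "\<bar>w t * ?\<chi> t\<bar>" t] by (simp add: mult.commute)
      qed (use i2 wc in auto)
      finally show ?thesis by simp
    qed
    moreover have "\<bar>LINT t|lborel. w t * (?\<chi> t * g t)\<bar> \<le> C * (LINT t|lborel. \<bar>?\<chi> t * g t\<bar>)"
      by (rule bd[OF t1])
    moreover have "(LINT t|lborel. \<bar>?\<chi> t * g t\<bar>) \<le> (LINT t|lborel. ?\<chi> t * \<bar>q t\<bar>) + d * ?K"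
    proof -
      have "(LINT t|lborel. \<bar>?\<chi> t * g t\<bar>) \<le> (LINT t|lborel. ?\<chi> t * \<bar>q t\<bar> + d * ?\<chi> t)"
      proof (rule integral_mono)
        have "integrable lborel (\<lambda>t. ?\<chi> t * (q t + r t))"
          by (rule integrable_mult_bounded[OF ci, of _ "B + d"])
            (use qB r in \<open>auto intro: order.trans[OF abs_triangle_ineq] add_mono\<close>)
        then show "integrable lborel (\<lambda>t. \<bar>?\<chi> t * g t\<bar>)" unfolding gr by simp
        show "integrable lborel (\<lambda>t. ?\<chi> t * \<bar>q t\<bar> + d * ?\<chi> t)" using i3 ci by simp
        show "\<bar>?\<chi> t * g t\<bar> \<le> ?\<chi> t * \<bar>q t\<bar> + d * ?\<chi> t" for t
        proof -
          have "\<bar>q t + r t\<bar> \<le> \<bar>q t\<bar> + d" using r[of t] by linarith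
          then have "?\<chi> t * \<bar>q t + r t\<bar> \<le> ?\<chi> t * (\<bar>q t\<bar> + d)" using bump_nonneg by (intro mult_left_mono) auto
          moreover have "\<bar>?\<chi> t * (q t + r t)\<bar> = ?\<chi> t * \<bar>q t + r t\<bar>" by (simp add: abs_mult bump_nonneg)
          ultimately show ?thesis unfolding gr by (simp add: distrib_left mult.commute)
        qed
      qed
      also have "\<dots> = (LINT t|lborel. ?\<chi> t * \<bar>q t\<bar>) + d * ?K"
        using i3 ci by simp
      finally show ?thesis .
    qed
    then have "C * (LINT t|lborel. \<bar>?\<chi> t * g t\<bar>) \<le> C * ((LINT t|lborel. ?\<chi> t * \<bar>q t\<bar>) + d * ?K)"
      by (rule mult_left_mono[OF _ C])
    ultimately have "\<bar>LINT t|lborel. w t * ?\<chi> t * q t\<bar> \<le> C * (LINT t|lborel. ?\<chi> t * \<bar>q t\<bar>) + d * (?W + C * ?K)"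
      by (simp add: algebra_simps abs_le_iff)
    with de show "\<bar>LINT t|lborel. w t * ?\<chi> t * q t\<bar> \<le> C * (LINT t|lborel. ?\<chi> t * \<bar>q t\<bar>) + e" by linarith
  qed
  \<comment> \<open>The optimal test factor: the sign of w, active only where the claimed bound
    fails.\<close>
  define q where "q t = (if \<bar>w t\<bar> > C then sgn (w t) else 0)" for t
  have [measurable]: "q \<in> borel_measurable borel" unfolding q_def sgn_if by measurable
  have q1: "\<bar>q t\<bar> \<le> 1" for t by (auto simp: q_def sgn_if)
  have "q measurable_on UNIV"
    by (rule lebesgue_measurable_imp_measurable_on) (auto intro: measurable_completion)
  then obtain Z g where Z: "negligible Z" and gc: "\<And>n. continuous_on UNIV (g n)"
    and gl: "\<And>x. x \<notin> Z \<Longrightarrow> (\<lambda>n. g n x) \<longlonglongrightarrow> q x"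
    unfolding measurable_on_def by auto
  have aeZ: "AE t in lborel. t \<notin> Z"
    using Z AE_not_in[of Z lebesgue] by (simp add: negligible_iff_null_sets AE_completion_iff)
  \<comment> \<open>Truncation to [-1, 1] keeps the limit, as |q| \<le> 1, and supplies the uniform
    bound for dominated convergence.\<close>
  define h where "h n t = max (-1) (min 1 (g n t))" for n t
  have hc: "continuous_on UNIV (h n)" for n unfolding h_def by (intro continuous_intros gc)
  have [measurable]: "h n \<in> borel_measurable borel" for n by (rule borel_measurable_continuous_onI[OF hc])
  have h1: "\<bar>h n t\<bar> \<le> 1" for n t by (auto simp: h_def)
  have hl: "AE t in lborel. (\<lambda>n. h n t) \<longlonglongrightarrow> q t"
    using aeZ
  proof eventually_elim
    case (elim t)
    have "(\<lambda>n. h n t) \<longlonglongrightarrow> max (-1) (min 1 (q t))"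
      unfolding h_def by (intro tendsto_intros gl elim)
    then show ?case using q1[of t] by (simp add: abs_le_iff max_def min_def split: if_splits)
  qed
  have L1: "(\<lambda>n. LINT t|lborel. w t * ?\<chi> t * h n t) \<longlonglongrightarrow> (LINT t|lborel. w t * ?\<chi> t * q t)"
  proof (rule integral_dominated_convergence[where w="\<lambda>t. \<bar>w t * ?\<chi> t\<bar>"])
    show "AE t in lborel. (\<lambda>n. w t * ?\<chi> t * h n t) \<longlonglongrightarrow> w t * ?\<chi> t * q t"
      using hl by eventually_elim (intro tendsto_intros)
    show "AE t in lborel. norm (w t * ?\<chi> t * h n t) \<le> \<bar>w t * ?\<chi> t\<bar>" for n
      using mult_left_mono[OF h1, of "\<bar>w _ * ?\<chi> _\<bar>" n] by (simp add: abs_mult)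
  qed (use wc in auto)
  have L2: "(\<lambda>n. LINT t|lborel. ?\<chi> t * \<bar>h n t\<bar>) \<longlonglongrightarrow> (LINT t|lborel. ?\<chi> t * \<bar>q t\<bar>)"
  proof (rule integral_dominated_convergence[where w="?\<chi>"])
    show "AE t in lborel. (\<lambda>n. ?\<chi> t * \<bar>h n t\<bar>) \<longlonglongrightarrow> ?\<chi> t * \<bar>q t\<bar>"
      using hl by eventually_elim (intro tendsto_intros)
    show "AE t in lborel. norm (?\<chi> t * \<bar>h n t\<bar>) \<le> ?\<chi> t" for n
      using mult_left_mono[OF h1, of "?\<chi> _" n] by (simp add: abs_mult bump_nonneg)
  qed (use ci in auto)
  have main: "\<bar>LINT t|lborel. w t * ?\<chi> t * q t\<bar> \<le> C * (LINT t|lborel. ?\<chi> t * \<bar>q t\<bar>)"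
  proof (rule LIMSEQ_le)
    show "(\<lambda>n. \<bar>LINT t|lborel. w t * ?\<chi> t * h n t\<bar>) \<longlonglongrightarrow> \<bar>LINT t|lborel. w t * ?\<chi> t * q t\<bar>"
      by (intro tendsto_intros L1)
    show "(\<lambda>n. C * (LINT t|lborel. ?\<chi> t * \<bar>h n t\<bar>)) \<longlonglongrightarrow> C * (LINT t|lborel. ?\<chi> t * \<bar>q t\<bar>)"
      by (intro tendsto_intros L2)
    show "\<exists>N. \<forall>n\<ge>N. \<bar>LINT t|lborel. w t * ?\<chi> t * h n t\<bar> \<le> C * (LINT t|lborel. ?\<chi> t * \<bar>h n t\<bar>)"
      using cont[OF hc h1] by blast
  qed
  have iq: "integrable lborel (\<lambda>t. w t * ?\<chi> t * q t)" by (rule integrable_mult_bounded[OF wc _ q1]) simp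
  have iq2: "integrable lborel (\<lambda>t. ?\<chi> t * \<bar>q t\<bar>)"
    by (rule integrable_mult_bounded[OF ci, of _ 1]) (use q1 in auto)
  let ?f = "\<lambda>t. w t * ?\<chi> t * q t - C * (?\<chi> t * \<bar>q t\<bar>)"
  \<comment> \<open>The integrand is the bump times the positive part of |w| - C; an integral that
    is at most 0 then forces this part to vanish where the bump is positive.\<close>
  have feq: "?f t = (if \<bar>w t\<bar> > C then ?\<chi> t * (\<bar>w t\<bar> - C) else 0)" for t
    using C by (auto simp: q_def sgn_if algebra_simps)
  have fi: "integrable lborel ?f" using iq iq2 by simp
  have f0: "0 \<le> ?f t" for t unfolding feq using bump_nonneg[of a b t] by simp
  have "(LINT t|lborel. ?f t) \<le> 0" using main iq iq2 by simp
  moreover have "0 \<le> (LINT t|lborel. ?f t)" using f0 by (intro integral_nonneg_AE) simp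
  ultimately have "(LINT t|lborel. ?f t) = 0" by simp
  then have "AE t in lborel. ?f t = 0"
    using integral_nonneg_eq_0_iff_AE[OF fi] f0 by simp
  then show ?thesis
  proof eventually_elim
    case (elim t)
    show ?case
    proof (intro impI, rule ccontr)
      assume "a < t \<and> t < b" "\<not> \<bar>w t\<bar> \<le> C"
      then show False using elim bump_pos[of a t b] unfolding feq by simp
    qed
  qed
qed

section \<open>The Green function of \<open>c\<^sup>2 - D\<^sup>2\<close>\<close>

lemma exp_half_line:
  assumes "0 < \<mu>"
  shows "integrable lborel (\<lambda>s::real. indicator {..t} s * exp (\<mu> * s))"
    and "(LINT s|lborel. indicator {..t} s * exp (\<mu> * s)) = exp (\<mu> * t) / \<mu>"
proof -
  let ?f = "\<lambda>s::real. indicator {- t..} s * exp (- \<mu> * s)"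
  have "(\<integral>\<^sup>+s. ennreal (exp (- \<mu> * s)) * indicator {- t..} s \<partial>lborel) = ennreal (0 - (- (exp (- \<mu> * (- t)) / \<mu>)))"
  proof (rule nn_integral_FTC_atLeast)
    show "((\<lambda>s. - (exp (- \<mu> * s) / \<mu>)) has_real_derivative exp (- \<mu> * x)) (at x)" for x
      using assms by (auto intro!: derivative_eq_intros)
    have "((\<lambda>s. - (exp (- \<mu> * s) / \<mu>)) \<longlongrightarrow> - (0 / \<mu>)) at_top"
      using assms by (intro tendsto_intros filterlim_compose[OF exp_at_bot]
           filterlim_tendsto_neg_mult_at_bot[OF tendsto_const _ filterlim_ident]) auto
    then show "((\<lambda>s. - (exp (- \<mu> * s) / \<mu>)) \<longlongrightarrow> 0) at_top" by simp
  qed auto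
  moreover have "ennreal (exp (- \<mu> * s)) * indicator {- t..} s = ennreal (?f s)" for s
    by (auto simp: indicator_def)
  ultimately have n: "(\<integral>\<^sup>+s. ennreal (?f s) \<partial>lborel) = ennreal (exp (\<mu> * t) / \<mu>)" by simp
  have i: "integrable lborel ?f" by (rule integrableI_nn_integral_finite[OF _ _ n]) auto
  have v: "(LINT s|lborel. ?f s) = exp (\<mu> * t) / \<mu>"
    using assms n by (subst integral_eq_nn_integral) auto
  have r: "?f (0 + -1 * s) = indicator {..t} s * exp (\<mu> * s)" for s by (auto simp: indicator_def)
  show "integrable lborel (\<lambda>s::real. indicator {..t} s * exp (\<mu> * s))"
    using lborel_integrable_real_affine[OF i, of "-1" 0] unfolding r by simp
  show "(LINT s|lborel. indicator {..t} s * exp (\<mu> * s)) = exp (\<mu> * t) / \<mu>"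
    using v lborel_integral_real_affine[of "-1" ?f 0] unfolding r by simp
qed

lemma exp_dominated_half_line:
  fixes G :: "real \<Rightarrow> real"
  assumes [measurable]: "G \<in> borel_measurable borel" and \<mu>: "0 < \<mu>"
    and bd: "\<And>s. s \<le> t \<Longrightarrow> \<bar>G s\<bar> \<le> M * exp (\<mu> * s)"
  shows "integrable lborel (\<lambda>s. indicator {..t} s * G s)"
    and "\<bar>LINT s|lborel. indicator {..t} s * G s\<bar> \<le> M * (exp (\<mu> * t) / \<mu>)"
proof -
  have b: "\<bar>indicator {..t} s * G s\<bar> \<le> M * (indicator {..t} s * exp (\<mu> * s))" for s
    using bd[of s] by (auto simp: indicator_def)
  have i: "integrable lborel (\<lambda>s. M * (indicator {..t} s * exp (\<mu> * s)))"
    by (intro integrable_mult_right exp_half_line \<mu>)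
  show I: "integrable lborel (\<lambda>s. indicator {..t} s * G s)"
    by (rule Bochner_Integration.integrable_bound[OF i])
      (use b in \<open>auto intro!: AE_I2 order.trans[OF b abs_ge_self]\<close>)
  have "\<bar>LINT s|lborel. indicator {..t} s * G s\<bar> \<le> (LINT s|lborel. \<bar>indicator {..t} s * G s\<bar>)"
    by (rule integral_abs_bound)
  also have "\<dots> \<le> (LINT s|lborel. M * (indicator {..t} s * exp (\<mu> * s)))"
    by (rule integral_mono) (use I i b in auto)
  also have "\<dots> = M * (exp (\<mu> * t) / \<mu>)" by (simp add: exp_half_line \<mu>)
  finally show "\<bar>LINT s|lborel. indicator {..t} s * G s\<bar> \<le> M * (exp (\<mu> * t) / \<mu>)" .
qed

text \<open>Variation of constants: z = \<open>exp (- c * t) * Jm c F t\<close> is the solution of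
  z' + c z = F that is bounded for bounded continuous F and c > 0.\<close>

definition Jm :: "real \<Rightarrow> (real \<Rightarrow> real) \<Rightarrow> real \<Rightarrow> real" where
  "Jm c F t = (LINT s|lborel. indicator {..t} s * (exp (c * s) * F s))"

text \<open>Equal to the integral of e^(-c s) F(s) over s \<ge> t. Defining it by reflection lets
  the estimates for \<open>Jm\<close> serve at both ends.\<close>

definition Jp :: "real \<Rightarrow> (real \<Rightarrow> real) \<Rightarrow> real \<Rightarrow> real" where
  "Jp c F t = Jm c (\<lambda>s. F (- s)) (- t)"

text \<open>The bounded solution of \<open>c\<^sup>2 z - z'' = F\<close>.\<close>

definition green :: "real \<Rightarrow> (real \<Rightarrow> real) \<Rightarrow> real \<Rightarrow> real" where
  "green c F t = (exp (- c * t) * Jm c F t + exp (c * t) * Jp c F t) / (2 * c)"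

definition green' :: "real \<Rightarrow> (real \<Rightarrow> real) \<Rightarrow> real \<Rightarrow> real" where
  "green' c F t = (exp (c * t) * Jp c F t - exp (- c * t) * Jm c F t) / 2"

lemma Jm_integrable:
  fixes c :: real
  assumes [measurable]: "F \<in> borel_measurable borel" and "\<And>s. \<bar>F s\<bar> \<le> M" "0 < c"
  shows "integrable lborel (\<lambda>s. indicator {..t} s * (exp (c * s) * F s))"
  by (rule exp_dominated_half_line(1)[where \<mu>=c and M=M])
    (use assms in \<open>auto simp: abs_mult mult.commute\<close>)

lemma Jm_weighted_bound:
  assumes [measurable]: "F \<in> borel_measurable borel"
    and "\<And>s. s \<le> t \<Longrightarrow> \<bar>F s\<bar> \<le> M * exp (\<mu> * s)" "0 < c + \<mu>"
  shows "\<bar>Jm c F t\<bar> \<le> M * (exp ((c + \<mu>) * t) / (c + \<mu>))"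
  unfolding Jm_def
proof (rule exp_dominated_half_line(2))
  fix s assume "s \<le> t"
  from mult_left_mono[OF assms(2)[OF this] exp_ge_zero[of "c * s"]]
  have "\<bar>exp (c * s) * F s\<bar> \<le> exp (c * s) * (M * exp (\<mu> * s))" by (simp add: abs_mult)
  then show "\<bar>exp (c * s) * F s\<bar> \<le> M * exp ((c + \<mu>) * s)"
    by (simp only: distrib_right[of c \<mu> s] exp_add) (simp only: mult_ac)
qed (use assms in auto)

lemma Jm_bound:
  assumes "F \<in> borel_measurable borel" "\<And>s. \<bar>F s\<bar> \<le> M" "0 < c"
  shows "\<bar>Jm c F t\<bar> \<le> M * (exp (c * t) / c)"
  using Jm_weighted_bound[OF assms(1), of t M 0 c] assms by simp

text \<open>Splitting the half-line at the fixed point t - 1 leaves a constant plus an integral over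
  a compact interval, to which the fundamental theorem of calculus applies near t.\<close>

lemma Jm_DERIV:
  assumes F: "continuous_on UNIV F" and bd: "\<And>s. \<bar>F s\<bar> \<le> M" and c: "0 < c"
  shows "(Jm c F has_real_derivative exp (c * t) * F t) (at t)"
proof -
  let ?g = "\<lambda>s. exp (c * s) * F s" and ?a = "t - 1" and ?b = "t + 1"
  have [measurable]: "F \<in> borel_measurable borel" by (rule borel_measurable_continuous_onI[OF F])
  have gc: "continuous_on S ?g" for S
    by (intro continuous_intros continuous_on_subset[OF F]) auto
  note I = Jm_integrable[OF _ bd c]
  have eq: "Jm c F x = Jm c F ?a + integral {?a..x} ?g" if x: "?a \<le> x" for x
  proof -
    have i2: "integrable lborel (\<lambda>s. indicator {?a..x} s *\<^sub>R ?g s)"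
      by (rule borel_integrable_compact) (use gc in auto)
    have "Jm c F x = (LINT s|lborel. indicator {..?a} s * ?g s + indicator {?a..x} s *\<^sub>R ?g s)"
      unfolding Jm_def
    proof (rule integral_cong_AE)
      have "AE s in lborel. s \<noteq> ?a" by (rule AE_lborel_singleton)
      then show "AE s in lborel. indicator {..x} s * ?g s = indicator {..?a} s * ?g s + indicator {?a..x} s *\<^sub>R ?g s"
        by eventually_elim (use x in \<open>auto simp: indicator_def\<close>)
    qed auto
    also have "\<dots> = Jm c F ?a + (LINT s:{?a..x}|lborel. ?g s)"
      unfolding Jm_def set_lebesgue_integral_def using I i2 by (subst Bochner_Integration.integral_add) auto
    also have "(LINT s:{?a..x}|lborel. ?g s) = integral {?a..x} ?g"
      using i2 by (intro set_borel_integral_eq_integral) (simp add: set_integrable_def)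
    finally show ?thesis .
  qed
  have "((\<lambda>x. integral {?a..x} ?g) has_real_derivative ?g t) (at t within {?a..?b})"
    by (rule integral_has_real_derivative[OF gc]) auto
  moreover have "at t within {?a..?b} = at t" by (rule at_within_Icc_at) auto
  ultimately have "((\<lambda>x. integral {?a..x} ?g) has_real_derivative ?g t) (at t)" by (simp only:)
  from DERIV_add[OF DERIV_const[of "Jm c F ?a"] this]
  have "((\<lambda>x. Jm c F ?a + integral {?a..x} ?g) has_real_derivative ?g t) (at t)" by simp
  moreover have ev: "\<forall>\<^sub>F x in nhds t. Jm c F ?a + integral {?a..x} ?g = Jm c F x"
  proof (rule eventually_mono[OF eventually_nhds_in_open[of "{?a<..}"]])
    show "Jm c F ?a + integral {?a..x} ?g = Jm c F x" if "x \<in> {?a<..}" for x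
      using that by (intro eq[symmetric]) auto
  qed auto
  ultimately show ?thesis using DERIV_cong_ev[OF refl ev refl] by simp
qed

lemma Jp_DERIV:
  assumes F: "continuous_on UNIV F" and bd: "\<And>s. \<bar>F s\<bar> \<le> M" and c: "0 < c"
  shows "(Jp c F has_real_derivative - (exp (- c * t) * F t)) (at t)"
proof -
  have c': "continuous_on UNIV (\<lambda>s. F (- s))"
    by (rule continuous_on_compose2[OF F]) (auto intro: continuous_intros)
  have "((\<lambda>t::real. - t) has_real_derivative -1) (at t)" by (auto intro!: derivative_eq_intros)
  from DERIV_chain2[OF Jm_DERIV[OF c' bd c] this]
  show ?thesis unfolding Jp_def[abs_def] by simp
qed

text \<open>The contributions of F from the two exponential pieces cancel in the first derivative
  and add up to -F in the second.\<close>

lemma green_DERIV: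
  assumes F: "continuous_on UNIV F" and bd: "\<And>s. \<bar>F s\<bar> \<le> M" and c: "0 < c"
  shows "(green c F has_real_derivative green' c F t) (at t)"
    and "(green' c F has_real_derivative c\<^sup>2 * green c F t - F t) (at t)"
proof -
  have em: "((\<lambda>t. exp (- c * t)) has_real_derivative - c * exp (- c * t)) (at t)"
    and ep: "((\<lambda>t. exp (c * t)) has_real_derivative c * exp (c * t)) (at t)"
    by (auto intro!: derivative_eq_intros)
  note a = DERIV_mult[OF em Jm_DERIV[OF F bd c]] and b = DERIV_mult[OF ep Jp_DERIV[OF F bd c]]
  have alg1: "(- c * A * J + B * f * A + (c * B * P + - (A * f) * B)) / (2 * c) = (B * P - A * J) / 2"
    for A B J P f :: real
    using c by (simp add: field_simps)
  have alg2: "(c * B * P + - (A * f) * B - (- c * A * J + B * f * A)) / 2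
      = c\<^sup>2 * ((A * J + B * P) / (2 * c)) - f" if AB: "A * B = 1" for A B J P f :: real
  proof -
    have "A * f * B = f" "B * f * A = f" using AB by (simp_all add: mult_ac)
    then show ?thesis using c by (simp add: field_simps power2_eq_square)
  qed
  show "(green c F has_real_derivative green' c F t) (at t)"
    unfolding green_def[abs_def] green'_def using DERIV_cdivide[OF DERIV_add[OF a b], of "2 * c"]
    unfolding alg1 .
  have "exp (- c * t) * exp (c * t) = 1" by (simp add: exp_minus)
  from DERIV_cdivide[OF DERIV_diff[OF b a], of 2]
  show "(green' c F has_real_derivative c\<^sup>2 * green c F t - F t) (at t)"
    unfolding green'_def[abs_def] green_def alg2[OF \<open>exp (- c * t) * exp (c * t) = 1\<close>] .
qed

section \<open>Green function bounds and symmetry\<close>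

lemma test1_bounded:
  assumes "test1 a b F"
  obtains M where "\<And>s. \<bar>F s\<bar> \<le> M"
proof -
  have "compact (F ` {a..b})"
    by (rule compact_continuous_image[OF test1_continuous[OF assms]]) simp
  then obtain M where M: "\<And>y. y \<in> F ` {a..b} \<Longrightarrow> norm y \<le> M"
    using bounded_iff compact_imp_bounded by metis
  have "\<bar>F s\<bar> \<le> max M 0" for s
  proof (cases "s \<in> {a..b}")
    case True
    then show ?thesis using M[of "F s"] by auto
  next
    case False
    then have "F s = 0" using assms by (auto simp: test1_def)
    then show ?thesis by simp
  qed
  then show ?thesis by (rule that)
qed

lemma Jm_test1_smooth:
  assumes F: "test1 a b F" and c: "0 < c"
  shows "smooth_on UNIV (Jm c F)" "smooth_on UNIV (Jp c F)"
proof -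
  obtain M where M: "\<And>s. \<bar>F s\<bar> \<le> M" using test1_bounded[OF F] by blast
  note cF = test1_continuous[OF F]
  have s: "smooth_on UNIV F" using F by (simp add: test1_def)
  show "smooth_on UNIV (Jm c F)"
    by (rule smooth_on_I[OF _ Jm_DERIV[OF cF M c]]) (auto intro!: smooth_on_mult smooth_on_exp s)
  have "smooth_on UNIV (\<lambda>x. (- 1) * (exp ((- c) * x) * F x))"
    by (intro smooth_on_cmult smooth_on_mult smooth_on_exp s) auto
  then show "smooth_on UNIV (Jp c F)"
    by (intro smooth_on_I[OF _ Jp_DERIV[OF cF M c]]) auto
qed

lemma test1_measurable: "test1 a b \<eta> \<Longrightarrow> \<eta> \<in> borel_measurable borel"
  by (rule borel_measurable_continuous_onI[OF test1_continuous])

lemma test1_integrable: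
  assumes "test1 a b \<eta>" shows "integrable lborel \<eta>"
proof (rule integrable_compact_support[OF test1_continuous[OF assms], of "max \<bar>a\<bar> \<bar>b\<bar>"])
  fix x :: real assume "max \<bar>a\<bar> \<bar>b\<bar> < norm x"
  then have "x < a \<or> b < x" by auto
  then show "\<eta> x = 0" using assms unfolding test1_def by blast
qed

text \<open>The constant depends on the support only through its length b - a. This is what makes
  the later L2 bounds independent of the position of a unit interval.\<close>

lemma Jm_test1_bound:
  assumes F: "test1 a b F" and c: "0 < c"
  shows "\<bar>exp (- c * t) * Jm c F t\<bar> \<le> exp (c * (b - a)) * exp (- c * \<bar>t - a\<bar>) * (LINT s|lborel. \<bar>F s\<bar>)"
proof (cases "t < a")
  case True
  have "indicator {..t} s * (exp (c * s) * F s) = 0" for s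
    using F True by (auto simp: test1_def indicator_def)
  then have "Jm c F t = 0" unfolding Jm_def by (simp only:) simp
  then show ?thesis by simp
next
  case False
  have i: "integrable lborel (\<lambda>s. \<bar>F s\<bar>)" using test1_integrable[OF F] by simp
  have "\<bar>Jm c F t\<bar> \<le> (LINT s|lborel. \<bar>indicator {..t} s * (exp (c * s) * F s)\<bar>)"
    unfolding Jm_def by (rule integral_abs_bound)
  also have "\<dots> \<le> (LINT s|lborel. exp (c * b) * \<bar>F s\<bar>)"
  proof (rule integral_mono)
    obtain M where M: "\<And>s. \<bar>F s\<bar> \<le> M" using test1_bounded[OF F] by blast
    show "integrable lborel (\<lambda>s. \<bar>indicator {..t} s * (exp (c * s) * F s)\<bar>)"
      using Jm_integrable[OF test1_measurable[OF F] M c] by simp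
    show "\<bar>indicator {..t} s * (exp (c * s) * F s)\<bar> \<le> exp (c * b) * \<bar>F s\<bar>" for s
    proof (cases "s \<le> b")
      case True
      then have "exp (c * s) * \<bar>F s\<bar> \<le> exp (c * b) * \<bar>F s\<bar>"
        using c by (intro mult_right_mono) auto
      then show ?thesis by (auto simp: abs_mult indicator_def)
    next
      case False
      then have "F s = 0" using F by (simp add: test1_def)
      then show ?thesis by simp
    qed
  qed (use i in auto)
  finally have J: "\<bar>Jm c F t\<bar> \<le> exp (c * b) * (LINT s|lborel. \<bar>F s\<bar>)" by simp
  have "\<bar>exp (- c * t) * Jm c F t\<bar> \<le> exp (- c * t) * (exp (c * b) * (LINT s|lborel. \<bar>F s\<bar>))"
    unfolding abs_mult using J by (intro mult_mono) auto
  also have "\<dots> = exp (c * (b - a)) * exp (- c * \<bar>t - a\<bar>) * (LINT s|lborel. \<bar>F s\<bar>)"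
  proof -
    have "- c * t + c * b = c * (b - a) + - c * \<bar>t - a\<bar>" using False by (simp add: algebra_simps)
    then have "exp (- c * t) * exp (c * b) = exp (c * (b - a)) * exp (- c * \<bar>t - a\<bar>)"
      by (simp only: exp_add[symmetric])
    then show ?thesis by (simp only: mult.assoc[symmetric])
  qed
  finally show ?thesis .
qed

lemma test1_reflect:
  assumes "test1 a b F" shows "test1 (- b) (- a) (\<lambda>s. F (- s))"
  unfolding test1_def
proof (intro conjI allI impI)
  have "smooth_on UNIV (\<lambda>s. (-1) * s)" by (intro smooth_on_cmult smooth_on_ident) auto
  then show "smooth_on UNIV (\<lambda>s. F (- s))"
    using assms by (intro smooth_on_compose[of UNIV UNIV "\<lambda>s. - s" F]) (auto simp: test1_def)
  show "F (- t) = 0" if "t < - b \<or> - a < t" for t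
    using that assms by (auto simp: test1_def)
qed

lemma Jp_test1_bound:
  assumes F: "test1 a b F" and c: "0 < c"
  shows "\<bar>exp (c * t) * Jp c F t\<bar> \<le> exp (c * (b - a)) * exp (- c * \<bar>t - b\<bar>) * (LINT s|lborel. \<bar>F s\<bar>)"
proof -
  have "(LINT s|lborel. \<bar>F (- s)\<bar>) = (LINT s|lborel. \<bar>F s\<bar>)"
    using lborel_integral_real_affine[of "-1" "\<lambda>s. \<bar>F s\<bar>" 0] by simp
  moreover have "\<bar>- t - - b\<bar> = \<bar>t - b\<bar>" by simp
  ultimately show ?thesis
    using Jm_test1_bound[OF test1_reflect[OF F] c, of "- t"] by (simp add: Jp_def)
qed

text \<open>Identifies the operator as convolution with e^(-c |t|) / (2 c), for data that are merely
  bounded and measurable. Symmetry, positivity and Fubini arguments are read off from this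
  form.\<close>

lemma green_as_convolution:
  assumes [measurable]: "F \<in> borel_measurable borel" and bd: "\<And>s. \<bar>F s\<bar> \<le> M" and c: "0 < c"
  shows "integrable lborel (\<lambda>s. exp (- c * \<bar>t - s\<bar>) * F s)"
    and "(LINT s|lborel. exp (- c * \<bar>t - s\<bar>) * F s) = 2 * c * green c F t"
proof -
  let ?m = "\<lambda>s. indicator {..t} s * (exp (c * s) * F s)"
    and ?p = "\<lambda>s. indicator {..- t} s * (exp (c * s) * F (- s))"
  have bd': "\<bar>F (- s)\<bar> \<le> M" for s by (rule bd)
  have im: "integrable lborel ?m" and ip: "integrable lborel ?p"
    using Jm_integrable[OF _ bd c] Jm_integrable[OF _ bd' c] by auto
  have ip': "integrable lborel (\<lambda>s. ?p (- s))"
    using lborel_integrable_real_affine[OF ip, of "-1" 0] by simp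
  have vp: "(LINT s|lborel. ?p (- s)) = Jp c F t"
    using lborel_integral_real_affine[of "-1" ?p 0] by (simp add: Jp_def Jm_def)
  let ?g = "\<lambda>s. exp (- c * t) * ?m s + exp (c * t) * ?p (- s)"
  have ae: "AE s in lborel. exp (- c * \<bar>t - s\<bar>) * F s = ?g s"
  proof -
    have "AE s in lborel. s \<noteq> t" by (rule AE_lborel_singleton)
    then show ?thesis
    proof eventually_elim
      case (elim s)
      have "exp (- c * t) * exp (c * s) = exp (- c * (t - s))" "exp (c * t) * exp (- (c * s)) = exp (- c * (s - t))"
        by (simp_all add: exp_add[symmetric] algebra_simps)
      then show ?case using elim by (cases "s < t") (simp_all add: indicator_def)
    qed
  qed
  have ig: "integrable lborel ?g" using im ip' by simp
  show "integrable lborel (\<lambda>s. exp (- c * \<bar>t - s\<bar>) * F s)"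
    using ig by (subst integrable_cong_AE[OF _ _ ae]) auto
  have "(LINT s|lborel. exp (- c * \<bar>t - s\<bar>) * F s) = (LINT s|lborel. ?g s)"
    by (rule integral_cong_AE[OF _ _ ae]) auto
  also have "\<dots> = exp (- c * t) * Jm c F t + exp (c * t) * Jp c F t"
    using im ip' vp by (simp add: Jm_def)
  finally show "(LINT s|lborel. exp (- c * \<bar>t - s\<bar>) * F s) = 2 * c * green c F t"
    using c by (simp add: green_def)
qed

lemma green_bound:
  assumes [measurable]: "F \<in> borel_measurable borel" and bd: "\<And>s. \<bar>F s\<bar> \<le> M" and c: "0 < c"
  shows "\<bar>green c F t\<bar> \<le> M / c\<^sup>2"
proof -
  have bd': "\<bar>F (- s)\<bar> \<le> M" for s by (rule bd)
  have "\<bar>exp (- c * t) * Jm c F t\<bar> \<le> exp (- c * t) * (M * (exp (c * t) / c))"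
    unfolding abs_mult using Jm_bound[where F=F and M=M and c=c and t=t] bd c assms(1)
    by (intro mult_mono) auto
  moreover have "\<bar>exp (c * t) * Jp c F t\<bar> \<le> exp (c * t) * (M * (exp (c * - t) / c))"
  proof -
    have "(\<lambda>s. F (- s)) \<in> borel_measurable borel" by measurable
    then show ?thesis
      unfolding abs_mult Jp_def using Jm_bound[where F="\<lambda>s. F (- s)" and M=M and c=c and t="- t"] bd c
      by (intro mult_mono) auto
  qed
  moreover have "exp (- c * t) * (M * (exp (c * t) / c)) = M / c" "exp (c * t) * (M * (exp (c * - t) / c)) = M / c"
    by (simp_all add: exp_minus)
  ultimately have "\<bar>exp (- c * t) * Jm c F t + exp (c * t) * Jp c F t\<bar> \<le> 2 * M / c"
    by linarith
  then show ?thesis using c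
    by (simp add: green_def abs_mult power2_eq_square divide_simps mult_ac)
qed

text \<open>The kernel is symmetric. Integrability of G alone secures Fubini, since the convolution
  of a bounded F is bounded.\<close>

lemma green_self_adjoint:
  assumes Fm [measurable]: "F \<in> borel_measurable borel" and F: "\<And>s. \<bar>F s\<bar> \<le> M"
    and Gm [measurable]: "G \<in> borel_measurable borel" and G: "\<And>s. \<bar>G s\<bar> \<le> K" and Gi: "integrable lborel G"
    and c: "0 < c"
  shows "(LINT t|lborel. G t * green c F t) = (LINT s|lborel. F s * green c G s)"
proof -
  let ?k = "\<lambda>t s. exp (- c * \<bar>t - s\<bar>) * F s * G t"
  have km: "(\<lambda>(t,s). ?k t s) \<in> borel_measurable (lborel \<Otimes>\<^sub>M lborel)" by measurable
  have I1: "integrable lborel (\<lambda>s. ?k t s)" for t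
    by (rule integrable_mult_left[OF green_as_convolution(1)[OF Fm F c]]) 
  have "integrable (lborel \<Otimes>\<^sub>M lborel) (\<lambda>(t,s). ?k t s)"
  proof (rule lborel_pair.Fubini_integrable[OF km])
    have nn: "(LINT s|lborel. norm (?k t s)) = \<bar>G t\<bar> * (2 * c * green c (\<lambda>s. \<bar>F s\<bar>) t)" for t
    proof -
      have "(LINT s|lborel. norm (?k t s)) = (LINT s|lborel. (exp (- c * \<bar>t - s\<bar>) * \<bar>F s\<bar>) * \<bar>G t\<bar>)"
        by (simp add: abs_mult)
      also have "\<dots> = (2 * c * green c (\<lambda>s. \<bar>F s\<bar>) t) * \<bar>G t\<bar>"
        using green_as_convolution[of "\<lambda>s. \<bar>F s\<bar>" M c t] F c by simp
      finally show ?thesis by (simp add: mult.commute)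
    qed
    have b: "\<bar>2 * c * green c (\<lambda>s. \<bar>F s\<bar>) t\<bar> \<le> 2 * c * (M / c\<^sup>2)" for t
      using mult_left_mono[OF green_bound[of "\<lambda>s. \<bar>F s\<bar>" M c t], of "2 * c"] F c by (simp add: abs_mult)
    have m: "(\<lambda>t. LINT s|lborel. (exp (- c * \<bar>t - s\<bar>) * \<bar>F s\<bar>)) \<in> borel_measurable lborel" by measurable
    have "(LINT s|lborel. (exp (- c * \<bar>t - s\<bar>) * \<bar>F s\<bar>)) = 2 * c * green c (\<lambda>s. \<bar>F s\<bar>) t" for t
      using green_as_convolution(2)[of "\<lambda>s. \<bar>F s\<bar>" M c t] F c by simp
    with m have "(\<lambda>t. 2 * c * green c (\<lambda>s. \<bar>F s\<bar>) t) \<in> borel_measurable lborel"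
      by (simp only:)
    from integrable_mult_bounded[OF integrable_abs[OF Gi] this b]
    show "integrable lborel (\<lambda>t. LINT s|lborel. norm (case (t, s) of (t, s) \<Rightarrow> ?k t s))"
      unfolding prod.case nn .
    show "AE t in lborel. integrable lborel (\<lambda>s. case (t, s) of (t, s) \<Rightarrow> ?k t s)" using I1 by simp
  qed
  from lborel_pair.Fubini_integral[OF this]
  have eq: "(LINT s|lborel. LINT t|lborel. ?k t s) = (LINT t|lborel. LINT s|lborel. ?k t s)" .
  have l: "(LINT s|lborel. ?k t s) = 2 * c * (G t * green c F t)" for t
    using green_as_convolution[OF Fm F c, of t] by simp
  have r: "(LINT t|lborel. ?k t s) = 2 * c * (F s * green c G s)" for s
  proof -
    have "(LINT t|lborel. ?k t s) = (LINT t|lborel. exp (- c * \<bar>s - t\<bar>) * G t * F s)"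
      by (simp add: abs_minus_commute mult_ac)
    then show ?thesis using green_as_convolution[OF Gm G c, of s] by simp
  qed
  show ?thesis using eq c unfolding l r by simp
qed

section \<open>Orbits of the fourth-order Emden--Fowler equation\<close>

definition nl :: "real \<Rightarrow> real \<Rightarrow> real" where
  "nl r y = \<bar>y\<bar> powr r * y"

lemma abs_nl: "\<bar>nl r y\<bar> = \<bar>y\<bar> powr r * \<bar>y\<bar>"
  by (simp add: nl_def abs_mult)

lemma nl_minus: "nl r (- y) = - nl r y"
  by (simp add: nl_def)

lemma nl_0 [simp]: "nl r 0 = 0"
  by (simp add: nl_def)

lemma nl_measurable [measurable]: "nl r \<in> borel_measurable borel"
  unfolding nl_def[abs_def] by measurable

lemma nl_DERIV:
  assumes r: "0 < r"
  shows "(nl r has_real_derivative (r + 1) * \<bar>y\<bar> powr r) (at y)"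
proof -
  consider "y > 0" | "y < 0" | "y = 0" by linarith
  then show ?thesis
  proof cases
    case 1
    have "((\<lambda>y. y powr r * y) has_real_derivative (r + 1) * \<bar>y\<bar> powr r) (at y)"
      using 1 powr_diff[of y r 1]
      by (auto intro!: derivative_eq_intros simp: field_simps)
    moreover have ev: "\<forall>\<^sub>F z in nhds y. z powr r * z = nl r z"
      using 1 by (intro eventually_mono[OF eventually_nhds_in_open[of "{0<..}"]]) (auto simp: nl_def)
    ultimately show ?thesis using DERIV_cong_ev[OF refl ev refl] by simp
  next
    case 2
    have "((\<lambda>y. (- y) powr r * y) has_real_derivative (r + 1) * \<bar>y\<bar> powr r) (at y)"
      using 2 powr_diff[of "- y" r 1]
      by (auto intro!: derivative_eq_intros simp: field_simps)
    moreover have ev: "\<forall>\<^sub>F z in nhds y. (- z) powr r * z = nl r z"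
      using 2 by (intro eventually_mono[OF eventually_nhds_in_open[of "{..<0}"]]) (auto simp: nl_def)
    ultimately show ?thesis using DERIV_cong_ev[OF refl ev refl] by simp
  next
    case 3
    have "((\<lambda>h::real. \<bar>h\<bar> powr r) \<longlongrightarrow> 0) (at 0)"
      using tendsto_powr'[of "\<lambda>h::real. \<bar>h\<bar>" 0 "at 0" "\<lambda>_. r" r] r
      by (auto intro!: tendsto_eq_intros)
    then have "((\<lambda>h. (nl r (0 + h) - nl r 0) / h) \<longlongrightarrow> 0) (at 0)"
      by (rule Lim_transform_eventually) (auto simp: nl_def eventually_at_filter)
    then show ?thesis using 3 r by (simp add: DERIV_def)
  qed
qed

lemma nl_continuous: "0 < r \<Longrightarrow> continuous_on S (nl r)"
  by (meson nl_DERIV DERIV_isCont continuous_at_imp_continuous_on)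

lemma nl_mono:
  assumes "0 < r" "x \<le> y" shows "nl r x \<le> nl r y"
  using assms by (intro DERIV_nonneg_imp_nondecreasing[OF assms(2)]) (use nl_DERIV[OF assms(1)] in fastforce)

lemma nl_lipschitz:
  assumes r: "0 < r" and R: "\<bar>x\<bar> \<le> R" "\<bar>y\<bar> \<le> R"
  shows "\<bar>nl r x - nl r y\<bar> \<le> (r + 1) * R powr r * \<bar>x - y\<bar>"
proof -
  have "norm (nl r x - nl r y) \<le> ((r + 1) * R powr r) * norm (x - y)"
  proof (rule field_differentiable_bound[of "{-R..R}" "nl r" "\<lambda>y. (r + 1) * \<bar>y\<bar> powr r"])
    show "(nl r has_field_derivative (r + 1) * \<bar>z\<bar> powr r) (at z within {-R..R})" for z
      using nl_DERIV[OF r] has_field_derivative_at_within by blast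
    show "norm ((r + 1) * \<bar>z\<bar> powr r) \<le> (r + 1) * R powr r" if "z \<in> {-R..R}" for z
      using that r powr_mono2[of r "\<bar>z\<bar>" R] by (auto simp: abs_mult)
  qed (use R in auto)
  then show ?thesis by simp
qed

lemma tendsto_exp_at_bot: "0 < (c::real) \<Longrightarrow> ((\<lambda>t. exp (c * t)) \<longlongrightarrow> 0) at_bot"
  by (rule filterlim_compose[OF exp_at_bot])
    (rule filterlim_tendsto_pos_mult_at_bot[OF tendsto_const _ filterlim_ident], simp)

lemma lower_bound_from_at_bot:
  fixes h :: "real \<Rightarrow> real"
  assumes "\<And>s. s \<le> t \<Longrightarrow> (h has_real_derivative h' s) (at s)" "\<And>s. s \<le> t \<Longrightarrow> 0 \<le> h' s"
    and "(h \<longlongrightarrow> L) at_bot"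
  shows "L \<le> h t"
proof (rule tendsto_upperbound[OF assms(3)])
  have "h s \<le> h t" if "s \<le> t" for s
    using that by (intro DERIV_nonneg_imp_nondecreasing[OF that]) (use assms(1,2) in blast)
  then show "\<forall>\<^sub>F s in at_bot. h s \<le> h t"
    using eventually_le_at_bot[of t] by (rule eventually_mono[rotated])
qed simp

text \<open>Integrates an exponential derivative bound from minus infinity, by comparing h and -h
  with the exact primitive. One application inverts one first-order factor of the operator.\<close>

lemma abs_bound_from_at_bot:
  fixes h :: "real \<Rightarrow> real"
  assumes d: "\<And>s. s \<le> t \<Longrightarrow> (h has_real_derivative h' s) (at s)"
    and b: "\<And>s. s \<le> t \<Longrightarrow> \<bar>h' s\<bar> \<le> K * exp (\<mu> * s)"
    and \<mu>: "0 < \<mu>" and l: "(h \<longlongrightarrow> 0) at_bot"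
  shows "\<bar>h t\<bar> \<le> K / \<mu> * exp (\<mu> * t)"
proof -
  have e: "((\<lambda>s. K / \<mu> * exp (\<mu> * s)) has_real_derivative K * exp (\<mu> * s)) (at s)" for s
    using \<mu> by (auto intro!: derivative_eq_intros)
  have el: "((\<lambda>s. K / \<mu> * exp (\<mu> * s)) \<longlongrightarrow> K / \<mu> * 0) at_bot"
    by (intro tendsto_intros tendsto_exp_at_bot \<mu>)
  have "0 \<le> K / \<mu> * exp (\<mu> * t) - h t"
  proof (rule lower_bound_from_at_bot[where h="\<lambda>s. K / \<mu> * exp (\<mu> * s) - h s"])
    show "((\<lambda>s. K / \<mu> * exp (\<mu> * s) - h s) has_real_derivative K * exp (\<mu> * s) - h' s) (at s)" if "s \<le> t" for s
      by (rule DERIV_diff[OF e d[OF that]])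
    show "0 \<le> K * exp (\<mu> * s) - h' s" if "s \<le> t" for s using b[OF that] by linarith
    show "((\<lambda>s. K / \<mu> * exp (\<mu> * s) - h s) \<longlongrightarrow> 0) at_bot" using tendsto_diff[OF el l] by simp
  qed
  moreover have "0 \<le> K / \<mu> * exp (\<mu> * t) + h t"
  proof (rule lower_bound_from_at_bot[where h="\<lambda>s. K / \<mu> * exp (\<mu> * s) + h s"])
    show "((\<lambda>s. K / \<mu> * exp (\<mu> * s) + h s) has_real_derivative K * exp (\<mu> * s) + h' s) (at s)" if "s \<le> t" for s
      by (rule DERIV_add[OF e d[OF that]])
    show "0 \<le> K * exp (\<mu> * s) + h' s" if "s \<le> t" for s using b[OF that] by linarith
    show "((\<lambda>s. K / \<mu> * exp (\<mu> * s) + h s) \<longlongrightarrow> 0) at_bot" using tendsto_add[OF el l] by simp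
  qed
  ultimately show ?thesis by linarith
qed

text \<open>Solutions of \<open>(D\<^sup>2 - m\<^sup>2)(D\<^sup>2 - k\<^sup>2) y = \<bar>y\<bar>\<^sup>r y\<close>, written as a system for \<open>y\<close> and
  \<open>w = y'' - k\<^sup>2 y\<close>, that emanate from the origin at \<open>-\<infinity>\<close> and stay bounded. The numbers \<open>A\<close>, \<open>B\<close>
  are the coordinates on the unstable manifold.\<close>

definition orbit :: "real \<Rightarrow> real \<Rightarrow> real \<Rightarrow> (real \<Rightarrow> real) \<Rightarrow> (real \<Rightarrow> real) \<Rightarrow> (real \<Rightarrow> real) \<Rightarrow>
    (real \<Rightarrow> real) \<Rightarrow> real \<Rightarrow> real \<Rightarrow> bool" where
  "orbit k m r y y1 w w1 A B \<longleftrightarrow>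
     (\<forall>t. (y has_real_derivative y1 t) (at t)) \<and>
     (\<forall>t. (y1 has_real_derivative k\<^sup>2 * y t + w t) (at t)) \<and>
     (\<forall>t. (w has_real_derivative w1 t) (at t)) \<and>
     (\<forall>t. (w1 has_real_derivative m\<^sup>2 * w t + nl r (y t)) (at t)) \<and>
     ((\<lambda>t. exp (- k * t) * y t) \<longlongrightarrow> A) at_bot \<and>
     ((\<lambda>t. exp (- k * t) * (y1 t + k * y t)) \<longlongrightarrow> 2 * k * A) at_bot \<and>
     ((\<lambda>t. exp (- m * t) * w t) \<longlongrightarrow> B) at_bot \<and>
     ((\<lambda>t. exp (- m * t) * (w1 t + m * w t)) \<longlongrightarrow> 2 * m * B) at_bot \<and>
     (\<exists>M. \<forall>t. \<bar>y t\<bar> \<le> M) \<and> (\<exists>M. \<forall>t. \<bar>w t\<bar> \<le> M)"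

lemma orbit_minus:
  assumes "orbit k m r y y1 w w1 A B"
  shows "orbit k m r (\<lambda>t. - y t) (\<lambda>t. - y1 t) (\<lambda>t. - w t) (\<lambda>t. - w1 t) (- A) (- B)"
proof -
  have 1: "((\<lambda>t. exp (- k * t) * (- y1 t + k * - y t)) \<longlongrightarrow> 2 * k * - A) at_bot"
    using tendsto_minus[of "\<lambda>t. exp (- k * t) * (y1 t + k * y t)" "2 * k * A"] assms
    by (simp add: orbit_def algebra_simps)
  have 2: "((\<lambda>t. exp (- m * t) * (- w1 t + m * - w t)) \<longlongrightarrow> 2 * m * - B) at_bot"
    using tendsto_minus[of "\<lambda>t. exp (- m * t) * (w1 t + m * w t)" "2 * m * B"] assms
    by (simp add: orbit_def algebra_simps)
  have 3: "((\<lambda>t. - y1 t) has_real_derivative k\<^sup>2 * - y t + - w t) (at t)"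
       "((\<lambda>t. - w1 t) has_real_derivative m\<^sup>2 * - w t + nl r (- y t)) (at t)" for t
    using assms DERIV_minus[of y1 "k\<^sup>2 * y t + w t" t UNIV] DERIV_minus[of w1 "m\<^sup>2 * w t + nl r (y t)" t UNIV]
    by (simp_all add: orbit_def nl_minus)
  show ?thesis
    using assms 1 2 3 unfolding orbit_def by (auto intro: DERIV_minus tendsto_minus)
qed

lemma orbit_zero: "orbit k m r (\<lambda>_. 0) (\<lambda>_. 0) (\<lambda>_. 0) (\<lambda>_. 0) 0 0"
  by (auto simp: orbit_def)

lemma weighted_DERIV:
  fixes f :: "real \<Rightarrow> real"
  assumes "(f has_real_derivative f') (at t)"
  shows "((\<lambda>t. exp (c * t) * f t) has_real_derivative exp (c * t) * (f' + c * f t)) (at t)"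
  using assms by (auto intro!: derivative_eq_intros simp: algebra_simps)

text \<open>The system is cooperative: writing it as first-order steps with factors \<open>D - m\<close>, \<open>D + m\<close>,
  \<open>D - k\<close>, \<open>D + k\<close>, an initial advantage \<open>B2 < B1\<close> at \<open>-\<infinity>\<close> propagates forever and makes \<open>w\<close>
  grow like \<open>e\<^sup>m\<^sup>t\<close>.\<close>

locale orbit_pair =
  fixes k m r y y1 w w1 Y Y1 W W1 A B1 B2
  assumes k: "0 < k" and km: "k < m" and r: "0 < r"
    and o1: "orbit k m r y y1 w w1 A B1" and o2: "orbit k m r Y Y1 W W1 A B2"
begin

definition "d t = y t - Y t"
definition "e t = w t - W t"
definition "g t = nl r (y t) - nl r (Y t)"
text \<open>\<open>P\<close> and \<open>Q\<close> carry integrating factors: P' = e^(-m t) g and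
  (e^(m t) e)' = e^(2 m t) P, and likewise Q' = e^(-k t) e and (e^(k t) d)' = e^(2 k t) Q. All
  kernels are positive, so signs and bounds pass from g to e and from e to d.\<close>

definition "P t = exp (- m * t) * ((w1 t - W1 t) + m * e t)"
definition "Q t = exp (- k * t) * ((y1 t - Y1 t) + k * d t)"

lemma m: "0 < m" using k km by simp

lemma d_DERIV: "(d has_real_derivative y1 t - Y1 t) (at t)"
  unfolding d_def[abs_def] using o1 o2 by (auto simp: orbit_def intro: DERIV_diff)

lemma d1_DERIV: "((\<lambda>t. y1 t - Y1 t) has_real_derivative k\<^sup>2 * d t + e t) (at t)"
  using DERIV_diff[of y1 "k\<^sup>2 * y t + w t" t UNIV Y1 "k\<^sup>2 * Y t + W t"] o1 o2
  by (simp add: orbit_def d_def e_def algebra_simps)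

lemma e_DERIV: "(e has_real_derivative w1 t - W1 t) (at t)"
  unfolding e_def[abs_def] using o1 o2 by (auto simp: orbit_def intro: DERIV_diff)

lemma e1_DERIV: "((\<lambda>t. w1 t - W1 t) has_real_derivative m\<^sup>2 * e t + g t) (at t)"
  using DERIV_diff[of w1 "m\<^sup>2 * w t + nl r (y t)" t UNIV W1 "m\<^sup>2 * W t + nl r (Y t)"] o1 o2
  by (simp add: orbit_def g_def e_def algebra_simps)

lemma P_DERIV: "(P has_real_derivative exp (- m * t) * g t) (at t)"
  unfolding P_def[abs_def]
  by (rule DERIV_cong[OF weighted_DERIV[OF DERIV_add[OF e1_DERIV DERIV_cmult[OF e_DERIV]]]])
    (simp add: algebra_simps power2_eq_square)

lemma Q_DERIV: "(Q has_real_derivative exp (- k * t) * e t) (at t)"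
  unfolding Q_def[abs_def]
  by (rule DERIV_cong[OF weighted_DERIV[OF DERIV_add[OF d1_DERIV DERIV_cmult[OF d_DERIV]]]])
    (simp add: algebra_simps power2_eq_square)

lemma exp_split: "exp (2 * c * t) * (exp (- c * t) * x) = exp (c * t) * (x::real)"
  by (simp add: mult.assoc[symmetric] exp_add[symmetric])

lemma we_DERIV: "((\<lambda>t. exp (m * t) * e t) has_real_derivative exp (2 * m * t) * P t) (at t)"
  unfolding P_def exp_split by (rule weighted_DERIV[OF e_DERIV])

lemma wd_DERIV: "((\<lambda>t. exp (k * t) * d t) has_real_derivative exp (2 * k * t) * Q t) (at t)"
  unfolding Q_def exp_split by (rule weighted_DERIV[OF d_DERIV])

lemma P_lim: "(P \<longlongrightarrow> 2 * m * (B1 - B2)) at_bot"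
proof -
  have "((\<lambda>t. exp (- m * t) * (w1 t + m * w t) - exp (- m * t) * (W1 t + m * W t)) \<longlongrightarrow> 2 * m * B1 - 2 * m * B2) at_bot"
    using o1 o2 by (intro tendsto_diff) (auto simp: orbit_def)
  then show ?thesis unfolding P_def[abs_def] e_def by (simp add: algebra_simps)
qed

lemma e_lim: "((\<lambda>t. exp (- m * t) * e t) \<longlongrightarrow> B1 - B2) at_bot"
proof -
  have "((\<lambda>t. exp (- m * t) * w t - exp (- m * t) * W t) \<longlongrightarrow> B1 - B2) at_bot"
    using o1 o2 by (intro tendsto_diff) (auto simp: orbit_def)
  then show ?thesis unfolding e_def by (simp add: algebra_simps)
qed

lemma Q_lim: "(Q \<longlongrightarrow> 0) at_bot"
proof -
  have "((\<lambda>t. exp (- k * t) * (y1 t + k * y t) - exp (- k * t) * (Y1 t + k * Y t)) \<longlongrightarrow> 2 * k * A - 2 * k * A) at_bot"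
    using o1 o2 by (intro tendsto_diff) (auto simp: orbit_def)
  then show ?thesis unfolding Q_def[abs_def] d_def by (simp add: algebra_simps)
qed

lemma d_lim: "((\<lambda>t. exp (- k * t) * d t) \<longlongrightarrow> 0) at_bot"
proof -
  have "((\<lambda>t. exp (- k * t) * y t - exp (- k * t) * Y t) \<longlongrightarrow> A - A) at_bot"
    using o1 o2 by (intro tendsto_diff) (auto simp: orbit_def)
  then show ?thesis unfolding d_def by (simp add: algebra_simps)
qed

lemma we_lim: "((\<lambda>t. exp (m * t) * e t) \<longlongrightarrow> 0) at_bot"
proof -
  have "((\<lambda>t. exp (2 * m * t) * (exp (- m * t) * e t)) \<longlongrightarrow> 0 * (B1 - B2)) at_bot"
    by (intro tendsto_mult tendsto_exp_at_bot e_lim) (use m in simp)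
  then show ?thesis unfolding exp_split by simp
qed

lemma wd_lim: "((\<lambda>t. exp (k * t) * d t) \<longlongrightarrow> 0) at_bot"
proof -
  have "((\<lambda>t. exp (2 * k * t) * (exp (- k * t) * d t)) \<longlongrightarrow> 0 * 0) at_bot"
    by (intro tendsto_mult tendsto_exp_at_bot d_lim) (use k in simp)
  then show ?thesis unfolding exp_split by simp
qed

text \<open>The lower bound for d is the exact response to the forcing D e^(m t): applying the
  operator D^2 - k^2 to e^(m t) multiplies it by (m - k)(m + k), and the homogeneous part is absent
  because Q tends to 0.\<close>

lemma d_pos_from_e:
  assumes D: "0 \<le> D" and e: "\<And>s. s \<le> t \<Longrightarrow> D * exp (m * s) \<le> e s" 
  shows "D / ((m - k) * (m + k)) * exp (m * t) \<le> d t"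
proof -
  have mk: "0 < m - k" "0 < m + k" using k km by auto
  have Q: "D / (m - k) * exp ((m - k) * s) \<le> Q s" if "s \<le> t" for s
  proof -
    have "0 \<le> Q s - D / (m - k) * exp ((m - k) * s)"
    proof (rule lower_bound_from_at_bot[where h="\<lambda>z. Q z - D / (m - k) * exp ((m - k) * z)"])
      fix z assume z: "z \<le> s"
      show "((\<lambda>z. Q z - D / (m - k) * exp ((m - k) * z)) has_real_derivative
          exp (- k * z) * e z - D * exp ((m - k) * z)) (at z)"
      proof (rule DERIV_diff[OF Q_DERIV])
        have "((\<lambda>z. D / (m - k) * exp ((m - k) * z)) has_real_derivative D / (m - k) * ((m - k) * exp ((m - k) * z))) (at z)"
          by (auto intro!: derivative_eq_intros)
        then show "((\<lambda>z. D / (m - k) * exp ((m - k) * z)) has_real_derivative D * exp ((m - k) * z)) (at z)"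
          by (rule DERIV_cong) (use mk in simp)
      qed
      have "exp (- k * z) * (D * exp (m * z)) \<le> exp (- k * z) * e z"
        using e z that by (intro mult_left_mono) auto
      moreover have "exp (- k * z) * exp (m * z) = exp ((m - k) * z)"
        by (simp add: exp_add[symmetric] algebra_simps)
      then have "exp (- k * z) * (D * exp (m * z)) = D * exp ((m - k) * z)"
        by (metis mult.left_commute)
      ultimately show "0 \<le> exp (- k * z) * e z - D * exp ((m - k) * z)" by linarith
    next
      have "((\<lambda>z. Q z - D / (m - k) * exp ((m - k) * z)) \<longlongrightarrow> 0 - D / (m - k) * 0) at_bot"
        by (intro tendsto_intros Q_lim tendsto_exp_at_bot mk)
      then show "((\<lambda>z. Q z - D / (m - k) * exp ((m - k) * z)) \<longlongrightarrow> 0) at_bot" by simp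
    qed
    then show ?thesis by simp
  qed
  let ?c = "D / ((m - k) * (m + k))"
  have "0 \<le> exp (k * t) * d t - ?c * exp ((m + k) * t)"
  proof (rule lower_bound_from_at_bot[where h="\<lambda>z. exp (k * z) * d z - ?c * exp ((m + k) * z)"])
    fix z assume z: "z \<le> t"
    show "((\<lambda>z. exp (k * z) * d z - ?c * exp ((m + k) * z)) has_real_derivative
        exp (2 * k * z) * Q z - D / (m - k) * exp ((m + k) * z)) (at z)"
    proof (rule DERIV_diff[OF wd_DERIV])
      have "((\<lambda>z. ?c * exp ((m + k) * z)) has_real_derivative ?c * ((m + k) * exp ((m + k) * z))) (at z)"
        by (rule DERIV_cmult) (auto intro!: derivative_eq_intros)
      then show "((\<lambda>z. ?c * exp ((m + k) * z)) has_real_derivative D / (m - k) * exp ((m + k) * z)) (at z)"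
      proof (rule DERIV_cong)
        have "D / (P * q) * (q * X) = D / P * X" if "q \<noteq> 0" for P q X :: real using that by simp
        from this[of "m + k" "m - k"] show "?c * ((m + k) * exp ((m + k) * z)) = D / (m - k) * exp ((m + k) * z)"
          using mk by simp
      qed
    qed
    have "exp (2 * k * z) * (D / (m - k) * exp ((m - k) * z)) \<le> exp (2 * k * z) * Q z"
      using Q z by (intro mult_left_mono) auto
    moreover have "exp (2 * k * z) * exp ((m - k) * z) = exp ((m + k) * z)"
      by (simp add: exp_add[symmetric] algebra_simps)
    then have "exp (2 * k * z) * (D / (m - k) * exp ((m - k) * z)) = D / (m - k) * exp ((m + k) * z)"
      by (metis mult.left_commute)
    ultimately show "0 \<le> exp (2 * k * z) * Q z - D / (m - k) * exp ((m + k) * z)" by linarith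
  next
    have "((\<lambda>z. exp (k * z) * d z - ?c * exp ((m + k) * z)) \<longlongrightarrow> 0 - ?c * 0) at_bot"
      by (intro tendsto_diff tendsto_mult tendsto_const wd_lim tendsto_exp_at_bot mk)
    then show "((\<lambda>z. exp (k * z) * d z - ?c * exp ((m + k) * z)) \<longlongrightarrow> 0) at_bot" by simp
  qed
  moreover have "exp ((m + k) * t) = exp (k * t) * exp (m * t)"
    by (simp add: exp_add[symmetric] algebra_simps)
  ultimately have "exp (k * t) * (?c * exp (m * t)) \<le> exp (k * t) * d t"
    by (simp only: mult.left_commute[of "exp (k * t)"] diff_ge_0_iff_ge)
  then show ?thesis by (rule mult_left_le_imp_le) simp
qed

text \<open>As long as d stays nonnegative, monotonicity of the nonlinearity makes g nonnegative, so
  P never falls below its limit 2 m (B1 - B2).\<close>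

lemma e_ge_from_d:
  assumes B: "B2 \<le> B1" and d: "\<And>s. s \<le> t \<Longrightarrow> 0 \<le> d s"
  shows "(B1 - B2) * exp (m * t) \<le> e t"
proof -
  let ?D = "B1 - B2"
  have P: "2 * m * ?D \<le> P s" if "s \<le> t" for s
  proof (rule lower_bound_from_at_bot[OF P_DERIV _ P_lim])
    show "0 \<le> exp (- m * z) * g z" if "z \<le> s" for z
      using d[of z] that \<open>s \<le> t\<close> nl_mono[OF r, of "Y z" "y z"] by (simp add: g_def d_def)
  qed
  have "0 \<le> exp (m * t) * e t - ?D * exp (2 * m * t)"
  proof (rule lower_bound_from_at_bot[where h="\<lambda>z. exp (m * z) * e z - ?D * exp (2 * m * z)"])
    fix z assume z: "z \<le> t"
    show "((\<lambda>z. exp (m * z) * e z - ?D * exp (2 * m * z)) has_real_derivative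
        exp (2 * m * z) * P z - ?D * (2 * m * exp (2 * m * z))) (at z)"
      by (intro DERIV_diff we_DERIV DERIV_cmult) (auto intro!: derivative_eq_intros)
    have "exp (2 * m * z) * (2 * m * ?D) \<le> exp (2 * m * z) * P z"
      using P[OF z] by (intro mult_left_mono) auto
    then show "0 \<le> exp (2 * m * z) * P z - ?D * (2 * m * exp (2 * m * z))" by (simp add: mult_ac)
  next
    have "((\<lambda>z. exp (m * z) * e z - ?D * exp (2 * m * z)) \<longlongrightarrow> 0 - ?D * 0) at_bot"
      by (intro tendsto_diff tendsto_mult tendsto_const we_lim tendsto_exp_at_bot) (use m in simp)
    then show "((\<lambda>z. exp (m * z) * e z - ?D * exp (2 * m * z)) \<longlongrightarrow> 0) at_bot" by simp
  qed
  moreover have "exp (2 * m * t) = exp (m * t) * exp (m * t)" by (simp add: exp_add[symmetric])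
  ultimately have "exp (m * t) * (?D * exp (m * t)) \<le> exp (m * t) * e t" by (simp add: mult_ac)
  then show ?thesis by simp
qed

text \<open>A first-exit argument. Up to the first point where d could turn negative the two
  preceding lemmas bound d below by a positive multiple of e^(m t), so this point cannot exist; then
  e grows exponentially, against the boundedness of w and W.\<close>

lemma B_le: "B1 \<le> B2"
proof (rule ccontr)
  assume "\<not> B1 \<le> B2"
  then have D: "0 < B1 - B2" by simp
  have mk: "0 < (m - k) * (m + k)" using k km by simp
  have "\<forall>\<^sub>F t in at_bot. 0 < exp (- m * t) * e t"
    using order_tendstoD(1)[OF e_lim D] .
  \<comment> \<open>Near minus infinity the sign of e is that of B1 - B2; this starts the
    continuation.\<close>
  then obtain T0 where T0: "\<And>s. s \<le> T0 \<Longrightarrow> 0 < e s"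
    by (auto simp: eventually_at_bot_linorder zero_less_mult_iff)
  have d0: "0 \<le> d t" if "t \<le> T0" for t
    using d_pos_from_e[of 0 t] T0 that by (simp add: less_imp_le)
  have dall: "0 \<le> d t" for t
  proof (rule ccontr)
    assume "\<not> 0 \<le> d t"
    then have ne: "{s. d s < 0} \<noteq> {}" using not_le by blast
    have bb: "bdd_below {s. d s < 0}"
      by (rule bdd_belowI[of _ T0]) (metis d0 mem_Collect_eq not_le le_cases)
    define T where "T = Inf {s. d s < 0}"
    have below: "0 \<le> d s" if "s < T" for s
      using that cInf_lower[OF _ bb, of s] by (force simp: T_def not_le[symmetric])
    have cd: "isCont d s" for s using d_DERIV DERIV_isCont by blast
    have "0 \<le> d T"
    proof (rule ccontr)
      assume "\<not> 0 \<le> d T"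
      then have "\<forall>\<^sub>F s in at T. d s < 0"
        using cd[of T] by (auto simp: isCont_def intro: order_tendstoD)
      then have "\<forall>\<^sub>F s in at_left T. d s < 0" by (rule filter_leD[OF at_le, rotated]) simp
      then have "\<exists>s<T. d s < 0"
        by (metis (mono_tags, lifting) eventually_at_left_field lt_ex dense)
      then show False using below by force
    qed
    with below have dT: "0 \<le> d s" if "s \<le> T" for s
      using that by (cases "s = T") auto
    have "(B1 - B2) / ((m - k) * (m + k)) * exp (m * T) \<le> d T"
      by (rule d_pos_from_e) (use D e_ge_from_d dT in \<open>auto intro: order.trans\<close>)
    moreover have "0 < (B1 - B2) / ((m - k) * (m + k)) * exp (m * T)" using D mk by simp
    ultimately have "0 < d T" by linarith
    then have "\<forall>\<^sub>F s in at T. 0 < d s"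
      using cd[of T] by (auto simp: isCont_def intro: order_tendstoD)
    then obtain \<delta> where \<delta>: "0 < \<delta>" "\<And>s. s \<noteq> T \<Longrightarrow> dist s T < \<delta> \<Longrightarrow> 0 < d s"
      unfolding eventually_at by auto
    have "T + \<delta> \<le> T" unfolding T_def
    proof (rule cInf_greatest[OF ne])
      fix s assume s: "s \<in> {s. d s < 0}"
      show "Inf {s. d s < 0} + \<delta> \<le> s"
      proof (rule ccontr)
        assume "\<not> Inf {s. d s < 0} + \<delta> \<le> s"
        moreover have "T \<le> s" using s cInf_lower[OF _ bb] by (simp add: T_def)
        ultimately have "dist s T < \<delta>" by (simp add: T_def dist_real_def)
        then show False using \<delta>(2)[of s] s \<open>0 < d T\<close> by (cases "s = T") auto
      qed
    qed
    then show False using \<delta>(1) by simp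
  qed
  obtain M1 M2 where M: "\<And>t. \<bar>w t\<bar> \<le> M1" "\<And>t. \<bar>W t\<bar> \<le> M2"
    using o1 o2 unfolding orbit_def by blast
  have "(B1 - B2) * exp (m * t) \<le> M1 + M2" for t
    using e_ge_from_d[of t] D dall M[of t] by (simp add: e_def)
  \<comment> \<open>At this time the exponent is x = (M1 + M2 + 1) / (B1 - B2), and e^x \<ge> 1 + x
    already exceeds the bound.\<close>
  from this[of "(M1 + M2 + 1) / (B1 - B2) / m"]
  have "(B1 - B2) * exp ((M1 + M2 + 1) / (B1 - B2)) \<le> M1 + M2" using m by simp
  moreover have "(B1 - B2) * ((M1 + M2 + 1) / (B1 - B2)) \<le> (B1 - B2) * exp ((M1 + M2 + 1) / (B1 - B2))"
    using D exp_ge_add_one_self[of "(M1 + M2 + 1) / (B1 - B2)"] by (intro mult_left_mono) linarith+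
  ultimately show False using D by simp
qed

text \<open>With equal coordinates the difference is \<open>O(S e\<^sup>k\<^sup>t)\<close> with \<open>S\<close> halved at each pass through the four
  first-order steps, hence vanishes near \<open>-\<infinity>\<close>; a Gronwall estimate does the rest.\<close>

lemma contraction:
  assumes B: "B1 = B2" and rk: "r * k = 2 * (m - k)" and S: "0 \<le> S" and C: "0 \<le> C"
    and g: "\<And>s. s \<le> t \<Longrightarrow> \<bar>g s\<bar> \<le> C * exp (r * k * s) * \<bar>d s\<bar>"
    and dS: "\<And>s. s \<le> t \<Longrightarrow> \<bar>d s\<bar> \<le> S * exp (k * s)"
  shows "\<bar>d t\<bar> \<le> C * S / (m - k) / (3 * m - k) / (2 * (m - k)) / (2 * m) * exp (2 * (m - k) * t) * exp (k * t)"
proof -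
  have mk: "0 < m - k" "0 < 3 * m - k" "0 < 2 * m" using k km by auto
  have P: "\<bar>P s\<bar> \<le> C * S / (m - k) * exp ((m - k) * s)" if s: "s \<le> t" for s
  proof (rule abs_bound_from_at_bot[OF P_DERIV _ mk(1)])
    show "(P \<longlongrightarrow> 0) at_bot" using P_lim B by simp
    fix z assume z: "z \<le> s"
    have "\<bar>g z\<bar> \<le> C * exp (r * k * z) * (S * exp (k * z))"
      using g[of z] mult_left_mono[OF dS[of z], of "C * exp (r * k * z)"] z s C by fastforce
    then have "exp (- m * z) * \<bar>g z\<bar> \<le> exp (- m * z) * (C * exp (r * k * z) * (S * exp (k * z)))"
      by (rule mult_left_mono) simp
    also have "\<dots> = C * S * (exp (- m * z) * exp (r * k * z) * exp (k * z))" by simp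
    \<comment> \<open>Here \<open>rk\<close> enters: the exponent -m + r k + k equals m - k, which
      is positive, so integration from minus infinity is possible.\<close>
    also have "exp (- m * z) * exp (r * k * z) * exp (k * z) = exp ((m - k) * z)"
      unfolding rk by (simp add: exp_add[symmetric] algebra_simps)
    finally show "\<bar>exp (- m * z) * g z\<bar> \<le> C * S * exp ((m - k) * z)" by (simp add: abs_mult)
  qed
  have e: "\<bar>e s\<bar> \<le> C * S / (m - k) / (3 * m - k) * exp ((2 * m - k) * s)" if s: "s \<le> t" for s
  proof -
    have "\<bar>exp (m * s) * e s\<bar> \<le> C * S / (m - k) / (3 * m - k) * exp ((3 * m - k) * s)"
    proof (rule abs_bound_from_at_bot[OF we_DERIV _ mk(2) we_lim])
      fix z assume z: "z \<le> s"
      have "exp (2 * m * z) * \<bar>P z\<bar> \<le> exp (2 * m * z) * (C * S / (m - k) * exp ((m - k) * z))"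
        using P z s by (intro mult_left_mono) auto
      also have "\<dots> = C * S / (m - k) * (exp (2 * m * z) * exp ((m - k) * z))" by simp
      also have "exp (2 * m * z) * exp ((m - k) * z) = exp ((3 * m - k) * z)"
        by (simp add: exp_add[symmetric] algebra_simps)
      finally show "\<bar>exp (2 * m * z) * P z\<bar> \<le> C * S / (m - k) * exp ((3 * m - k) * z)"
        by (simp add: abs_mult)
    qed
    also have "exp ((3 * m - k) * s) = exp (m * s) * exp ((2 * m - k) * s)"
      by (simp add: exp_add[symmetric] algebra_simps)
    finally have "exp (m * s) * \<bar>e s\<bar> \<le> exp (m * s) * (C * S / (m - k) / (3 * m - k) * exp ((2 * m - k) * s))"
      by (simp add: abs_mult mult_ac)
    then show ?thesis by (rule mult_left_le_imp_le) simp
  qed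
  have Q: "\<bar>Q s\<bar> \<le> C * S / (m - k) / (3 * m - k) / (2 * (m - k)) * exp (2 * (m - k) * s)" if s: "s \<le> t" for s
  proof (rule abs_bound_from_at_bot[OF Q_DERIV _ _ Q_lim])
    fix z assume z: "z \<le> s"
    have "exp (- k * z) * \<bar>e z\<bar> \<le> exp (- k * z) * (C * S / (m - k) / (3 * m - k) * exp ((2 * m - k) * z))"
      using e z s by (intro mult_left_mono) auto
    also have "\<dots> = C * S / (m - k) / (3 * m - k) * (exp (- k * z) * exp ((2 * m - k) * z))" by simp
    also have "exp (- k * z) * exp ((2 * m - k) * z) = exp (2 * (m - k) * z)"
      by (simp add: exp_add[symmetric] algebra_simps)
    finally show "\<bar>exp (- k * z) * e z\<bar> \<le> C * S / (m - k) / (3 * m - k) * exp (2 * (m - k) * z)"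
      by (simp add: abs_mult)
  qed (use mk in simp)
  let ?K = "C * S / (m - k) / (3 * m - k) / (2 * (m - k))"
  have "\<bar>exp (k * t) * d t\<bar> \<le> ?K / (2 * m) * exp (2 * m * t)"
  proof (rule abs_bound_from_at_bot[OF wd_DERIV _ mk(3) wd_lim])
    fix z assume z: "z \<le> t"
    have "exp (2 * k * z) * \<bar>Q z\<bar> \<le> exp (2 * k * z) * (?K * exp (2 * (m - k) * z))"
      using Q z by (intro mult_left_mono) auto
    also have "\<dots> = ?K * (exp (2 * k * z) * exp (2 * (m - k) * z))" by simp
    also have "exp (2 * k * z) * exp (2 * (m - k) * z) = exp (2 * m * z)"
      by (simp add: exp_add[symmetric] algebra_simps)
    finally show "\<bar>exp (2 * k * z) * Q z\<bar> \<le> ?K * exp (2 * m * z)" by (simp add: abs_mult)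
  qed
  also have "exp (2 * m * t) = exp (k * t) * (exp (2 * (m - k) * t) * exp (k * t))"
    by (simp add: exp_add[symmetric] algebra_simps)
  finally have "exp (k * t) * \<bar>d t\<bar> \<le> exp (k * t) * (?K / (2 * m) * exp (2 * (m - k) * t) * exp (k * t))"
    by (simp add: abs_mult mult_ac)
  then have "\<bar>d t\<bar> \<le> ?K / (2 * m) * exp (2 * (m - k) * t) * exp (k * t)"
    by (rule mult_left_le_imp_le) simp
  then show ?thesis .
qed

lemma weighted_bound_near_at_bot:
  fixes f :: "real \<Rightarrow> real"
  assumes "((\<lambda>t. exp (- k * t) * f t) \<longlongrightarrow> A) at_bot"
  obtains T where "\<And>t. t \<le> T \<Longrightarrow> \<bar>f t\<bar> \<le> (\<bar>A\<bar> + 1) * exp (k * t)"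
proof -
  have "\<forall>\<^sub>F t in at_bot. dist (exp (- k * t) * f t) A < 1" using assms by (rule tendstoD) simp
  then obtain T where T: "\<And>t. t \<le> T \<Longrightarrow> dist (exp (- k * t) * f t) A < 1"
    by (auto simp: eventually_at_bot_linorder)
  show ?thesis
  proof (rule that)
    fix t assume "t \<le> T"
    then have "\<bar>exp (- k * t) * f t\<bar> \<le> \<bar>A\<bar> + 1" using T[of t] by (simp add: dist_real_def)
    then have "exp (k * t) * (exp (- k * t) * \<bar>f t\<bar>) \<le> exp (k * t) * (\<bar>A\<bar> + 1)"
      by (intro mult_left_mono) (auto simp: abs_mult)
    moreover have "exp (k * t) * (exp (- k * t) * \<bar>f t\<bar>) = \<bar>f t\<bar>"
      by (simp add: mult.assoc[symmetric] exp_add[symmetric])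
    ultimately have "\<bar>f t\<bar> \<le> exp (k * t) * (\<bar>A\<bar> + 1)" by linarith
    then show "\<bar>f t\<bar> \<le> (\<bar>A\<bar> + 1) * exp (k * t)" by (simp only: mult.commute)
  qed
qed

lemma eq_near_at_bot:
  assumes B: "B1 = B2" and rk: "r * k = 2 * (m - k)"
  obtains T where "\<And>t. t \<le> T \<Longrightarrow> d t = 0"
proof -
  obtain T1 where T1: "\<And>t. t \<le> T1 \<Longrightarrow> \<bar>y t\<bar> \<le> (\<bar>A\<bar> + 1) * exp (k * t)"
    using weighted_bound_near_at_bot[of y] o1 by (auto simp: orbit_def)
  obtain T2 where T2: "\<And>t. t \<le> T2 \<Longrightarrow> \<bar>Y t\<bar> \<le> (\<bar>A\<bar> + 1) * exp (k * t)"
    using weighted_bound_near_at_bot[of Y] o2 by (auto simp: orbit_def)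
  define C where "C = (r + 1) * (\<bar>A\<bar> + 1) powr r"
  have C: "0 \<le> C" using r by (simp add: C_def)
  have g: "\<bar>g s\<bar> \<le> C * exp (r * k * s) * \<bar>d s\<bar>" if "s \<le> min T1 T2" for s
  proof -
    have "\<bar>g s\<bar> \<le> (r + 1) * ((\<bar>A\<bar> + 1) * exp (k * s)) powr r * \<bar>y s - Y s\<bar>"
      unfolding g_def using T1[of s] T2[of s] that by (intro nl_lipschitz[OF r]) auto
    also have "((\<bar>A\<bar> + 1) * exp (k * s)) powr r = (\<bar>A\<bar> + 1) powr r * exp (r * k * s)"
      by (simp add: powr_mult powr_def[of "exp _"] mult_ac)
    finally show ?thesis by (simp add: C_def d_def mult_ac)
  qed
  define K where "K = C / (m - k) / (3 * m - k) / (2 * (m - k)) / (2 * m)"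
  have "\<forall>\<^sub>F t in at_bot. K * exp (2 * (m - k) * t) < 1/2"
  proof -
    have "((\<lambda>t. K * exp (2 * (m - k) * t)) \<longlongrightarrow> K * 0) at_bot"
      by (intro tendsto_intros tendsto_exp_at_bot) (use km in simp)
    from order_tendstoD(2)[OF this, of "1/2"] show ?thesis by simp
  qed
  \<comment> \<open>Far enough to the left the factor e^(2 (m - k) t) brings the contraction
    constant below 1/2.\<close>
  then obtain T3 where T3: "\<And>t. t \<le> T3 \<Longrightarrow> K * exp (2 * (m - k) * t) < 1/2"
    by (auto simp: eventually_at_bot_linorder)
  define T where "T = min T3 (min T1 T2)"
  have it: "\<forall>t\<le>T. \<bar>d t\<bar> \<le> (2 * (\<bar>A\<bar> + 1)) * (1/2) ^ n * exp (k * t)" for n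
  proof (induction n)
    case 0
    show ?case
    proof (intro allI impI)
      fix t assume "t \<le> T"
      then have "\<bar>y t\<bar> + \<bar>Y t\<bar> \<le> (\<bar>A\<bar> + 1) * exp (k * t) + (\<bar>A\<bar> + 1) * exp (k * t)"
        using T1[of t] T2[of t] by (intro add_mono) (auto simp: T_def)
      then show "\<bar>d t\<bar> \<le> 2 * (\<bar>A\<bar> + 1) * (1/2) ^ 0 * exp (k * t)"
        unfolding d_def by (simp add: algebra_simps)
    qed
  next
    case (Suc n)
    let ?S = "2 * (\<bar>A\<bar> + 1) * (1/2) ^ n"
    show ?case
    proof (intro allI impI)
      fix t assume t: "t \<le> T"
      have "\<bar>d t\<bar> \<le> C * ?S / (m - k) / (3 * m - k) / (2 * (m - k)) / (2 * m) * exp (2 * (m - k) * t) * exp (k * t)"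
        by (rule contraction[OF B rk _ C]) (use g Suc t in \<open>auto simp: T_def\<close>)
      also have "\<dots> = ?S * (K * exp (2 * (m - k) * t)) * exp (k * t)" by (simp add: K_def)
      also have "\<dots> \<le> ?S * (1/2) * exp (k * t)"
        using T3[of t] t by (intro mult_right_mono mult_left_mono) (auto simp: T_def)
      finally show "\<bar>d t\<bar> \<le> 2 * (\<bar>A\<bar> + 1) * (1/2) ^ Suc n * exp (k * t)" by simp
    qed
  qed
  have "d t = 0" if "t \<le> T" for t
  proof -
    have "(\<lambda>n. 2 * (\<bar>A\<bar> + 1) * (1/2) ^ n * exp (k * t)) \<longlonglongrightarrow> 2 * (\<bar>A\<bar> + 1) * 0 * exp (k * t)"
      by (intro tendsto_intros LIMSEQ_realpow_zero) auto
    moreover have "\<exists>N. \<forall>n\<ge>N. \<bar>d t\<bar> \<le> 2 * (\<bar>A\<bar> + 1) * (1/2) ^ n * exp (k * t)" using it that by blast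
    ultimately have "\<bar>d t\<bar> \<le> 2 * (\<bar>A\<bar> + 1) * 0 * exp (k * t)" by (rule LIMSEQ_le_const)
    then show ?thesis by simp
  qed
  then show ?thesis by (rule that)
qed

lemma DERIV_0_of_locally_0:
  fixes f :: "real \<Rightarrow> real"
  assumes "(f has_real_derivative f') (at t)" "t < T" "\<And>s. s < T \<Longrightarrow> f s = 0"
  shows "f' = 0"
proof -
  have ev: "\<forall>\<^sub>F s in nhds t. f s = 0"
    by (rule eventually_mono[OF eventually_nhds_in_open[of "{..<T}"]]) (use assms in auto)
  have "(f has_real_derivative 0) (at t)" using DERIV_cong_ev[OF refl ev refl] by simp
  then show ?thesis using assms(1) DERIV_unique by blast
qed

lemma eq_everywhere:
  assumes B: "B1 = B2" and rk: "r * k = 2 * (m - k)"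
  shows "y t = Y t"
proof -
  obtain T where T: "\<And>t. t \<le> T \<Longrightarrow> d t = 0" using eq_near_at_bot[OF B rk] by blast
  have d1: "y1 s - Y1 s = 0" if "s < T" for s
    by (rule DERIV_0_of_locally_0[OF d_DERIV that]) (use T in auto)
  have e0: "e s = 0" if "s < T" for s
    using DERIV_0_of_locally_0[OF d1_DERIV that d1] T[of s] that by simp
  have e1: "w1 s - W1 s = 0" if "s < T" for s
    by (rule DERIV_0_of_locally_0[OF e_DERIV that e0])
  obtain M1 M2 where M12: "\<And>t. \<bar>y t\<bar> \<le> M1" "\<And>t. \<bar>Y t\<bar> \<le> M2"
    using o1 o2 unfolding orbit_def by blast
  define L where "L = (r + 1) * max M1 M2 powr r"
  have L0: "0 \<le> L" using r by (simp add: L_def)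
  have gL: "\<bar>g s\<bar> \<le> L * \<bar>d s\<bar>" for s
    unfolding g_def L_def d_def using M12[of s] by (intro nl_lipschitz[OF r]) auto
  \<comment> \<open>The Gronwall constant: the three cross terms with coefficient 1 give 3, the
    linear terms give k^2 and m^2, and the Lipschitz constant of the nonlinearity on the common
    range gives L.\<close>
  define K where "K = 3 + k\<^sup>2 + m\<^sup>2 + L"
  define E where "E t = (d t)\<^sup>2 + (y1 t - Y1 t)\<^sup>2 + (e t)\<^sup>2 + (w1 t - W1 t)\<^sup>2" for t
  define E' where "E' t = 2 * (d t * (y1 t - Y1 t)) + 2 * ((y1 t - Y1 t) * (k\<^sup>2 * d t + e t))
      + 2 * (e t * (w1 t - W1 t)) + 2 * ((w1 t - W1 t) * (m\<^sup>2 * e t + g t))" for t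
  have E: "(E has_real_derivative E' t) (at t)" for t
    unfolding E_def[abs_def] E'_def
    by (rule DERIV_cong[OF DERIV_add[OF DERIV_add[OF DERIV_add[OF DERIV_power[OF d_DERIV] DERIV_power[OF d1_DERIV]]
          DERIV_power[OF e_DERIV]] DERIV_power[OF e1_DERIV]]]) simp
  have am: "2 * (a * b) \<le> a\<^sup>2 + b\<^sup>2" for a b :: real using sum_squares_bound[of a b] by simp
  have E'K: "E' t \<le> K * E t" for t
  proof -
    let ?a = "d t" and ?b = "y1 t - Y1 t" and ?c = "e t" and ?f = "w1 t - W1 t"
    have E0: "?a\<^sup>2 + ?b\<^sup>2 \<le> E t" "?b\<^sup>2 + ?c\<^sup>2 \<le> E t" "?c\<^sup>2 + ?f\<^sup>2 \<le> E t" "?a\<^sup>2 + ?f\<^sup>2 \<le> E t"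
      by (simp_all add: E_def)
    have 1: "2 * (?a * ?b) \<le> E t" using am[of ?a ?b] E0 by linarith
    have 2: "2 * (?b * ?c) \<le> E t" using am[of ?b ?c] E0 by linarith
    have 3: "2 * (?c * ?f) \<le> E t" using am[of ?c ?f] E0 by linarith
    have 4: "2 * (?f * g t) \<le> L * E t"
    proof -
      have "?f * g t \<le> \<bar>?f\<bar> * \<bar>g t\<bar>" by (metis abs_ge_self abs_mult)
      also have "\<dots> \<le> \<bar>?f\<bar> * (L * \<bar>?a\<bar>)" by (intro mult_left_mono gL) auto
      finally have "2 * (?f * g t) \<le> L * (2 * (\<bar>?a\<bar> * \<bar>?f\<bar>))" by (simp add: mult_ac)
      also have "\<dots> \<le> L * E t"
        using am[of "\<bar>?a\<bar>" "\<bar>?f\<bar>"] E0 L0 by (intro mult_left_mono) auto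
      finally show ?thesis .
    qed
    have 5: "k\<^sup>2 * (2 * (?a * ?b)) \<le> k\<^sup>2 * E t" by (intro mult_left_mono 1) simp
    have 6: "m\<^sup>2 * (2 * (?c * ?f)) \<le> m\<^sup>2 * E t" by (intro mult_left_mono 3) simp
    have "E' t = 2 * (?a * ?b) + k\<^sup>2 * (2 * (?a * ?b)) + 2 * (?b * ?c) + 2 * (?c * ?f) + m\<^sup>2 * (2 * (?c * ?f)) + 2 * (?f * g t)"
      by (simp add: E'_def algebra_simps)
    also have "\<dots> \<le> E t + k\<^sup>2 * E t + E t + E t + m\<^sup>2 * E t + L * E t"
      using 1 2 3 4 5 6 by linarith
    also have "\<dots> = K * E t" by (simp add: K_def algebra_simps)
    finally show ?thesis .
  qed
  have "d t = 0"
  proof (cases "t \<le> T")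
    case False
    \<comment> \<open>The comparison starts at T - 1 rather than T, because the derivatives are
      known to vanish only strictly to the left of T.\<close>
    have "exp (- K * t) * E t \<le> exp (- K * (T - 1)) * E (T - 1)"
    proof (rule DERIV_nonpos_imp_nonincreasing[of "T - 1" t])
      fix x
      show "\<exists>y. ((\<lambda>t. exp (- K * t) * E t) has_real_derivative y) (at x) \<and> y \<le> 0"
        using weighted_DERIV[OF E, of "- K" x] E'K[of x] by (intro exI conjI) (auto simp: mult_le_0_iff)
    qed (use False in simp)
    moreover have "E (T - 1) = 0" using T[of "T - 1"] d1[of "T - 1"] e0[of "T - 1"] e1[of "T - 1"] by (simp add: E_def)
    ultimately have "E t \<le> 0" by (simp add: mult_le_0_iff)
    moreover have "(d t)\<^sup>2 \<le> E t" by (simp add: E_def)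
    ultimately have "(d t)\<^sup>2 \<le> 0" by (rule order.trans[rotated])
    then show ?thesis by simp
  qed (rule T)
  then show ?thesis by (simp add: d_def)
qed

end

text \<open>Exchanging the roles of the two orbits excludes both strict orderings of the second
  coordinates, which reduces the claim to equal data at minus infinity.\<close>

theorem orbit_unique:
  assumes "0 < k" "k < m" "r * k = 2 * (m - k)"
    and o1: "orbit k m r y y1 w w1 A B1" and o2: "orbit k m r Y Y1 W W1 A B2"
  shows "y t = Y t"
proof -
  have r: "0 < r" using assms(1-3) by (metis diff_gt_0_iff_gt mult_pos_pos zero_less_mult_pos2 zero_less_numeral)
  interpret a: orbit_pair k m r y y1 w w1 Y Y1 W W1 A B1 B2 by unfold_locales (use assms r in auto)
  interpret b: orbit_pair k m r Y Y1 W W1 y y1 w w1 A B2 B1 by unfold_locales (use assms r in auto)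
  show ?thesis using a.eq_everywhere a.B_le b.B_le assms(3) by simp
qed

section \<open>From the integral equation to an orbit\<close>

text \<open>Exponentials of rate \<kappa> < c are eigenfunctions of the Green operator with
  eigenvalue 1 / (c^2 - \<kappa>^2), so weighted bounds pass through it with an explicit
  constant.\<close>

lemma exp_convolution:
  fixes c \<kappa> t :: real
  assumes "0 \<le> \<kappa>" "\<kappa> < c"
  shows "integrable lborel (\<lambda>s. exp (- c * \<bar>t - s\<bar>) * exp (\<kappa> * s))"
    and "(LINT s|lborel. exp (- c * \<bar>t - s\<bar>) * exp (\<kappa> * s)) = 2 * c * (exp (\<kappa> * t) / (c\<^sup>2 - \<kappa>\<^sup>2))"
proof -
  have c: "0 < c + \<kappa>" "0 < c - \<kappa>" using assms by auto
  let ?m = "\<lambda>s. indicator {..t} s * exp ((c + \<kappa>) * s)"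
    and ?p = "\<lambda>s. indicator {..- t} s * exp ((c - \<kappa>) * s)"
  note im = exp_half_line[OF c(1), of t] and ip = exp_half_line[OF c(2), of "- t"]
  have ip': "integrable lborel (\<lambda>s. ?p (- s))"
    using lborel_integrable_real_affine[OF ip(1), of "-1" 0] by simp
  have vp: "(LINT s|lborel. ?p (- s)) = exp ((c - \<kappa>) * - t) / (c - \<kappa>)"
    using lborel_integral_real_affine[of "-1" ?p 0] ip(2) by simp
  let ?g = "\<lambda>s. exp (- c * t) * ?m s + exp (c * t) * ?p (- s)"
  have ae: "AE s in lborel. exp (- c * \<bar>t - s\<bar>) * exp (\<kappa> * s) = ?g s"
  proof -
    have "AE s in lborel. s \<noteq> t" by (rule AE_lborel_singleton)
    then show ?thesis
    proof eventually_elim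
      case (elim s)
      have "exp (- c * t) * exp ((c + \<kappa>) * s) = exp (- c * (t - s)) * exp (\<kappa> * s)"
         "exp (c * t) * exp ((c - \<kappa>) * - s) = exp (- c * (s - t)) * exp (\<kappa> * s)"
        by (simp_all add: exp_add[symmetric] algebra_simps)
      then show ?case using elim by (cases "s < t") (simp_all add: indicator_def)
    qed
  qed
  show "integrable lborel (\<lambda>s. exp (- c * \<bar>t - s\<bar>) * exp (\<kappa> * s))"
    using im(1) ip' by (subst integrable_cong_AE[OF _ _ ae]) auto
  have "(LINT s|lborel. exp (- c * \<bar>t - s\<bar>) * exp (\<kappa> * s)) = (LINT s|lborel. ?g s)"
    by (rule integral_cong_AE[OF _ _ ae]) auto
  also have "\<dots> = exp (- c * t) * (exp ((c + \<kappa>) * t) / (c + \<kappa>)) + exp (c * t) * (exp ((c - \<kappa>) * - t) / (c - \<kappa>))"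
    using im ip' vp by simp
  also have "exp (- c * t) * (exp ((c + \<kappa>) * t) / (c + \<kappa>)) = exp (\<kappa> * t) / (c + \<kappa>)"
    by (simp add: exp_add[symmetric] algebra_simps)
  also have "exp (c * t) * (exp ((c - \<kappa>) * - t) / (c - \<kappa>)) = exp (\<kappa> * t) / (c - \<kappa>)"
    by (simp add: exp_add[symmetric] algebra_simps)
  also have "exp (\<kappa> * t) / (c + \<kappa>) + exp (\<kappa> * t) / (c - \<kappa>) = 2 * c * (exp (\<kappa> * t) / (c\<^sup>2 - \<kappa>\<^sup>2))"
  proof -
    have "c\<^sup>2 - \<kappa>\<^sup>2 = (c + \<kappa>) * (c - \<kappa>)" by (simp add: power2_eq_square algebra_simps)
    then show ?thesis using c by (simp add: divide_simps) (simp add: algebra_simps)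
  qed
  finally show "(LINT s|lborel. exp (- c * \<bar>t - s\<bar>) * exp (\<kappa> * s)) = 2 * c * (exp (\<kappa> * t) / (c\<^sup>2 - \<kappa>\<^sup>2))" .
qed

lemma green_exp_bound:
  assumes Fm: "F \<in> borel_measurable borel" and bd: "\<And>s. \<bar>F s\<bar> \<le> M"
    and F: "\<And>s. \<bar>F s\<bar> \<le> a + B * exp (\<kappa> * s)" and \<kappa>: "0 \<le> \<kappa>" "\<kappa> < c"
  shows "\<bar>green c F t\<bar> \<le> a / c\<^sup>2 + B * (exp (\<kappa> * t) / (c\<^sup>2 - \<kappa>\<^sup>2))"
proof -
  have c: "0 < c" using \<kappa> by simp
  note G = green_as_convolution[OF Fm bd c, of t]
  have c0: "(0::real) \<le> 0" by simp
  note E0 = exp_convolution[OF c0 c, of t] and E1 = exp_convolution[OF \<kappa>, of t]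
  have "\<bar>2 * c * green c F t\<bar> \<le> (LINT s|lborel. \<bar>exp (- c * \<bar>t - s\<bar>) * F s\<bar>)"
    unfolding G(2)[symmetric] by (rule integral_abs_bound)
  also have "\<dots> \<le> (LINT s|lborel. a * (exp (- c * \<bar>t - s\<bar>) * exp (0 * s)) + B * (exp (- c * \<bar>t - s\<bar>) * exp (\<kappa> * s)))"
  proof (rule integral_mono)
    show "integrable lborel (\<lambda>s. \<bar>exp (- c * \<bar>t - s\<bar>) * F s\<bar>)" using G(1) by simp
    show "integrable lborel (\<lambda>s. a * (exp (- c * \<bar>t - s\<bar>) * exp (0 * s)) + B * (exp (- c * \<bar>t - s\<bar>) * exp (\<kappa> * s)))"
      by (intro Bochner_Integration.integrable_add integrable_mult_right E0(1) E1(1))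
    show "\<bar>exp (- c * \<bar>t - s\<bar>) * F s\<bar> \<le> a * (exp (- c * \<bar>t - s\<bar>) * exp (0 * s)) + B * (exp (- c * \<bar>t - s\<bar>) * exp (\<kappa> * s))" for s
      using mult_left_mono[OF F[of s] exp_ge_zero[of "- c * \<bar>t - s\<bar>"]] by (simp add: abs_mult algebra_simps)
  qed
  also have "\<dots> = a * (2 * c * (exp (0 * t) / (c\<^sup>2 - 0\<^sup>2))) + B * (2 * c * (exp (\<kappa> * t) / (c\<^sup>2 - \<kappa>\<^sup>2)))"
    by (subst Bochner_Integration.integral_add)
      (use E0 E1 in \<open>auto simp del: mult_zero_left\<close>)
  also have "\<dots> = 2 * c * (a / c\<^sup>2 + B * (exp (\<kappa> * t) / (c\<^sup>2 - \<kappa>\<^sup>2)))" by (simp add: algebra_simps)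
  finally have "2 * c * \<bar>green c F t\<bar> \<le> 2 * c * (a / c\<^sup>2 + B * (exp (\<kappa> * t) / (c\<^sup>2 - \<kappa>\<^sup>2)))"
    using c by (simp add: abs_mult)
  then show ?thesis using c by simp
qed

text \<open>A decaying solution of the integral equation decays exponentially with every rate \<open>\<kappa> < k\<close>:
  the part of the nonlinearity near \<open>-\<infinity>\<close> acts as a small linear perturbation.\<close>

lemma integral_equation_decay:
  assumes k: "0 < k" and km: "k < m" and r: "0 < r" and \<kappa>: "0 \<le> \<kappa>" "\<kappa> < k"
    and ym: "y \<in> borel_measurable borel" and yM: "\<And>t. \<bar>y t\<bar> \<le> M" and ylim: "(y \<longlongrightarrow> 0) at_bot"
    and eq: "\<And>t. y t = (green k (\<lambda>s. nl r (y s)) t - green m (\<lambda>s. nl r (y s)) t) / (m\<^sup>2 - k\<^sup>2)"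
  obtains C where "\<And>t. \<bar>y t\<bar> \<le> C * exp (\<kappa> * t)"
proof -
  let ?F = "\<lambda>s. nl r (y s)"
  have M0: "0 \<le> M" using yM[of 0] by linarith
  have Fm: "?F \<in> borel_measurable borel" using ym by measurable
  define MF where "MF = M powr r * M"
  have F: "\<bar>?F s\<bar> \<le> MF" for s
    unfolding abs_nl MF_def using yM[of s] r by (intro mult_mono powr_mono2) auto
  have MF0: "0 \<le> MF" using F[of 0] by linarith
  have mk: "0 < m\<^sup>2 - k\<^sup>2" using k km by (simp add: power_strict_mono)
  \<comment> \<open>\<open>ca\<close> and \<open>cb\<close> bound the gain of the combined Green
    operator on constants and on e^(\<kappa> t).\<close>
  define ca where "ca = (1 / k\<^sup>2 + 1 / m\<^sup>2) / (m\<^sup>2 - k\<^sup>2)"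
  define cb where "cb = (1 / (k\<^sup>2 - \<kappa>\<^sup>2) + 1 / (m\<^sup>2 - \<kappa>\<^sup>2)) / (m\<^sup>2 - k\<^sup>2)"
  have kk: "0 < k\<^sup>2 - \<kappa>\<^sup>2" "0 < m\<^sup>2 - \<kappa>\<^sup>2" using k km \<kappa> by (simp_all add: power_strict_mono)
  have ca: "0 < ca" using k km mk by (simp add: ca_def add_pos_pos)
  have cb: "0 < cb" using kk mk by (simp add: cb_def add_pos_pos)
  have step: "\<bar>y t\<bar> \<le> ca * a + cb * B * exp (\<kappa> * t)"
    if F': "\<And>s. \<bar>?F s\<bar> \<le> a + B * exp (\<kappa> * s)" for a B t
  proof -
    have "\<bar>green k ?F t - green m ?F t\<bar> \<le> (a / k\<^sup>2 + B * (exp (\<kappa> * t) / (k\<^sup>2 - \<kappa>\<^sup>2))) + (a / m\<^sup>2 + B * (exp (\<kappa> * t) / (m\<^sup>2 - \<kappa>\<^sup>2)))"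
      using green_exp_bound[OF Fm F F' \<kappa>, of t] green_exp_bound[OF Fm F F' \<kappa>(1), of m t] \<kappa> km by linarith
    then have "\<bar>y t\<bar> \<le> ((a / k\<^sup>2 + B * (exp (\<kappa> * t) / (k\<^sup>2 - \<kappa>\<^sup>2))) + (a / m\<^sup>2 + B * (exp (\<kappa> * t) / (m\<^sup>2 - \<kappa>\<^sup>2)))) / (m\<^sup>2 - k\<^sup>2)"
      using mk eq[of t] by (simp add: abs_divide divide_right_mono)
    also have "\<dots> = ca * a + cb * B * exp (\<kappa> * t)"
      unfolding ca_def cb_def by (simp add: add_divide_distrib distrib_right distrib_left mult_ac)
    finally show ?thesis .
  qed
  define \<epsilon> where "\<epsilon> = min (1 / (2 * ca)) (1 / (2 * cb))"
  have \<epsilon>: "0 < \<epsilon>" "ca * \<epsilon> \<le> 1/2" "cb * \<epsilon> \<le> 1/2"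
    using ca cb by (auto simp: \<epsilon>_def min_def divide_simps mult.commute)
  have "((\<lambda>t. \<bar>y t\<bar> powr r) \<longlongrightarrow> 0) at_bot"
    using tendsto_powr'[of "\<lambda>t. \<bar>y t\<bar>" 0 at_bot "\<lambda>_. r" r] r tendsto_rabs_zero[OF ylim] by simp
  from order_tendstoD(2)[OF this \<epsilon>(1)]
  obtain T where T: "\<And>t. t \<le> T \<Longrightarrow> \<bar>y t\<bar> powr r < \<epsilon>" by (auto simp: eventually_at_bot_linorder)
  \<comment> \<open>Normalised to 1 at T, so that to the right of T, where no smallness is known,
    the crude bound MF is dominated by MF E.\<close>
  define E where "E t = exp (\<kappa> * (t - T))" for t
  have E: "exp (\<kappa> * t) = exp (\<kappa> * T) * E t" for t by (simp add: E_def exp_add[symmetric] algebra_simps)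
  \<comment> \<open>The fixed point of C -> C/2 + cb MF: the exponential part of the bound
    reproduces itself while the constant part is halved at each pass.\<close>
  define C where "C = 2 * cb * MF"
  have C0: "0 \<le> C" using cb MF0 by (simp add: C_def)
  have it: "\<forall>t\<le>T. \<bar>y t\<bar> \<le> M * (1/2) ^ n + C * E t" for n
  proof (induction n)
    case 0
    have "0 \<le> C * E t" for t using C0 by (simp add: E_def)
    then show ?case using yM by (simp add: add_increasing2)
  next
    case (Suc n)
    have F': "\<bar>?F s\<bar> \<le> \<epsilon> * (M * (1/2) ^ n) + ((\<epsilon> * C + MF) / exp (\<kappa> * T)) * exp (\<kappa> * s)" for s
    proof -
      have n0: "0 \<le> \<epsilon> * (M * (1/2) ^ n)" "0 \<le> \<epsilon> * C * E s" "0 \<le> MF * E s"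
        using \<epsilon>(1) M0 C0 MF0 by (simp_all add: E_def)
      have "\<bar>?F s\<bar> \<le> \<epsilon> * (M * (1/2) ^ n) + \<epsilon> * C * E s + MF * E s"
      proof (cases "s \<le> T")
        case True
        have "\<bar>?F s\<bar> \<le> \<epsilon> * (M * (1/2) ^ n + C * E s)"
          unfolding abs_nl using T[OF True] Suc True \<epsilon>(1) by (intro mult_mono) auto
        then show ?thesis using n0 by (simp add: distrib_left)
      next
        case False
        then have "1 \<le> E s" using \<kappa> by (simp add: E_def)
        then have "MF \<le> MF * E s" using MF0 mult_left_mono[of 1 "E s" MF] by simp
        then show ?thesis using n0 F[of s] by linarith
      qed
      moreover have "((\<epsilon> * C + MF) / exp (\<kappa> * T)) * exp (\<kappa> * s) = \<epsilon> * C * E s + MF * E s"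
        unfolding E[of s] by (simp add: field_simps)
      ultimately show ?thesis by linarith
    qed
    show ?case
    proof (intro allI impI)
      fix t assume "t \<le> T"
      have "\<bar>y t\<bar> \<le> ca * (\<epsilon> * (M * (1/2) ^ n)) + cb * ((\<epsilon> * C + MF) / exp (\<kappa> * T)) * exp (\<kappa> * t)"
        by (rule step[OF F'])
      also have "\<dots> = (ca * \<epsilon>) * (M * (1/2) ^ n) + ((cb * \<epsilon>) * C + cb * MF) * E t"
        unfolding E[of t] by (simp add: field_simps)
      also have "\<dots> \<le> (1/2) * (M * (1/2) ^ n) + ((1/2) * C + cb * MF) * E t"
        using \<epsilon> M0 C0 MF0 by (intro add_mono mult_right_mono) (auto simp: E_def)
      also have "\<dots> = M * (1/2) ^ Suc n + C * E t" by (simp add: C_def)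
      finally show "\<bar>y t\<bar> \<le> M * (1/2) ^ Suc n + C * E t" .
    qed
  qed
  have lim: "\<bar>y t\<bar> \<le> C * E t" if "t \<le> T" for t
  proof -
    have "(\<lambda>n. M * (1/2) ^ n + C * E t) \<longlonglongrightarrow> M * 0 + C * E t"
      by (intro tendsto_intros LIMSEQ_realpow_zero) auto
    moreover have "\<exists>N. \<forall>n\<ge>N. \<bar>y t\<bar> \<le> M * (1/2) ^ n + C * E t" using it that by blast
    ultimately have "\<bar>y t\<bar> \<le> M * 0 + C * E t" by (rule LIMSEQ_le_const)
    then show ?thesis by simp
  qed
  show ?thesis
  proof (rule that)
    fix t
    have "\<bar>y t\<bar> \<le> (C + M) * E t"
    proof (cases "t \<le> T")
      case True
      have "0 \<le> M * E t" using M0 by (simp add: E_def)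
      then show ?thesis using lim[OF True] by (simp add: distrib_right)
    next
      case False
      then have "1 \<le> E t" using \<kappa> by (simp add: E_def)
      then have "M \<le> M * E t" using M0 mult_left_mono[of 1 "E t" M] by simp
      moreover have "0 \<le> C * E t" using C0 by (simp add: E_def)
      ultimately show ?thesis using yM[of t] by (simp add: distrib_right)
    qed
    also have "\<dots> = ((C + M) / exp (\<kappa> * T)) * exp (\<kappa> * t)" unfolding E[of t] by simp
    finally show "\<bar>y t\<bar> \<le> ((C + M) / exp (\<kappa> * T)) * exp (\<kappa> * t)" .
  qed
qed

text \<open>The limit is I = (1 / (2 c)) times the integral of e^(-c s) F(s) over the line, which
  converges at minus infinity because \<mu> > c. The left half-line part is of order e^(\<mu> t) and
  drops out.\<close>

lemma green_lim:
  assumes Fc: "continuous_on UNIV F" and bd: "\<And>s. \<bar>F s\<bar> \<le> M"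
    and F: "\<And>s. \<bar>F s\<bar> \<le> D * exp (\<mu> * s)" and c: "0 < c" "c < \<mu>"
  obtains I where "((\<lambda>t. exp (- c * t) * green c F t) \<longlongrightarrow> I) at_bot"
    "((\<lambda>t. exp (- c * t) * (green' c F t + c * green c F t)) \<longlongrightarrow> 2 * c * I) at_bot"
proof -
  have Fm [measurable]: "F \<in> borel_measurable borel" by (rule borel_measurable_continuous_onI[OF Fc])
  let ?f = "\<lambda>s. exp (c * s) * F (- s)"
  have fi: "integrable lborel ?f"
  proof -
    have i1: "integrable lborel (\<lambda>s. indicator {..0} s * ?f s)"
      by (rule exp_dominated_half_line(1)[where \<mu>=c and M=M])
        (use bd c in \<open>auto simp: abs_mult mult.commute\<close>)
    have i2: "integrable lborel (\<lambda>s. indicator {..0} s * ?f (- s))"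
    proof (rule exp_dominated_half_line(1)[where \<mu>="\<mu> - c" and M=D])
      fix s :: real assume "s \<le> 0"
      have "\<bar>?f (- s)\<bar> \<le> exp (c * - s) * (D * exp (\<mu> * s))"
        using F[of s] by (simp add: abs_mult)
      also have "\<dots> = D * exp ((\<mu> - c) * s)" by (simp add: left_diff_distrib exp_diff exp_minus field_simps)
      finally show "\<bar>?f (- s)\<bar> \<le> D * exp ((\<mu> - c) * s)" .
    qed (use c in auto)
    have i3: "integrable lborel (\<lambda>s. indicator {..0} (- s) * ?f s)"
      using lborel_integrable_real_affine[OF i2, of "-1" 0] by simp
    have "AE s in lborel. ?f s = indicator {..0} s * ?f s + indicator {..0} (- s) * ?f s"
      using AE_lborel_singleton[of "0::real"] by eventually_elim (auto simp: indicator_def)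
    from integrable_cong_AE[OF _ _ this] show ?thesis using i1 i3 by simp
  qed
  let ?L = "LINT s|lborel. ?f s"
  have "((\<lambda>t. LINT s|lborel. indicator {..t} s *\<^sub>R ?f s) \<longlongrightarrow> ?L) at_top"
    by (rule tendsto_integral_at_top[OF _ fi]) simp
  then have "((\<lambda>t. LINT s|lborel. indicator {..- t} s *\<^sub>R ?f s) \<longlongrightarrow> ?L) at_bot"
    by (rule filterlim_compose) (rule filterlim_uminus_at_top_at_bot)
  then have Jp: "(Jp c F \<longlongrightarrow> ?L) at_bot" by (simp add: Jp_def[abs_def] Jm_def)
  have Jm: "((\<lambda>t. exp (- 2 * c * t) * Jm c F t) \<longlongrightarrow> 0) at_bot"
  proof (rule Lim_null_comparison)
    show "\<forall>\<^sub>F t in at_bot. norm (exp (- 2 * c * t) * Jm c F t) \<le> (D / (c + \<mu>)) * exp ((\<mu> - c) * t)"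
    proof (rule always_eventually, rule allI)
      fix t
      have "\<bar>Jm c F t\<bar> \<le> D * (exp ((c + \<mu>) * t) / (c + \<mu>))"
        by (rule Jm_weighted_bound[OF Fm F]) (use c in simp)
      then have "exp (- 2 * c * t) * \<bar>Jm c F t\<bar> \<le> exp (- 2 * c * t) * (D * (exp ((c + \<mu>) * t) / (c + \<mu>)))"
        by (rule mult_left_mono) simp
      also have "\<dots> = (D / (c + \<mu>)) * (exp (- 2 * c * t) * exp ((c + \<mu>) * t))" by simp
      also have "exp (- 2 * c * t) * exp ((c + \<mu>) * t) = exp ((\<mu> - c) * t)"
        by (simp add: exp_add[symmetric] algebra_simps)
      finally show "norm (exp (- 2 * c * t) * Jm c F t) \<le> (D / (c + \<mu>)) * exp ((\<mu> - c) * t)"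
        by (simp add: abs_mult)
    qed
    have "((\<lambda>t. (D / (c + \<mu>)) * exp ((\<mu> - c) * t)) \<longlongrightarrow> (D / (c + \<mu>)) * 0) at_bot"
      by (intro tendsto_intros tendsto_exp_at_bot) (use c in simp)
    then show "((\<lambda>t. (D / (c + \<mu>)) * exp ((\<mu> - c) * t)) \<longlongrightarrow> 0) at_bot" by simp
  qed
  have e: "exp (- c * t) * exp (c * t) = 1" "exp (- c * t) * exp (- c * t) = exp (- 2 * c * t)" for t
    by (simp_all add: exp_add[symmetric])
  show ?thesis
  proof (rule that)
    have "exp (- c * t) * green c F t = (exp (- 2 * c * t) * Jm c F t + Jp c F t) / (2 * c)" for t
    proof -
      have "exp (- c * t) * green c F t = ((exp (- c * t) * exp (- c * t)) * Jm c F t + (exp (- c * t) * exp (c * t)) * Jp c F t) / (2 * c)"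
        by (simp add: green_def algebra_simps)
      then show ?thesis by (simp only: e mult_1)
    qed
    moreover have "((\<lambda>t. (exp (- 2 * c * t) * Jm c F t + Jp c F t) / (2 * c)) \<longlongrightarrow> (0 + ?L) / (2 * c)) at_bot"
      using c by (intro tendsto_intros Jm Jp) auto
    ultimately show "((\<lambda>t. exp (- c * t) * green c F t) \<longlongrightarrow> ?L / (2 * c)) at_bot" by simp
    have "exp (- c * t) * (green' c F t + c * green c F t) = Jp c F t" for t
    proof -
      have "green' c F t + c * green c F t = exp (c * t) * Jp c F t"
        using c by (simp add: green_def green'_def field_simps)
      then show ?thesis using e(1)[of t] by (simp add: mult.assoc[symmetric])
    qed
    then show "((\<lambda>t. exp (- c * t) * (green' c F t + c * green c F t)) \<longlongrightarrow> 2 * c * (?L / (2 * c))) at_bot"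
      using Jp c by simp
  qed
qed

lemma orbit_of_integral_equation:
  assumes k: "0 < k" and km: "k < m" and rk: "r * k = 2 * (m - k)"
    and yc: "continuous_on UNIV y" and yM: "\<And>t. \<bar>y t\<bar> \<le> M" and ylim: "(y \<longlongrightarrow> 0) at_bot"
    and eq: "\<And>t. y t = (green k (\<lambda>s. nl r (y s)) t - green m (\<lambda>s. nl r (y s)) t) / (m\<^sup>2 - k\<^sup>2)"
  obtains y1 w w1 A B where "orbit k m r y y1 w w1 A B"
proof -
  define F where "F s = nl r (y s)" for s
  have eq': "y = (\<lambda>t. (green k F t - green m F t) / (m\<^sup>2 - k\<^sup>2))"
    using eq unfolding F_def[abs_def] by (rule ext)
  have r: "0 < r" using k km rk by (metis diff_gt_0_iff_gt mult_pos_pos zero_less_mult_pos2 zero_less_numeral)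
  have m: "0 < m" using k km by simp
  have M0: "0 \<le> M" using yM[of 0] by linarith
  have Fc: "continuous_on UNIV F" unfolding F_def
    by (rule continuous_on_compose2[OF nl_continuous[OF r] yc]) auto
  define MF where "MF = M powr r * M"
  have F: "\<bar>F s\<bar> \<le> MF" for s
    unfolding F_def abs_nl MF_def using yM[of s] r by (intro mult_mono powr_mono2) auto
  \<comment> \<open>The midpoint between m, which must be exceeded for the limit at rate m to exist,
    and (r + 1) k = 2 m - k, which cannot be reached.\<close>
  define \<mu> where "\<mu> = m + (m - k) / 2"
  \<comment> \<open>The rate at which v must decay for |v|^r v to decay at rate \<mu>; it lies below
    k because \<mu> < (r + 1) k.\<close>
  define \<kappa> where "\<kappa> = \<mu> / (r + 1)"
  have r1: "(r + 1) * k = 2 * m - k" using rk by (simp add: algebra_simps)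
  have \<mu>: "m < \<mu>" "\<mu> < 2 * m - k" using km by (auto simp: \<mu>_def field_simps)
  have \<kappa>: "0 \<le> \<kappa>" "\<kappa> < k" using r m \<mu> r1 by (auto simp: \<kappa>_def divide_simps mult.commute)
  have ym: "y \<in> borel_measurable borel" by (rule borel_measurable_continuous_onI[OF yc])
  obtain C where C: "\<And>t. \<bar>y t\<bar> \<le> C * exp (\<kappa> * t)"
    using integral_equation_decay[OF k km r \<kappa> ym yM ylim eq] by blast
  have C0: "0 \<le> C" using C[of 0] by simp
  have FD: "\<bar>F s\<bar> \<le> (C powr r * C) * exp (\<mu> * s)" for s
  proof -
    have "\<bar>F s\<bar> \<le> (C * exp (\<kappa> * s)) powr r * (C * exp (\<kappa> * s))"
      unfolding F_def abs_nl using C[of s] r by (intro mult_mono powr_mono2) auto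
    also have "(C * exp (\<kappa> * s)) powr r = C powr r * exp (r * \<kappa> * s)"
      using C0 by (simp add: powr_mult powr_def[of "exp _"] mult_ac)
    also have "C powr r * exp (r * \<kappa> * s) * (C * exp (\<kappa> * s)) = (C powr r * C) * (exp (r * \<kappa> * s) * exp (\<kappa> * s))"
      by simp
    also have "exp (r * \<kappa> * s) * exp (\<kappa> * s) = exp (\<mu> * s)"
    proof -
      have "(r + 1) * \<kappa> = \<mu>" using r by (simp add: \<kappa>_def)
      then have "r * \<kappa> * s + \<kappa> * s = \<mu> * s" by (metis distrib_right mult_1)
      then show ?thesis by (simp only: exp_add[symmetric])
    qed
    finally show ?thesis .
  qed
  obtain Ik where Ik: "((\<lambda>t. exp (- k * t) * green k F t) \<longlongrightarrow> Ik) at_bot"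
    "((\<lambda>t. exp (- k * t) * (green' k F t + k * green k F t)) \<longlongrightarrow> 2 * k * Ik) at_bot"
    using green_lim[OF Fc F FD k order.strict_trans[OF km \<mu>(1)]] by blast
  obtain Im where Im: "((\<lambda>t. exp (- m * t) * green m F t) \<longlongrightarrow> Im) at_bot"
    "((\<lambda>t. exp (- m * t) * (green' m F t + m * green m F t)) \<longlongrightarrow> 2 * m * Im) at_bot"
    using green_lim[OF Fc F FD m \<mu>(1)] by blast
  have mk: "0 < m\<^sup>2 - k\<^sup>2" using k km by (simp add: power_strict_mono)
  have shift: "exp ((m - k) * t) * (exp (- m * t) * x) = exp (- k * t) * (x::real)" for t x
    by (simp add: mult.assoc[symmetric] exp_add[symmetric] algebra_simps)
  have sm: "((\<lambda>t. exp ((m - k) * t)) \<longlongrightarrow> 0) at_bot" by (rule tendsto_exp_at_bot) (use km in simp)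
  \<comment> \<open>The rate-m part is of smaller order than e^(k t), so it contributes nothing to
    the first coordinate.\<close>
  have gm0: "((\<lambda>t. exp (- k * t) * green m F t) \<longlongrightarrow> 0) at_bot"
    using tendsto_mult[OF sm Im(1)] unfolding shift by simp
  have gm1: "((\<lambda>t. exp (- k * t) * (green' m F t + m * green m F t)) \<longlongrightarrow> 0) at_bot"
    using tendsto_mult[OF sm Im(2)] unfolding shift by simp
  let ?y1 = "\<lambda>t. (green' k F t - green' m F t) / (m\<^sup>2 - k\<^sup>2)"
  \<comment> \<open>In the difference y'' - k^2 y the two copies of F cancel, leaving
    -\<open>green m F\<close>; hence this w, and the coordinates are the limits of the two Green
    terms.\<close>
  have "orbit k m r y ?y1 (\<lambda>t. - green m F t) (\<lambda>t. - green' m F t) (Ik / (m\<^sup>2 - k\<^sup>2)) (- Im)"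
    unfolding orbit_def
  proof (intro conjI allI)
    fix t
    note dk = green_DERIV[OF Fc F k] and dm = green_DERIV[OF Fc F m]
    have "((\<lambda>t. (green k F t - green m F t) / (m\<^sup>2 - k\<^sup>2)) has_real_derivative ?y1 t) (at t)"
      by (rule DERIV_cdivide[OF DERIV_diff[OF dk(1) dm(1)]])
    then show "(y has_real_derivative ?y1 t) (at t)" unfolding eq'[symmetric] .
    have key: "k\<^sup>2 * green k F t - F t - (m\<^sup>2 * green m F t - F t)
        = (m\<^sup>2 - k\<^sup>2) * (k\<^sup>2 * y t + - green m F t)"
      using mk by (simp add: fun_cong[OF eq'] field_simps)
    from DERIV_cdivide[OF DERIV_diff[OF dk(2) dm(2)], of "m\<^sup>2 - k\<^sup>2" t]
    show "(?y1 has_real_derivative k\<^sup>2 * y t + - green m F t) (at t)"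
      unfolding key nonzero_mult_div_cancel_left[OF less_imp_neq[OF mk, symmetric]] .
    show "((\<lambda>t. - green m F t) has_real_derivative - green' m F t) (at t)"
      by (rule DERIV_minus[OF dm(1)])
    show "((\<lambda>t. - green' m F t) has_real_derivative m\<^sup>2 * - green m F t + nl r (y t)) (at t)"
      by (rule DERIV_cong[OF DERIV_minus[OF dm(2)]]) (simp add: F_def[of t])
  next
    have "((\<lambda>t. (exp (- k * t) * green k F t - exp (- k * t) * green m F t) / (m\<^sup>2 - k\<^sup>2)) \<longlongrightarrow> (Ik - 0) / (m\<^sup>2 - k\<^sup>2)) at_bot"
      using mk by (intro tendsto_intros Ik gm0) auto
    moreover have "(exp (- k * t) * green k F t - exp (- k * t) * green m F t) / (m\<^sup>2 - k\<^sup>2) = exp (- k * t) * y t" for t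
      by (simp add: fun_cong[OF eq'] right_diff_distrib)
    ultimately show "((\<lambda>t. exp (- k * t) * y t) \<longlongrightarrow> Ik / (m\<^sup>2 - k\<^sup>2)) at_bot" by simp
    have "((\<lambda>t. (exp (- k * t) * (green' k F t + k * green k F t)
        - (exp (- k * t) * (green' m F t + m * green m F t) - (m - k) * (exp (- k * t) * green m F t))) / (m\<^sup>2 - k\<^sup>2))
        \<longlongrightarrow> (2 * k * Ik - (0 - (m - k) * 0)) / (m\<^sup>2 - k\<^sup>2)) at_bot"
      using mk by (intro tendsto_intros Ik gm0 gm1) auto
    moreover have "(exp (- k * t) * (green' k F t + k * green k F t)
        - (exp (- k * t) * (green' m F t + m * green m F t) - (m - k) * (exp (- k * t) * green m F t))) / (m\<^sup>2 - k\<^sup>2)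
        = exp (- k * t) * (?y1 t + k * y t)" for t
    proof -
      have "(e * (a + k * b) - (e * (c + m * g) - (m - k) * (e * g))) / D = e * ((a - c) / D + k * ((b - g) / D))"
        for e a b c g D :: real
        by (simp add: diff_divide_distrib add_divide_distrib algebra_simps)
      then show ?thesis unfolding fun_cong[OF eq', of t] .
    qed
    ultimately show "((\<lambda>t. exp (- k * t) * (?y1 t + k * y t)) \<longlongrightarrow> 2 * k * (Ik / (m\<^sup>2 - k\<^sup>2))) at_bot" by simp
    show "((\<lambda>t. exp (- m * t) * - green m F t) \<longlongrightarrow> - Im) at_bot"
      using tendsto_minus[OF Im(1)] by simp
    show "((\<lambda>t. exp (- m * t) * (- green' m F t + m * - green m F t)) \<longlongrightarrow> 2 * m * - Im) at_bot"
      using tendsto_minus[OF Im(2)] by (simp add: algebra_simps)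
    show "\<exists>M. \<forall>t. \<bar>y t\<bar> \<le> M" using yM by blast
    have "\<bar>- green m F t\<bar> \<le> MF / m\<^sup>2" for t
      using green_bound[OF borel_measurable_continuous_onI[OF Fc] F m] by simp
    then show "\<exists>M. \<forall>t. \<bar>- green m F t\<bar> \<le> M" by blast
  qed
  then show ?thesis by (rule that)
qed

section \<open>The explicit orbit\<close>

text \<open>This is (2 cosh (\<delta> t / 2))^(-n). The exponential form shows the behaviour at
  minus infinity and matches the bubble directly.\<close>

definition sech_pow :: "real \<Rightarrow> real \<Rightarrow> real \<Rightarrow> real" where
  "sech_pow \<delta> n t = exp (\<delta> * n / 2 * t) * (1 + exp (\<delta> * t)) powr (- n)"

text \<open>This is -tanh (\<delta> t / 2), the logarithmic derivative of
  \<open>sech_pow \<delta> n\<close> up to the factor \<delta> n / 2.\<close>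

definition neg_tanh :: "real \<Rightarrow> real \<Rightarrow> real" where
  "neg_tanh \<delta> t = (1 - exp (\<delta> * t)) / (1 + exp (\<delta> * t))"

lemma one_plus_exp_pos [simp]: "0 < 1 + exp (x::real)"
  by (simp add: add_pos_pos)

lemma one_plus_exp_neq_0 [simp]: "1 + exp (x::real) \<noteq> 0"
  using one_plus_exp_pos[of x] by linarith

lemma sech_pow_pos: "0 < sech_pow \<delta> n t"
  by (simp add: sech_pow_def)

lemma sech_pow_add: "sech_pow \<delta> n t * sech_pow \<delta> l t = sech_pow \<delta> (n + l) t"
proof -
  have "exp (\<delta> * n / 2 * t) * exp (\<delta> * l / 2 * t) = exp (\<delta> * (n + l) / 2 * t)"
    by (simp add: exp_add[symmetric] field_simps)
  moreover have "(1 + exp (\<delta> * t)) powr (- n) * (1 + exp (\<delta> * t)) powr (- l) = (1 + exp (\<delta> * t)) powr (- (n + l))"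
    by (simp add: powr_add[symmetric])
  ultimately show ?thesis unfolding sech_pow_def by (simp add: mult_ac)
qed

lemma sech_pow_powr: "sech_pow \<delta> n t powr r = sech_pow \<delta> (n * r) t"
  unfolding sech_pow_def
  by (simp add: powr_mult powr_powr powr_def[of "exp _"] mult_ac)

lemma sech_pow_DERIV:
  "(sech_pow \<delta> n has_real_derivative \<delta> * n / 2 * (sech_pow \<delta> n t * neg_tanh \<delta> t)) (at t)"
proof -
  let ?X = "1 + exp (\<delta> * t)"
  have X: "0 < ?X" by simp
  have 1: "((\<lambda>t. 1 + exp (\<delta> * t)) has_real_derivative \<delta> * exp (\<delta> * t)) (at t)"
    by (auto intro!: derivative_eq_intros)
  have 2: "((\<lambda>t. (1 + exp (\<delta> * t)) powr (- n)) has_real_derivative - n * ?X powr (- n - 1) * (\<delta> * exp (\<delta> * t))) (at t)"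
    by (rule DERIV_chain2[OF has_real_derivative_powr[OF X] 1])
  have 3: "((\<lambda>t. exp (\<delta> * n / 2 * t)) has_real_derivative \<delta> * n / 2 * exp (\<delta> * n / 2 * t)) (at t)"
    by (auto intro!: derivative_eq_intros)
  have p: "?X powr (- n - 1) = ?X powr (- n) / ?X" using X by (simp add: powr_diff)
  show ?thesis
    unfolding sech_pow_def[abs_def]
    by (rule DERIV_cong[OF DERIV_mult[OF 3 2]]) (use X in \<open>simp add: p neg_tanh_def field_simps\<close>)
qed

lemma sech_pow_2: "sech_pow \<delta> 2 t = exp (\<delta> * t) / (1 + exp (\<delta> * t))\<^sup>2"
proof -
  have "(1 + exp (\<delta> * t)) powr (- 2) = inverse ((1 + exp (\<delta> * t)) powr 2)" by (rule powr_minus)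
  also have "(1 + exp (\<delta> * t)) powr 2 = (1 + exp (\<delta> * t))\<^sup>2"
    using one_plus_exp_pos[of "\<delta> * t"] by (intro powr_numeral less_imp_le)
  finally show ?thesis by (simp only: sech_pow_def divide_inverse) simp
qed

lemma neg_tanh_DERIV: "(neg_tanh \<delta> has_real_derivative - 2 * \<delta> * sech_pow \<delta> 2 t) (at t)"
proof -
  let ?X = "1 + exp (\<delta> * t)"
  have X: "0 < ?X" by simp
  note s = sech_pow_2[of \<delta> t]
  let ?E = "exp (\<delta> * t)"
  have 1: "((\<lambda>t. 1 - exp (\<delta> * t)) has_real_derivative - (\<delta> * ?E)) (at t)"
    and 2: "((\<lambda>t. 1 + exp (\<delta> * t)) has_real_derivative \<delta> * ?E) (at t)"
    by (auto intro!: derivative_eq_intros)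
  have num: "- (\<delta> * ?E) * ?X - (1 - ?E) * (\<delta> * ?E) = - 2 * \<delta> * ?E" by (simp add: algebra_simps)
  from DERIV_divide[OF 1 2]
  have "((\<lambda>t. (1 - exp (\<delta> * t)) / (1 + exp (\<delta> * t))) has_real_derivative
      (- (\<delta> * ?E) * ?X - (1 - ?E) * (\<delta> * ?E)) / (?X * ?X)) (at t)" by simp
  then show ?thesis unfolding neg_tanh_def[abs_def] num s power2_eq_square by (simp add: mult.assoc)
qed

lemma neg_tanh_sq: "(neg_tanh \<delta> t)\<^sup>2 = 1 - 4 * sech_pow \<delta> 2 t"
proof -
  let ?X = "1 + exp (\<delta> * t)"
  have X: "0 < ?X" by simp
  note s = sech_pow_2[of \<delta> t]
  have "1 - 4 * (exp (\<delta> * t) / ?X\<^sup>2) = (?X\<^sup>2 - 4 * exp (\<delta> * t)) / ?X\<^sup>2"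
    by (simp add: diff_divide_distrib)
  moreover have "(1 - exp (\<delta> * t))\<^sup>2 = ?X\<^sup>2 - 4 * exp (\<delta> * t)"
    by (simp add: power2_eq_square algebra_simps)
  ultimately show ?thesis unfolding s neg_tanh_def power_divide by (simp only:)
qed

lemma abs_neg_tanh_le_1: "\<bar>neg_tanh \<delta> t\<bar> \<le> 1"
proof -
  have "(neg_tanh \<delta> t)\<^sup>2 \<le> 1" using neg_tanh_sq[of \<delta> t] sech_pow_pos[of \<delta> 2 t] by simp
  then show ?thesis by (simp add: abs_square_le_1)
qed

text \<open>After tanh^2 is replaced by 1 - 4 \<open>sech_pow \<delta> 2\<close>, the operator D^2 -
  (\<delta> n / 2)^2 leaves a single term with the power raised by two.\<close>

lemma sech_pow_DERIV2:
  "((\<lambda>t. \<delta> * n / 2 * (sech_pow \<delta> n t * neg_tanh \<delta> t)) has_real_derivative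
     (\<delta> * n / 2)\<^sup>2 * sech_pow \<delta> n t - \<delta>\<^sup>2 * n * (n + 1) * sech_pow \<delta> (n + 2) t) (at t)"
proof (rule DERIV_cong[OF DERIV_cmult[OF DERIV_mult[OF sech_pow_DERIV neg_tanh_DERIV]]])
  let ?S = "sech_pow \<delta> n t" and ?S2 = "sech_pow \<delta> 2 t"
  have "\<delta> * n / 2 * (\<delta> * n / 2 * (?S * neg_tanh \<delta> t) * neg_tanh \<delta> t + - 2 * \<delta> * ?S2 * ?S)
     = (\<delta> * n / 2)\<^sup>2 * ?S * (neg_tanh \<delta> t)\<^sup>2 - \<delta>\<^sup>2 * n * (?S * ?S2)"
    by (simp add: power2_eq_square algebra_simps)
  also have "\<dots> = (\<delta> * n / 2)\<^sup>2 * ?S - \<delta>\<^sup>2 * n * (n + 1) * (?S * ?S2)"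
    unfolding neg_tanh_sq power_divide power_mult_distrib by (simp add: power2_eq_square field_simps)
  finally show "\<delta> * n / 2 * (\<delta> * n / 2 * (?S * neg_tanh \<delta> t) * neg_tanh \<delta> t + - 2 * \<delta> * ?S2 * ?S)
     = (\<delta> * n / 2)\<^sup>2 * ?S - \<delta>\<^sup>2 * n * (n + 1) * sech_pow \<delta> (n + 2) t"
    unfolding sech_pow_add .
qed

lemma sech_pow_le:
  assumes "0 < \<delta>" "0 \<le> n"
  shows "sech_pow \<delta> n t \<le> exp (- (\<delta> * n / 2) * \<bar>t\<bar>)"
proof -
  have X: "1 \<le> 1 + exp (\<delta> * t)" "exp (\<delta> * t) \<le> 1 + exp (\<delta> * t)" by simp_all
  show ?thesis
  proof (cases "t \<le> 0")
    case True
    have "(1 + exp (\<delta> * t)) powr (- n) \<le> 1"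
      using X(1) assms(2) ge_one_powr_ge_zero[of "1 + exp (\<delta> * t)" n] by (simp add: powr_minus divide_simps)
    then have "sech_pow \<delta> n t \<le> exp (\<delta> * n / 2 * t) * 1"
      unfolding sech_pow_def by (intro mult_left_mono) auto
    then show ?thesis using True by simp
  next
    case False
    have "(1 + exp (\<delta> * t)) powr (- n) \<le> exp (\<delta> * t) powr (- n)"
      using X(2) assms(2) by (intro powr_mono2') auto
    also have "\<dots> = exp (- \<delta> * n * t)" by (simp add: powr_def)
    finally have "sech_pow \<delta> n t \<le> exp (\<delta> * n / 2 * t) * exp (- \<delta> * n * t)"
      unfolding sech_pow_def by (intro mult_left_mono) auto
    also have "\<dots> = exp (- (\<delta> * n / 2) * \<bar>t\<bar>)" using False by (simp add: exp_add[symmetric] field_simps)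
    finally show ?thesis .
  qed
qed

lemma sech_pow_lim:
  assumes \<delta>: "0 < \<delta>" and c: "\<delta> * n / 2 = c"
  shows "((\<lambda>t. exp (- c * t) * sech_pow \<delta> n (t + \<tau>)) \<longlongrightarrow> exp (c * \<tau>)) at_bot"
    and "((\<lambda>t. exp (- c * t) * (sech_pow \<delta> n (t + \<tau>) * neg_tanh \<delta> (t + \<tau>))) \<longlongrightarrow> exp (c * \<tau>)) at_bot"
proof -
  have e: "((\<lambda>t. exp (\<delta> * (t + \<tau>))) \<longlongrightarrow> 0) at_bot"
  proof -
    have "((\<lambda>t. exp (\<delta> * \<tau>) * exp (\<delta> * t)) \<longlongrightarrow> exp (\<delta> * \<tau>) * 0) at_bot"
      by (intro tendsto_intros tendsto_exp_at_bot \<delta>)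
    then show ?thesis by (simp add: distrib_left exp_add mult.commute)
  qed
  have "((\<lambda>t. exp (c * \<tau>) * (1 + exp (\<delta> * (t + \<tau>))) powr (- n)) \<longlongrightarrow> exp (c * \<tau>) * (1 + 0) powr (- n)) at_bot"
    by (intro tendsto_intros e) auto
  moreover have "exp (- c * t) * sech_pow \<delta> n (t + \<tau>) = exp (c * \<tau>) * (1 + exp (\<delta> * (t + \<tau>))) powr (- n)" for t
  proof -
    have "exp (- c * t) * exp (c * (t + \<tau>)) = exp (c * \<tau>)" by (simp add: exp_add[symmetric] algebra_simps)
    then show ?thesis unfolding sech_pow_def c by (metis mult.assoc)
  qed
  ultimately show 1: "((\<lambda>t. exp (- c * t) * sech_pow \<delta> n (t + \<tau>)) \<longlongrightarrow> exp (c * \<tau>)) at_bot" by simp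
  have "((\<lambda>t. neg_tanh \<delta> (t + \<tau>)) \<longlongrightarrow> (1 - 0) / (1 + 0)) at_bot"
    unfolding neg_tanh_def by (intro tendsto_intros e) auto
  from tendsto_mult[OF 1 this]
  show "((\<lambda>t. exp (- c * t) * (sech_pow \<delta> n (t + \<tau>) * neg_tanh \<delta> (t + \<tau>))) \<longlongrightarrow> exp (c * \<tau>)) at_bot"
    by (simp add: mult.assoc)
qed

lemma DERIV_translate:
  fixes f :: "real \<Rightarrow> real"
  assumes "\<And>t. (f has_real_derivative f' t) (at t)"
  shows "((\<lambda>t. f (t + \<tau>)) has_real_derivative f' (t + \<tau>)) (at t)"
  using assms[of "t + \<tau>"] by (simp add: DERIV_shift)

text \<open>With \<delta> = m - k the powers q and q + 2 have rates k and m, so the two second-order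
  factors lead from q through q + 2 to q + 4. The nonlinearity reaches q + 4 as well because q r =
  4, and \<open>Cr\<close> matches the coefficients.\<close>

lemma sech_orbit:
  fixes k m r C q \<tau> :: real
  assumes k: "0 < k" and km: "k < m" and C: "0 < C"
    and r: "r = 2 * (m - k) / k" and q: "q = 2 * k / (m - k)"
    and Cr: "C powr r = (m - k) ^ 4 * (q * (q + 1) * (q + 2) * (q + 3))"
  defines "S \<equiv> \<lambda>n t. sech_pow (m - k) n (t + \<tau>)" and "T \<equiv> \<lambda>t. neg_tanh (m - k) (t + \<tau>)"
    and "D \<equiv> C * (m - k)\<^sup>2 * q * (q + 1)"
  shows "orbit k m r (\<lambda>t. C * S q t) (\<lambda>t. C * (k * (S q t * T t)))
     (\<lambda>t. - D * S (q + 2) t) (\<lambda>t. - D * (m * (S (q + 2) t * T t))) (C * exp (k * \<tau>)) (- D * exp (m * \<tau>))"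
proof -
  have d: "0 < m - k" using km by simp
  have q0: "0 < q" using k d by (simp add: q)
  have qk: "(m - k) * q / 2 = k" using d by (simp add: q)
  have qm: "(m - k) * (q + 2) / 2 = m" using qk by (simp add: distrib_left add_divide_distrib)
  have qr: "q * r = 4" using k d by (simp add: q r field_simps)
  have D0: "0 < D" using C d q0 by (simp add: D_def)
  have S1: "(S n has_real_derivative (m - k) * n / 2 * (S n t * T t)) (at t)" for n t
    unfolding S_def T_def by (rule DERIV_translate[OF sech_pow_DERIV])
  have S2: "((\<lambda>t. (m - k) * n / 2 * (S n t * T t)) has_real_derivative
      ((m - k) * n / 2)\<^sup>2 * S n t - (m - k)\<^sup>2 * n * (n + 1) * S (n + 2) t) (at t)" for n t
    unfolding S_def T_def by (rule DERIV_translate[OF sech_pow_DERIV2])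
  have S_le1: "\<bar>S n t\<bar> \<le> 1" if "0 \<le> n" for n t
  proof -
    have "sech_pow (m - k) n (t + \<tau>) \<le> exp (- ((m - k) * n / 2) * \<bar>t + \<tau>\<bar>)" by (rule sech_pow_le[OF d that])
    also have "\<dots> \<le> 1" using d that by simp
    finally show ?thesis using sech_pow_pos[of "m - k" n "t + \<tau>"] by (simp add: S_def)
  qed
  have nlS: "nl r (C * S q t) = C * (m - k) ^ 4 * (q * (q + 1) * (q + 2) * (q + 3)) * S (q + 4) t" for t
  proof -
    have "nl r (C * S q t) = (C powr r * S q t powr r) * (C * S q t)"
      using C sech_pow_pos[of "m - k" q "t + \<tau>"] by (simp add: nl_def powr_mult S_def)
    also have "S q t powr r = S 4 t" unfolding S_def sech_pow_powr qr ..
    also have "(C powr r * S 4 t) * (C * S q t) = C * C powr r * (S q t * S 4 t)" by simp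
    also have "S q t * S 4 t = S (q + 4) t" unfolding S_def by (rule sech_pow_add)
    finally show ?thesis unfolding Cr by (simp add: mult_ac)
  qed
  show ?thesis
    unfolding orbit_def
  proof (intro conjI allI)
    fix t
    show "((\<lambda>t. C * S q t) has_real_derivative C * (k * (S q t * T t))) (at t)"
      using DERIV_cmult[OF S1[of q t], of C] unfolding qk .
    show "((\<lambda>t. C * (k * (S q t * T t))) has_real_derivative k\<^sup>2 * (C * S q t) + - D * S (q + 2) t) (at t)"
      using DERIV_cmult[OF S2[of q t], of C] unfolding qk
      by (rule DERIV_cong) (simp add: D_def algebra_simps)
    show "((\<lambda>t. - D * S (q + 2) t) has_real_derivative - D * (m * (S (q + 2) t * T t))) (at t)"
      using DERIV_cmult[OF S1[of "q + 2" t], of "- D"] unfolding qm .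
    have "q + 2 + 1 = q + 3" "q + 2 + 2 = q + 4" by simp_all
    then show "((\<lambda>t. - D * (m * (S (q + 2) t * T t))) has_real_derivative m\<^sup>2 * (- D * S (q + 2) t) + nl r (C * S q t)) (at t)"
      using DERIV_cmult[OF S2[of "q + 2" t], of "- D"] unfolding qm nlS
      by (elim DERIV_cong) (simp add: D_def power4_eq_xxxx power2_eq_square algebra_simps)
  next
    have lq: "((\<lambda>t. exp (- k * t) * S q t) \<longlongrightarrow> exp (k * \<tau>)) at_bot"
        "((\<lambda>t. exp (- k * t) * (S q t * T t)) \<longlongrightarrow> exp (k * \<tau>)) at_bot"
      unfolding S_def T_def by (rule sech_pow_lim[OF d qk])+
    have lm: "((\<lambda>t. exp (- m * t) * S (q + 2) t) \<longlongrightarrow> exp (m * \<tau>)) at_bot"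
        "((\<lambda>t. exp (- m * t) * (S (q + 2) t * T t)) \<longlongrightarrow> exp (m * \<tau>)) at_bot"
      unfolding S_def T_def by (rule sech_pow_lim[OF d qm])+
    show "((\<lambda>t. exp (- k * t) * (C * S q t)) \<longlongrightarrow> C * exp (k * \<tau>)) at_bot"
      using tendsto_mult_left[OF lq(1), of C] by (simp add: mult_ac)
    have "((\<lambda>t. C * k * (exp (- k * t) * (S q t * T t)) + C * k * (exp (- k * t) * S q t)) \<longlongrightarrow>
        C * k * exp (k * \<tau>) + C * k * exp (k * \<tau>)) at_bot"
      by (intro tendsto_intros lq)
    then show "((\<lambda>t. exp (- k * t) * (C * (k * (S q t * T t)) + k * (C * S q t))) \<longlongrightarrow> 2 * k * (C * exp (k * \<tau>))) at_bot"
      by (simp add: algebra_simps)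
    show "((\<lambda>t. exp (- m * t) * (- D * S (q + 2) t)) \<longlongrightarrow> - D * exp (m * \<tau>)) at_bot"
      using tendsto_mult_left[OF lm(1), of "- D"] by (simp add: mult_ac)
    have "((\<lambda>t. - D * m * (exp (- m * t) * (S (q + 2) t * T t)) + - D * m * (exp (- m * t) * S (q + 2) t)) \<longlongrightarrow>
        - D * m * exp (m * \<tau>) + - D * m * exp (m * \<tau>)) at_bot"
      by (intro tendsto_intros lm)
    then show "((\<lambda>t. exp (- m * t) * (- D * (m * (S (q + 2) t * T t)) + m * (- D * S (q + 2) t))) \<longlongrightarrow> 2 * m * (- D * exp (m * \<tau>))) at_bot"
      by (simp add: algebra_simps)
    have "\<bar>C * S q t\<bar> \<le> C" for t using S_le1[of q t] q0 C by (simp add: abs_mult)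
    then show "\<exists>M. \<forall>t. \<bar>C * S q t\<bar> \<le> M" by blast
    have "\<bar>- D * S (q + 2) t\<bar> \<le> D" for t using S_le1[of "q + 2" t] q0 D0 by (simp add: abs_mult)
    then show "\<exists>M. \<forall>t. \<bar>- D * S (q + 2) t\<bar> \<le> M" by blast
  qed
qed

text \<open>Constants with \<open>D \<plusminus> m\<close>, \<open>D \<plusminus> k\<close> the four first-order factors of the operator in the variable
  \<open>t = ln |x|\<close> after substituting \<open>u = |x|\<^sup>-\<^sup>m v\<close>.\<close>

locale emden_fowler =
  fixes N \<alpha> \<beta> \<gamma> k m r :: real
  assumes N: "5 \<le> N" and \<alpha>: "2 - N < \<alpha>" and \<beta>1: "(N - 4) / (N - 2) * \<alpha> - 4 \<le> \<beta>" and \<beta>2: "\<beta> < \<alpha> - 2"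
    and \<gamma>: "(N + \<beta>) * (N + \<gamma>) = (N + 2 * \<alpha> - \<beta> - 4)\<^sup>2"
    and k_def: "k = (N + \<beta>) / 2" and m_def: "m = (N + 2 * \<alpha> - \<beta> - 4) / 2" and r_def: "r = 2 * (m - k) / k"
begin

text \<open>At \<alpha> = 2 - N the lower bound for \<beta> is exactly -N, and it increases strictly
  with \<alpha>; hence N + \<beta> > 0.\<close>

lemma k: "0 < k"
proof -
  have "(N - 4) / (N - 2) * (2 - N) \<le> (N - 4) / (N - 2) * \<alpha>"
    using N \<alpha> by (intro mult_left_mono) auto
  moreover have "(N - 4) / (N - 2) * (2 - N) = 4 - N" using N by (simp add: field_simps)
  moreover have "(N - 4) / (N - 2) * (2 - N) < (N - 4) / (N - 2) * \<alpha>"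
    using N \<alpha> by (intro mult_strict_left_mono) auto
  ultimately show ?thesis using \<beta>1 by (simp add: k_def)
qed

lemma mk_diff: "m - k = \<alpha> - \<beta> - 2" by (simp add: m_def k_def field_simps)

lemma km: "k < m" using mk_diff \<beta>2 by linarith

lemma m: "0 < m" using k km by simp

lemma r: "0 < r" using k km by (simp add: r_def)

lemma rk: "r * k = 2 * (m - k)" using k by (simp add: r_def)

lemma a_eq: "N + \<alpha> - 2 = m + k" by (simp add: m_def k_def field_simps)

lemma N\<beta>: "N + \<beta> = 2 * k" and N2m: "N + 2 * \<alpha> - \<beta> - 4 = 2 * m"
  by (simp_all add: k_def m_def)

text \<open>Criticality in the new parameters: the powers of |x| produced by the nonlinearity
  cancel, so the equation on the line has no explicit t.\<close>

lemma N\<gamma>: "N + \<gamma> = m * (r + 2)"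
proof -
  have "2 * k * (N + \<gamma>) = 2 * k * (m * (r + 2))"
  proof -
    have "2 * k * (m * (r + 2)) = 2 * m * (r * k) + 4 * m * k" by (simp add: algebra_simps)
    then show ?thesis using \<gamma> unfolding rk N\<beta> N2m by (simp add: power2_eq_square algebra_simps)
  qed
  then show ?thesis using k by simp
qed

lemma crit_exp_eq: "crit_exp N \<alpha> \<beta> \<gamma> - 2 = r"
proof -
  have "crit_exp N \<alpha> \<beta> \<gamma> = (N + \<gamma>) / m" by (simp add: crit_exp_def m_def)
  then show ?thesis using m by (simp add: N\<gamma>)
qed

definition "q = 2 * k / (m - k)"

lemma bubble_const_powr: "bubble_const N \<alpha> \<beta> powr r = (m - k) ^ 4 * (q * (q + 1) * (q + 2) * (q + 3))"
  and bubble_const_pos: "0 < bubble_const N \<alpha> \<beta>"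
proof -
  let ?d = "m - k"
  have d: "0 < ?d" using km by simp
  have q: "?d * q = 2 * k" using d by (simp add: q_def)
  let ?P = "(N + \<beta>) * (N + \<alpha> - 2) * (N + 2 * \<alpha> - \<beta> - 4) * (N + 3 * \<alpha> - 2 * \<beta> - 6)"
  \<comment> \<open>The four factors form the arithmetic progression 2 k, 2 k + d, 2 k + 2 d, 2 k +
    3 d with d = m - k; in units of d they are q, ..., q + 3.\<close>
  have "?P = (2 * k) * (2 * k + ?d) * (2 * k + 2 * ?d) * (2 * k + 3 * ?d)"
    by (simp add: k_def m_def field_simps)
  also have "\<dots> = (?d * q) * (?d * q + ?d) * (?d * q + 2 * ?d) * (?d * q + 3 * ?d)" unfolding q ..
  also have "\<dots> = ?d ^ 4 * (q * (q + 1) * (q + 2) * (q + 3))"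
    by (simp add: power4_eq_xxxx algebra_simps)
  finally have P: "?P = ?d ^ 4 * (q * (q + 1) * (q + 2) * (q + 3))" .
  have q0: "0 < q" using k d by (simp add: q_def)
  have P0: "0 < ?P" unfolding P using d q0 by simp
  have "0 < x powr a" if "0 < x" for x a :: real using that by simp
  from this[OF P0] show "0 < bubble_const N \<alpha> \<beta>" unfolding bubble_const_def .
  \<comment> \<open>The exponent of the normalising constant is 1/r, so its r-th power is the bare
    product.\<close>
  have e: "(N + \<beta>) / (4 * (\<alpha> - \<beta> - 2)) * r = 1"
  proof -
    have "(N + \<beta>) / (4 * (\<alpha> - \<beta> - 2)) = 2 * k / (4 * ?d)" unfolding mk_diff N\<beta> ..
    moreover have "2 * k / (4 * ?d) * r = 1" using k d by (simp add: r_def)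
    ultimately show ?thesis by (simp only:)
  qed
  show "bubble_const N \<alpha> \<beta> powr r = ?d ^ 4 * (q * (q + 1) * (q + 2) * (q + 3))"
  proof -
    have "(x powr a) powr r = x" if "0 < x" "a * r = 1" for x a using that by (simp add: powr_powr)
    from this[OF P0 e] show ?thesis unfolding bubble_const_def P .
  qed
qed

definition "profile \<tau> t = bubble_const N \<alpha> \<beta> * sech_pow (m - k) q (t + \<tau>)"

text \<open>Dilation by s becomes translation of the profile by ln s. The origin has to be excluded
  because the logarithm carries no information there.\<close>

lemma scaled_bubble_eq_lift:
  fixes x :: "'a::euclidean_space"
  assumes s: "0 < s" and x: "x \<noteq> 0"
  shows "scaled_bubble N \<alpha> \<beta> s x = lift (- m) (profile (ln s)) x"
proof -
  let ?d = "m - k" and ?z = "s * norm x" and ?C = "bubble_const N \<alpha> \<beta>"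
  have d: "0 < ?d" using km by simp
  have z: "0 < ?z" using s x by simp
  have lz: "ln (norm x) + ln s = ln ?z" using s x by (simp add: ln_mult)
  have Nb: "(N + \<beta>) / ?d = q" unfolding N\<beta> q_def ..
  have "scaled_bubble N \<alpha> \<beta> s x = s powr m * (?C / (?z powr ?d * (1 + ?z powr ?d) powr q))"
    using s by (simp add: scaled_bubble_def bubble_def mk_diff[symmetric] Nb N2m)
  also have "\<dots> = ?C * (s powr m * ?z powr (- ?d)) * (1 + ?z powr ?d) powr (- q)"
    by (simp only: powr_minus divide_inverse inverse_mult_distrib mult_ac)
  also have "s powr m * ?z powr (- ?d) = norm x powr (- m) * ?z powr k"
  proof -
    have "?z powr (- ?d) = ?z powr (- m) * ?z powr k" by (simp add: powr_add[symmetric])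
    moreover have "s powr m * ?z powr (- m) = norm x powr (- m)"
      using s by (simp add: powr_mult powr_minus)
    ultimately show ?thesis by (metis mult.assoc)
  qed
  also have "?C * (norm x powr (- m) * ?z powr k) * (1 + ?z powr ?d) powr (- q) = lift (- m) (profile (ln s)) x"
  proof -
    have "?d * q / 2 = k" using d by (simp add: q_def)
    moreover have "exp (c * ln z) = z powr c" if "0 < z" for c z :: real using that by (simp add: powr_def)
    note this[OF z, of k] this[OF z, of ?d]
    ultimately show ?thesis by (simp add: lift_def profile_def sech_pow_def lz)
  qed
  finally show ?thesis .
qed

text \<open>The bounds by e^(-k |t|) at both ends go beyond what an orbit provides; they dominate
  the energy of the cut-off errors when the bubble is placed in the energy space.\<close>

lemma profile_orbit:
  obtains y1 w w1 B K where "orbit k m r (profile \<tau>) y1 w w1 (bubble_const N \<alpha> \<beta> * exp (k * \<tau>)) B"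
    "\<And>t. \<bar>profile \<tau> t\<bar> \<le> K * exp (- k * \<bar>t\<bar>)" "\<And>t. \<bar>y1 t\<bar> \<le> K * exp (- k * \<bar>t\<bar>)"
    "\<And>t. \<bar>w t\<bar> \<le> K * exp (- k * \<bar>t\<bar>)"
proof -
  let ?S = "\<lambda>n t. sech_pow (m - k) n (t + \<tau>)"
  define C where "C = bubble_const N \<alpha> \<beta>"
  define D where "D = C * (m - k)\<^sup>2 * q * (q + 1)"
  have C: "0 < C" unfolding C_def by (rule bubble_const_pos)
  have d: "0 < m - k" using km by simp
  have q0: "0 < q" using k d by (simp add: q_def)
  have qk: "(m - k) * q / 2 = k" using d by (simp add: q_def)
  have qm: "(m - k) * (q + 2) / 2 = m" using qk by (simp add: distrib_left add_divide_distrib)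
  have D0: "0 < D" using C d q0 by (simp add: D_def)
  note O = sech_orbit[OF k km C r_def q_def, of \<tau>, folded D_def]
  have shift: "exp (- k * \<bar>t + \<tau>\<bar>) \<le> exp (k * \<bar>\<tau>\<bar>) * exp (- k * \<bar>t\<bar>)" for t
  proof -
    have "k * \<bar>t\<bar> \<le> k * (\<bar>t + \<tau>\<bar> + \<bar>\<tau>\<bar>)" using k by (intro mult_left_mono) auto
    then show ?thesis by (simp add: exp_add[symmetric] distrib_left)
  qed
  have S1: "\<bar>?S q t\<bar> \<le> exp (k * \<bar>\<tau>\<bar>) * exp (- k * \<bar>t\<bar>)" for t
    using sech_pow_le[OF d, of q "t + \<tau>"] shift[of t] q0 sech_pow_pos[of "m - k" q "t + \<tau>"]
    unfolding qk by simp
  have S2: "\<bar>?S (q + 2) t\<bar> \<le> exp (k * \<bar>\<tau>\<bar>) * exp (- k * \<bar>t\<bar>)" for t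
  proof -
    have "exp (- m * \<bar>t + \<tau>\<bar>) \<le> exp (- k * \<bar>t + \<tau>\<bar>)"
      using km by (simp add: mult_right_mono)
    moreover have "?S (q + 2) t \<le> exp (- m * \<bar>t + \<tau>\<bar>)"
      using sech_pow_le[OF d, of "q + 2" "t + \<tau>"] q0 unfolding qm by simp
    ultimately show ?thesis using shift[of t] sech_pow_pos[of "m - k" "q + 2" "t + \<tau>"] by linarith
  qed
  define K where "K = (C + C * k + D) * exp (k * \<bar>\<tau>\<bar>)"
  have cK: "\<bar>c * x\<bar> \<le> K * exp (- k * \<bar>t\<bar>)" if "\<bar>x\<bar> \<le> exp (k * \<bar>\<tau>\<bar>) * exp (- k * \<bar>t\<bar>)" "\<bar>c\<bar> \<le> C + C * k + D" for c x t
    unfolding abs_mult K_def mult.assoc using that by (intro mult_mono) auto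
  show ?thesis
  proof (rule that)
    show "orbit k m r (profile \<tau>) (\<lambda>t. C * (k * (?S q t * neg_tanh (m - k) (t + \<tau>)))) (\<lambda>t. - D * ?S (q + 2) t)
      (\<lambda>t. - D * (m * (?S (q + 2) t * neg_tanh (m - k) (t + \<tau>)))) (bubble_const N \<alpha> \<beta> * exp (k * \<tau>)) (- D * exp (m * \<tau>))"
      using O bubble_const_powr unfolding profile_def[abs_def] C_def by blast
    show "\<bar>profile \<tau> t\<bar> \<le> K * exp (- k * \<bar>t\<bar>)" for t
      unfolding profile_def C_def[symmetric] by (rule cK[OF S1]) (use C D0 k in simp)
    show "\<bar>C * (k * (?S q t * neg_tanh (m - k) (t + \<tau>)))\<bar> \<le> K * exp (- k * \<bar>t\<bar>)" for t
    proof -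
      have "\<bar>?S q t * neg_tanh (m - k) (t + \<tau>)\<bar> \<le> \<bar>?S q t\<bar> * 1"
        unfolding abs_mult by (intro mult_left_mono abs_neg_tanh_le_1) auto
      then have "\<bar>?S q t * neg_tanh (m - k) (t + \<tau>)\<bar> \<le> exp (k * \<bar>\<tau>\<bar>) * exp (- k * \<bar>t\<bar>)" using S1[of t] by simp
      from cK[OF this, of "C * k"] show ?thesis using C D0 k by (simp add: mult.assoc)
    qed
    show "\<bar>- D * ?S (q + 2) t\<bar> \<le> K * exp (- k * \<bar>t\<bar>)" for t
      by (rule cK[OF S2]) (use C D0 k in simp)
  qed
qed

lemma profile_pos: "0 < profile \<tau> t"
  using bubble_const_pos sech_pow_pos by (simp add: profile_def)

end

section \<open>The energy space\<close>

lemma integral_Cauchy_Schwarz: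
  fixes X Y :: "'a \<Rightarrow> real"
  assumes X: "integrable M (\<lambda>x. (X x)\<^sup>2)" and Y: "integrable M (\<lambda>x. (Y x)\<^sup>2)"
    and XY: "integrable M (\<lambda>x. X x * Y x)"
  shows "\<bar>LINT x|M. X x * Y x\<bar> \<le> sqrt (LINT x|M. (X x)\<^sup>2) * sqrt (LINT x|M. (Y x)\<^sup>2)"
proof -
  define a b c where "a = (LINT x|M. (X x)\<^sup>2)" and "b = (LINT x|M. (Y x)\<^sup>2)" and "c = (LINT x|M. X x * Y x)"
  have q: "0 \<le> a - 2 * s * c + s\<^sup>2 * b" for s
  proof -
    have "0 \<le> (LINT x|M. (X x - s * Y x)\<^sup>2)" by (rule integral_nonneg_AE) simp
    also have "(\<lambda>x. (X x - s * Y x)\<^sup>2) = (\<lambda>x. (X x)\<^sup>2 - 2 * s * (X x * Y x) + s\<^sup>2 * (Y x)\<^sup>2)"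
      by (simp add: power2_eq_square algebra_simps fun_eq_iff)
    also have "(LINT x|M. (X x)\<^sup>2 - 2 * s * (X x * Y x) + s\<^sup>2 * (Y x)\<^sup>2) = a - 2 * s * c + s\<^sup>2 * b"
      unfolding a_def b_def c_def using X Y XY by simp
    finally show ?thesis .
  qed
  have b0: "0 \<le> b" unfolding b_def by (rule integral_nonneg_AE) simp
  have "c\<^sup>2 \<le> a * b"
  proof (cases "b = 0")
    case True
    have "c = 0"
    proof (rule ccontr)
      assume "c \<noteq> 0"
      \<comment> \<open>For b = 0 the quadratic is affine in s, and this s makes its value
        -1.\<close>
      then show False using q[of "(a + 1) / (2 * c)"] True by simp
    qed
    then show ?thesis using True by simp
  next
    case False
    have "0 \<le> b * (a - 2 * (c / b) * c + (c / b)\<^sup>2 * b)" using q b0 by (intro mult_nonneg_nonneg)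
    also have "\<dots> = a * b - c\<^sup>2" using False by (simp add: power2_eq_square field_simps)
    finally show ?thesis by simp
  qed
  then have "sqrt (c\<^sup>2) \<le> sqrt (a * b)" by (rule real_sqrt_le_mono)
  then show ?thesis by (simp add: real_sqrt_mult a_def b_def c_def)
qed

lemma lift_mult: "lift c f x * lift d g x = lift (c + d) (\<lambda>t. f t * g t) x"
  by (simp add: lift_def powr_add mult_ac)

lemma lift_cong: "(\<And>t. f t = g t) \<Longrightarrow> lift c f x = lift c g x"
  by (simp add: lift_def)

lemma wdiv_test_support:
  fixes \<phi> :: "'a::euclidean_space \<Rightarrow> real"
  assumes "\<phi> \<in> test_functions"
  obtains R where "\<And>x. R < norm x \<Longrightarrow> wdiv \<alpha> \<phi> x = 0"
proof -
  obtain r R where r: "0 < r" "\<And>x. norm x < r \<or> R < norm x \<Longrightarrow> \<phi> x = 0"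
    using test_functions_support[OF assms] by blast
  have ps: "pd \<phi> i x = 0" if "norm x < r \<or> R < norm x" for i x
    using pd_support[of r R \<phi> x i, OF r(2)] that by blast
  have pps: "pd (pd \<phi> i) j x = 0" if "norm x < r \<or> R < norm x" for i j x
    using pd_support[of r R "pd \<phi> i" x j, OF ps] that by blast
  show ?thesis by (rule that[of R]) (simp add: wdiv_test[OF assms] ps pps)
qed

locale emden_fowler_space = emden_fowler N \<alpha> \<beta> \<gamma> k m r
  for N \<alpha> \<beta> \<gamma> k m r :: real and ty :: "'a::euclidean_space itself" +
  assumes dim: "N = real DIM('a)"
begin

text \<open>Distributing the weight evenly turns the energy norm into an ordinary L2 norm, ready for
  Cauchy-Schwarz.\<close>

lemma D_norm_eq:
  fixes \<phi> :: "'a \<Rightarrow> real"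
  assumes \<phi>: "\<phi> \<in> test_functions"
  shows "integrable lborel (\<lambda>x. (wdiv \<alpha> \<phi> x * lift (- \<beta> / 2) (\<lambda>_. 1) x)\<^sup>2)"
    and "D_norm \<alpha> \<beta> \<phi> = sqrt (LINT x|lborel. (wdiv \<alpha> \<phi> x * lift (- \<beta> / 2) (\<lambda>_. 1) x)\<^sup>2)"
proof -
  let ?X = "\<lambda>x. wdiv \<alpha> \<phi> x * lift (- \<beta> / 2) (\<lambda>_. 1) x"
  have c: "continuous_on UNIV (\<lambda>x. (?X x)\<^sup>2)"
    using wdiv_lift_continuous[OF \<phi>, of "\<lambda>_. 1"] by (intro continuous_on_power) auto
  obtain R where "\<And>x. R < norm x \<Longrightarrow> wdiv \<alpha> \<phi> x = 0" using wdiv_test_support[OF \<phi>] by blast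
  then show "integrable lborel (\<lambda>x. (?X x)\<^sup>2)"
    by (intro integrable_compact_support[OF c, of R]) simp
  have "norm x powr (- \<beta>) * \<bar>wdiv \<alpha> \<phi> x\<bar>\<^sup>2 = (?X x)\<^sup>2" for x
  proof -
    have "norm x powr (- \<beta>) = norm x powr (- \<beta> / 2) * norm x powr (- \<beta> / 2)"
      by (simp add: powr_add[symmetric])
    then show ?thesis by (simp add: lift_def power_mult_distrib power2_eq_square)
  qed
  then show "D_norm \<alpha> \<beta> \<phi> = sqrt (LINT x|lborel. (?X x)\<^sup>2)"
    unfolding D_norm_def using borel_measurable_continuous_onI[OF c] by (simp add: integral_completion)
qed

section \<open>Duality between the energy space and radial weights\<close>

text \<open>Here \<eta> = (D + m)(D - k) \<zeta> with \<zeta> in L2. Such a \<zeta> certifies that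
  pairing with the weight of profile \<eta> is bounded in the energy norm.\<close>

definition admissible :: "(real \<Rightarrow> real) \<Rightarrow> (real \<Rightarrow> real) \<Rightarrow> bool" where
  "admissible \<zeta> \<eta> \<longleftrightarrow> (\<exists>\<zeta>1 \<zeta>2. (\<forall>t. (\<zeta> has_real_derivative \<zeta>1 t) (at t)) \<and>
     (\<forall>t. (\<zeta>1 has_real_derivative \<zeta>2 t) (at t)) \<and> continuous_on UNIV \<zeta>2 \<and>
     (\<forall>t. \<eta> t = \<zeta>2 t + (m - k) * \<zeta>1 t - m * k * \<zeta> t)) \<and>
     integrable lborel (\<lambda>t. (\<zeta> t)\<^sup>2)"

lemma admissible_continuous:
  assumes "admissible \<zeta> \<eta>" shows "continuous_on UNIV \<eta>" "continuous_on UNIV \<zeta>"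
proof -
  obtain \<zeta>1 \<zeta>2 where z: "\<And>t. (\<zeta> has_real_derivative \<zeta>1 t) (at t)" "\<And>t. (\<zeta>1 has_real_derivative \<zeta>2 t) (at t)"
    "continuous_on UNIV \<zeta>2" "\<And>t. \<eta> t = \<zeta>2 t + (m - k) * \<zeta>1 t - m * k * \<zeta> t"
    using assms unfolding admissible_def by blast
  show c0: "continuous_on UNIV \<zeta>" using z(1) by (meson DERIV_isCont continuous_at_imp_continuous_on)
  have c1: "continuous_on UNIV \<zeta>1" using z(2) by (meson DERIV_isCont continuous_at_imp_continuous_on)
  have "continuous_on UNIV (\<lambda>t. \<zeta>2 t + (m - k) * \<zeta>1 t - m * k * \<zeta> t)"
    by (intro continuous_intros z(3) c0 c1)
  then show "continuous_on UNIV \<eta>" using z(4) by simp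
qed

text \<open>After integration by parts, |x|^(-k) \<zeta> is split into the weight of the energy norm
  and |x|^(\<beta>/2 - k) \<zeta>. The square of the latter has exponent \<beta> - 2 k = -N, so its
  integral is the unweighted L2 norm of \<zeta> times the area of the sphere.\<close>

lemma pairing_bound:
  fixes \<phi> :: "'a \<Rightarrow> real"
  assumes \<phi>: "\<phi> \<in> test_functions" and adm: "admissible \<zeta> \<eta>"
  shows "\<bar>LINT x|lborel. \<phi> x * lift (\<alpha> - k - 2) \<eta> x\<bar> \<le> D_norm \<alpha> \<beta> \<phi> * sqrt (sphere_const DIM('a) * (LINT t|lborel. (\<zeta> t)\<^sup>2))"
    and "integrable lborel (\<lambda>x. \<phi> x * lift (\<alpha> - k - 2) \<eta> x)"
proof -
  obtain \<zeta>1 \<zeta>2 where z: "\<And>t. (\<zeta> has_real_derivative \<zeta>1 t) (at t)" "\<And>t. (\<zeta>1 has_real_derivative \<zeta>2 t) (at t)"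
    "continuous_on UNIV \<zeta>2" "\<And>t. \<eta> t = \<zeta>2 t + (m - k) * \<zeta>1 t - m * k * \<zeta> t"
    and zi: "integrable lborel (\<lambda>t. (\<zeta> t)\<^sup>2)"
    using adm unfolding admissible_def by blast
  have [measurable]: "\<zeta> \<in> borel_measurable borel"
    by (rule borel_measurable_continuous_onI[OF admissible_continuous(2)[OF adm]])
  have c1: "2 * - k + real DIM('a) + \<alpha> - 2 = m - k" and c2: "- k * (- k + real DIM('a) + \<alpha> - 2) = - (m * k)"
    using a_eq by (simp_all add: dim algebra_simps)
  have eta: "\<eta> = (\<lambda>t. \<zeta>2 t + (2 * - k + real DIM('a) + \<alpha> - 2) * \<zeta>1 t + - k * (- k + real DIM('a) + \<alpha> - 2) * \<zeta> t)"
    unfolding c1 c2 using z(4) by (simp add: fun_eq_iff)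
  have ex: "\<alpha> + - k - 2 = \<alpha> - k - 2" by simp
  note IBP = wdiv_lift_by_parts[OF \<phi> z(1,2,3), of \<alpha> "- k", folded eta, unfolded ex]
  let ?X = "\<lambda>x. wdiv \<alpha> \<phi> x * lift (- \<beta> / 2) (\<lambda>_. 1) x" and ?Y = "\<lambda>x::'a. lift (\<beta> / 2 - k) \<zeta> x"
  have XY: "?X x * ?Y x = wdiv \<alpha> \<phi> x * lift (- k) \<zeta> x" for x
    by (simp add: mult.assoc lift_mult)
  have Y2: "(?Y x)\<^sup>2 = lift (\<beta> - 2 * k) (\<lambda>t. (\<zeta> t)\<^sup>2) x" for x :: 'a
    unfolding power2_eq_square lift_mult by simp
  have ne: "real DIM('a) + (\<beta> - 2 * k) = 0" using N\<beta> by (simp add: dim)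
  note Yint = lift_integral[of "\<lambda>t. (\<zeta> t)\<^sup>2" "\<beta> - 2 * k", where 'a='a, unfolded ne]
  have iY: "integrable lborel (\<lambda>x. (?Y x)\<^sup>2)" unfolding Y2 using Yint(2) zi by (simp add: eta_contract_eq)
  have "\<bar>LINT x|lborel. ?X x * ?Y x\<bar> \<le> sqrt (LINT x|lborel. (?X x)\<^sup>2) * sqrt (LINT x|lborel. (?Y x)\<^sup>2)"
    by (rule integral_Cauchy_Schwarz[OF D_norm_eq(1)[OF \<phi>] iY]) (simp only: XY IBP(2))
  then show "\<bar>LINT x|lborel. \<phi> x * lift (\<alpha> - k - 2) \<eta> x\<bar> \<le> D_norm \<alpha> \<beta> \<phi> * sqrt (sphere_const DIM('a) * (LINT t|lborel. (\<zeta> t)\<^sup>2))"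
    unfolding XY IBP(1) D_norm_eq(2)[OF \<phi>] Y2 using Yint(1) by simp
  show "integrable lborel (\<lambda>x. \<phi> x * lift (\<alpha> - k - 2) \<eta> x)" by (rule IBP(3))
qed

lemma compact_annulus: "compact {x::'a. exp a \<le> norm x \<and> norm x \<le> exp b}" "0 \<notin> {x::'a. exp a \<le> norm x \<and> norm x \<le> exp b}"
proof -
  have "closed {x::'a. exp a \<le> norm x \<and> norm x \<le> exp b}"
    by (intro closed_Collect_conj closed_Collect_le continuous_intros)
  moreover have "bounded {x::'a. exp a \<le> norm x \<and> norm x \<le> exp b}"
    by (rule bounded_subset[OF bounded_cball[of 0 "exp b"]]) auto
  ultimately show "compact {x::'a. exp a \<le> norm x \<and> norm x \<le> exp b}" by (simp add: compact_eq_bounded_closed)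
  show "0 \<notin> {x::'a. exp a \<le> norm x \<and> norm x \<le> exp b}" by (simp add: not_le)
qed

lemma lift_outside_annulus:
  assumes "\<And>t. t < a \<or> b < t \<Longrightarrow> \<eta> t = 0" "x \<notin> {x. exp a \<le> norm x \<and> norm x \<le> exp b}"
  shows "lift c \<eta> x = 0"
proof (cases "x = 0")
  case False
  then have "ln (norm x) < a \<or> b < ln (norm x)" using assms(2) by (intro ln_norm_outside) auto
  then show ?thesis using assms(1) by (auto simp: lift_def)
qed (simp add: lift_def)

lemma lift_bounded:
  assumes "continuous_on UNIV \<eta>" "\<And>t. t < a \<or> b < t \<Longrightarrow> \<eta> t = 0"
  obtains B where "\<And>x::'a. \<bar>lift c \<eta> x\<bar> \<le> B"
proof -
  let ?K = "{x::'a. exp a \<le> norm x \<and> norm x \<le> exp b}"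
  have "compact (lift c \<eta> ` ?K)"
    using compact_annulus[of a b]
    by (intro compact_continuous_image continuous_on_subset[OF lift_continuous_on[OF assms(1)]]) auto
  then obtain B where B: "\<And>y. y \<in> lift c \<eta> ` ?K \<Longrightarrow> norm y \<le> B"
    using bounded_iff compact_imp_bounded by metis
  have "\<bar>lift c \<eta> x\<bar> \<le> max B 0" for x :: 'a
  proof (cases "x \<in> ?K")
    case True
    then have "norm (lift c \<eta> x) \<le> B" by (intro B) auto
    then show ?thesis by simp
  next
    case False
    then show ?thesis using lift_outside_annulus[OF assms(2) False, where c=c] by simp
  qed
  then show ?thesis by (rule that)
qed

lemma integral_against_profile:
  fixes u :: "'a \<Rightarrow> real"
  assumes [measurable]: "v \<in> borel_measurable borel" "\<eta> \<in> borel_measurable borel"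
    and u: "u \<in> borel_measurable lebesgue"
    and uv: "AE x in lborel. u x = lift (- m) v x"
  shows "(LINT x|lebesgue. u x * lift (\<alpha> - k - 2) \<eta> x) = sphere_const DIM('a) * (LINT t|lborel. v t * \<eta> t)"
proof -
  have "(LINT x|lebesgue. u x * lift (\<alpha> - k - 2) \<eta> x) = (LINT x|(lebesgue::'a measure). lift (- m + (\<alpha> - k - 2)) (\<lambda>t. v t * \<eta> t) x)"
  proof (rule integral_cong_AE)
    show "(\<lambda>x. u x * lift (\<alpha> - k - 2) \<eta> x) \<in> borel_measurable lebesgue"
      by (intro borel_measurable_times u measurable_completion) simp
    show "(\<lambda>x::'a. lift (- m + (\<alpha> - k - 2)) (\<lambda>t. v t * \<eta> t) x) \<in> borel_measurable lebesgue"
      by (intro measurable_completion) simp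
    have "AE x in lborel. u x * lift (\<alpha> - k - 2) \<eta> x = lift (- m + (\<alpha> - k - 2)) (\<lambda>t. v t * \<eta> t) x"
      using uv by eventually_elim (simp only: lift_mult)
    then show "AE x in lebesgue. u x * lift (\<alpha> - k - 2) \<eta> x = lift (- m + (\<alpha> - k - 2)) (\<lambda>t. v t * \<eta> t) x"
      by (rule AE_completion)
  qed
  also have "\<dots> = (LINT x|(lborel::'a measure). lift (- m + (\<alpha> - k - 2)) (\<lambda>t. v t * \<eta> t) x)"
    by (rule integral_completion) simp
  also have "real DIM('a) + (- m + (\<alpha> - k - 2)) = 0" using a_eq by (simp add: dim)
  then have "(LINT x|(lborel::'a measure). lift (- m + (\<alpha> - k - 2)) (\<lambda>t. v t * \<eta> t) x) = sphere_const DIM('a) * (LINT t|lborel. v t * \<eta> t)"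
    by (subst lift_integral(1)) simp_all
  finally show ?thesis .
qed

text \<open>The restrictions to an exhausting sequence of annuli are measurable and eventually equal
  u at each nonzero point; the value at the origin is patched in.\<close>

lemma loc_integrable_measurable:
  fixes u :: "'a \<Rightarrow> real"
  assumes "loc_integrable u" shows "u \<in> borel_measurable lebesgue"
proof -
  define K where "K n = {x::'a. exp (- real n) \<le> norm x \<and> norm x \<le> exp (real n)}" for n
  have m: "(\<lambda>x. indicator (K n) x *\<^sub>R u x) \<in> borel_measurable lebesgue" for n
    using assms compact_annulus[of "- real n" "real n"]
    unfolding loc_integrable_def set_integrable_def K_def by (intro borel_measurable_integrable) blast
  have "(\<lambda>x. if x = 0 then u 0 else lim (\<lambda>n. indicator (K n) x *\<^sub>R u x)) \<in> borel_measurable lebesgue"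
    by (intro measurable_If borel_measurable_lim_metric m) auto
  moreover have "lim (\<lambda>n. indicator (K n) x *\<^sub>R u x) = u x" if x: "x \<noteq> 0" for x
  proof (rule limI, rule tendsto_eventually)
    have "\<forall>\<^sub>F n in sequentially. \<bar>ln (norm x)\<bar> \<le> real n"
      using filterlim_at_top[THEN iffD1, OF filterlim_real_sequentially] by blast
    then show "\<forall>\<^sub>F n in sequentially. indicator (K n) x *\<^sub>R u x = u x"
    proof eventually_elim
      case (elim n)
      have "exp (- real n) \<le> exp (ln (norm x))" "exp (ln (norm x)) \<le> exp (real n)" using elim by auto
      then have "x \<in> K n" using x by (simp add: K_def)
      then show ?case by simp
    qed
  qed
  ultimately have "(\<lambda>x. if x = 0 then u 0 else u x) \<in> borel_measurable lebesgue" by (simp cong: if_cong)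
  moreover have "(\<lambda>x. if x = 0 then u 0 else u x) = u" by auto
  ultimately show ?thesis by simp
qed

text \<open>On a bounded interval the exponential Jacobian is bounded above and below, so it can be
  divided out.\<close>

lemma profile_loc_integrable:
  fixes u :: "'a \<Rightarrow> real"
  assumes u: "loc_integrable u" and [measurable]: "v \<in> borel_measurable borel"
    and uv: "AE x in lborel. u x = lift (- m) v x"
  shows "integrable lborel (\<lambda>t. indicator {a..b} t * v t)"
proof -
  let ?K = "{x::'a. exp a \<le> norm x \<and> norm x \<le> exp b}" and ?w = "\<lambda>t. indicator {a..b} t * v t"
  have "integrable lebesgue (\<lambda>x. indicator ?K x *\<^sub>R u x)"
    using u compact_annulus[of a b] unfolding loc_integrable_def set_integrable_def by blast
  moreover have "AE x in lborel. indicator ?K x *\<^sub>R u x = lift (- m) ?w x"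
    using uv AE_lborel_singleton[of "0::'a"]
  proof eventually_elim
    case (elim x)
    have "exp a \<le> norm x \<longleftrightarrow> a \<le> ln (norm x)" "norm x \<le> exp b \<longleftrightarrow> ln (norm x) \<le> b"
      using elim(2) by (metis exp_le_cancel_iff exp_ln zero_less_norm_iff)+
    then show ?case using elim by (auto simp: indicator_def lift_def)
  qed
  ultimately have "integrable lebesgue (lift (- m) ?w :: 'a \<Rightarrow> real)"
    by (subst integrable_cong_AE[OF _ _ AE_completion, symmetric])
      (auto intro: borel_measurable_integrable measurable_completion)
  then have "integrable lborel (lift (- m) ?w :: 'a \<Rightarrow> real)" by (subst (asm) integrable_completion) auto
  then have i: "integrable lborel (\<lambda>t. exp ((real DIM('a) + - m) * t) * ?w t)"
    by (subst (asm) lift_integral(2)) auto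
  let ?e = "\<lambda>t. indicator {a..b} t * exp (- (real DIM('a) + - m) * t)"
  have "\<bar>?e t\<bar> \<le> exp (\<bar>real DIM('a) + - m\<bar> * max \<bar>a\<bar> \<bar>b\<bar>)" for t
  proof (cases "t \<in> {a..b}")
    case True
    then have "\<bar>t\<bar> \<le> max \<bar>a\<bar> \<bar>b\<bar>" by auto
    then have "\<bar>real DIM('a) + - m\<bar> * \<bar>t\<bar> \<le> \<bar>real DIM('a) + - m\<bar> * max \<bar>a\<bar> \<bar>b\<bar>" by (rule mult_left_mono) simp
    moreover have "- (real DIM('a) + - m) * t \<le> \<bar>real DIM('a) + - m\<bar> * \<bar>t\<bar>"
      by (metis abs_ge_self abs_minus_cancel abs_mult)
    ultimately show ?thesis using True by simp
  qed simp
  from integrable_mult_bounded[OF i _ this]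
  have "integrable lborel (\<lambda>t. exp ((real DIM('a) + - m) * t) * ?w t * ?e t)" by simp
  moreover have "exp ((real DIM('a) + - m) * t) * ?w t * ?e t = ?w t" for t
    by (auto simp: indicator_def exp_add[symmetric] algebra_simps)
  ultimately show ?thesis by (simp only:)
qed

text \<open>One index n serves all weights at once. Convergence in L1 on an annulus replaces u by
  \<phi> l with l large, and the Cauchy property bounds the pairing with \<phi> l - \<phi> n through
  the energy norm.\<close>

lemma D_space_functional:
  fixes u :: "'a \<Rightarrow> real"
  assumes uD: "u \<in> D_space \<alpha> \<beta>" and [measurable]: "v \<in> borel_measurable borel"
    and uv: "AE x in lborel. u x = lift (- m) v x"
  obtains \<phi> where "\<And>n::nat. \<phi> n \<in> (test_functions :: ('a \<Rightarrow> real) set)"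
    and "\<And>\<epsilon>. 0 < \<epsilon> \<Longrightarrow> \<exists>n. \<forall>\<zeta> \<eta> a b. admissible \<zeta> \<eta> \<longrightarrow> (\<forall>t. t < a \<or> b < t \<longrightarrow> \<eta> t = 0) \<longrightarrow>
      \<bar>sphere_const DIM('a) * (LINT t|lborel. v t * \<eta> t) - (LINT x|lborel. \<phi> n x * lift (\<alpha> - k - 2) \<eta> x)\<bar>
        \<le> \<epsilon> * sqrt (sphere_const DIM('a) * (LINT t|lborel. (\<zeta> t)\<^sup>2))"
proof -
  have li: "loc_integrable u" using uD by (simp add: D_space_def)
  have "\<exists>\<phi>. (\<forall>n. \<phi> n \<in> test_functions) \<and>
     (\<forall>\<epsilon>>0. \<exists>M::nat. \<forall>m\<ge>M. \<forall>n\<ge>M. D_norm \<alpha> \<beta> (\<lambda>x. \<phi> m x - \<phi> n x) < \<epsilon>) \<and>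
     (\<forall>K. compact K \<and> 0 \<notin> K \<longrightarrow> (\<lambda>n. LINT x:K|lebesgue. \<bar>\<phi> n x - u x\<bar>) \<longlonglongrightarrow> 0)"
    using uD by (simp add: D_space_def)
  then obtain \<phi> where \<phi>': "\<forall>n. \<phi> n \<in> test_functions"
    and C: "\<forall>\<epsilon>>0. \<exists>M::nat. \<forall>m\<ge>M. \<forall>n\<ge>M. D_norm \<alpha> \<beta> (\<lambda>x. \<phi> m x - \<phi> n x) < \<epsilon>"
    and L': "\<forall>K. compact K \<and> 0 \<notin> K \<longrightarrow> (\<lambda>n. LINT x:K|lebesgue. \<bar>\<phi> n x - u x\<bar>) \<longlonglongrightarrow> 0"
    by (elim exE conjE)
  have \<phi>: "\<phi> n \<in> test_functions" for n using \<phi>' by simp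
  have L: "(\<lambda>n. LINT x:K|lebesgue. \<bar>\<phi> n x - u x\<bar>) \<longlonglongrightarrow> 0" if "compact K" "0 \<notin> K" for K
    using L' that by simp
  note um = loc_integrable_measurable[OF li]
  show ?thesis
  proof (rule that[of \<phi>, OF \<phi>])
    fix \<epsilon> :: real assume \<epsilon>: "0 < \<epsilon>"
    obtain n where n: "\<And>l. n \<le> l \<Longrightarrow> D_norm \<alpha> \<beta> (\<lambda>x. \<phi> l x - \<phi> n x) < \<epsilon>" using C[rule_format, OF \<epsilon>] by (elim exE) blast
    show "\<exists>n. \<forall>\<zeta> \<eta> a b. admissible \<zeta> \<eta> \<longrightarrow> (\<forall>t. t < a \<or> b < t \<longrightarrow> \<eta> t = 0) \<longrightarrow>
      \<bar>sphere_const DIM('a) * (LINT t|lborel. v t * \<eta> t) - (LINT x|lborel. \<phi> n x * lift (\<alpha> - k - 2) \<eta> x)\<bar>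
        \<le> \<epsilon> * sqrt (sphere_const DIM('a) * (LINT t|lborel. (\<zeta> t)\<^sup>2))"
    proof (intro exI[of _ n] allI impI)
      fix \<zeta> \<eta> a b
      assume adm: "admissible \<zeta> \<eta>" and "\<forall>t. t < a \<or> b < t \<longrightarrow> \<eta> t = 0"
      then have out: "\<And>t. t < a \<or> b < t \<Longrightarrow> \<eta> t = 0" by blast
      let ?h = "\<lambda>x::'a. lift (\<alpha> - k - 2) \<eta> x" and ?K = "{x::'a. exp a \<le> norm x \<and> norm x \<le> exp b}"
      let ?S = "sqrt (sphere_const DIM('a) * (LINT t|lborel. (\<zeta> t)\<^sup>2))"
      have [measurable]: "\<eta> \<in> borel_measurable borel"
        by (rule borel_measurable_continuous_onI[OF admissible_continuous(1)[OF adm]])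
      have hm: "?h \<in> borel_measurable lebesgue" by (intro measurable_completion) simp
      obtain B where B: "\<And>x. \<bar>?h x\<bar> \<le> B" using lift_bounded[OF admissible_continuous(1)[OF adm] out] by blast
      have uK: "integrable lebesgue (\<lambda>x. indicator ?K x *\<^sub>R u x)"
        using li compact_annulus[of a b] unfolding loc_integrable_def set_integrable_def by blast
      have uh: "u x * ?h x = (indicator ?K x *\<^sub>R u x) * ?h x" for x
        using lift_outside_annulus[OF out, where x=x and c="\<alpha> - k - 2"] by (cases "x \<in> ?K") auto
      have iuh: "integrable lebesgue (\<lambda>x. u x * ?h x)"
        unfolding uh by (rule integrable_mult_bounded[OF uK hm B])
      have iph: "integrable lborel (\<lambda>x. \<phi> l x * ?h x)" for l by (rule pairing_bound(2)[OF \<phi> adm])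
      have iphl: "integrable lebesgue (\<lambda>x. \<phi> l x * ?h x)" for l
        using iph[of l] by (subst integrable_completion) (auto intro: borel_measurable_integrable)
      have eqp: "(LINT x|lebesgue. \<phi> l x * ?h x) = (LINT x|lborel. \<phi> l x * ?h x)" for l
        by (rule integral_completion[OF borel_measurable_integrable[OF iph]])
      have "(\<lambda>l. LINT x|lborel. \<phi> l x * ?h x) \<longlonglongrightarrow> (LINT x|lebesgue. u x * ?h x)"
      proof (rule LIM_zero_cancel, rule Lim_null_comparison)
        have "(\<lambda>l. B * (LINT x:?K|lebesgue. \<bar>\<phi> l x - u x\<bar>)) \<longlonglongrightarrow> B * 0"
          by (intro tendsto_intros L compact_annulus)
        then show "(\<lambda>l. B * (LINT x:?K|lebesgue. \<bar>\<phi> l x - u x\<bar>)) \<longlonglongrightarrow> 0" by simp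
        have "norm ((LINT x|lborel. \<phi> l x * ?h x) - (LINT x|lebesgue. u x * ?h x)) \<le> B * (LINT x:?K|lebesgue. \<bar>\<phi> l x - u x\<bar>)" for l
        proof -
          have pK: "integrable lebesgue (\<lambda>x. indicator ?K x *\<^sub>R \<phi> l x)"
          proof -
            have "integrable lborel (\<lambda>x. indicator ?K x *\<^sub>R \<phi> l x)"
              by (rule borel_integrable_compact[OF compact_annulus(1)])
                (rule continuous_on_subset[OF Ck_continuous[OF test_functions_Ck[OF \<phi>]]], simp)
            then show ?thesis by (subst integrable_completion) (auto intro: borel_measurable_integrable)
          qed
          have dK: "integrable lebesgue (\<lambda>x. B * (indicator ?K x *\<^sub>R \<bar>\<phi> l x - u x\<bar>))"
          proof -
            have "integrable lebesgue (\<lambda>x. \<bar>indicator ?K x *\<^sub>R \<phi> l x - indicator ?K x *\<^sub>R u x\<bar>)"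
              using pK uK by (intro integrable_abs Bochner_Integration.integrable_diff)
            moreover have "\<bar>indicator ?K x *\<^sub>R \<phi> l x - indicator ?K x *\<^sub>R u x\<bar> = indicator ?K x *\<^sub>R \<bar>\<phi> l x - u x\<bar>" for x
              by (auto simp: indicator_def)
            ultimately show ?thesis by simp
          qed
          have "(LINT x|lborel. \<phi> l x * ?h x) - (LINT x|lebesgue. u x * ?h x) = (LINT x|lebesgue. \<phi> l x * ?h x - u x * ?h x)"
            unfolding eqp[symmetric] using iphl iuh by simp
          then have "norm ((LINT x|lborel. \<phi> l x * ?h x) - (LINT x|lebesgue. u x * ?h x)) \<le> (LINT x|lebesgue. \<bar>\<phi> l x * ?h x - u x * ?h x\<bar>)"
            by (simp only: real_norm_def integral_abs_bound)
          also have "\<dots> \<le> (LINT x|lebesgue. B * (indicator ?K x *\<^sub>R \<bar>\<phi> l x - u x\<bar>))"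
          proof (rule integral_mono)
            show "integrable lebesgue (\<lambda>x. \<bar>\<phi> l x * ?h x - u x * ?h x\<bar>)" using iphl iuh by simp
            show "\<bar>\<phi> l x * ?h x - u x * ?h x\<bar> \<le> B * (indicator ?K x *\<^sub>R \<bar>\<phi> l x - u x\<bar>)" for x
            proof (cases "x \<in> ?K")
              case True
              have "\<bar>\<phi> l x * ?h x - u x * ?h x\<bar> = \<bar>?h x\<bar> * \<bar>\<phi> l x - u x\<bar>"
                by (simp add: abs_mult[symmetric] algebra_simps)
              also have "\<dots> \<le> B * \<bar>\<phi> l x - u x\<bar>" by (intro mult_right_mono B) simp
              finally show ?thesis using True by simp
            next
              case False
              then show ?thesis using lift_outside_annulus[OF out False, where c="\<alpha> - k - 2"] by simp
            qed
          qed (rule dK)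
          also have "\<dots> = B * (LINT x:?K|lebesgue. \<bar>\<phi> l x - u x\<bar>)" by (simp add: set_lebesgue_integral_def)
          finally show ?thesis .
        qed
        then show "\<forall>\<^sub>F l in sequentially. norm ((LINT x|lborel. \<phi> l x * ?h x) - (LINT x|lebesgue. u x * ?h x))
            \<le> B * (LINT x:?K|lebesgue. \<bar>\<phi> l x - u x\<bar>)" by simp
      qed
      then have lim: "(\<lambda>l. \<bar>(LINT x|lborel. \<phi> l x * ?h x) - (LINT x|lborel. \<phi> n x * ?h x)\<bar>) \<longlonglongrightarrow>
          \<bar>(LINT x|lebesgue. u x * ?h x) - (LINT x|lborel. \<phi> n x * ?h x)\<bar>"
        by (intro tendsto_intros)
      have "\<bar>(LINT x|lebesgue. u x * ?h x) - (LINT x|lborel. \<phi> n x * ?h x)\<bar> \<le> \<epsilon> * ?S"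
      proof (rule LIMSEQ_le_const2[OF lim], intro exI[of _ n] allI impI)
        fix l assume l: "n \<le> l"
        have "(LINT x|lborel. \<phi> l x * ?h x) - (LINT x|lborel. \<phi> n x * ?h x) = (LINT x|lborel. (\<phi> l x - \<phi> n x) * ?h x)"
          using iph by (simp add: left_diff_distrib)
        also have "\<bar>\<dots>\<bar> \<le> D_norm \<alpha> \<beta> (\<lambda>x. \<phi> l x - \<phi> n x) * ?S"
          by (rule pairing_bound(1)[OF test_functions_diff[OF \<phi> \<phi>] adm])
        also have "\<dots> \<le> \<epsilon> * ?S"
        proof (rule mult_right_mono)
          have "0 \<le> (LINT t|lborel. (\<zeta> t)\<^sup>2)" by (rule integral_nonneg_AE) simp
          then show "0 \<le> ?S" using sphere_const_pos[of "DIM('a)"] by simp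
        qed (use n[OF l] in simp)
        finally show "\<bar>(LINT x|lborel. \<phi> l x * ?h x) - (LINT x|lborel. \<phi> n x * ?h x)\<bar> \<le> \<epsilon> * ?S" .
      qed
      then show "\<bar>sphere_const DIM('a) * (LINT t|lborel. v t * \<eta> t) - (LINT x|lborel. \<phi> n x * ?h x)\<bar> \<le> \<epsilon> * ?S"
        using integral_against_profile[OF _ _ um uv, of \<eta>] by simp
    qed
  qed
qed

text \<open>The constant K does not depend on the position T of the unit interval. Positivity of
  both m and k gives the inverse decay at both ends and thus puts it in L2.\<close>

lemma admissible_solution:
  obtains K where "\<And>T \<eta>. test1 T (T + 1) \<eta> \<Longrightarrow>
    \<exists>\<zeta>. admissible \<zeta> \<eta> \<and> sqrt (LINT t|lborel. (\<zeta> t)\<^sup>2) \<le> K * (LINT t|lborel. \<bar>\<eta> t\<bar>)" "0 \<le> K"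
proof -
  \<comment> \<open>From (p + q)^2 \<le> 2 p^2 + 2 q^2 and the support bounds on an interval of
    length 1; the integrals of e^(-2 m |t|) and e^(-2 k |t|) are 1/m and 1/k.\<close>
  define c1 c2 where "c1 = 2 * (exp m / (m + k))\<^sup>2" and "c2 = 2 * (exp k / (m + k))\<^sup>2"
  define K where "K = sqrt (c1 / m + c2 / k)"
  have mk: "0 < m + k" using m k by simp
  have K0: "0 \<le> c1 / m + c2 / k" using m k by (simp add: c1_def c2_def)
  show ?thesis
  proof (rule that)
    show "0 \<le> K" using K0 by (simp add: K_def)
    fix T \<eta> assume t1: "test1 T (T + 1) \<eta>"
    let ?I = "LINT t|lborel. \<bar>\<eta> t\<bar>"
    have I0: "0 \<le> ?I" by (rule integral_nonneg_AE) simp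
    obtain B where B: "\<And>s. \<bar>\<eta> s\<bar> \<le> B" using test1_bounded[OF t1] by blast
    note c = test1_continuous[OF t1, of UNIV]
    define P where "P t = exp (- m * t) * Jm m \<eta> t" for t
    define Q where "Q t = exp (k * t) * Jp k \<eta> t" for t
    have e1: "exp (- m * t) * exp (m * t) = 1" "exp (k * t) * exp (- k * t) = 1" for t
      by (simp_all add: exp_add[symmetric])
    have P: "(P has_real_derivative \<eta> t - m * P t) (at t)" for t
    proof -
      have "exp (- m * t) * (exp (m * t) * \<eta> t + - m * Jm m \<eta> t) = \<eta> t - m * P t"
      proof -
        have "exp (- m * t) * (exp (m * t) * \<eta> t + - m * Jm m \<eta> t) = (exp (- m * t) * exp (m * t)) * \<eta> t - m * P t"
          unfolding P_def by (simp only: distrib_left mult.assoc) simp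
        then show ?thesis unfolding e1 by simp
      qed
      then show ?thesis using weighted_DERIV[OF Jm_DERIV[OF c B m], of "- m" t] unfolding P_def[abs_def] by simp
    qed
    have Q: "(Q has_real_derivative k * Q t - \<eta> t) (at t)" for t
    proof -
      have "exp (k * t) * (- (exp (- k * t) * \<eta> t) + k * Jp k \<eta> t) = k * Q t - \<eta> t"
      proof -
        have "exp (k * t) * (- (exp (- k * t) * \<eta> t) + k * Jp k \<eta> t) = k * Q t - (exp (k * t) * exp (- k * t)) * \<eta> t"
          unfolding Q_def by (simp only: distrib_left mult.assoc) simp
        then show ?thesis unfolding e1 by simp
      qed
      then show ?thesis using weighted_DERIV[OF Jp_DERIV[OF c B k], of k t] unfolding Q_def[abs_def] by simp
    qed
    \<comment> \<open>Partial fractions of 1 / ((D + m)(D - k)): P solves (D + m) P = \<eta> and Q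
      solves (k - D) Q = \<eta>.\<close>
    define \<zeta> where "\<zeta> t = - (P t + Q t) / (m + k)" for t
    define \<zeta>1 where "\<zeta>1 t = (m * P t - k * Q t) / (m + k)" for t
    define \<zeta>2 where "\<zeta>2 t = \<eta> t - (m\<^sup>2 * P t + k\<^sup>2 * Q t) / (m + k)" for t
    have d0: "(\<zeta> has_real_derivative \<zeta>1 t) (at t)" for t
      unfolding \<zeta>_def[abs_def]
      by (rule DERIV_cong[OF DERIV_cdivide[OF DERIV_minus[OF DERIV_add[OF P Q]]]]) (simp add: \<zeta>1_def)
    have d1: "(\<zeta>1 has_real_derivative \<zeta>2 t) (at t)" for t
      unfolding \<zeta>1_def[abs_def]
      by (rule DERIV_cong[OF DERIV_cdivide[OF DERIV_diff[OF DERIV_cmult[OF P] DERIV_cmult[OF Q]]]])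
        (use mk in \<open>simp add: \<zeta>2_def field_simps power2_eq_square\<close>)
    have Pc: "continuous_on UNIV P" using P by (meson DERIV_isCont continuous_at_imp_continuous_on)
    have Qc: "continuous_on UNIV Q" using Q by (meson DERIV_isCont continuous_at_imp_continuous_on)
    have [measurable]: "P \<in> borel_measurable borel" "Q \<in> borel_measurable borel"
      by (rule borel_measurable_continuous_onI[OF Pc], rule borel_measurable_continuous_onI[OF Qc])
    have [measurable]: "\<zeta> \<in> borel_measurable borel" unfolding \<zeta>_def by measurable
    have c2': "continuous_on UNIV \<zeta>2" unfolding \<zeta>2_def using mk by (intro continuous_intros c Pc Qc) auto
    have et: "\<eta> t = \<zeta>2 t + (m - k) * \<zeta>1 t - m * k * \<zeta> t" for t
    proof -
      have "\<zeta>2 t + (m - k) * \<zeta>1 t - m * k * \<zeta> t = \<eta> t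
          + ((m - k) * (m * P t - k * Q t) + m * k * (P t + Q t) - (m\<^sup>2 * P t + k\<^sup>2 * Q t)) / (m + k)"
        by (simp add: \<zeta>2_def \<zeta>1_def \<zeta>_def add_divide_distrib diff_divide_distrib algebra_simps)
      also have "(m - k) * (m * P t - k * Q t) + m * k * (P t + Q t) - (m\<^sup>2 * P t + k\<^sup>2 * Q t) = 0"
        by (simp add: power2_eq_square algebra_simps)
      finally show ?thesis by simp
    qed
    let ?G = "\<lambda>t. ?I\<^sup>2 * (c1 * (exp (- (2 * m) * \<bar>T - t\<bar>) * exp (0 * t)) + c2 * (exp (- (2 * k) * \<bar>(T + 1) - t\<bar>) * exp (0 * t)))"
    have Z: "(\<zeta> t)\<^sup>2 \<le> ?G t" for t
    proof -
      have sq: "(A * exp (- c * z))\<^sup>2 = A\<^sup>2 * exp (- (2 * c) * z)" for A c z :: real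
        by (simp add: power_mult_distrib power2_eq_square exp_add[symmetric])
      define p where "p = exp m / (m + k) * exp (- m * \<bar>t - T\<bar>)"
      define q where "q = exp k / (m + k) * exp (- k * \<bar>t - (T + 1)\<bar>)"
      have "\<bar>P t\<bar> \<le> exp m * exp (- m * \<bar>t - T\<bar>) * ?I" "\<bar>Q t\<bar> \<le> exp k * exp (- k * \<bar>t - (T + 1)\<bar>) * ?I"
        using Jm_test1_bound[OF t1 m, of t] Jp_test1_bound[OF t1 k, of t] by (simp_all add: P_def Q_def)
      then have "\<bar>P t + Q t\<bar> \<le> (exp m * exp (- m * \<bar>t - T\<bar>) + exp k * exp (- k * \<bar>t - (T + 1)\<bar>)) * ?I"
        by (simp add: distrib_right)
      then have "\<bar>P t + Q t\<bar> / (m + k) \<le> (exp m * exp (- m * \<bar>t - T\<bar>) + exp k * exp (- k * \<bar>t - (T + 1)\<bar>)) * ?I / (m + k)"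
        using mk by (intro divide_right_mono) auto
      moreover have "\<bar>\<zeta> t\<bar> = \<bar>P t + Q t\<bar> / (m + k)"
        using mk by (simp only: \<zeta>_def abs_divide abs_minus_cancel abs_of_pos)
      ultimately have z: "\<bar>\<zeta> t\<bar> \<le> (p + q) * ?I"
        using mk by (simp add: p_def q_def add_divide_distrib distrib_right)
      have "(\<zeta> t)\<^sup>2 \<le> ((p + q) * ?I)\<^sup>2" using z power_mono[OF z, of 2] by simp
      also have "\<dots> \<le> ?I\<^sup>2 * (2 * p\<^sup>2 + 2 * q\<^sup>2)"
      proof -
        have "(p + q)\<^sup>2 \<le> 2 * p\<^sup>2 + 2 * q\<^sup>2" using sum_squares_bound[of p q] by (simp add: power2_sum)
        from mult_right_mono[OF this, of "?I\<^sup>2"] show ?thesis by (simp add: power_mult_distrib mult_ac)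
      qed
      also have "2 * p\<^sup>2 = c1 * exp (- (2 * m) * \<bar>T - t\<bar>)"
        unfolding p_def sq c1_def abs_minus_commute[of t T] by (simp only: mult.assoc)
      also have "2 * q\<^sup>2 = c2 * exp (- (2 * k) * \<bar>(T + 1) - t\<bar>)"
        unfolding q_def sq c2_def abs_minus_commute[of t "T + 1"] by (simp only: mult.assoc)
      finally show ?thesis by simp
    qed
    have m2: "(0::real) \<le> 0" "0 < 2 * m" "0 < 2 * k" using m k by auto
    note E1 = exp_convolution[OF m2(1,2), of T] and E2 = exp_convolution[OF m2(1,3), of "T + 1"]
    have iG: "integrable lborel ?G"
      by (intro integrable_mult_right Bochner_Integration.integrable_add E1(1) E2(1))
    have vG: "(LINT t|lborel. ?G t) = ?I\<^sup>2 * (c1 / m + c2 / k)"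
    proof -
      have "(LINT t|lborel. ?G t) = ?I\<^sup>2 * (c1 * (2 * (2 * m) * (exp (0 * T) / ((2 * m)\<^sup>2 - 0\<^sup>2)))
          + c2 * (2 * (2 * k) * (exp (0 * (T + 1)) / ((2 * k)\<^sup>2 - 0\<^sup>2))))"
        using E1 E2 by (simp del: mult_zero_left)
      also have "\<dots> = ?I\<^sup>2 * (c1 / m + c2 / k)" using m k by (simp add: power2_eq_square)
      finally show ?thesis .
    qed
    have iz: "integrable lborel (\<lambda>t. (\<zeta> t)\<^sup>2)"
    proof (rule Bochner_Integration.integrable_bound[OF iG])
      show "AE t in lborel. norm ((\<zeta> t)\<^sup>2) \<le> norm (?G t)"
        unfolding real_norm_def abs_power2 by (intro AE_I2 order.trans[OF Z abs_ge_self])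
    qed measurable
    have "(LINT t|lborel. (\<zeta> t)\<^sup>2) \<le> ?I\<^sup>2 * (c1 / m + c2 / k)"
      unfolding vG[symmetric] by (rule integral_mono[OF iz iG Z])
    then have "sqrt (LINT t|lborel. (\<zeta> t)\<^sup>2) \<le> sqrt (?I\<^sup>2 * (c1 / m + c2 / k))" by (rule real_sqrt_le_mono)
    also have "\<dots> = K * ?I" using I0 by (simp add: K_def real_sqrt_mult)
    finally have "sqrt (LINT t|lborel. (\<zeta> t)\<^sup>2) \<le> K * ?I" .
    then show "\<exists>\<zeta>. admissible \<zeta> \<eta> \<and> sqrt (LINT t|lborel. (\<zeta> t)\<^sup>2) \<le> K * ?I"
      unfolding admissible_def using d0 d1 c2' et iz by (intro exI[of _ \<zeta>] conjI exI[of _ \<zeta>1] exI[of _ \<zeta>2]) auto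
  qed
qed

end

section \<open>From the weak equation to the bubble\<close>

text \<open>Unit intervals with rational left endpoints suffice, so only countably many null sets
  are united. The bound R - 1 leaves room for the whole interval around t.\<close>

lemma AE_below_from_unit_intervals:
  fixes R :: real
  assumes "\<And>T. T + 1 < R \<Longrightarrow> AE t in lborel. T < t \<and> t < T + 1 \<longrightarrow> P t"
  shows "AE t in lborel. t < R - 1 \<longrightarrow> P t"
proof -
  have "AE t in lborel. \<forall>T\<in>{T\<in>\<rat>. T + 1 < R}. T < t \<and> t < T + 1 \<longrightarrow> P t"
    by (rule AE_ball_countable[THEN iffD2]) (use assms in \<open>auto intro: countable_subset[OF _ countable_rat]\<close>)
  then show ?thesis
  proof eventually_elim
    case (elim t)
    show ?case
    proof
      assume t: "t < R - 1"
      obtain q where q: "q \<in> \<rat>" "t - 1 < q" "q < t" using Rats_dense_in_real[of "t - 1" t] by auto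
      then show "P t" using elim t by auto
    qed
  qed
qed

text \<open>The set of violations below R is open, and a non-empty open set is not null.\<close>

lemma AE_bound_continuous:
  fixes f :: "real \<Rightarrow> real"
  assumes c: "continuous_on UNIV f" and ae: "AE t in lborel. t < R \<longrightarrow> \<bar>f t\<bar> \<le> \<epsilon>" and t: "t < R"
  shows "\<bar>f t\<bar> \<le> \<epsilon>"
proof (rule ccontr)
  assume "\<not> \<bar>f t\<bar> \<le> \<epsilon>"
  define S where "S = {t. t < R \<and> \<epsilon> < \<bar>f t\<bar>}"
  have "open S" unfolding S_def by (intro open_Collect_conj open_Collect_less continuous_intros c)
  moreover have "S \<noteq> {}" using \<open>\<not> \<bar>f t\<bar> \<le> \<epsilon>\<close> t by (auto simp: S_def)
  ultimately have "\<not> negligible S" by (rule open_not_negligible)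
  moreover have "AE t in lborel. t \<notin> S" using ae by eventually_elim (auto simp: S_def)
  then have "AE t in lebesgue. t \<notin> S" by (rule AE_completion)
  then have "negligible S" by (simp add: negligible_iff_null_sets AE_iff_null_sets[symmetric] \<open>open S\<close> borel_open sets_completionI_sets)
  ultimately show False by simp
qed

text \<open>The data are only measurable here, so the derivative formula is not at hand; the kernels
  at nearby points are dominated by a multiple of the kernel at t.\<close>

lemma green_continuous:
  assumes Fm [measurable]: "F \<in> borel_measurable borel" and bd: "\<And>s. \<bar>F s\<bar> \<le> M" and c: "0 < c"
  shows "continuous_on UNIV (green c F)"
proof (rule continuous_at_imp_continuous_on, intro ballI)
  fix t :: real
  have M0: "0 \<le> M" using bd[of 0] by linarith
  note G = green_as_convolution[OF Fm bd c]
  show "isCont (green c F) t"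
    unfolding continuous_at_sequentially
  proof (intro allI impI)
    fix x :: "nat \<Rightarrow> real" assume x: "x \<longlonglongrightarrow> t"
    then have "(\<lambda>n. \<bar>x n - t\<bar>) \<longlonglongrightarrow> \<bar>t - t\<bar>" by (intro tendsto_intros)
    then have "Bseq (\<lambda>n. \<bar>x n - t\<bar>)" by (rule convergent_imp_Bseq[OF convergentI])
    then obtain B where B: "\<And>n. \<bar>x n - t\<bar> \<le> B" by (auto simp: Bseq_def)
    have "(\<lambda>n. LINT s|lborel. exp (- c * \<bar>x n - s\<bar>) * F s) \<longlonglongrightarrow> (LINT s|lborel. exp (- c * \<bar>t - s\<bar>) * F s)"
    proof (rule integral_dominated_convergence[where w="\<lambda>s. exp (c * B) * \<bar>exp (- c * \<bar>t - s\<bar>) * F s\<bar>"])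
      show "integrable lborel (\<lambda>s. exp (c * B) * \<bar>exp (- c * \<bar>t - s\<bar>) * F s\<bar>)" using G(1)[of t] by simp
      show "AE s in lborel. (\<lambda>n. exp (- c * \<bar>x n - s\<bar>) * F s) \<longlonglongrightarrow> exp (- c * \<bar>t - s\<bar>) * F s"
        by (intro always_eventually allI tendsto_intros x)
      have "norm (exp (- c * \<bar>x n - s\<bar>) * F s) \<le> exp (c * B) * \<bar>exp (- c * \<bar>t - s\<bar>) * F s\<bar>" for n s
      proof -
        have "c * \<bar>t - s\<bar> \<le> c * (B + \<bar>x n - s\<bar>)" using B[of n] c by (intro mult_left_mono) auto
        then have "exp (- c * \<bar>x n - s\<bar>) \<le> exp (c * B) * exp (- c * \<bar>t - s\<bar>)"
          by (simp add: exp_add[symmetric] distrib_left)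
        from mult_right_mono[OF this, of "\<bar>F s\<bar>"] show ?thesis by (simp add: abs_mult mult.assoc)
      qed
      then show "AE s in lborel. norm (exp (- c * \<bar>x n - s\<bar>) * F s) \<le> exp (c * B) * \<bar>exp (- c * \<bar>t - s\<bar>) * F s\<bar>" for n
        by simp
    qed auto
    then have L: "(\<lambda>n. 2 * c * green c F (x n)) \<longlonglongrightarrow> 2 * c * green c F t" unfolding G(2) .
    show "(green c F \<circ> x) \<longlonglongrightarrow> green c F t"
      using tendsto_mult_left[OF L, of "1 / (2 * c)"] c by (simp add: o_def)
  qed
qed

lemma green_cong_AE:
  assumes F: "F \<in> borel_measurable borel" "\<And>s. \<bar>F s\<bar> \<le> M" and G: "G \<in> borel_measurable borel" "\<And>s. \<bar>G s\<bar> \<le> K"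
    and ae: "AE s in lborel. F s = G s" and c: "0 < c"
  shows "green c F t = green c G t"
proof -
  have "(LINT s|lborel. exp (- c * \<bar>t - s\<bar>) * F s) = (LINT s|lborel. exp (- c * \<bar>t - s\<bar>) * G s)"
    using F(1) G(1) ae by (intro integral_cong_AE) auto
  then show ?thesis unfolding green_as_convolution(2)[OF F c] green_as_convolution(2)[OF G c] using c by simp
qed

lemma green_test1_bound:
  assumes F: "test1 a b F" and c: "0 < c"
  obtains K where "\<And>t. \<bar>green c F t\<bar> \<le> K * exp (- c * \<bar>t\<bar>)" "\<And>t. \<bar>green' c F t\<bar> \<le> K * exp (- c * \<bar>t\<bar>)" "0 \<le> K"
proof -
  define I where "I = exp (c * (b - a)) * (LINT s|lborel. \<bar>F s\<bar>)"
  define L where "L = exp (c * \<bar>a\<bar>) * I + exp (c * \<bar>b\<bar>) * I"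
  have I0: "0 \<le> I" unfolding I_def by (intro mult_nonneg_nonneg integral_nonneg_AE) auto
  have L0: "0 \<le> L" using I0 by (simp add: L_def)
  have sh: "exp (- c * \<bar>t - d\<bar>) \<le> exp (c * \<bar>d\<bar>) * exp (- c * \<bar>t\<bar>)" for t d :: real
  proof -
    have "c * \<bar>t\<bar> \<le> c * (\<bar>t - d\<bar> + \<bar>d\<bar>)" using c by (intro mult_left_mono) auto
    then show ?thesis by (simp add: exp_add[symmetric] distrib_left)
  qed
  have m: "\<bar>exp (- c * t) * Jm c F t\<bar> \<le> exp (c * \<bar>a\<bar>) * I * exp (- c * \<bar>t\<bar>)" for t
  proof -
    have "\<bar>exp (- c * t) * Jm c F t\<bar> \<le> I * exp (- c * \<bar>t - a\<bar>)"
      using Jm_test1_bound[OF F c, of t] by (simp add: I_def mult_ac)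
    also have "\<dots> \<le> I * (exp (c * \<bar>a\<bar>) * exp (- c * \<bar>t\<bar>))" by (rule mult_left_mono[OF sh I0])
    finally show ?thesis by (simp add: mult_ac)
  qed
  have p: "\<bar>exp (c * t) * Jp c F t\<bar> \<le> exp (c * \<bar>b\<bar>) * I * exp (- c * \<bar>t\<bar>)" for t
  proof -
    have "\<bar>exp (c * t) * Jp c F t\<bar> \<le> I * exp (- c * \<bar>t - b\<bar>)"
      using Jp_test1_bound[OF F c, of t] by (simp add: I_def mult_ac)
    also have "\<dots> \<le> I * (exp (c * \<bar>b\<bar>) * exp (- c * \<bar>t\<bar>))" by (rule mult_left_mono[OF sh I0])
    finally show ?thesis by (simp add: mult_ac)
  qed
  have s: "\<bar>exp (- c * t) * Jm c F t\<bar> + \<bar>exp (c * t) * Jp c F t\<bar> \<le> L * exp (- c * \<bar>t\<bar>)" for t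
    using m[of t] p[of t] by (simp add: L_def distrib_right)
  show ?thesis
  proof (rule that)
    show "0 \<le> L * (1 / (2 * c) + 1)" using L0 c by simp
    fix t
    have X: "0 \<le> L * exp (- c * \<bar>t\<bar>)" using L0 by simp
    have "\<bar>green c F t\<bar> \<le> L * exp (- c * \<bar>t\<bar>) / (2 * c)"
      unfolding green_def abs_divide using s[of t] c abs_triangle_ineq[of "exp (- c * t) * Jm c F t" "exp (c * t) * Jp c F t"]
      by (intro frac_le) auto
    also have "\<dots> \<le> L * exp (- c * \<bar>t\<bar>) / (2 * c) + L * exp (- c * \<bar>t\<bar>)" using X by linarith
    also have "\<dots> = L * (1 / (2 * c) + 1) * exp (- c * \<bar>t\<bar>)" by (simp add: algebra_simps)
    finally show "\<bar>green c F t\<bar> \<le> L * (1 / (2 * c) + 1) * exp (- c * \<bar>t\<bar>)" .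
    have "\<bar>green' c F t\<bar> \<le> L * exp (- c * \<bar>t\<bar>)"
      unfolding green'_def abs_divide using s[of t] X abs_triangle_ineq4[of "exp (c * t) * Jp c F t" "exp (- c * t) * Jm c F t"]
      by simp
    also have "\<dots> \<le> L * exp (- c * \<bar>t\<bar>) / (2 * c) + L * exp (- c * \<bar>t\<bar>)" using X c by simp
    also have "\<dots> = L * (1 / (2 * c) + 1) * exp (- c * \<bar>t\<bar>)" by (simp add: algebra_simps)
    finally show "\<bar>green' c F t\<bar> \<le> L * (1 / (2 * c) + 1) * exp (- c * \<bar>t\<bar>)" .
  qed
qed

lemma DERIV_borel_measurable:
  fixes f :: "real \<Rightarrow> real"
  assumes "\<And>t. (f has_real_derivative f' t) (at t)" shows "f \<in> borel_measurable borel"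
  using DERIV_isCont[OF assms]
  by (intro borel_measurable_continuous_onI) (simp add: continuous_at_imp_continuous_on)

lemma deriv_eqI: "(\<And>t. (f has_real_derivative f' t) (at t)) \<Longrightarrow> deriv f = f'"
  by (rule ext) (rule DERIV_imp_deriv)

section \<open>Cut-offs and the weak equation on the line\<close>

text \<open>Only the second and the fourth derivative are recorded, because the operator contains
  only even ones.\<close>

lemma Leibniz4:
  fixes f0 g0 :: "real \<Rightarrow> real"
  assumes f: "\<And>t. (f0 has_real_derivative f1 t) (at t)" "\<And>t. (f1 has_real_derivative f2 t) (at t)"
      "\<And>t. (f2 has_real_derivative f3 t) (at t)" "\<And>t. (f3 has_real_derivative f4 t) (at t)"
    and g: "\<And>t. (g0 has_real_derivative g1 t) (at t)" "\<And>t. (g1 has_real_derivative g2 t) (at t)"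
      "\<And>t. (g2 has_real_derivative g3 t) (at t)" "\<And>t. (g3 has_real_derivative g4 t) (at t)"
  shows "deriv (deriv (\<lambda>t. f0 t * g0 t)) = (\<lambda>t. f2 t * g0 t + 2 * (f1 t * g1 t) + f0 t * g2 t)"
    and "deriv (deriv (deriv (deriv (\<lambda>t. f0 t * g0 t)))) = (\<lambda>t. f4 t * g0 t + 4 * (f3 t * g1 t) + 6 * (f2 t * g2 t)
      + 4 * (f1 t * g3 t) + f0 t * g4 t)"
proof -
  have 1: "deriv (\<lambda>t. f0 t * g0 t) = (\<lambda>t. f1 t * g0 t + f0 t * g1 t)"
    by (rule deriv_eqI, rule DERIV_cong[OF DERIV_mult[OF f(1) g(1)]]) (simp add: algebra_simps)
  have 2: "deriv (\<lambda>t. f1 t * g0 t + f0 t * g1 t) = (\<lambda>t. f2 t * g0 t + 2 * (f1 t * g1 t) + f0 t * g2 t)"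
    by (rule deriv_eqI, rule DERIV_cong[OF DERIV_add[OF DERIV_mult[OF f(2) g(1)] DERIV_mult[OF f(1) g(2)]]])
      (simp add: algebra_simps)
  have 3: "deriv (\<lambda>t. f2 t * g0 t + 2 * (f1 t * g1 t) + f0 t * g2 t)
      = (\<lambda>t. f3 t * g0 t + 3 * (f2 t * g1 t) + 3 * (f1 t * g2 t) + f0 t * g3 t)"
    by (rule deriv_eqI, rule DERIV_cong[OF DERIV_add[OF DERIV_add[OF DERIV_mult[OF f(3) g(1)]
          DERIV_cmult[OF DERIV_mult[OF f(2) g(2)]]] DERIV_mult[OF f(1) g(3)]]])
      (simp add: algebra_simps)
  have 4: "deriv (\<lambda>t. f3 t * g0 t + 3 * (f2 t * g1 t) + 3 * (f1 t * g2 t) + f0 t * g3 t)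
      = (\<lambda>t. f4 t * g0 t + 4 * (f3 t * g1 t) + 6 * (f2 t * g2 t) + 4 * (f1 t * g3 t) + f0 t * g4 t)"
    by (rule deriv_eqI, rule DERIV_cong[OF DERIV_add[OF DERIV_add[OF DERIV_add[OF DERIV_mult[OF f(4) g(1)]
          DERIV_cmult[OF DERIV_mult[OF f(3) g(2)]]] DERIV_cmult[OF DERIV_mult[OF f(2) g(3)]]] DERIV_mult[OF f(1) g(4)]]])
      (simp add: algebra_simps)
  show "deriv (deriv (\<lambda>t. f0 t * g0 t)) = (\<lambda>t. f2 t * g0 t + 2 * (f1 t * g1 t) + f0 t * g2 t)"
    unfolding 1 2 ..
  show "deriv (deriv (deriv (deriv (\<lambda>t. f0 t * g0 t)))) = (\<lambda>t. f4 t * g0 t + 4 * (f3 t * g1 t) + 6 * (f2 t * g2 t)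
      + 4 * (f1 t * g3 t) + f0 t * g4 t)"
    unfolding 1 2 3 4 ..
qed

definition cutoff :: "nat \<Rightarrow> real \<Rightarrow> real" where
  "cutoff j t = (deriv ^^ j) (bump (-1) 1) t / bump (-1) 1 0"

text \<open>The j-th derivative of a bump stretched to width n + 1; the power in the denominator is
  the chain rule factor, and it makes all derivatives of positive order tend to 0.\<close>

definition cutoffs :: "nat \<Rightarrow> nat \<Rightarrow> real \<Rightarrow> real" where
  "cutoffs n j t = cutoff j (t / real (Suc n)) / real (Suc n) ^ j"

lemma test1_cutoff_aux: "test1 (-1) 1 ((deriv ^^ j) (bump (-1) 1))"
  by (induction j) (auto intro: test1_bump test1_deriv)

lemma cutoff_DERIV: "(cutoff j has_real_derivative cutoff (Suc j) t) (at t)"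
  unfolding cutoff_def[abs_def] using DERIV_cdivide[OF test1_DERIV[OF test1_cutoff_aux[of j]]] by simp

lemma cutoff_bounded: obtains B where "\<And>j t. j \<le> 4 \<Longrightarrow> \<bar>cutoff j t\<bar> \<le> B"
proof -
  have "\<exists>B. \<forall>t. \<bar>cutoff j t\<bar> \<le> B" for j
  proof -
    obtain M where M: "\<And>t. \<bar>(deriv ^^ j) (bump (-1) 1) t\<bar> \<le> M" using test1_bounded[OF test1_cutoff_aux[of j]] by blast
    have "\<bar>cutoff j t\<bar> \<le> M / bump (-1) 1 0" for t
      unfolding cutoff_def abs_divide using M[of t] bump_pos[of "-1" 0 1] by (simp add: divide_right_mono)
    then show ?thesis by blast
  qed
  then obtain B where B: "\<And>j t. \<bar>cutoff j t\<bar> \<le> B j" by metis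
  have "\<bar>cutoff j t\<bar> \<le> Max (B ` {..4})" if "j \<le> 4" for j t
    by (rule order.trans[OF B]) (use that in \<open>auto intro!: Max_ge\<close>)
  then show ?thesis by (rule that)
qed

lemma cutoffs_DERIV: "(cutoffs n j has_real_derivative cutoffs n (Suc j) t) (at t)"
proof -
  have "((\<lambda>t. t / real (Suc n)) has_real_derivative 1 / real (Suc n)) (at t)"
    by (auto intro!: derivative_eq_intros)
  from DERIV_cdivide[OF DERIV_chain2[OF cutoff_DERIV this], of j "real (Suc n) ^ j"]
  show ?thesis unfolding cutoffs_def[abs_def] by (rule DERIV_cong) (simp add: mult.commute)
qed

lemma cutoffs_le:
  assumes "\<And>t. \<bar>cutoff j t\<bar> \<le> B" shows "\<bar>cutoffs n j t\<bar> \<le> B"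
proof -
  have p: "1 \<le> real (Suc n) ^ j" by (rule one_le_power) simp
  have "\<bar>cutoffs n j t\<bar> = \<bar>cutoff j (t / real (Suc n))\<bar> / real (Suc n) ^ j"
    using p unfolding cutoffs_def abs_divide by (simp del: of_nat_Suc)
  also have "\<dots> \<le> \<bar>cutoff j (t / real (Suc n))\<bar> / 1" using p by (intro frac_le) auto
  finally have "\<bar>cutoffs n j t\<bar> \<le> \<bar>cutoff j (t / real (Suc n))\<bar>" by simp
  then show ?thesis using assms order.trans by blast
qed

lemma cutoffs_lim: "(\<lambda>n. cutoffs n 0 t) \<longlonglongrightarrow> 1" "0 < j \<Longrightarrow> j \<le> 4 \<Longrightarrow> (\<lambda>n. cutoffs n j t) \<longlonglongrightarrow> 0"
proof -
  have i: "(\<lambda>n. 1 / real (Suc n)) \<longlonglongrightarrow> 0" by (rule LIMSEQ_Suc[OF lim_1_over_n])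
  have z: "(\<lambda>n. t / real (Suc n)) \<longlonglongrightarrow> 0" using tendsto_mult_right[OF i, of t] by simp
  have "(\<lambda>n. cutoff 0 (t / real (Suc n))) \<longlonglongrightarrow> cutoff 0 0"
    using isCont_tendsto_compose[OF DERIV_isCont[OF cutoff_DERIV] z] .
  moreover have "cutoff 0 0 = 1" using bump_pos[of "-1" 0 1] by (simp add: cutoff_def)
  ultimately show "(\<lambda>n. cutoffs n 0 t) \<longlonglongrightarrow> 1" by (simp add: cutoffs_def)
  assume j: "0 < j" "j \<le> 4"
  obtain B where B: "\<And>j t. j \<le> 4 \<Longrightarrow> \<bar>cutoff j t\<bar> \<le> B" using cutoff_bounded by blast
  show "(\<lambda>n. cutoffs n j t) \<longlonglongrightarrow> 0"
  proof (rule Lim_null_comparison)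
    have "(\<lambda>n. B * (1 / real (Suc n)) ^ j) \<longlonglongrightarrow> B * 0 ^ j" by (intro tendsto_intros i)
    moreover have "B * 0 ^ j = 0" using j by simp
    ultimately show "(\<lambda>n. B * (1 / real (Suc n)) ^ j) \<longlonglongrightarrow> 0" by (simp only:)
    have "norm (cutoffs n j t) \<le> B * (1 / real (Suc n)) ^ j" for n
      using divide_right_mono[OF B[OF j(2), of "t / Suc n"], of "real (Suc n) ^ j"]
      by (simp add: cutoffs_def abs_divide power_divide del: of_nat_Suc)
    then show "\<forall>\<^sub>F n in sequentially. norm (cutoffs n j t) \<le> B * (1 / real (Suc n)) ^ j" by simp
  qed
qed

lemma smooth_on_cutoffs: "smooth_on UNIV (cutoffs n 0)"
proof -
  have "smooth_on UNIV (\<lambda>t. (1 / real (Suc n)) * t)" by (intro smooth_on_cmult smooth_on_ident) auto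
  then have "smooth_on UNIV (\<lambda>t. bump (-1) 1 ((1 / real (Suc n)) * t))"
    by (rule smooth_on_compose[OF open_UNIV open_UNIV subset_UNIV smooth_on_bump])
  from smooth_on_cmult[OF open_UNIV this, of "1 / bump (-1) 1 0"]
  show ?thesis by (simp add: cutoffs_def[abs_def] cutoff_def)
qed

lemma test1_cutoffs:
  assumes "smooth_on UNIV f"
  shows "test1 (- real (Suc n)) (real (Suc n)) (\<lambda>t. cutoffs n 0 t * f t)"
  unfolding test1_def
proof (intro conjI allI impI smooth_on_mult smooth_on_cutoffs assms open_UNIV)
  fix t assume "t < - real (Suc n) \<or> real (Suc n) < t"
  then have "t / real (Suc n) \<le> -1 \<or> 1 \<le> t / real (Suc n)"
    by (auto simp: divide_simps simp del: of_nat_Suc)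
  then show "cutoffs n 0 t * f t = 0" by (simp add: cutoffs_def cutoff_def bump_eq_0)
qed

lemma exp_abs_integrable: "0 < c \<Longrightarrow> integrable lborel (\<lambda>t::real. exp (- c * \<bar>t\<bar>))"
  using exp_convolution(1)[of 0 c 0] by simp

text \<open>The weak equation on the line, tested with cut-offs of \<open>K * \<theta>\<close>, \<open>K\<close> the Green function of
  \<open>(D\<^sup>2 - m\<^sup>2)(D\<^sup>2 - k\<^sup>2)\<close>, becomes the integral equation \<open>v = K * nl v\<close>.\<close>

lemma weak_to_integral_equation:
  assumes k: "0 < k" and km: "k < m"
    and vm [measurable]: "v \<in> borel_measurable borel" and vM: "\<And>t. \<bar>v t\<bar> \<le> M"
    and Fm [measurable]: "F \<in> borel_measurable borel" and FM: "\<And>t. \<bar>F t\<bar> \<le> MF"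
    and weak: "\<And>a b \<eta>. test1 a b \<eta> \<Longrightarrow> (LINT t|lborel. v t * (deriv (deriv (deriv (deriv \<eta>))) t
       - (m\<^sup>2 + k\<^sup>2) * deriv (deriv \<eta>) t + m\<^sup>2 * k\<^sup>2 * \<eta> t)) = (LINT t|lborel. F t * \<eta> t)"
  shows "AE t in lborel. v t = (green k F t - green m F t) / (m\<^sup>2 - k\<^sup>2)"
proof -
  have m: "0 < m" using k km by simp
  have mk: "0 < m\<^sup>2 - k\<^sup>2" using k km by (simp add: power_strict_mono)
  define y where "y t = (green k F t - green m F t) / (m\<^sup>2 - k\<^sup>2)" for t
  have yc: "continuous_on UNIV y"
    unfolding y_def using mk by (intro continuous_intros green_continuous[OF Fm FM] k m) auto
  have [measurable]: "y \<in> borel_measurable borel" by (rule borel_measurable_continuous_onI[OF yc])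
  have "\<bar>y t\<bar> \<le> (MF / k\<^sup>2 + MF / m\<^sup>2) / (m\<^sup>2 - k\<^sup>2)" for t
    unfolding y_def abs_divide using green_bound[OF Fm FM k, of t] green_bound[OF Fm FM m, of t] mk
    by (intro frac_le) auto
  then obtain MY where MY: "\<And>t. \<bar>y t\<bar> \<le> MY" by blast
  \<comment> \<open>Testing with K * \<theta> in place of \<theta> inverts the operator on the left,
    and symmetry of the Green operators then transfers K to F.\<close>
  have eq: "(LINT t|lborel. v t * \<theta> t) = (LINT t|lborel. y t * \<theta> t)" if \<theta>: "test1 a b \<theta>" for a b \<theta>
  proof -
    obtain T where T: "\<And>s. \<bar>\<theta> s\<bar> \<le> T" using test1_bounded[OF \<theta>] by blast
    note \<theta>c = test1_continuous[OF \<theta>, of UNIV] and \<theta>m [measurable] = test1_measurable[OF \<theta>] and \<theta>i = test1_integrable[OF \<theta>]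
    note gk = green_DERIV[OF \<theta>c T k] and gm = green_DERIV[OF \<theta>c T m]
    \<comment> \<open>z0 is K * \<theta>, and z1 to z4 are its derivatives, expressed through
      \<open>green\<close> and \<open>green'\<close> by means of their equations.\<close>
    define z0 where "z0 t = (green k \<theta> t - green m \<theta> t) / (m\<^sup>2 - k\<^sup>2)" for t
    define z1 where "z1 t = (green' k \<theta> t - green' m \<theta> t) / (m\<^sup>2 - k\<^sup>2)" for t
    define z2 where "z2 t = k\<^sup>2 * z0 t - green m \<theta> t" for t
    define z3 where "z3 t = k\<^sup>2 * z1 t - green' m \<theta> t" for t
    define z4 where "z4 t = k\<^sup>2 * z2 t - (m\<^sup>2 * green m \<theta> t - \<theta> t)" for t
    have d0: "(z0 has_real_derivative z1 t) (at t)" for t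
      unfolding z0_def[abs_def] z1_def by (rule DERIV_cdivide[OF DERIV_diff[OF gk(1) gm(1)]])
    have d1: "(z1 has_real_derivative z2 t) (at t)" for t
    proof -
      have e: "k\<^sup>2 * a - x - (m\<^sup>2 * b - x) = (m\<^sup>2 - k\<^sup>2) * (k\<^sup>2 * ((a - b) / (m\<^sup>2 - k\<^sup>2)) - b)" for a b x :: real
        using mk by (simp add: field_simps)
      show ?thesis
        using DERIV_cdivide[OF DERIV_diff[OF gk(2) gm(2)], of "m\<^sup>2 - k\<^sup>2" t]
        unfolding z1_def[abs_def] z2_def z0_def e nonzero_mult_div_cancel_left[OF less_imp_neq[OF mk, symmetric]] .
    qed
    have d2: "(z2 has_real_derivative z3 t) (at t)" for t
      unfolding z2_def[abs_def] z3_def by (rule DERIV_diff[OF DERIV_cmult[OF d0] gm(1)])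
    have d3: "(z3 has_real_derivative z4 t) (at t)" for t
      unfolding z3_def[abs_def] z4_def by (rule DERIV_diff[OF DERIV_cmult[OF d1] gm(2)])
    have L: "z4 t - (m\<^sup>2 + k\<^sup>2) * z2 t + m\<^sup>2 * k\<^sup>2 * z0 t = \<theta> t" for t
      by (simp add: z4_def z2_def algebra_simps)
    have gs: "smooth_on UNIV (green c \<theta>)" if "0 < c" for c
    proof -
      have "smooth_on UNIV (\<lambda>t. (1 / (2 * c)) * (exp (- c * t) * Jm c \<theta> t + exp (c * t) * Jp c \<theta> t))"
        by (intro smooth_on_cmult smooth_on_add smooth_on_mult smooth_on_exp Jm_test1_smooth[OF \<theta> that]) auto
      then show ?thesis by (simp add: green_def[abs_def])
    qed
    have zs: "smooth_on UNIV z0"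
    proof -
      have "smooth_on UNIV (\<lambda>t. (1 / (m\<^sup>2 - k\<^sup>2)) * (green k \<theta> t - green m \<theta> t))"
        by (intro smooth_on_cmult smooth_on_diff gs k m) auto
      then show ?thesis by (simp add: z0_def[abs_def])
    qed
    obtain Kk where Kk: "\<And>t. \<bar>green k \<theta> t\<bar> \<le> Kk * exp (- k * \<bar>t\<bar>)" "\<And>t. \<bar>green' k \<theta> t\<bar> \<le> Kk * exp (- k * \<bar>t\<bar>)" "0 \<le> Kk"
      using green_test1_bound[OF \<theta> k] by blast
    obtain Km where Km': "\<And>t. \<bar>green m \<theta> t\<bar> \<le> Km * exp (- m * \<bar>t\<bar>)" "\<And>t. \<bar>green' m \<theta> t\<bar> \<le> Km * exp (- m * \<bar>t\<bar>)" "0 \<le> Km"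
      using green_test1_bound[OF \<theta> m] by blast
    have emk: "Km * exp (- m * \<bar>t\<bar>) \<le> Km * exp (- k * \<bar>t\<bar>)" for t :: real
      using km Km'(3) by (intro mult_left_mono) (auto simp: mult_right_mono)
    have Km: "\<bar>green m \<theta> t\<bar> \<le> Km * exp (- k * \<bar>t\<bar>)" "\<bar>green' m \<theta> t\<bar> \<le> Km * exp (- k * \<bar>t\<bar>)" for t
      using order.trans[OF Km'(1) emk] order.trans[OF Km'(2) emk] by auto
    define E where "E t = exp (- k * \<bar>t\<bar>)" for t :: real
    define K0 where "K0 = (Kk + Km) / (m\<^sup>2 - k\<^sup>2)"
    define K where "K = K0 + (k\<^sup>2 * K0 + Km)"
    have K00: "0 \<le> K0" using Kk(3) Km'(3) mk by (simp add: K0_def)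
    have E0: "0 \<le> E t" for t by (simp add: E_def)
    have b0: "\<bar>z0 t\<bar> \<le> K0 * E t" "\<bar>z1 t\<bar> \<le> K0 * E t" for t
    proof -
      have "\<bar>a - b\<bar> / (m\<^sup>2 - k\<^sup>2) \<le> (Kk * E t + Km * E t) / (m\<^sup>2 - k\<^sup>2)" if "\<bar>a\<bar> \<le> Kk * E t" "\<bar>b\<bar> \<le> Km * E t" for a b
        using that mk by (intro divide_right_mono) auto
      from this[OF Kk(1)[of t, folded E_def] Km(1)[of t, folded E_def]] this[OF Kk(2)[of t, folded E_def] Km(2)[of t, folded E_def]]
      show "\<bar>z0 t\<bar> \<le> K0 * E t" "\<bar>z1 t\<bar> \<le> K0 * E t"
        using mk by (simp_all add: z0_def z1_def K0_def abs_divide add_divide_distrib distrib_right)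
    qed
    have b2: "\<bar>z2 t\<bar> \<le> (k\<^sup>2 * K0 + Km) * E t" "\<bar>z3 t\<bar> \<le> (k\<^sup>2 * K0 + Km) * E t" for t
    proof -
      have "\<bar>k\<^sup>2 * a - b\<bar> \<le> (k\<^sup>2 * K0 + Km) * E t" if "\<bar>a\<bar> \<le> K0 * E t" "\<bar>b\<bar> \<le> Km * E t" for a b
      proof -
        have "k\<^sup>2 * \<bar>a\<bar> \<le> k\<^sup>2 * (K0 * E t)" by (rule mult_left_mono[OF that(1)]) simp
        then have "\<bar>k\<^sup>2 * a\<bar> \<le> k\<^sup>2 * K0 * E t" by (simp add: abs_mult mult.assoc)
        then show ?thesis using that(2) by (simp add: distrib_right)
      qed
      then show "\<bar>z2 t\<bar> \<le> (k\<^sup>2 * K0 + Km) * E t" "\<bar>z3 t\<bar> \<le> (k\<^sup>2 * K0 + Km) * E t"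
        unfolding z2_def z3_def using b0 Km[of t, folded E_def] by blast+
    qed
    have zK: "\<bar>z0 t\<bar> \<le> K * E t" "\<bar>z1 t\<bar> \<le> K * E t" "\<bar>z2 t\<bar> \<le> K * E t" "\<bar>z3 t\<bar> \<le> K * E t" for t
    proof -
      have "K0 * E t \<le> K * E t" "(k\<^sup>2 * K0 + Km) * E t \<le> K * E t"
        unfolding K_def using K00 Km'(3) E0 by (intro mult_right_mono; simp)+
      then show "\<bar>z0 t\<bar> \<le> K * E t" "\<bar>z1 t\<bar> \<le> K * E t" "\<bar>z2 t\<bar> \<le> K * E t" "\<bar>z3 t\<bar> \<le> K * E t"
        using b0 b2 order.trans by blast+
    qed
    define X where "X n j t = cutoffs n j t" for n j t
    define A where "A = m\<^sup>2 + k\<^sup>2"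
    have A0: "0 \<le> A" by (simp add: A_def)
    define \<eta> where "\<eta> n t = X n 0 t * z0 t" for n t
    have t1: "test1 (- real (Suc n)) (real (Suc n)) (\<eta> n)" for n
      unfolding \<eta>_def[abs_def] X_def by (rule test1_cutoffs[OF zs])
    \<comment> \<open>The commutator of the operator with the cut-off. Every term contains a
      derivative of the cut-off, so it tends to 0 pointwise.\<close>
    define R where "R n t = X n 4 t * z0 t + 4 * (X n 3 t * z1 t) + 6 * (X n 2 t * z2 t) + 4 * (X n 1 t * z3 t)
        - A * (X n 2 t * z0 t + 2 * (X n 1 t * z1 t))" for n t
    have Lw: "deriv (deriv (deriv (deriv (\<eta> n)))) t - (m\<^sup>2 + k\<^sup>2) * deriv (deriv (\<eta> n)) t + m\<^sup>2 * k\<^sup>2 * \<eta> n t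
        = X n 0 t * \<theta> t + R n t" for n t
    proof -
      have XD': "(X n 0 has_real_derivative X n 1 t) (at t)" "(X n 1 has_real_derivative X n 2 t) (at t)"
        "(X n 2 has_real_derivative X n 3 t) (at t)" "(X n 3 has_real_derivative X n 4 t) (at t)" for t
        using cutoffs_DERIV[of n 0 t] cutoffs_DERIV[of n 1 t] cutoffs_DERIV[of n 2 t] cutoffs_DERIV[of n 3 t]
        unfolding X_def[abs_def] by (simp_all add: eval_nat_numeral)
      note LL = Leibniz4[OF XD' d0 d1 d2 d3]
      show ?thesis
        unfolding \<eta>_def[abs_def] LL(2) unfolding LL(1) R_def A_def[symmetric] L[of t, symmetric]
        by (simp add: algebra_simps)
    qed
    obtain B where B: "\<And>j t. j \<le> 4 \<Longrightarrow> \<bar>cutoff j t\<bar> \<le> B" using cutoff_bounded by blast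
    have XB: "\<bar>X n j t\<bar> \<le> B" if "j \<le> 4" for n j t unfolding X_def by (rule cutoffs_le[OF B[OF that]])
    have B0: "0 \<le> B" using XB[of 0 0 0] by simp
    have K0': "0 \<le> K" using K00 Km'(3) by (simp add: K_def)
    define H where "H = B * K"
    have H0: "0 \<le> H" using B0 K0' by (simp add: H_def)
    have pr: "\<bar>X n j t * z\<bar> \<le> H * E t" if "j \<le> 4" "\<bar>z\<bar> \<le> K * E t" for n j t z
      using mult_mono[OF XB[OF that(1)] that(2) B0] by (simp add: abs_mult H_def mult.assoc)
    \<comment> \<open>The coefficients 15 = 1 + 4 + 6 + 4 and 3 = 1 + 2 are the sums of the Leibniz
      coefficients in R.\<close>
    have Rb: "\<bar>R n t\<bar> \<le> (15 + 3 * A) * H * E t" for n t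
    proof -
      have p: "\<bar>X n 4 t * z0 t\<bar> \<le> H * E t" "\<bar>X n 3 t * z1 t\<bar> \<le> H * E t" "\<bar>X n 2 t * z2 t\<bar> \<le> H * E t"
        "\<bar>X n 1 t * z3 t\<bar> \<le> H * E t" "\<bar>X n 2 t * z0 t\<bar> \<le> H * E t" "\<bar>X n 1 t * z1 t\<bar> \<le> H * E t"
        by (rule pr; simp add: zK)+
      have "\<bar>X n 2 t * z0 t + 2 * (X n 1 t * z1 t)\<bar> \<le> 3 * (H * E t)" using p(5,6) by linarith
      from mult_left_mono[OF this A0] have "\<bar>A * (X n 2 t * z0 t + 2 * (X n 1 t * z1 t))\<bar> \<le> A * (3 * (H * E t))"
        using A0 by (simp add: abs_mult)
      then have "\<bar>R n t\<bar> \<le> 15 * (H * E t) + A * (3 * (H * E t))" unfolding R_def using p by linarith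
      then show ?thesis by (simp add: algebra_simps)
    qed
    have Ei: "integrable lborel E" unfolding E_def[abs_def] by (rule exp_abs_integrable[OF k])
    have Xm [measurable]: "X n j \<in> borel_measurable borel" for n j
    proof -
      have "isCont (cutoffs n j) t" for t by (rule DERIV_isCont[OF cutoffs_DERIV])
      then have "continuous_on UNIV (cutoffs n j)" by (simp add: continuous_at_imp_continuous_on)
      then show ?thesis unfolding X_def[abs_def] by (rule borel_measurable_continuous_onI)
    qed
    have zm [measurable]: "z0 \<in> borel_measurable borel" "z1 \<in> borel_measurable borel" "z2 \<in> borel_measurable borel" "z3 \<in> borel_measurable borel"
      using DERIV_borel_measurable[of z0 z1] DERIV_borel_measurable[of z1 z2] DERIV_borel_measurable[of z2 z3]
        DERIV_borel_measurable[of z3 z4] d0 d1 d2 d3 by auto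
    have Rm [measurable]: "R n \<in> borel_measurable borel" for n unfolding R_def[abs_def] by measurable
    have R0: "(\<lambda>n. R n t) \<longlonglongrightarrow> 0" for t
    proof -
      have "(\<lambda>n. R n t) \<longlonglongrightarrow> 0 * z0 t + 4 * (0 * z1 t) + 6 * (0 * z2 t) + 4 * (0 * z3 t) - A * (0 * z0 t + 2 * (0 * z1 t))"
        unfolding R_def X_def by (intro tendsto_intros cutoffs_lim(2)) auto
      then show ?thesis by simp
    qed
    have l1: "(\<lambda>n. LINT t|lborel. v t * (X n 0 t * \<theta> t + R n t)) \<longlonglongrightarrow> (LINT t|lborel. v t * \<theta> t)"
    proof (rule integral_dominated_convergence[where w="\<lambda>t. M * (B * \<bar>\<theta> t\<bar> + (15 + 3 * A) * H * E t)"])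
      show "integrable lborel (\<lambda>t. M * (B * \<bar>\<theta> t\<bar> + (15 + 3 * A) * H * E t))" using \<theta>i Ei by simp
      have "(\<lambda>n. v t * (X n 0 t * \<theta> t + R n t)) \<longlonglongrightarrow> v t * (1 * \<theta> t + 0)" for t
        unfolding X_def by (intro tendsto_intros cutoffs_lim R0)
      then show "AE t in lborel. (\<lambda>n. v t * (X n 0 t * \<theta> t + R n t)) \<longlonglongrightarrow> v t * \<theta> t" by simp
      have "norm (v t * (X n 0 t * \<theta> t + R n t)) \<le> M * (B * \<bar>\<theta> t\<bar> + (15 + 3 * A) * H * E t)" for n t
      proof -
        have "\<bar>X n 0 t * \<theta> t\<bar> \<le> B * \<bar>\<theta> t\<bar>" unfolding abs_mult by (intro mult_right_mono XB) auto
        then have "\<bar>X n 0 t * \<theta> t + R n t\<bar> \<le> B * \<bar>\<theta> t\<bar> + (15 + 3 * A) * H * E t" using Rb[of n t] by linarith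
        then show ?thesis unfolding real_norm_def abs_mult by (intro mult_mono vM) (use vM[of 0] in auto)
      qed
      then show "AE t in lborel. norm (v t * (X n 0 t * \<theta> t + R n t)) \<le> M * (B * \<bar>\<theta> t\<bar> + (15 + 3 * A) * H * E t)" for n by simp
    qed measurable
    have l2: "(\<lambda>n. LINT t|lborel. F t * \<eta> n t) \<longlonglongrightarrow> (LINT t|lborel. F t * z0 t)"
    proof (rule integral_dominated_convergence[where w="\<lambda>t. MF * (H * E t)"])
      show "integrable lborel (\<lambda>t. MF * (H * E t))" using Ei by simp
      have "(\<lambda>n. F t * \<eta> n t) \<longlonglongrightarrow> F t * (1 * z0 t)" for t
        unfolding \<eta>_def X_def by (intro tendsto_intros cutoffs_lim)
      then show "AE t in lborel. (\<lambda>n. F t * \<eta> n t) \<longlonglongrightarrow> F t * z0 t" by simp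
      have "norm (F t * \<eta> n t) \<le> MF * (H * E t)" for n t
      proof -
        have "\<bar>X n 0 t * z0 t\<bar> \<le> H * E t" by (rule pr) (simp_all add: zK)
        from mult_mono[OF FM[of t] this] show ?thesis
          using FM[of 0] by (simp add: \<eta>_def abs_mult mult.assoc)
      qed
      then show "AE t in lborel. norm (F t * \<eta> n t) \<le> MF * (H * E t)" for n by simp
      show "(\<lambda>t. F t * \<eta> n t) \<in> borel_measurable lborel" for n unfolding \<eta>_def by measurable
    qed measurable
    have "(LINT t|lborel. v t * (X n 0 t * \<theta> t + R n t)) = (LINT t|lborel. F t * \<eta> n t)" for n
      using weak[OF t1[of n]] unfolding Lw .
    with l1 l2 have e1: "(LINT t|lborel. v t * \<theta> t) = (LINT t|lborel. F t * z0 t)"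
      using LIMSEQ_unique by simp
    have gi: "integrable lborel (\<lambda>t. green c \<theta> t)" if g: "\<And>t. \<bar>green c \<theta> t\<bar> \<le> K' * exp (- k * \<bar>t\<bar>)" and c: "0 < c" for c K'
    proof (rule Bochner_Integration.integrable_bound)
      show "integrable lborel (\<lambda>t. K' * exp (- k * \<bar>t\<bar>))" by (intro integrable_mult_right exp_abs_integrable k)
      show "(\<lambda>t. green c \<theta> t) \<in> borel_measurable lborel"
        using borel_measurable_continuous_onI[OF green_continuous[OF \<theta>m T c]] by simp
      show "AE t in lborel. norm (green c \<theta> t) \<le> norm (K' * exp (- k * \<bar>t\<bar>))"
        unfolding real_norm_def by (intro AE_I2 order.trans[OF g abs_ge_self])
    qed
    note gik = gi[OF Kk(1) k] and gim = gi[OF Km(1) m]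
    have iF: "integrable lborel (\<lambda>t. F t * green c \<theta> t)" if "integrable lborel (\<lambda>t. green c \<theta> t)" for c
      using integrable_mult_bounded[OF that _ FM] by (simp add: mult.commute)
    have "(LINT t|lborel. F t * z0 t) = ((LINT t|lborel. F t * green k \<theta> t) - (LINT t|lborel. F t * green m \<theta> t)) / (m\<^sup>2 - k\<^sup>2)"
    proof -
      have "F t * z0 t = (F t * green k \<theta> t - F t * green m \<theta> t) / (m\<^sup>2 - k\<^sup>2)" for t
        by (simp add: z0_def right_diff_distrib)
      then show ?thesis using iF[OF gik] iF[OF gim] by simp
    qed
    also have "\<dots> = ((LINT t|lborel. \<theta> t * green k F t) - (LINT t|lborel. \<theta> t * green m F t)) / (m\<^sup>2 - k\<^sup>2)"
      using green_self_adjoint[OF Fm FM \<theta>m T \<theta>i k] green_self_adjoint[OF Fm FM \<theta>m T \<theta>i m] by simp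
    also have "\<dots> = (LINT t|lborel. y t * \<theta> t)"
    proof -
      have i: "integrable lborel (\<lambda>t. \<theta> t * green c F t)" if "0 < c" for c
        by (rule integrable_mult_bounded[OF \<theta>i _ green_bound[OF Fm FM that]])
          (use borel_measurable_continuous_onI[OF green_continuous[OF Fm FM that]] in simp)
      have "y t * \<theta> t = (\<theta> t * green k F t - \<theta> t * green m F t) / (m\<^sup>2 - k\<^sup>2)" for t
        by (simp add: y_def algebra_simps)
      then show ?thesis using i[OF k] i[OF m] by simp
    qed
    finally show ?thesis using e1 by simp
  qed
  \<comment> \<open>The difference annihilates all test profiles, so the fundamental lemma applies
    with bound 0.\<close>
  have "AE t in lborel. - real n < t \<and> t < real n \<longrightarrow> \<bar>v t - y t\<bar> \<le> 0" for n
  proof (rule AE_bound_from_test_functions)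
    show "integrable lborel (\<lambda>t. indicator {- real n..real n} t * (v t - y t))"
    proof (rule integrable_mult_bounded)
      show "\<bar>v t - y t\<bar> \<le> M + MY" for t using vM[of t] MY[of t] by linarith
    qed auto
    fix \<eta> assume t: "test1 (- real n) (real n) \<eta>"
    have i: "integrable lborel (\<lambda>t. v t * \<eta> t)" "integrable lborel (\<lambda>t. y t * \<eta> t)"
      using integrable_mult_bounded[OF test1_integrable[OF t] _ vM] integrable_mult_bounded[OF test1_integrable[OF t] _ MY]
      by (simp_all add: mult.commute)
    have "(LINT t|lborel. (v t - y t) * \<eta> t) = (LINT t|lborel. v t * \<eta> t) - (LINT t|lborel. y t * \<eta> t)"
      using i by (simp add: left_diff_distrib)
    then show "\<bar>LINT t|lborel. (v t - y t) * \<eta> t\<bar> \<le> 0 * (LINT t|lborel. \<bar>\<eta> t\<bar>)" using eq[OF t] by simp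
  qed auto
  then have "AE t in lborel. \<forall>n. - real n < t \<and> t < real n \<longrightarrow> \<bar>v t - y t\<bar> \<le> 0"
    unfolding AE_all_countable by blast
  then show ?thesis
  proof eventually_elim
    case (elim t)
    obtain n where "\<bar>t\<bar> < real n" using reals_Archimedean2 by blast
    then have "\<bar>v t - y t\<bar> \<le> 0" using elim by (auto simp: abs_less_iff)
    then show ?case by (simp add: y_def)
  qed
qed

section \<open>Classification of the radial solutions\<close>

context emden_fowler_space
begin

text \<open>The pairing with v is a bounded functional on L1 of each unit interval, with one norm
  for all intervals. Near the origin an approximant \<phi> n vanishes, so only the approximation
  error survives there, and this can be made small in advance.\<close>

lemma profile_bounded_decay:
  fixes u :: "'a \<Rightarrow> real"
  assumes uD: "u \<in> D_space \<alpha> \<beta>" and vm: "v \<in> borel_measurable borel"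
    and uv: "AE x in lborel. u x = lift (- m) v x"
  obtains M where "0 \<le> M" "AE t in lborel. \<bar>v t\<bar> \<le> M"
    and "\<And>\<epsilon>. 0 < \<epsilon> \<Longrightarrow> \<exists>R. AE t in lborel. t < R \<longrightarrow> \<bar>v t\<bar> \<le> \<epsilon>"
proof -
  let ?s = "sphere_const DIM('a)"
  have s: "0 < ?s" by (rule sphere_const_pos) simp
  have li: "loc_integrable u" using uD by (simp add: D_space_def)
  obtain \<phi> where \<phi>: "\<And>n::nat. \<phi> n \<in> (test_functions :: ('a \<Rightarrow> real) set)"
    and F: "\<And>\<epsilon>. 0 < \<epsilon> \<Longrightarrow> \<exists>n. \<forall>\<zeta> \<eta> a b. admissible \<zeta> \<eta> \<longrightarrow> (\<forall>t. t < a \<or> b < t \<longrightarrow> \<eta> t = 0) \<longrightarrow>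
      \<bar>?s * (LINT t|lborel. v t * \<eta> t) - (LINT x|lborel. \<phi> n x * lift (\<alpha> - k - 2) \<eta> x)\<bar>
        \<le> \<epsilon> * sqrt (?s * (LINT t|lborel. (\<zeta> t)\<^sup>2))"
    using D_space_functional[OF uD vm uv] by blast
  obtain K where K: "\<And>T \<eta>. test1 T (T + 1) \<eta> \<Longrightarrow>
    \<exists>\<zeta>. admissible \<zeta> \<eta> \<and> sqrt (LINT t|lborel. (\<zeta> t)\<^sup>2) \<le> K * (LINT t|lborel. \<bar>\<eta> t\<bar>)" "0 \<le> K"
    using admissible_solution by blast
  have approx: "\<exists>n. \<forall>T \<eta>. test1 T (T + 1) \<eta> \<longrightarrow>
      \<bar>?s * (LINT t|lborel. v t * \<eta> t) - (LINT x|lborel. \<phi> n x * lift (\<alpha> - k - 2) \<eta> x)\<bar> \<le> \<epsilon> * (sqrt ?s * K * (LINT t|lborel. \<bar>\<eta> t\<bar>))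
      \<and> \<bar>LINT x|lborel. \<phi> n x * lift (\<alpha> - k - 2) \<eta> x\<bar> \<le> D_norm \<alpha> \<beta> (\<phi> n) * (sqrt ?s * K * (LINT t|lborel. \<bar>\<eta> t\<bar>))"
    if \<epsilon>: "0 < \<epsilon>" for \<epsilon>
  proof -
    obtain n where n: "\<And>\<zeta> \<eta> a b. admissible \<zeta> \<eta> \<Longrightarrow> (\<forall>t. t < a \<or> b < t \<longrightarrow> \<eta> t = 0) \<Longrightarrow>
      \<bar>?s * (LINT t|lborel. v t * \<eta> t) - (LINT x|lborel. \<phi> n x * lift (\<alpha> - k - 2) \<eta> x)\<bar>
        \<le> \<epsilon> * sqrt (?s * (LINT t|lborel. (\<zeta> t)\<^sup>2))" using F[OF \<epsilon>] by blast
    show ?thesis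
    proof (intro exI[of _ n] allI impI)
      fix T \<eta> assume t: "test1 T (T + 1) \<eta>"
      obtain \<zeta> where z: "admissible \<zeta> \<eta>" "sqrt (LINT t|lborel. (\<zeta> t)\<^sup>2) \<le> K * (LINT t|lborel. \<bar>\<eta> t\<bar>)"
        using K(1)[OF t] by blast
      have sz: "sqrt (?s * (LINT t|lborel. (\<zeta> t)\<^sup>2)) \<le> sqrt ?s * K * (LINT t|lborel. \<bar>\<eta> t\<bar>)"
        using mult_left_mono[OF z(2), of "sqrt ?s"] s by (simp add: real_sqrt_mult mult.assoc)
      have D: "0 \<le> D_norm \<alpha> \<beta> (\<phi> n)" unfolding D_norm_eq(2)[OF \<phi>] by (simp add: integral_nonneg_AE)
      have o: "\<forall>t'. t' < T \<or> T + 1 < t' \<longrightarrow> \<eta> t' = 0" using t by (simp add: test1_def)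
      show "\<bar>?s * (LINT t|lborel. v t * \<eta> t) - (LINT x|lborel. \<phi> n x * lift (\<alpha> - k - 2) \<eta> x)\<bar> \<le> \<epsilon> * (sqrt ?s * K * (LINT t|lborel. \<bar>\<eta> t\<bar>))
      \<and> \<bar>LINT x|lborel. \<phi> n x * lift (\<alpha> - k - 2) \<eta> x\<bar> \<le> D_norm \<alpha> \<beta> (\<phi> n) * (sqrt ?s * K * (LINT t|lborel. \<bar>\<eta> t\<bar>))"
        using order.trans[OF n[OF z(1) o] mult_left_mono[OF sz less_imp_le[OF \<epsilon>]]]
          order.trans[OF pairing_bound(1)[OF \<phi> z(1)] mult_left_mono[OF sz D]] by blast
    qed
  qed
  have FL: "AE t in lborel. T < t \<and> t < T + 1 \<longrightarrow> \<bar>v t\<bar> \<le> c * (sqrt ?s * K) / ?s"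
    if c: "0 \<le> c" and b: "\<And>\<eta>. test1 T (T + 1) \<eta> \<Longrightarrow> \<bar>?s * (LINT t|lborel. v t * \<eta> t)\<bar> \<le> c * (sqrt ?s * K * (LINT t|lborel. \<bar>\<eta> t\<bar>))"
    for T c
  proof (rule AE_bound_from_test_functions[OF vm profile_loc_integrable[OF li vm uv]])
    show "0 \<le> c * (sqrt ?s * K) / ?s" using c K(2) s by simp
    fix \<eta> assume "test1 T (T + 1) \<eta>"
    from b[OF this] have "?s * \<bar>LINT t|lborel. v t * \<eta> t\<bar> \<le> c * (sqrt ?s * K * (LINT t|lborel. \<bar>\<eta> t\<bar>))"
      using s by (simp add: abs_mult)
    then show "\<bar>LINT t|lborel. v t * \<eta> t\<bar> \<le> c * (sqrt ?s * K) / ?s * (LINT t|lborel. \<bar>\<eta> t\<bar>)"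
      using s by (simp add: pos_le_divide_eq mult_ac)
  qed
  obtain n1 where n1: "\<And>T \<eta>. test1 T (T + 1) \<eta> \<Longrightarrow>
      \<bar>?s * (LINT t|lborel. v t * \<eta> t) - (LINT x|lborel. \<phi> n1 x * lift (\<alpha> - k - 2) \<eta> x)\<bar> \<le> 1 * (sqrt ?s * K * (LINT t|lborel. \<bar>\<eta> t\<bar>))
      \<and> \<bar>LINT x|lborel. \<phi> n1 x * lift (\<alpha> - k - 2) \<eta> x\<bar> \<le> D_norm \<alpha> \<beta> (\<phi> n1) * (sqrt ?s * K * (LINT t|lborel. \<bar>\<eta> t\<bar>))"
    using approx[OF zero_less_one] by blast
  define c1 where "c1 = 1 + D_norm \<alpha> \<beta> (\<phi> n1)"
  have c1: "0 \<le> c1" unfolding c1_def D_norm_eq(2)[OF \<phi>] by (simp add: integral_nonneg_AE)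
  have U: "AE t in lborel. T < t \<and> t < T + 1 \<longrightarrow> \<bar>v t\<bar> \<le> c1 * (sqrt ?s * K) / ?s" for T
  proof (rule FL[OF c1])
    fix \<eta> assume "test1 T (T + 1) \<eta>"
    from n1[OF this] show "\<bar>?s * (LINT t|lborel. v t * \<eta> t)\<bar> \<le> c1 * (sqrt ?s * K * (LINT t|lborel. \<bar>\<eta> t\<bar>))"
      unfolding c1_def distrib_right by linarith
  qed
  show ?thesis
  proof (rule that)
    show "0 \<le> c1 * (sqrt ?s * K) / ?s" using c1 K(2) s by simp
    have "AE t in lborel. \<forall>j::nat. t < real j - 1 \<longrightarrow> \<bar>v t\<bar> \<le> c1 * (sqrt ?s * K) / ?s"
      unfolding AE_all_countable by (intro allI AE_below_from_unit_intervals U)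
    then show "AE t in lborel. \<bar>v t\<bar> \<le> c1 * (sqrt ?s * K) / ?s"
    proof eventually_elim
      case (elim t)
      obtain j where "t + 1 < real j" using reals_Archimedean2 by blast
      then show ?case using elim[rule_format, of j] by (simp add: less_diff_eq)
    qed
    fix \<epsilon> :: real assume \<epsilon>: "0 < \<epsilon>"
    \<comment> \<open>Chosen so that the resulting pointwise bound e sqrt(s) K / s stays below
      \<epsilon>, s being the area of the sphere.\<close>
    define e where "e = \<epsilon> * ?s / (sqrt ?s * K + 1)"
    have den: "0 < sqrt ?s * K + 1" using K(2) s by (simp add: add_nonneg_pos)
    have e: "0 < e" using \<epsilon> s den by (simp add: e_def)
    have e\<epsilon>: "e * (sqrt ?s * K) / ?s \<le> \<epsilon>"
    proof -
      have "e * (sqrt ?s * K) \<le> e * (sqrt ?s * K + 1)" using e by (intro mult_left_mono) auto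
      also have "\<dots> = \<epsilon> * ?s" using den by (simp add: e_def)
      finally show ?thesis using s by (simp add: pos_divide_le_eq)
    qed
    obtain n where n: "\<And>T \<eta>. test1 T (T + 1) \<eta> \<Longrightarrow>
        \<bar>?s * (LINT t|lborel. v t * \<eta> t) - (LINT x|lborel. \<phi> n x * lift (\<alpha> - k - 2) \<eta> x)\<bar> \<le> e * (sqrt ?s * K * (LINT t|lborel. \<bar>\<eta> t\<bar>))"
      using approx[OF e] by blast
    obtain \<rho> R where \<rho>: "0 < \<rho>" "\<And>x. norm x < \<rho> \<or> R < norm x \<Longrightarrow> \<phi> n x = 0"
      using test_functions_support[OF \<phi>] by blast
    have "AE t in lborel. t < ln \<rho> - 1 \<longrightarrow> \<bar>v t\<bar> \<le> e * (sqrt ?s * K) / ?s"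
    proof (rule AE_below_from_unit_intervals, rule FL[OF less_imp_le[OF e]])
      fix T \<eta> assume T: "T + 1 < ln \<rho>" and t: "test1 T (T + 1) \<eta>"
      \<comment> \<open>The support of \<phi> n starts at radius \<rho>, to the right of the
        interval carrying \<eta>; the pairing with \<phi> n is therefore zero.\<close>
      have z: "\<phi> n x * lift (\<alpha> - k - 2) \<eta> x = 0" for x
      proof (cases "norm x < \<rho>")
        case False
        then have "ln \<rho> \<le> ln (norm x)" using \<rho>(1) by (intro ln_mono) auto
        then have "\<eta> (ln (norm x)) = 0" using t T by (simp add: test1_def)
        then show ?thesis by (simp add: lift_def)
      qed (use \<rho>(2) in simp)
      have "(LINT x|lborel. \<phi> n x * lift (\<alpha> - k - 2) \<eta> x) = 0" by (simp only: z) simp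
      with n[OF t] show "\<bar>?s * (LINT t|lborel. v t * \<eta> t)\<bar> \<le> e * (sqrt ?s * K * (LINT t|lborel. \<bar>\<eta> t\<bar>))"
        by (simp only: diff_0_right)
    qed
    then have "AE t in lborel. t < ln \<rho> - 1 \<longrightarrow> \<bar>v t\<bar> \<le> \<epsilon>" by eventually_elim (use e\<epsilon> in auto)
    then show "\<exists>R. AE t in lborel. t < R \<longrightarrow> \<bar>v t\<bar> \<le> \<epsilon>" by blast
  qed
qed

text \<open>The inner equation is tested with |x|^(-k) \<theta> and the outer one with |x|^(-m)
  \<eta>. The weight |x|^(-\<beta>) carries the divergence of the second into the first, so the
  unknown inner function f drops out.\<close>

lemma weak_equation_on_line:
  fixes u :: "'a \<Rightarrow> real"
  assumes w: "weak_solution \<alpha> \<beta> \<gamma> (crit_exp N \<alpha> \<beta> \<gamma>) u" and vm [measurable]: "v \<in> borel_measurable borel"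
    and uv: "AE x in lborel. u x = lift (- m) v x" and \<eta>: "test1 a b \<eta>"
  shows "(LINT t|lborel. v t * (deriv (deriv (deriv (deriv \<eta>))) t
       - (m\<^sup>2 + k\<^sup>2) * deriv (deriv \<eta>) t + m\<^sup>2 * k\<^sup>2 * \<eta> t)) = (LINT t|lborel. nl r (v t) * \<eta> t)"
proof -
  obtain f where 1: "weak_wdiv \<alpha> u f"
    and 2: "weak_wdiv \<alpha> (\<lambda>x. norm x powr (- \<beta>) * f x) (\<lambda>x. norm x powr \<gamma> * (\<bar>u x\<bar> powr (crit_exp N \<alpha> \<beta> \<gamma> - 2) * u x))"
    using w unfolding weak_solution_def by blast
  have um: "u \<in> borel_measurable lebesgue" using 1 loc_integrable_measurable by (simp add: weak_wdiv_def)
  \<comment> \<open>This is (D - m)(D + k) \<eta>; the second application contributes (D - k)(D +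
    m), which completes the fourth-order operator.\<close>
  define \<theta> where "\<theta> t = deriv (deriv \<eta>) t + (k - m) * deriv \<eta> t + (- (m * k)) * \<eta> t" for t
  have d\<eta>: "test1 a b (deriv \<eta>)" "test1 a b (deriv (deriv \<eta>))" "test1 a b (deriv (deriv (deriv \<eta>)))"
      "test1 a b (deriv (deriv (deriv (deriv \<eta>))))"
    by (intro test1_deriv \<eta>)+
  have t\<theta>: "test1 a b \<theta>" unfolding \<theta>_def by (intro test1_add test1_cmult \<eta> d\<eta>)
  have \<theta>1: "deriv \<theta> = (\<lambda>t. deriv (deriv (deriv \<eta>)) t + (k - m) * deriv (deriv \<eta>) t + (- (m * k)) * deriv \<eta> t)"
    unfolding \<theta>_def
    by (rule deriv_eqI, intro DERIV_add DERIV_cmult test1_DERIV[OF \<eta>] test1_DERIV[OF d\<eta>(1)] test1_DERIV[OF d\<eta>(2)])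
  have \<theta>2: "deriv (deriv \<theta>) = (\<lambda>t. deriv (deriv (deriv (deriv \<eta>))) t + (k - m) * deriv (deriv (deriv \<eta>)) t + (- (m * k)) * deriv (deriv \<eta>) t)"
    unfolding \<theta>1
    by (rule deriv_eqI, intro DERIV_add DERIV_cmult test1_DERIV[OF d\<eta>(1)] test1_DERIV[OF d\<eta>(2)] test1_DERIV[OF d\<eta>(3)])
  let ?\<phi> = "lift (- m) \<eta> :: 'a \<Rightarrow> real" and ?\<psi> = "lift (- k) \<theta> :: 'a \<Rightarrow> real"
  have c1: "2 * - m + real DIM('a) + \<alpha> - 2 = k - m" "- m * (- m + real DIM('a) + \<alpha> - 2) = - (m * k)"
    and c2: "2 * - k + real DIM('a) + \<alpha> - 2 = m - k" "- k * (- k + real DIM('a) + \<alpha> - 2) = - (m * k)"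
    using a_eq by (simp_all add: dim algebra_simps)
  have w\<phi>: "wdiv \<alpha> ?\<phi> x = lift (\<alpha> - m - 2) \<theta> x" for x
    unfolding wdiv_lift[OF \<eta>] c1 \<theta>_def by simp
  have w\<psi>: "wdiv \<alpha> ?\<psi> x = lift (\<alpha> - k - 2) (\<lambda>t. deriv (deriv (deriv (deriv \<eta>))) t
       - (m\<^sup>2 + k\<^sup>2) * deriv (deriv \<eta>) t + m\<^sup>2 * k\<^sup>2 * \<eta> t) x" for x
  proof -
    have "wdiv \<alpha> ?\<psi> x = lift (\<alpha> + - k - 2) (\<lambda>t. deriv (deriv \<theta>) t + (m - k) * deriv \<theta> t + - (m * k) * \<theta> t) x"
      unfolding wdiv_lift[OF t\<theta>] c2 ..
    also have "(\<lambda>t. deriv (deriv \<theta>) t + (m - k) * deriv \<theta> t + - (m * k) * \<theta> t) = (\<lambda>t. deriv (deriv (deriv (deriv \<eta>))) t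
       - (m\<^sup>2 + k\<^sup>2) * deriv (deriv \<eta>) t + m\<^sup>2 * k\<^sup>2 * \<eta> t)"
      unfolding \<theta>2 unfolding \<theta>1 \<theta>_def by (simp add: power2_eq_square algebra_simps)
    finally show ?thesis by simp
  qed
  have [measurable]: "\<eta> \<in> borel_measurable borel" by (rule test1_measurable[OF \<eta>])
  have Lm: "(\<lambda>t. deriv (deriv (deriv (deriv \<eta>))) t - (m\<^sup>2 + k\<^sup>2) * deriv (deriv \<eta>) t + m\<^sup>2 * k\<^sup>2 * \<eta> t) \<in> borel_measurable borel"
    using test1_measurable[OF d\<eta>(4)] test1_measurable[OF d\<eta>(2)] by measurable
  have "(LINT x|lebesgue. u x * wdiv \<alpha> ?\<psi> x) = (LINT x|lebesgue. f x * ?\<psi> x)"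
    using 1 lift_test_function[OF t\<theta>, of "- k"] unfolding weak_wdiv_def by blast
  also have "(\<lambda>x. f x * ?\<psi> x) = (\<lambda>x. norm x powr (- \<beta>) * f x * wdiv \<alpha> ?\<phi> x)"
  proof
    fix x :: 'a
    have "- \<beta> + (\<alpha> - m - 2) = - k" using mk_diff by linarith
    then have "norm x powr (- \<beta>) * norm x powr (\<alpha> - m - 2) = norm x powr (- k)" by (simp only: powr_add[symmetric])
    then show "f x * ?\<psi> x = norm x powr (- \<beta>) * f x * wdiv \<alpha> ?\<phi> x"
      unfolding w\<phi> lift_def by (metis mult.assoc mult.left_commute)
  qed
  also have "(LINT x|lebesgue. norm x powr (- \<beta>) * f x * wdiv \<alpha> ?\<phi> x)
      = (LINT x|lebesgue. norm x powr \<gamma> * (\<bar>u x\<bar> powr (crit_exp N \<alpha> \<beta> \<gamma> - 2) * u x) * ?\<phi> x)"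
    using 2 lift_test_function[OF \<eta>, of "- m"] unfolding weak_wdiv_def by blast
  also have "\<dots> = (LINT x|(lebesgue::'a measure). lift (\<gamma> - m * (r + 2)) (\<lambda>t. nl r (v t) * \<eta> t) x)"
  proof (rule integral_cong_AE)
    show "(\<lambda>x. norm x powr \<gamma> * (\<bar>u x\<bar> powr (crit_exp N \<alpha> \<beta> \<gamma> - 2) * u x) * ?\<phi> x) \<in> borel_measurable lebesgue"
    proof -
      have "(\<lambda>x::'a. norm x powr \<gamma> * ?\<phi> x) \<in> borel_measurable lebesgue" by (intro measurable_completion) measurable
      moreover have "(\<lambda>x. \<bar>u x\<bar> powr (crit_exp N \<alpha> \<beta> \<gamma> - 2) * u x) \<in> borel_measurable lebesgue" using um by measurable
      ultimately have "(\<lambda>x. (norm x powr \<gamma> * ?\<phi> x) * (\<bar>u x\<bar> powr (crit_exp N \<alpha> \<beta> \<gamma> - 2) * u x)) \<in> borel_measurable lebesgue"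
        by (rule borel_measurable_times)
      then show ?thesis by (simp add: mult_ac)
    qed
    show "(\<lambda>x::'a. lift (\<gamma> - m * (r + 2)) (\<lambda>t. nl r (v t) * \<eta> t) x) \<in> borel_measurable lebesgue"
      by (intro measurable_completion) simp
    have "AE x in lborel. norm x powr \<gamma> * (\<bar>u x\<bar> powr (crit_exp N \<alpha> \<beta> \<gamma> - 2) * u x) * ?\<phi> x = lift (\<gamma> - m * (r + 2)) (\<lambda>t. nl r (v t) * \<eta> t) x"
      using uv
    proof eventually_elim
      case (elim x)
      let ?n = "norm x" and ?l = "ln (norm x)"
      have "\<bar>?n powr (- m) * v ?l\<bar> powr r = ?n powr (- m * r) * \<bar>v ?l\<bar> powr r"
        by (simp add: abs_mult powr_mult powr_powr)
      then have "norm x powr \<gamma> * (\<bar>u x\<bar> powr r * u x) * ?\<phi> x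
          = (?n powr \<gamma> * ?n powr (- m * r) * ?n powr (- m) * ?n powr (- m)) * (nl r (v ?l) * \<eta> ?l)"
        unfolding elim lift_def nl_def by (simp add: mult_ac)
      also have "?n powr \<gamma> * ?n powr (- m * r) * ?n powr (- m) * ?n powr (- m) = ?n powr (\<gamma> - m * (r + 2))"
        by (simp add: powr_add[symmetric] algebra_simps)
      finally show ?case unfolding crit_exp_eq lift_def .
    qed
    then show "AE x in lebesgue. norm x powr \<gamma> * (\<bar>u x\<bar> powr (crit_exp N \<alpha> \<beta> \<gamma> - 2) * u x) * ?\<phi> x = lift (\<gamma> - m * (r + 2)) (\<lambda>t. nl r (v t) * \<eta> t) x"
      by (rule AE_completion)
  qed
  also have "\<dots> = (LINT x|(lborel::'a measure). lift (\<gamma> - m * (r + 2)) (\<lambda>t. nl r (v t) * \<eta> t) x)"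
    by (rule integral_completion) simp
  also have "\<dots> = sphere_const DIM('a) * (LINT t|lborel. nl r (v t) * \<eta> t)"
  proof -
    have "real DIM('a) + (\<gamma> - m * (r + 2)) = 0" using N\<gamma> by (simp add: dim)
    then show ?thesis by (subst lift_integral(1)) simp_all
  qed
  finally have "sphere_const DIM('a) * (LINT t|lborel. v t * (deriv (deriv (deriv (deriv \<eta>))) t
       - (m\<^sup>2 + k\<^sup>2) * deriv (deriv \<eta>) t + m\<^sup>2 * k\<^sup>2 * \<eta> t)) = sphere_const DIM('a) * (LINT t|lborel. nl r (v t) * \<eta> t)"
    unfolding w\<psi> integral_against_profile[OF vm Lm um uv] .
  then show ?thesis using sphere_const_pos[of "DIM('a)"] by simp
qed

theorem radial_solution_is_bubble:
  fixes u :: "'a \<Rightarrow> real"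
  assumes uD: "u \<in> D_space \<alpha> \<beta>" and w: "weak_solution \<alpha> \<beta> \<gamma> (crit_exp N \<alpha> \<beta> \<gamma>) u"
    and rad: "radial u" and nt: "nontrivial u"
  shows "\<exists>s>0. (AE x in lebesgue. u x = scaled_bubble N \<alpha> \<beta> s x) \<or> (AE x in lebesgue. u x = - scaled_bubble N \<alpha> \<beta> s x)"
proof -
  have li: "loc_integrable u" using uD by (simp add: D_space_def)
  obtain v where vm: "v \<in> borel_measurable borel" and uv: "AE x in lborel. u x = lift (- m) v x"
    using radial_borel_profile[OF loc_integrable_measurable[OF li] rad] by blast
  obtain M where M0: "0 \<le> M" and vM: "AE t in lborel. \<bar>v t\<bar> \<le> M"
    and dec: "\<And>\<epsilon>. 0 < \<epsilon> \<Longrightarrow> \<exists>R. AE t in lborel. t < R \<longrightarrow> \<bar>v t\<bar> \<le> \<epsilon>"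
    using profile_bounded_decay[OF uD vm uv] by blast
  \<comment> \<open>The Green operator lemmas ask for a bound at every point; v is bounded only
    almost everywhere, so it is changed on a null set.\<close>
  define b where "b t = (if \<bar>v t\<bar> \<le> M then v t else 0)" for t
  have bm [measurable]: "b \<in> borel_measurable borel" unfolding b_def using vm by measurable
  have bM: "\<bar>b t\<bar> \<le> M" for t using M0 by (simp add: b_def)
  have bv: "AE t in lborel. b t = v t" using vM by eventually_elim (simp add: b_def)
  have ub: "AE x in lborel. u x = lift (- m) b x"
    using uv AE_radial[OF bv, where 'a='a] by eventually_elim (simp add: lift_def)
  define F where "F t = nl r (b t)" for t
  have Fm: "F \<in> borel_measurable borel" unfolding F_def by measurable
  have FM: "\<bar>F t\<bar> \<le> M powr r * M" for t
    unfolding F_def abs_nl using bM[of t] r by (intro mult_mono powr_mono2) auto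
  define y where "y t = (green k F t - green m F t) / (m\<^sup>2 - k\<^sup>2)" for t
  have b_y: "AE t in lborel. b t = y t"
    unfolding y_def
    by (rule weak_to_integral_equation[OF k km bm bM Fm FM])
      (unfold F_def, rule weak_equation_on_line[OF w bm ub])
  have mk: "0 < m\<^sup>2 - k\<^sup>2" using k km by (simp add: power_strict_mono)
  have yc: "continuous_on UNIV y"
    unfolding y_def using mk by (intro continuous_intros green_continuous[OF Fm FM] k m) auto
  have ym [measurable]: "y \<in> borel_measurable borel" by (rule borel_measurable_continuous_onI[OF yc])
  have yM: "\<bar>y t\<bar> \<le> M" for t
  proof (rule AE_bound_continuous[OF yc])
    show "AE t' in lborel. t' < t + 1 \<longrightarrow> \<bar>y t'\<bar> \<le> M" using b_y by eventually_elim (metis bM)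
  qed simp
  have ylim: "(y \<longlongrightarrow> 0) at_bot"
  proof (rule tendstoI)
    fix e :: real assume "0 < e"
    then obtain R where R: "AE t in lborel. t < R \<longrightarrow> \<bar>v t\<bar> \<le> e / 2" using dec[of "e / 2"] by auto
    have "AE t in lborel. t < R \<longrightarrow> \<bar>y t\<bar> \<le> e / 2" using R b_y bv by eventually_elim simp
    then have "\<bar>y t\<bar> \<le> e / 2" if "t < R" for t using AE_bound_continuous[OF yc _ that] by blast
    then show "\<forall>\<^sub>F t in at_bot. dist (y t) 0 < e"
      using \<open>0 < e\<close> by (intro eventually_mono[OF eventually_gt_at_bot[of R]]) (force simp: dist_real_def)
  qed
  have nlM: "\<bar>nl r (y s)\<bar> \<le> M powr r * M" for s
    unfolding abs_nl using yM[of s] r by (intro mult_mono powr_mono2) auto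
  have Fy: "AE s in lborel. F s = nl r (y s)" using b_y by eventually_elim (simp add: F_def)
  have gF: "green c F t = green c (\<lambda>s. nl r (y s)) t" if "0 < c" for c t
    by (rule green_cong_AE[OF Fm FM _ nlM Fy that]) measurable
  have eq: "y t = (green k (\<lambda>s. nl r (y s)) t - green m (\<lambda>s. nl r (y s)) t) / (m\<^sup>2 - k\<^sup>2)" for t
    using gF[OF k, of t] gF[OF m, of t] by (simp add: y_def)
  obtain y1 w w1 A B where o: "orbit k m r y y1 w w1 A B"
    using orbit_of_integral_equation[OF k km rk yc yM ylim eq] by blast
  have uy: "AE x in lborel. u x = lift (- m) y x"
    using ub AE_radial[OF b_y, where 'a='a] by eventually_elim (simp add: lift_def)
  let ?C = "bubble_const N \<alpha> \<beta>"
  have bub: "AE x::'a in lborel. lift (- m) (profile (ln s)) x = scaled_bubble N \<alpha> \<beta> s x" if "0 < s" for s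
    using AE_lborel_singleton[of "0::'a"] by eventually_elim (simp add: scaled_bubble_eq_lift[OF that])
  \<comment> \<open>This \<tau> solves C e^(k \<tau>) = A', so the translated explicit orbit has the
    same first coordinate.\<close>
  have pos: "y' t = profile \<tau> t"
    if o': "orbit k m r y' y1' w' w1' A' B'" and "0 < A'" and \<tau>: "\<tau> = ln (A' / ?C) / k" for y' y1' w' w1' A' B' \<tau> t
  proof -
    obtain Y1 W W1 B2 where "orbit k m r (profile \<tau>) Y1 W W1 (?C * exp (k * \<tau>)) B2"
      using profile_orbit[of \<tau>] by metis
    moreover have "?C * exp (k * \<tau>) = A'" using that(2) bubble_const_pos k by (simp add: \<tau>)
    ultimately show ?thesis using orbit_unique[OF k km rk o'] by simp
  qed
  consider "A = 0" | "0 < A" | "A < 0" by linarith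
  then show ?thesis
  proof cases
    case 1
    have "y t = 0" for t using orbit_unique[OF k km rk o orbit_zero[of k m r, folded 1]] 1 by simp
    then have "AE x in lborel. u x = 0" using uy by (simp add: lift_def)
    then have "AE x in lebesgue. u x = 0" by (rule AE_completion)
    then show ?thesis using nt by (simp add: nontrivial_def)
  next
    case 2
    define \<tau> where "\<tau> = ln (A / ?C) / k"
    have "y = profile \<tau>" using pos[OF o 2 \<tau>_def] by (rule ext)
    then have "AE x in lborel. u x = scaled_bubble N \<alpha> \<beta> (exp \<tau>) x"
      using uy bub[of "exp \<tau>"] by (auto elim: eventually_elim2)
    then show ?thesis using AE_completion exp_gt_zero by blast
  next
    case 3
    define \<tau> where "\<tau> = ln (- A / ?C) / k"
    \<comment> \<open>For negative A the reflected orbit has positive first coordinate, the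
      nonlinearity being odd.\<close>
    have "- y t = profile \<tau> t" for t
      by (rule pos[OF orbit_minus[OF o]]) (use 3 in \<open>simp_all add: \<tau>_def\<close>)
    then have "y t = - profile \<tau> t" for t by (metis minus_minus)
    then have ly: "lift (- m) y x = - lift (- m) (profile \<tau>) x" for x :: 'a by (simp add: lift_def)
    have "AE x in lborel. u x = - scaled_bubble N \<alpha> \<beta> (exp \<tau>) x"
      using uy bub[of "exp \<tau>"] unfolding ly by (auto elim: eventually_elim2)
    then show ?thesis using AE_completion exp_gt_zero by blast
  qed
qed

end

section \<open>From the bubble to the weak equation\<close>

lemma smooth_on_translate:
  assumes "smooth_on UNIV f" shows "smooth_on UNIV (\<lambda>t. f (t + \<tau>))"
  by (rule smooth_on_compose[OF open_UNIV open_UNIV subset_UNIV assms])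
    (intro smooth_on_add smooth_on_ident smooth_on_const open_UNIV)

lemma smooth_on_sech_pow: "smooth_on UNIV (sech_pow \<delta> n)"
proof -
  have "smooth_on UNIV (\<lambda>t. (1 + exp (\<delta> * t)) powr (- n))"
    by (rule smooth_on_compose[of UNIV "{0<..}" "\<lambda>t. 1 + exp (\<delta> * t)" "\<lambda>x. x powr (- n)"])
      (auto intro!: smooth_on_powr smooth_on_add smooth_on_exp)
  then show ?thesis
    unfolding sech_pow_def[abs_def] by (intro smooth_on_mult smooth_on_exp open_UNIV)
qed

lemma (in emden_fowler) smooth_on_profile: "smooth_on UNIV (profile \<tau>)"
  unfolding profile_def[abs_def]
  by (intro smooth_on_cmult smooth_on_translate smooth_on_sech_pow open_UNIV)

lemma test1_mono: "test1 a b \<eta> \<Longrightarrow> a' \<le> a \<Longrightarrow> b \<le> b' \<Longrightarrow> test1 a' b' \<eta>"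
  by (auto simp: test1_def)

lemma loc_integrable_lift:
  fixes u :: "'a::euclidean_space \<Rightarrow> real"
  assumes c: "continuous_on UNIV \<eta>" and u: "AE x in lborel. u x = lift c \<eta> x"
  shows "loc_integrable u"
  unfolding loc_integrable_def set_integrable_def
proof (intro allI impI)
  fix K :: "'a set" assume K: "compact K \<and> 0 \<notin> K"
  have i: "integrable lborel (\<lambda>x. indicator K x *\<^sub>R lift c \<eta> x)"
    using K by (intro borel_integrable_compact continuous_on_subset[OF lift_continuous_on[OF c]]) auto
  then have i2: "integrable lebesgue (\<lambda>x. indicator K x *\<^sub>R lift c \<eta> x)"
    by (subst integrable_completion) (auto intro: borel_measurable_integrable)
  have "AE x in lborel. indicator K x *\<^sub>R lift c \<eta> x = indicator K x *\<^sub>R u x"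
    using u by eventually_elim simp
  then have ae: "AE x in lebesgue. indicator K x *\<^sub>R lift c \<eta> x = indicator K x *\<^sub>R u x"
    by (rule AE_completion)
  show "integrable lebesgue (\<lambda>x. indicator K x *\<^sub>R u x)"
    by (rule integrable_cong_AE_imp[OF i2 borel_measurable_AE[OF borel_measurable_integrable[OF i2] ae] ae])
qed

text \<open>For profiles with two derivatives, the second continuous, the distributional identity is
  the integration by parts formula. Almost-everywhere equality is enough, so whole classes of
  functions are covered.\<close>

lemma weak_wdiv_lift:
  fixes u h :: "'a::euclidean_space \<Rightarrow> real" and \<zeta> \<zeta>1 \<zeta>2 \<theta> :: "real \<Rightarrow> real" and c \<alpha> :: real
  assumes d1: "\<And>t. (\<zeta> has_real_derivative \<zeta>1 t) (at t)"
    and d2: "\<And>t. (\<zeta>1 has_real_derivative \<zeta>2 t) (at t)" and c2: "continuous_on UNIV \<zeta>2"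
    and \<theta>: "\<And>t. \<theta> t = \<zeta>2 t + (2 * c + DIM('a) + \<alpha> - 2) * \<zeta>1 t + c * (c + DIM('a) + \<alpha> - 2) * \<zeta> t"
    and u: "AE x in lborel. u x = lift c \<zeta> x" and h: "AE x in lborel. h x = lift (\<alpha> + c - 2) \<theta> x"
  shows "weak_wdiv \<alpha> u h"
proof -
  have c0: "continuous_on UNIV \<zeta>" using d1 by (meson DERIV_isCont continuous_at_imp_continuous_on)
  have c1: "continuous_on UNIV \<zeta>1" using d2 by (meson DERIV_isCont continuous_at_imp_continuous_on)
  have "continuous_on UNIV (\<lambda>t. \<zeta>2 t + (2 * c + DIM('a) + \<alpha> - 2) * \<zeta>1 t + c * (c + DIM('a) + \<alpha> - 2) * \<zeta> t)"
    by (intro continuous_intros c0 c1 c2)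
  then have c\<theta>: "continuous_on UNIV \<theta>" using \<theta> by simp
  have \<theta>': "\<theta> = (\<lambda>t. \<zeta>2 t + (2 * c + DIM('a) + \<alpha> - 2) * \<zeta>1 t + c * (c + DIM('a) + \<alpha> - 2) * \<zeta> t)"
    using \<theta> by (rule ext)
  have li: "loc_integrable u" "loc_integrable h"
    by (rule loc_integrable_lift[OF c0 u], rule loc_integrable_lift[OF c\<theta> h])
  have "(LINT x|lebesgue. u x * wdiv \<alpha> \<phi> x) = (LINT x|lebesgue. h x * \<phi> x)"
    if \<phi>: "\<phi> \<in> test_functions" for \<phi> :: "'a \<Rightarrow> real"
  proof -
    note P = wdiv_lift_by_parts[OF \<phi> d1 d2 c2, of \<alpha> c, folded \<theta>']
    have e: "(LINT x|lebesgue. f x) = (LINT x|lborel. g x)" if g: "integrable lborel g" and fg: "AE x in lborel. f x = g x" for f g :: "'a \<Rightarrow> real"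
    proof -
      have gm: "g \<in> borel_measurable lebesgue" by (rule measurable_completion[OF borel_measurable_integrable[OF g]])
      have ae: "AE x in lebesgue. g x = f x" by (rule AE_completion) (use fg in \<open>eventually_elim, simp\<close>)
      have "(LINT x|lebesgue. f x) = (LINT x|lebesgue. g x)"
        by (rule integral_cong_AE[OF gm borel_measurable_AE[OF gm ae] ae, symmetric])
      also have "\<dots> = (LINT x|lborel. g x)" by (rule integral_completion[OF borel_measurable_integrable[OF g]])
      finally show ?thesis .
    qed
    have "(LINT x|lebesgue. u x * wdiv \<alpha> \<phi> x) = (LINT x|lborel. wdiv \<alpha> \<phi> x * lift c \<zeta> x)"
      by (rule e[OF P(2)]) (use u in \<open>eventually_elim, simp\<close>)
    also have "\<dots> = (LINT x|lborel. \<phi> x * lift (\<alpha> + c - 2) \<theta> x)" by (rule P(1)[symmetric])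
    also have "\<dots> = (LINT x|lebesgue. h x * \<phi> x)"
      by (rule e[OF P(3), symmetric]) (use h in \<open>eventually_elim, simp\<close>)
    finally show ?thesis .
  qed
  then show ?thesis using li by (simp add: weak_wdiv_def)
qed

section \<open>The bubbles as elements of the energy space and as solutions\<close>

context emden_fowler_space
begin

text \<open>The orbit system itself supplies the third and fourth derivative of the profile, after
  which the weak divergence of a lift is applied twice, with exponents -m and -k.\<close>

lemma weak_solution_of_profile:
  fixes u :: "'a \<Rightarrow> real"
  assumes o: "orbit k m r y y1 w w1 A B" and u: "AE x in lborel. u x = lift (- m) y x"
  shows "weak_solution \<alpha> \<beta> \<gamma> (crit_exp N \<alpha> \<beta> \<gamma>) u"
proof -
  have d: "(y has_real_derivative y1 t) (at t)" "(y1 has_real_derivative k\<^sup>2 * y t + w t) (at t)"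
    "(w has_real_derivative w1 t) (at t)" "(w1 has_real_derivative m\<^sup>2 * w t + nl r (y t)) (at t)" for t
    using o by (simp_all add: orbit_def)
  have cy: "continuous_on UNIV y" and cy1: "continuous_on UNIV y1" and cw: "continuous_on UNIV w" and cw1: "continuous_on UNIV w1"
    using d by (meson DERIV_isCont continuous_at_imp_continuous_on)+
  define y2 where "y2 t = k\<^sup>2 * y t + w t" for t
  define y3 where "y3 t = k\<^sup>2 * y1 t + w1 t" for t
  define y4 where "y4 t = k\<^sup>2 * y2 t + (m\<^sup>2 * w t + nl r (y t))" for t
  have D1: "(y1 has_real_derivative y2 t) (at t)" for t unfolding y2_def by (rule d(2))
  have D2: "(y2 has_real_derivative y3 t) (at t)" for t
    unfolding y2_def[abs_def] y3_def by (rule DERIV_add[OF DERIV_cmult[OF d(1)] d(3)])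
  have D3: "(y3 has_real_derivative y4 t) (at t)" for t
    unfolding y3_def[abs_def] y4_def by (rule DERIV_add[OF DERIV_cmult[OF D1] d(4)])
  have cy2: "continuous_on UNIV y2" unfolding y2_def by (intro continuous_intros cy cw)
  have cy3: "continuous_on UNIV y3" unfolding y3_def by (intro continuous_intros cy1 cw1)
  have cy4: "continuous_on UNIV y4"
    unfolding y4_def by (intro continuous_intros cy2 cw continuous_on_compose2[OF nl_continuous[OF r] cy]) auto
  have c1: "2 * - m + real DIM('a) + \<alpha> - 2 = k - m" "- m * (- m + real DIM('a) + \<alpha> - 2) = - (m * k)"
    and c2: "2 * - k + real DIM('a) + \<alpha> - 2 = m - k" "- k * (- k + real DIM('a) + \<alpha> - 2) = - (m * k)"
    using a_eq by (simp_all add: dim algebra_simps)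
  define \<theta> where "\<theta> t = y2 t + (k - m) * y1 t + - (m * k) * y t" for t
  define \<theta>1 where "\<theta>1 t = y3 t + (k - m) * y2 t + - (m * k) * y1 t" for t
  define \<theta>2 where "\<theta>2 t = y4 t + (k - m) * y3 t + - (m * k) * y2 t" for t
  have E1: "(\<theta> has_real_derivative \<theta>1 t) (at t)" for t
    unfolding \<theta>_def[abs_def] \<theta>1_def by (intro DERIV_add DERIV_cmult D2 D1 d(1))
  have E2: "(\<theta>1 has_real_derivative \<theta>2 t) (at t)" for t
    unfolding \<theta>1_def[abs_def] \<theta>2_def by (intro DERIV_add DERIV_cmult D3 D2 D1)
  have cE: "continuous_on UNIV \<theta>2" unfolding \<theta>2_def by (intro continuous_intros cy4 cy3 cy2)
  define f where "f = (lift (\<alpha> + - m - 2) \<theta> :: 'a \<Rightarrow> real)"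
  have W1: "weak_wdiv \<alpha> u f"
  proof (rule weak_wdiv_lift[OF d(1) D1 cy2 _ u])
    show "\<theta> t = y2 t + (2 * - m + real DIM('a) + \<alpha> - 2) * y1 t + - m * (- m + real DIM('a) + \<alpha> - 2) * y t" for t
      unfolding c1 \<theta>_def ..
    show "AE x in lborel. f x = lift (\<alpha> + - m - 2) \<theta> x" by (simp add: f_def)
  qed
  have vf: "norm x powr (- \<beta>) * f x = lift (- k) \<theta> x" for x
  proof -
    have "- \<beta> + (\<alpha> + - m - 2) = - k" using mk_diff by linarith
    then have "norm x powr (- \<beta>) * norm x powr (\<alpha> + - m - 2) = norm x powr (- k)" by (simp only: powr_add[symmetric])
    then show ?thesis unfolding f_def lift_def by (metis mult.assoc)
  qed
  have nlL: "\<theta>2 t + (m - k) * \<theta>1 t + - (m * k) * \<theta> t = nl r (y t)" for t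
    by (simp add: \<theta>2_def \<theta>1_def \<theta>_def y4_def y3_def y2_def power2_eq_square algebra_simps)
  have "weak_wdiv \<alpha> (\<lambda>x. norm x powr (- \<beta>) * f x) (\<lambda>x. norm x powr \<gamma> * (\<bar>u x\<bar> powr (crit_exp N \<alpha> \<beta> \<gamma> - 2) * u x))"
  proof (rule weak_wdiv_lift[OF E1 E2 cE])
    show "nl r (y t) = \<theta>2 t + (2 * - k + real DIM('a) + \<alpha> - 2) * \<theta>1 t + - k * (- k + real DIM('a) + \<alpha> - 2) * \<theta> t" for t
      unfolding c2 nlL ..
    show "AE x in lborel. norm x powr (- \<beta>) * f x = lift (- k) \<theta> x" by (simp add: vf)
    show "AE x in lborel. norm x powr \<gamma> * (\<bar>u x\<bar> powr (crit_exp N \<alpha> \<beta> \<gamma> - 2) * u x) = lift (\<alpha> + - k - 2) (\<lambda>t. nl r (y t)) x"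
      using u
    proof eventually_elim
      case (elim x)
      let ?n = "norm x" and ?l = "ln (norm x)"
      have e: "\<gamma> + - m * r + - m = \<alpha> + - k - 2" using N\<gamma> a_eq by (simp add: algebra_simps)
      have "\<bar>?n powr (- m) * y ?l\<bar> powr r = ?n powr (- m * r) * \<bar>y ?l\<bar> powr r"
        by (simp add: abs_mult powr_mult powr_powr)
      then have "norm x powr \<gamma> * (\<bar>u x\<bar> powr r * u x) = (?n powr \<gamma> * ?n powr (- m * r) * ?n powr (- m)) * nl r (y ?l)"
        unfolding elim lift_def nl_def by (simp add: mult_ac)
      also have "?n powr \<gamma> * ?n powr (- m * r) * ?n powr (- m) = ?n powr (\<alpha> + - k - 2)"
        unfolding e[symmetric] by (simp only: powr_add)
      finally show ?case unfolding crit_exp_eq lift_def .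
    qed
  qed
  with W1 show ?thesis unfolding weak_solution_def by blast
qed

text \<open>Cutting off in the variable ln |x| produces radial test functions whose energy is an
  unweighted L2 norm on the line. The errors are dominated by e^(-k |t|) and tend to 0 pointwise,
  which gives the Cauchy property.\<close>

lemma D_space_of_profile:
  fixes u :: "'a \<Rightarrow> real"
  assumes o: "orbit k m r y y1 w w1 A B" and u: "AE x in lborel. u x = lift (- m) y x"
    and ys: "smooth_on UNIV y"
    and yb: "\<And>t. \<bar>y t\<bar> \<le> K * exp (- k * \<bar>t\<bar>)" "\<And>t. \<bar>y1 t\<bar> \<le> K * exp (- k * \<bar>t\<bar>)" "\<And>t. \<bar>w t\<bar> \<le> K * exp (- k * \<bar>t\<bar>)"
  shows "u \<in> D_space \<alpha> \<beta>"
proof -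
  have d: "(y has_real_derivative y1 t) (at t)" "(y1 has_real_derivative k\<^sup>2 * y t + w t) (at t)"
    "(w has_real_derivative w1 t) (at t)" for t
    using o by (simp_all add: orbit_def)
  have cy: "continuous_on UNIV y" and cy1: "continuous_on UNIV y1" and cw: "continuous_on UNIV w"
    using d by (meson DERIV_isCont continuous_at_imp_continuous_on)+
  note ym [measurable] = borel_measurable_continuous_onI[OF cy]
    and y1m [measurable] = borel_measurable_continuous_onI[OF cy1]
    and wm [measurable] = borel_measurable_continuous_onI[OF cw]
  have li: "loc_integrable u" by (rule loc_integrable_lift[OF cy u])
  define X where "X n j t = cutoffs n j t" for n j t
  have XD: "(X n 0 has_real_derivative X n 1 t) (at t)" "(X n 1 has_real_derivative X n 2 t) (at t)" for n t
    using cutoffs_DERIV[of n 0 t] cutoffs_DERIV[of n 1 t] unfolding X_def[abs_def] by (simp_all add: eval_nat_numeral)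
  obtain C where C: "\<And>j t. j \<le> 4 \<Longrightarrow> \<bar>cutoff j t\<bar> \<le> C" using cutoff_bounded by blast
  have XB: "\<bar>X n j t\<bar> \<le> C" if "j \<le> 4" for n j t unfolding X_def by (rule cutoffs_le[OF C[OF that]])
  have C0: "0 \<le> C" using XB[of 0 0 0] by simp
  have Xm [measurable]: "X n j \<in> borel_measurable borel" for n j
    unfolding X_def[abs_def] using DERIV_borel_measurable[OF cutoffs_DERIV] by simp
  define \<eta> where "\<eta> n t = X n 0 t * y t" for n t
  have t1: "test1 (- real (Suc n)) (real (Suc n)) (\<eta> n)" for n
    unfolding \<eta>_def[abs_def] X_def by (rule test1_cutoffs[OF ys])
  define y2 where "y2 t = k\<^sup>2 * y t + w t" for t
  have D1: "(y1 has_real_derivative y2 t) (at t)" for t unfolding y2_def by (rule d(2))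
  \<comment> \<open>The profile (D - m)(D + k) y of the inner divergence; the next definition is the
    same expression for the cut-off profile.\<close>
  define \<theta> where "\<theta> t = y2 t + (k - m) * y1 t - m * k * y t" for t
  define \<theta>n where "\<theta>n n t = (X n 2 t * y t + 2 * (X n 1 t * y1 t) + X n 0 t * y2 t)
      + (k - m) * (X n 1 t * y t + X n 0 t * y1 t) - m * k * \<eta> n t" for n t
  have \<eta>1: "(\<eta> n has_real_derivative X n 1 t * y t + X n 0 t * y1 t) (at t)" for n t
    unfolding \<eta>_def[abs_def]
    by (rule DERIV_cong[OF DERIV_mult[OF XD(1) d(1)]]) (simp add: algebra_simps)
  have \<eta>2: "((\<lambda>t. X n 1 t * y t + X n 0 t * y1 t) has_real_derivative X n 2 t * y t + 2 * (X n 1 t * y1 t) + X n 0 t * y2 t) (at t)" for n t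
    by (rule DERIV_cong[OF DERIV_add[OF DERIV_mult[OF XD(2) d(1)] DERIV_mult[OF XD(1) D1]]]) (simp add: algebra_simps)
  define \<phi> where "\<phi> n = (lift (- m) (\<eta> n) :: 'a \<Rightarrow> real)" for n
  have \<phi>t: "\<phi> n \<in> test_functions" for n unfolding \<phi>_def by (rule lift_test_function[OF t1])
  have c1: "2 * - m + real DIM('a) + \<alpha> - 2 = k - m" "- m * (- m + real DIM('a) + \<alpha> - 2) = - (m * k)"
    using a_eq by (simp_all add: dim algebra_simps)
  have wd: "wdiv \<alpha> (\<lambda>x. \<phi> i x - \<phi> j x) x = lift (\<alpha> + - m - 2) (\<lambda>t. \<theta>n i t - \<theta>n j t) x" for i j x
  proof -
    let ?b = "max (real (Suc i)) (real (Suc j))" and ?e = "\<lambda>t. \<eta> i t + (-1) * \<eta> j t"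
    have t: "test1 (- ?b) ?b ?e"
      by (intro test1_add test1_cmult test1_mono[OF t1]) auto
    have e1: "deriv ?e = (\<lambda>t. (X i 1 t * y t + X i 0 t * y1 t) + (-1) * (X j 1 t * y t + X j 0 t * y1 t))"
      by (rule deriv_eqI) (intro DERIV_add[OF \<eta>1 DERIV_cmult[OF \<eta>1]])
    have e2: "deriv (\<lambda>t. (X i 1 t * y t + X i 0 t * y1 t) + (-1) * (X j 1 t * y t + X j 0 t * y1 t))
       = (\<lambda>t. (X i 2 t * y t + 2 * (X i 1 t * y1 t) + X i 0 t * y2 t) + (-1) * (X j 2 t * y t + 2 * (X j 1 t * y1 t) + X j 0 t * y2 t))"
      by (rule deriv_eqI) (intro DERIV_add[OF \<eta>2 DERIV_cmult[OF \<eta>2]])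
    have "(\<lambda>x. \<phi> i x - \<phi> j x) = lift (- m) ?e" by (simp add: \<phi>_def lift_def right_diff_distrib fun_eq_iff)
    then have "wdiv \<alpha> (\<lambda>x. \<phi> i x - \<phi> j x) x = wdiv \<alpha> (lift (- m) ?e) x" by simp
    also have "\<dots> = lift (\<alpha> + - m - 2) (\<lambda>t. deriv (deriv ?e) t + (k - m) * deriv ?e t + - (m * k) * ?e t) x"
      unfolding wdiv_lift[OF t] c1 ..
    also have "\<dots> = lift (\<alpha> + - m - 2) (\<lambda>t. \<theta>n i t - \<theta>n j t) x"
      unfolding e1 e2 \<theta>n_def by (rule lift_cong) (simp add: algebra_simps)
    finally show ?thesis .
  qed
  have \<theta>nm [measurable]: "\<theta>n n \<in> borel_measurable borel" for n
    unfolding \<theta>n_def[abs_def] \<eta>_def y2_def by measurable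
  have \<theta>m [measurable]: "\<theta> \<in> borel_measurable borel" unfolding \<theta>_def[abs_def] y2_def by measurable
  have Dn: "D_norm \<alpha> \<beta> (\<lambda>x. \<phi> i x - \<phi> j x) = sqrt (sphere_const DIM('a) * (LINT t|lborel. (\<theta>n i t - \<theta>n j t)\<^sup>2))" for i j
  proof -
    have e: "norm x powr (- \<beta>) * \<bar>lift (\<alpha> + - m - 2) (\<lambda>t. \<theta>n i t - \<theta>n j t) x\<bar>\<^sup>2
        = lift (- \<beta> + (\<alpha> + - m - 2) + (\<alpha> + - m - 2)) (\<lambda>t. (\<theta>n i t - \<theta>n j t)\<^sup>2) x" for x :: 'a
      unfolding power2_abs lift_def powr_add by (simp add: power2_eq_square mult_ac)
    \<comment> \<open>By the choice of m the energy integrand has total exponent minus the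
      dimension, so no exponential weight remains.\<close>
    have z: "real DIM('a) + (- \<beta> + (\<alpha> + - m - 2) + (\<alpha> + - m - 2)) = 0" by (simp add: dim[symmetric] m_def field_simps)
    have "(LINT x|(lebesgue::'a measure). lift (- \<beta> + (\<alpha> + - m - 2) + (\<alpha> + - m - 2)) (\<lambda>t. (\<theta>n i t - \<theta>n j t)\<^sup>2) x)
      = (LINT x|(lborel::'a measure). lift (- \<beta> + (\<alpha> + - m - 2) + (\<alpha> + - m - 2)) (\<lambda>t. (\<theta>n i t - \<theta>n j t)\<^sup>2) x)"
      by (rule integral_completion) simp
    also have "\<dots> = sphere_const DIM('a) * (LINT t|lborel. (\<theta>n i t - \<theta>n j t)\<^sup>2)"
      by (subst lift_integral(1)) (simp, simp only: z, simp)
    finally show ?thesis unfolding D_norm_def wd e by simp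
  qed
  define E where "E t = exp (- k * \<bar>t\<bar>)" for t :: real
  have K0: "0 \<le> K" using yb(1)[of 0] by simp
  define L where "L = k\<^sup>2 * K + K"
  have L: "0 \<le> L" "K \<le> L" using K0 by (simp_all add: L_def)
  have b: "\<bar>y t\<bar> \<le> L * E t" "\<bar>y1 t\<bar> \<le> L * E t" "\<bar>y2 t\<bar> \<le> L * E t" for t
  proof -
    have KL: "K * E t \<le> L * E t" using L(2) by (simp add: E_def mult_right_mono)
    show "\<bar>y t\<bar> \<le> L * E t" "\<bar>y1 t\<bar> \<le> L * E t"
      using yb(1,2)[of t, folded E_def] KL by linarith+
    have "\<bar>k\<^sup>2 * y t\<bar> \<le> k\<^sup>2 * (K * E t)"
      unfolding abs_mult abs_power2 using yb(1)[of t, folded E_def] by (intro mult_left_mono) auto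
    then show "\<bar>y2 t\<bar> \<le> L * E t" using yb(3)[of t, folded E_def] by (simp add: y2_def L_def distrib_right mult.assoc)
  qed
  \<comment> \<open>4 = 1 + 2 + 1 counts the terms of the second derivative, 2 those of the first,
    and C + 1 bounds both the cut-off derivatives and the distance of the cut-off from 1.\<close>
  define H where "H = (C + 1) * (4 + 2 * \<bar>k - m\<bar> + m * k) * L"
  have mk0: "0 \<le> m * k" using m k by simp
  have diff: "\<bar>\<theta>n n t - \<theta> t\<bar> \<le> H * E t" for n t
  proof -
    let ?Q = "(C + 1) * (L * E t)"
    have pr: "\<bar>c * z\<bar> \<le> ?Q" if "\<bar>c\<bar> \<le> C + 1" "\<bar>z\<bar> \<le> L * E t" for c z
      unfolding abs_mult using that C0 by (intro mult_mono) auto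
    have X0: "\<bar>X n 0 t - 1\<bar> \<le> C + 1" "\<bar>X n 1 t\<bar> \<le> C + 1" "\<bar>X n 2 t\<bar> \<le> C + 1"
      using XB[of 0 n t] XB[of 1 n t] XB[of 2 n t] by auto
    have q: "\<bar>X n 2 t * y t\<bar> \<le> ?Q" "\<bar>X n 1 t * y1 t\<bar> \<le> ?Q" "\<bar>(X n 0 t - 1) * y2 t\<bar> \<le> ?Q" "\<bar>X n 1 t * y t\<bar> \<le> ?Q"
      "\<bar>(X n 0 t - 1) * y1 t\<bar> \<le> ?Q" "\<bar>(X n 0 t - 1) * y t\<bar> \<le> ?Q"
      by (rule pr[OF X0(3) b(1)], rule pr[OF X0(2) b(2)], rule pr[OF X0(1) b(3)], rule pr[OF X0(2) b(1)],
          rule pr[OF X0(1) b(2)], rule pr[OF X0(1) b(1)])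
    have 1: "\<bar>(k - m) * (X n 1 t * y t + (X n 0 t - 1) * y1 t)\<bar> \<le> \<bar>k - m\<bar> * (2 * ?Q)"
      unfolding abs_mult using q(4,5) by (intro mult_left_mono) auto
    have 2: "\<bar>m * k * ((X n 0 t - 1) * y t)\<bar> \<le> m * k * ?Q"
    proof -
      have "\<bar>m * k * ((X n 0 t - 1) * y t)\<bar> = m * k * \<bar>(X n 0 t - 1) * y t\<bar>" using m k by (simp add: abs_mult)
      then show ?thesis using mult_left_mono[OF q(6) mk0] by simp
    qed
    have "\<theta>n n t - \<theta> t = X n 2 t * y t + 2 * (X n 1 t * y1 t) + (X n 0 t - 1) * y2 t
        + (k - m) * (X n 1 t * y t + (X n 0 t - 1) * y1 t) - m * k * ((X n 0 t - 1) * y t)"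
      by (simp add: \<theta>n_def \<theta>_def \<eta>_def algebra_simps)
    then have "\<bar>\<theta>n n t - \<theta> t\<bar> \<le> 4 * ?Q + \<bar>k - m\<bar> * (2 * ?Q) + m * k * ?Q"
      using q(1,2,3) 1 2 by linarith
    also have "\<dots> = H * E t" by (simp add: H_def algebra_simps)
    finally show ?thesis .
  qed
  define a where "a n = (LINT t|lborel. (\<theta>n n t - \<theta> t)\<^sup>2)" for n
  let ?W = "\<lambda>t::real. H\<^sup>2 * exp (- (2 * k) * \<bar>t\<bar>)"
  have sq: "(\<theta>n n t - \<theta> t)\<^sup>2 \<le> ?W t" for n t
  proof -
    have "\<bar>\<theta>n n t - \<theta> t\<bar>\<^sup>2 \<le> (H * E t)\<^sup>2" by (rule power_mono[OF diff]) simp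
    also have "(H * E t)\<^sup>2 = ?W t" by (simp add: E_def power_mult_distrib power2_eq_square exp_add[symmetric])
    finally show ?thesis by simp
  qed
  have Wi: "integrable lborel ?W" by (intro integrable_mult_right exp_abs_integrable) (use k in simp)
  have ai: "integrable lborel (\<lambda>t. (\<theta>n n t - \<theta> t)\<^sup>2)" for n
    by (rule Bochner_Integration.integrable_bound[OF Wi]) (use sq in auto)
  have a0: "a \<longlonglongrightarrow> 0"
  proof -
    have "(\<lambda>n. LINT t|lborel. (\<theta>n n t - \<theta> t)\<^sup>2) \<longlonglongrightarrow> (LINT t|(lborel::real measure). 0)"
    proof (rule integral_dominated_convergence[OF _ _ Wi])
      have "(\<lambda>n. (\<theta>n n t - \<theta> t)\<^sup>2) \<longlonglongrightarrow> (((0 * y t + 2 * (0 * y1 t) + 1 * y2 t) + (k - m) * (0 * y t + 1 * y1 t) - m * k * (1 * y t)) - \<theta> t)\<^sup>2" for t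
        unfolding \<theta>n_def \<eta>_def X_def by (intro tendsto_intros cutoffs_lim) auto
      then show "AE t in lborel. (\<lambda>n. (\<theta>n n t - \<theta> t)\<^sup>2) \<longlonglongrightarrow> 0" by (simp add: \<theta>_def)
      show "AE t in lborel. norm ((\<theta>n n t - \<theta> t)\<^sup>2) \<le> ?W t" for n using sq[of n] by simp
    qed auto
    then show ?thesis unfolding a_def[abs_def] by simp
  qed
  have cauchy: "\<exists>M::nat. \<forall>i\<ge>M. \<forall>j\<ge>M. D_norm \<alpha> \<beta> (\<lambda>x. \<phi> i x - \<phi> j x) < \<epsilon>" if \<epsilon>: "0 < \<epsilon>" for \<epsilon>
  proof -
    let ?s = "sphere_const DIM('a)"
    have s: "0 < ?s" by (rule sphere_const_pos) simp
    \<comment> \<open>The factor 8 absorbs the loss in (a + b)^2 \<le> 2 a^2 + 2 b^2 for two errors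
      and leaves \<epsilon>^2 / 2, strictly below \<epsilon>^2.\<close>
    have "0 < \<epsilon>\<^sup>2 / (8 * ?s)" using \<epsilon> s by simp
    from order_tendstoD(2)[OF a0 this] obtain M where M: "\<And>n. M \<le> n \<Longrightarrow> a n < \<epsilon>\<^sup>2 / (8 * ?s)"
      by (auto simp: eventually_sequentially)
    show ?thesis
    proof (intro exI[of _ M] allI impI)
      fix i j assume ij: "M \<le> i" "M \<le> j"
      have "(LINT t|lborel. (\<theta>n i t - \<theta>n j t)\<^sup>2) \<le> (LINT t|lborel. 2 * (\<theta>n i t - \<theta> t)\<^sup>2 + 2 * (\<theta>n j t - \<theta> t)\<^sup>2)"
      proof (rule integral_mono')
        show "integrable lborel (\<lambda>t. 2 * (\<theta>n i t - \<theta> t)\<^sup>2 + 2 * (\<theta>n j t - \<theta> t)\<^sup>2)" using ai by simp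
        show "(\<theta>n i t - \<theta>n j t)\<^sup>2 \<le> 2 * (\<theta>n i t - \<theta> t)\<^sup>2 + 2 * (\<theta>n j t - \<theta> t)\<^sup>2" for t
        proof -
          have "0 \<le> ((\<theta>n i t - \<theta> t) + (\<theta>n j t - \<theta> t))\<^sup>2" by simp
          then show ?thesis by (simp add: power2_eq_square algebra_simps)
        qed
      qed simp
      also have "\<dots> = 2 * a i + 2 * a j" using ai by (simp add: a_def)
      also have "\<dots> < 4 * (\<epsilon>\<^sup>2 / (8 * ?s))" using M[OF ij(1)] M[OF ij(2)] by linarith
      finally have "?s * (LINT t|lborel. (\<theta>n i t - \<theta>n j t)\<^sup>2) < ?s * (4 * (\<epsilon>\<^sup>2 / (8 * ?s)))"
        using s by (intro mult_strict_left_mono)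
      also have "\<dots> = \<epsilon>\<^sup>2 / 2" using s by simp
      also have "\<dots> < \<epsilon>\<^sup>2" using \<epsilon> by simp
      finally have "sqrt (?s * (LINT t|lborel. (\<theta>n i t - \<theta>n j t)\<^sup>2)) < sqrt (\<epsilon>\<^sup>2)" by (rule real_sqrt_less_mono)
      then show "D_norm \<alpha> \<beta> (\<lambda>x. \<phi> i x - \<phi> j x) < \<epsilon>" unfolding Dn using \<epsilon> by simp
    qed
  qed
  have conv: "(\<lambda>n. LINT x:S|lebesgue. \<bar>\<phi> n x - u x\<bar>) \<longlonglongrightarrow> 0" if S: "compact S" "0 \<notin> S" for S
  proof -
    have uS: "integrable lebesgue (\<lambda>x. indicator S x *\<^sub>R u x)"
      using li S unfolding loc_integrable_def set_integrable_def by blast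
    have um: "u \<in> borel_measurable lebesgue" by (rule loc_integrable_measurable[OF li])
    have pu: "AE x in lebesgue. \<forall>n. \<phi> n x = X n 0 (ln (norm x)) * u x"
    proof (rule AE_completion)
      show "AE x in lborel. \<forall>n. \<phi> n x = X n 0 (ln (norm x)) * u x"
        using u by eventually_elim (simp add: \<phi>_def \<eta>_def lift_def mult_ac)
    qed
    have "(\<lambda>n. LINT x|lebesgue. indicator S x *\<^sub>R \<bar>\<phi> n x - u x\<bar>) \<longlonglongrightarrow> (LINT x|(lebesgue::'a measure). 0)"
    proof (rule integral_dominated_convergence[where w="\<lambda>x. (C + 1) * \<bar>indicator S x *\<^sub>R u x\<bar>"])
      show "integrable lebesgue (\<lambda>x. (C + 1) * \<bar>indicator S x *\<^sub>R u x\<bar>)" using uS by (intro integrable_mult_right integrable_abs)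
      have "\<phi> n \<in> borel_measurable lebesgue" for n
        using borel_measurable_continuous_onI[OF Ck_continuous[OF test_functions_Ck[OF \<phi>t]]]
        by (intro measurable_completion) simp
      moreover have "S \<in> sets lebesgue" using S(1) by (simp add: borel_compact sets_completionI_sets)
      ultimately show "(\<lambda>x. indicator S x *\<^sub>R \<bar>\<phi> n x - u x\<bar>) \<in> borel_measurable lebesgue" for n using um by measurable
      show "AE x in lebesgue. (\<lambda>n. indicator S x *\<^sub>R \<bar>\<phi> n x - u x\<bar>) \<longlonglongrightarrow> 0"
        using pu
      proof eventually_elim
        case (elim x)
        have "(\<lambda>n. indicator S x *\<^sub>R \<bar>X n 0 (ln (norm x)) * u x - u x\<bar>) \<longlonglongrightarrow> indicator S x *\<^sub>R \<bar>1 * u x - u x\<bar>"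
          unfolding X_def by (intro tendsto_intros cutoffs_lim)
        then show ?case using elim by simp
      qed
      show "AE x in lebesgue. norm (indicator S x *\<^sub>R \<bar>\<phi> n x - u x\<bar>) \<le> (C + 1) * \<bar>indicator S x *\<^sub>R u x\<bar>" for n
        using pu
      proof eventually_elim
        case (elim x)
        have "\<phi> n x - u x = (X n 0 (ln (norm x)) - 1) * u x" using elim by (simp add: algebra_simps)
        moreover have "\<bar>X n 0 (ln (norm x)) - 1\<bar> \<le> C + 1" using XB[of 0 n "ln (norm x)"] by linarith
        ultimately show ?case by (auto simp: indicator_def abs_mult intro!: mult_right_mono)
      qed
    qed simp
    then show ?thesis by (simp add: set_lebesgue_integral_def)
  qed
  show ?thesis
    unfolding D_space_def mem_Collect_eq
  proof (intro conjI li exI[of _ \<phi>] allI impI \<phi>t)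
    show "\<exists>M. \<forall>m\<ge>M. \<forall>n\<ge>M. D_norm \<alpha> \<beta> (\<lambda>x. \<phi> m x - \<phi> n x) < \<epsilon>" if "0 < \<epsilon>" for \<epsilon> using cauchy[OF that] .
    show "(\<lambda>n. LINT x:S|lebesgue. \<bar>\<phi> n x - u x\<bar>) \<longlonglongrightarrow> 0" if "compact S \<and> 0 \<notin> S" for S using conv that by blast
  qed
qed

theorem bubble_is_radial_solution:
  fixes u :: "'a \<Rightarrow> real"
  assumes s: "0 < s"
    and u: "(AE x in lebesgue. u x = scaled_bubble N \<alpha> \<beta> s x) \<or> (AE x in lebesgue. u x = - scaled_bubble N \<alpha> \<beta> s x)"
  shows "u \<in> D_space \<alpha> \<beta>" "weak_solution \<alpha> \<beta> \<gamma> (crit_exp N \<alpha> \<beta> \<gamma>) u" "radial u" "nontrivial u"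
proof -
  let ?p = "profile (ln s)"
  obtain y1 w w1 B K where o: "orbit k m r ?p y1 w w1 (bubble_const N \<alpha> \<beta> * exp (k * ln s)) B"
    and b: "\<And>t. \<bar>?p t\<bar> \<le> K * exp (- k * \<bar>t\<bar>)" "\<And>t. \<bar>y1 t\<bar> \<le> K * exp (- k * \<bar>t\<bar>)" "\<And>t. \<bar>w t\<bar> \<le> K * exp (- k * \<bar>t\<bar>)"
    using profile_orbit[of "ln s"] by blast
  have "\<exists>y. (AE x in lborel. u x = lift (- m) y x) \<and> (\<forall>t. y t \<noteq> 0) \<and> u \<in> D_space \<alpha> \<beta> \<and> weak_solution \<alpha> \<beta> \<gamma> (crit_exp N \<alpha> \<beta> \<gamma>) u"
    using u
  proof
    assume "AE x in lebesgue. u x = scaled_bubble N \<alpha> \<beta> s x"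
    then have "AE x in lborel. u x = scaled_bubble N \<alpha> \<beta> s x" by (simp add: AE_completion_iff)
    with AE_lborel_singleton[of "0::'a"] have a: "AE x in lborel. u x = lift (- m) ?p x"
      by eventually_elim (simp add: scaled_bubble_eq_lift[OF s])
    have "?p t \<noteq> 0" for t using profile_pos[of "ln s" t] by linarith
    moreover have "u \<in> D_space \<alpha> \<beta>" by (rule D_space_of_profile[OF o a smooth_on_profile b])
    ultimately show ?thesis using a weak_solution_of_profile[OF o a] by blast
  next
    let ?q = "\<lambda>t. - ?p t"
    assume "AE x in lebesgue. u x = - scaled_bubble N \<alpha> \<beta> s x"
    then have "AE x in lborel. u x = - scaled_bubble N \<alpha> \<beta> s x" by (simp add: AE_completion_iff)
    with AE_lborel_singleton[of "0::'a"] have a: "AE x in lborel. u x = lift (- m) ?q x"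
      by eventually_elim (simp add: scaled_bubble_eq_lift[OF s] lift_def)
    \<comment> \<open>For the negative bubble the orbit is reflected; the decay bounds involve
      absolute values only and carry over.\<close>
    have sm: "smooth_on UNIV ?q" using smooth_on_cmult[OF open_UNIV smooth_on_profile, of "-1" "ln s"] by simp
    note o' = orbit_minus[OF o]
    have D: "u \<in> D_space \<alpha> \<beta>" by (rule D_space_of_profile[OF o' a sm, of K]) (use b in simp_all)
    have "?q t \<noteq> 0" for t using profile_pos[of "ln s" t] by linarith
    then show ?thesis using a D weak_solution_of_profile[OF o' a] by (intro exI[of _ ?q]) simp
  qed
  then obtain y where a: "AE x in lborel. u x = lift (- m) y x" and y0: "\<And>t. y t \<noteq> 0"
    and D: "u \<in> D_space \<alpha> \<beta>" and W: "weak_solution \<alpha> \<beta> \<gamma> (crit_exp N \<alpha> \<beta> \<gamma>) u" by blast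
  show "u \<in> D_space \<alpha> \<beta>" "weak_solution \<alpha> \<beta> \<gamma> (crit_exp N \<alpha> \<beta> \<gamma>) u" by (rule D, rule W)
  show "radial u"
    unfolding radial_def using AE_completion[OF a]
    by (intro exI[of _ "\<lambda>\<rho>. \<rho> powr (- m) * y (ln \<rho>)"]) (simp add: lift_def)
  show "nontrivial u"
    unfolding nontrivial_def AE_completion_iff
  proof
    assume "AE x in lborel. u x = 0"
    with a AE_lborel_singleton[of "0::'a"] have "AE x::'a in lborel. False"
      by eventually_elim (simp add: lift_def y0)
    moreover have "ae_filter (lborel :: 'a measure) \<noteq> bot"
      by (simp add: ae_filter_eq_bot_iff emeasure_lborel_UNIV)
    ultimately show False using eventually_happens' by blast
  qed
qed

end

theorem theorem1p4:
  fixes N :: nat and \<alpha> \<beta> \<gamma> :: real and u :: "real ^ 'n \<Rightarrow> real"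
  assumes "CARD('n) = N" and "N \<ge> 5"
    and "\<alpha> > 2 - real N"
    and "(real N - 4) / (real N - 2) * \<alpha> - 4 \<le> \<beta>" and "\<beta> < \<alpha> - 2"
    and "(real N + \<beta>) * (real N + \<gamma>) = (real N + 2 * \<alpha> - \<beta> - 4)\<^sup>2"
  shows "(u \<in> D_space \<alpha> \<beta> \<and> weak_solution \<alpha> \<beta> \<gamma> (crit_exp N \<alpha> \<beta> \<gamma>) u \<and> radial u \<and> nontrivial u)
     \<longleftrightarrow> (\<exists>s>0. (AE x in lebesgue. u x = scaled_bubble N \<alpha> \<beta> s x) \<or>
                (AE x in lebesgue. u x = - scaled_bubble N \<alpha> \<beta> s x))"
proof -
  define k where "k = (real N + \<beta>) / 2"
  define m where "m = (real N + 2 * \<alpha> - \<beta> - 4) / 2"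
  define r where "r = 2 * (m - k) / k"
  interpret emden_fowler_space "real N" \<alpha> \<beta> \<gamma> k m r "TYPE(real ^ 'n)"
    by unfold_locales (use assms in \<open>simp_all add: k_def m_def r_def\<close>)
  show ?thesis
    using radial_solution_is_bubble bubble_is_radial_solution by blast
qed

end
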